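(* Let $\mathbf{C}$ be a Bass--Serre category. Suppose $Q\in\mathrm{Graph}(\mathbf{C})$ is a graph and $\mathcal{G}\in\mathrm{Grp}(\mathrm{Graph}(\mathbf{C})_{/Q})$ is a graph of groups, with fundamental group $\pi=\pi_1(\mathcal{G})$ and standard graph $T=T(\mathcal{G})$, such that the unit $\mathcal{G}\to\Delta(\pi)=\pi\times Q$ is monic. Then there is a canonical isomorphism $\mathcal{G}\cong t^*\pi_T$, where $\pi_T$ is the stabiliser of the action of $\pi$ on $T$ and $t\colon Q=\pi\backslash T\to T$ is the canonical section. In particular, if $\mathcal{G}=s^*G_X$ comes from the action of a group object $G\in\mathrm{Grp}(\mathbf{C})$ on a graph $X\in\mathrm{Graph}(\mathbf{C})$ whose quotient map $X\to G\backslash X$ has a section $s$ in $\mathrm{Graph}(\mathbf{C})$ (so $Q=G\backslash X$), then $\mathcal{G}\to\Delta(\pi)$ is always monic and therefore $s^*G_X\cong t^*\pi_T$ canonically.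
   Context: Basic notation. For a category $\mathbf{C}$ with finite limits (terminal object $*$), $\mathrm{Grp}(\mathbf{C})$ is the category of group objects in $\mathbf{C}$, with structure maps $m_G,i_G,e_G$. $\mathrm{Graph}(\mathbf{C})$ is the category of internal directed graphs $X=(d_0,d_1\colon EX\rightrightarrows VX)$, i.e. functors from the parallel-pair category to $\mathbf{C}$; limits and colimits are computed on $E$ and $V$ separately. An object $C$ of $\mathbf{C}$ is also regarded as the constant graph $(C\rightrightarrows C)$, so $C\times X=(C\times EX\rightrightarrows C\times VX)$. A $G$-graph ("$G$ acts on the graph $X$") is a graph with left $G$-actions on $EX$ and $VX$ for which $d_0,d_1$ are equivariant, so there is an action map $a\colon G\times X\to X$ in $\mathrm{Graph}(\mathbf{C})$. The quotient $q\colon X\to G\backslash X$ is the coequaliser of $a,\mathrm{pr}_X\colon G\times X\rightrightarrows X$. The stabiliser $G_X$ is the equaliser of $a,\mathrm{pr}_X\colon G\times X\rightrightarrows X$; with its map to $X$ it is a group object in the slice category over $X$, with multiplication induced by $m_G$. For a section $s$ of $q$, $s^*G_X\in\mathrm{Grp}(\mathrm{Graph}(\mathbf{C})_{/(G\backslash X)})$ is the pullback of $G_X\to X$ along $s$. Graphs of groups. A graph of groups over $Q\in\mathrm{Graph}(\mathbf{C})$ is an object $\mathcal{G}$ of $\mathrm{Grp}(\mathrm{Graph}(\mathbf{C})_{/Q})$. Let $\Delta\colon\mathrm{Grp}(\mathbf{C})\to\mathrm{Grp}(\mathrm{Graph}(\mathbf{C})_{/Q})$, $H\mapsto H\times Q$.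 When $\Delta$ has a left adjoint $\operatorname{colim}$ (this is so in a Bass--Serre category), the fundamental group of $\mathcal{G}$ is $\pi=\pi_1(\mathcal{G})=\operatorname{colim}\mathcal{G}$, with unit $\mathcal{G}\to\Delta(\pi)$. The standard graph $T=T(\mathcal{G})$ is the coequaliser in $\mathrm{Graph}(\mathbf{C})$ of the two maps $\pi\times\mathcal{G}\rightrightarrows\pi\times Q$ given by $\mathrm{id}_\pi\times(\mathcal{G}\to Q)$ and by $\pi\times\mathcal{G}\to\pi\times\Delta(\pi)=\pi\times\pi\times Q\xrightarrow{m_\pi\times\mathrm{id}_Q}\pi\times Q$. Left multiplication of $\pi$ on the factor $\pi$ induces an action of $\pi$ on $T$, and $\pi\backslash T\cong Q$ canonically (induced by the projection $\pi\times Q\to Q$). The map $t\colon Q=*\times Q\xrightarrow{e_\pi\times\mathrm{id}}\pi\times Q\to T$ is a section of the quotient map $T\to\pi\backslash T=Q$. The canonical map $\mathcal{G}\to t^*\pi_T$ is the one through which the unit $\mathcal{G}\to\pi\times Q$ factors, $t^*\pi_T$ being the subobject of $\pi\times Q$ obtained by pulling back $\pi_T\hookrightarrow\pi\times T$ along $t$. Action Barr-exactness. In a regular category $\mathbf{D}$, if $H\in\mathrm{Grp}(\mathbf{D})$ acts on $Y$, then the image $R\hookrightarrow Y\times Y$ in the (regular epi)-mono factorisation of $(a,\mathrm{pr}_Y)\colon H\times Y\to Y\times Y$ is a congruence (internal equivalence relation) on $Y$. A regular category $\mathbf{D}$ is action Barr-exact if every such congruence is effective (has a coequaliser and is the kernel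 pair of it). $\mathbf{C}$ is locally action Barr-exact if every slice $\mathbf{C}_{/Y}$ is action Barr-exact. Bass--Serre category. A category $\mathbf{C}$ is Bass--Serre if: (1) $\mathbf{C}$ is locally action Barr-exact, has a terminal object, and has coequalisers, which are preserved by $C\times(-)$ for every $C\in\mathbf{C}$; (2) $\mathrm{Grp}(\mathbf{C})$ has coequalisers and $\mathbf{C}$-internal coproducts, i.e. for each $C\in\mathbf{C}$ the functor $\mathrm{Grp}(\mathbf{C})\to\mathrm{Grp}(\mathbf{C}_{/C})$, $K\mapsto K\times C$, has a left adjoint $\operatorname{colim}_{C^\delta}$; moreover for every $C$ and $H\in\mathrm{Grp}(\mathbf{C}_{/C})$, $H$ generates $\operatorname{colim}_{C^\delta}H$, meaning that $(\operatorname{colim}_{C^\delta}H)\times H\rightrightarrows\operatorname{colim}_{C^\delta}H\to *$ is a coequaliser in $\mathbf{C}$, where the two maps are the projection and the map (canonical map $H\to\operatorname{colim}_{C^\delta}H$ on the second factor, followed by multiplication). *)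

theory Defs
  imports Main
begin

section \<open>Categories\<close>

text \<open>
  A category is given by its hom-sets. Hom-sets of different pairs of objects may overlap, and
  composition is a single operation on arrows; any category can be presented in this way. The
  point is that an arrow of a slice, of a category of groups or of a category of graphs is then
  literally an arrow (or a pair of arrows) of the underlying category. The price is that
  constructions on arrows carry the relevant objects as arguments.
  The composite \<open>g \<cdot>\<^bsub>C\<^esub> f\<close> means: first \<open>f\<close>, then \<open>g\<close>.
\<close>

record ('o, 'm) cat =
  Obj :: "'o set"
  Hom :: "'o \<Rightarrow> 'o \<Rightarrow> 'm set"
  Ident :: "'o \<Rightarrow> 'm"
  Comp :: "'m \<Rightarrow> 'm \<Rightarrow> 'm"  (infixl "\<cdot>\<index>" 70)

locale category =
  fixes C :: "('o, 'm) cat" (structure)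
  assumes Ident_in: "A \<in> Obj C \<Longrightarrow> Ident C A \<in> Hom C A A"
    and Comp_in: "\<lbrakk>A \<in> Obj C; B \<in> Obj C; D \<in> Obj C; f \<in> Hom C A B; g \<in> Hom C B D\<rbrakk>
      \<Longrightarrow> g \<cdot> f \<in> Hom C A D"
    and Comp_Ident: "\<lbrakk>A \<in> Obj C; B \<in> Obj C; f \<in> Hom C A B\<rbrakk> \<Longrightarrow> f \<cdot> Ident C A = f"
    and Ident_Comp: "\<lbrakk>A \<in> Obj C; B \<in> Obj C; f \<in> Hom C A B\<rbrakk> \<Longrightarrow> Ident C B \<cdot> f = f"
    and Comp_assoc: "\<lbrakk>A \<in> Obj C; B \<in> Obj C; D \<in> Obj C; E \<in> Obj C;
        f \<in> Hom C A B; g \<in> Hom C B D; h \<in> Hom C D E\<rbrakk> \<Longrightarrow> (h \<cdot> g) \<cdot> f = h \<cdot> (g \<cdot> f)"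

definition monic :: "('o, 'm) cat \<Rightarrow> 'o \<Rightarrow> 'o \<Rightarrow> 'm \<Rightarrow> bool" where
  "monic C A B f \<longleftrightarrow> f \<in> Hom C A B \<and>
     (\<forall>T\<in>Obj C. \<forall>x\<in>Hom C T A. \<forall>y\<in>Hom C T A. f \<cdot>\<^bsub>C\<^esub> x = f \<cdot>\<^bsub>C\<^esub> y \<longrightarrow> x = y)"

definition is_iso :: "('o, 'm) cat \<Rightarrow> 'o \<Rightarrow> 'o \<Rightarrow> 'm \<Rightarrow> bool" where
  "is_iso C A B f \<longleftrightarrow> A \<in> Obj C \<and> B \<in> Obj C \<and> f \<in> Hom C A B \<and>
     (\<exists>g\<in>Hom C B A. g \<cdot>\<^bsub>C\<^esub> f = Ident C A \<and> f \<cdot>\<^bsub>C\<^esub> g = Ident C B)"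

section \<open>Limits and colimits\<close>

definition is_terminal :: "('o, 'm) cat \<Rightarrow> 'o \<Rightarrow> bool" where
  "is_terminal C Z \<longleftrightarrow> Z \<in> Obj C \<and> (\<forall>A\<in>Obj C. \<exists>!f. f \<in> Hom C A Z)"

definition is_product :: "('o, 'm) cat \<Rightarrow> 'o \<Rightarrow> 'o \<Rightarrow> 'o \<Rightarrow> 'm \<Rightarrow> 'm \<Rightarrow> bool" where
  "is_product C A B P p q \<longleftrightarrow> P \<in> Obj C \<and> p \<in> Hom C P A \<and> q \<in> Hom C P B \<and>
     (\<forall>T\<in>Obj C. \<forall>f\<in>Hom C T A. \<forall>g\<in>Hom C T B.
        \<exists>!h. h \<in> Hom C T P \<and> p \<cdot>\<^bsub>C\<^esub> h = f \<and> q \<cdot>\<^bsub>C\<^esub> h = g)"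

definition is_equaliser ::
  "('o, 'm) cat \<Rightarrow> 'o \<Rightarrow> 'o \<Rightarrow> 'm \<Rightarrow> 'm \<Rightarrow> 'o \<Rightarrow> 'm \<Rightarrow> bool" where
  "is_equaliser C A B f g E i \<longleftrightarrow> E \<in> Obj C \<and> i \<in> Hom C E A \<and> f \<cdot>\<^bsub>C\<^esub> i = g \<cdot>\<^bsub>C\<^esub> i \<and>
     (\<forall>T\<in>Obj C. \<forall>h\<in>Hom C T A. f \<cdot>\<^bsub>C\<^esub> h = g \<cdot>\<^bsub>C\<^esub> h \<longrightarrow>
        (\<exists>!k. k \<in> Hom C T E \<and> i \<cdot>\<^bsub>C\<^esub> k = h))"

definition is_coequaliser ::
  "('o, 'm) cat \<Rightarrow> 'o \<Rightarrow> 'o \<Rightarrow> 'm \<Rightarrow> 'm \<Rightarrow> 'o \<Rightarrow> 'm \<Rightarrow> bool" where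
  "is_coequaliser C A B f g Z q \<longleftrightarrow> Z \<in> Obj C \<and> q \<in> Hom C B Z \<and> q \<cdot>\<^bsub>C\<^esub> f = q \<cdot>\<^bsub>C\<^esub> g \<and>
     (\<forall>T\<in>Obj C. \<forall>h\<in>Hom C B T. h \<cdot>\<^bsub>C\<^esub> f = h \<cdot>\<^bsub>C\<^esub> g \<longrightarrow>
        (\<exists>!k. k \<in> Hom C Z T \<and> k \<cdot>\<^bsub>C\<^esub> q = h))"

text \<open>\<open>P\<close> with projections \<open>p\<close>, \<open>q\<close> is a pullback of \<open>f : A \<rightarrow> B\<close> and \<open>g : A' \<rightarrow> B\<close>.\<close>

definition is_pullback ::
  "('o, 'm) cat \<Rightarrow> 'o \<Rightarrow> 'o \<Rightarrow> 'm \<Rightarrow> 'm \<Rightarrow> 'o \<Rightarrow> 'm \<Rightarrow> 'm \<Rightarrow> bool" where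
  "is_pullback C A A' f g P p q \<longleftrightarrow> P \<in> Obj C \<and> p \<in> Hom C P A \<and> q \<in> Hom C P A' \<and>
     f \<cdot>\<^bsub>C\<^esub> p = g \<cdot>\<^bsub>C\<^esub> q \<and>
     (\<forall>T\<in>Obj C. \<forall>x\<in>Hom C T A. \<forall>y\<in>Hom C T A'. f \<cdot>\<^bsub>C\<^esub> x = g \<cdot>\<^bsub>C\<^esub> y \<longrightarrow>
        (\<exists>!h. h \<in> Hom C T P \<and> p \<cdot>\<^bsub>C\<^esub> h = x \<and> q \<cdot>\<^bsub>C\<^esub> h = y))"

definition has_coequalisers :: "('o, 'm) cat \<Rightarrow> bool" where
  "has_coequalisers C \<longleftrightarrow> (\<forall>A\<in>Obj C. \<forall>B\<in>Obj C. \<forall>f\<in>Hom C A B. \<forall>g\<in>Hom C A B.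
     \<exists>Z q. is_coequaliser C A B f g Z q)"

definition has_finite_limits :: "('o, 'm) cat \<Rightarrow> bool" where
  "has_finite_limits C \<longleftrightarrow> (\<exists>Z. is_terminal C Z) \<and>
     (\<forall>A\<in>Obj C. \<forall>B\<in>Obj C. \<exists>P p q. is_product C A B P p q) \<and>
     (\<forall>A\<in>Obj C. \<forall>B\<in>Obj C. \<forall>f\<in>Hom C A B. \<forall>g\<in>Hom C A B. \<exists>E i. is_equaliser C A B f g E i)"

text \<open>
  Limits that are referred to as objects are fixed once and for all by choice. All constructions
  below depend on these choices only up to canonical isomorphism.
\<close>

definition Term :: "('o, 'm) cat \<Rightarrow> 'o" where
  "Term C = (SOME Z. is_terminal C Z)"

definition bang :: "('o, 'm) cat \<Rightarrow> 'o \<Rightarrow> 'm" where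
  "bang C A = (THE f. f \<in> Hom C A (Term C))"

definition product_cone :: "('o, 'm) cat \<Rightarrow> 'o \<Rightarrow> 'o \<Rightarrow> 'o \<times> 'm \<times> 'm" where
  "product_cone C A B = (SOME (P, p, q). is_product C A B P p q)"

definition Prod :: "('o, 'm) cat \<Rightarrow> 'o \<Rightarrow> 'o \<Rightarrow> 'o" where
  "Prod C A B = fst (product_cone C A B)"

definition pr1 :: "('o, 'm) cat \<Rightarrow> 'o \<Rightarrow> 'o \<Rightarrow> 'm" where
  "pr1 C A B = fst (snd (product_cone C A B))"

definition pr2 :: "('o, 'm) cat \<Rightarrow> 'o \<Rightarrow> 'o \<Rightarrow> 'm" where
  "pr2 C A B = snd (snd (product_cone C A B))"

text \<open>\<open>tuple C T A B f g\<close> is the arrow \<open>(f, g) : T \<rightarrow> A \<times> B\<close>.\<close>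

definition tuple :: "('o, 'm) cat \<Rightarrow> 'o \<Rightarrow> 'o \<Rightarrow> 'o \<Rightarrow> 'm \<Rightarrow> 'm \<Rightarrow> 'm" where
  "tuple C T A B f g =
     (THE h. h \<in> Hom C T (Prod C A B) \<and> pr1 C A B \<cdot>\<^bsub>C\<^esub> h = f \<and> pr2 C A B \<cdot>\<^bsub>C\<^esub> h = g)"

text \<open>\<open>prod_map C A A' B B' f g\<close> is \<open>f \<times> g : A \<times> B \<rightarrow> A' \<times> B'\<close>, where \<open>f : A \<rightarrow> A'\<close> and \<open>g : B \<rightarrow> B'\<close>.\<close>

definition prod_map :: "('o, 'm) cat \<Rightarrow> 'o \<Rightarrow> 'o \<Rightarrow> 'o \<Rightarrow> 'o \<Rightarrow> 'm \<Rightarrow> 'm \<Rightarrow> 'm" where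
  "prod_map C A A' B B' f g =
     tuple C (Prod C A B) A' B' (f \<cdot>\<^bsub>C\<^esub> pr1 C A B) (g \<cdot>\<^bsub>C\<^esub> pr2 C A B)"

definition equaliser :: "('o, 'm) cat \<Rightarrow> 'o \<Rightarrow> 'o \<Rightarrow> 'm \<Rightarrow> 'm \<Rightarrow> 'o \<times> 'm" where
  "equaliser C A B f g = (SOME (E, i). is_equaliser C A B f g E i)"

definition coequaliser :: "('o, 'm) cat \<Rightarrow> 'o \<Rightarrow> 'o \<Rightarrow> 'm \<Rightarrow> 'm \<Rightarrow> 'o \<times> 'm" where
  "coequaliser C A B f g = (SOME (Z, q). is_coequaliser C A B f g Z q)"

definition pullback :: "('o, 'm) cat \<Rightarrow> 'o \<Rightarrow> 'o \<Rightarrow> 'm \<Rightarrow> 'm \<Rightarrow> 'o \<times> 'm \<times> 'm" where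
  "pullback C A A' f g = (SOME (P, p, q). is_pullback C A A' f g P p q)"

section \<open>Functors and adjunctions\<close>

definition is_functor ::
  "('o, 'm) cat \<Rightarrow> ('p, 'n) cat \<Rightarrow> ('o \<Rightarrow> 'p) \<Rightarrow> ('o \<Rightarrow> 'o \<Rightarrow> 'm \<Rightarrow> 'n) \<Rightarrow> bool" where
  "is_functor C D F F1 \<longleftrightarrow>
     (\<forall>A\<in>Obj C. F A \<in> Obj D) \<and>
     (\<forall>A\<in>Obj C. \<forall>B\<in>Obj C. \<forall>f\<in>Hom C A B. F1 A B f \<in> Hom D (F A) (F B)) \<and>
     (\<forall>A\<in>Obj C. F1 A A (Ident C A) = Ident D (F A)) \<and>
     (\<forall>A\<in>Obj C. \<forall>B\<in>Obj C. \<forall>E\<in>Obj C. \<forall>f\<in>Hom C A B. \<forall>g\<in>Hom C B E.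
        F1 A E (g \<cdot>\<^bsub>C\<^esub> f) = F1 B E g \<cdot>\<^bsub>D\<^esub> F1 A B f)"

text \<open>\<open>u : X \<rightarrow> R U\<close> is a universal arrow from \<open>X\<close> to the functor \<open>R : A \<rightarrow> B\<close>.\<close>

definition universal_arrow ::
  "('o, 'm) cat \<Rightarrow> ('p, 'n) cat \<Rightarrow> ('o \<Rightarrow> 'p) \<Rightarrow> ('o \<Rightarrow> 'o \<Rightarrow> 'm \<Rightarrow> 'n) \<Rightarrow> 'p \<Rightarrow> 'o \<Rightarrow> 'n \<Rightarrow> bool"
where
  "universal_arrow A B R R1 X U u \<longleftrightarrow> U \<in> Obj A \<and> u \<in> Hom B X (R U) \<and>
     (\<forall>Y\<in>Obj A. \<forall>f\<in>Hom B X (R Y). \<exists>!g. g \<in> Hom A U Y \<and> R1 U Y g \<cdot>\<^bsub>B\<^esub> u = f)"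

text \<open>\<open>L : B \<rightarrow> A\<close> is left adjoint to \<open>R : A \<rightarrow> B\<close> with unit \<open>\<eta>\<close>.\<close>

definition is_left_adjoint ::
  "('o, 'm) cat \<Rightarrow> ('p, 'n) cat \<Rightarrow> ('o \<Rightarrow> 'p) \<Rightarrow> ('o \<Rightarrow> 'o \<Rightarrow> 'm \<Rightarrow> 'n) \<Rightarrow>
   ('p \<Rightarrow> 'o) \<Rightarrow> ('p \<Rightarrow> 'p \<Rightarrow> 'n \<Rightarrow> 'm) \<Rightarrow> ('p \<Rightarrow> 'n) \<Rightarrow> bool" where
  "is_left_adjoint A B R R1 L L1 \<eta> \<longleftrightarrow>
     is_functor A B R R1 \<and> is_functor B A L L1 \<and>
     (\<forall>X\<in>Obj B. \<forall>Y\<in>Obj B. \<forall>f\<in>Hom B X Y.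
        R1 (L X) (L Y) (L1 X Y f) \<cdot>\<^bsub>B\<^esub> \<eta> X = \<eta> Y \<cdot>\<^bsub>B\<^esub> f) \<and>
     (\<forall>X\<in>Obj B. universal_arrow A B R R1 X (L X) (\<eta> X))"

section \<open>Slices\<close>

definition Slice :: "('o, 'm) cat \<Rightarrow> 'o \<Rightarrow> ('o \<times> 'm, 'm) cat" where
  "Slice C Y = \<lparr>
     Obj = {(A, f). A \<in> Obj C \<and> f \<in> Hom C A Y},
     Hom = (\<lambda>(A, f) (B, g). {h \<in> Hom C A B. g \<cdot>\<^bsub>C\<^esub> h = f}),
     Ident = (\<lambda>(A, f). Ident C A),
     Comp = Comp C \<rparr>"

section \<open>Group objects and actions\<close>

record ('o, 'm) grp =
  Carr :: 'o
  Mul :: 'm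
  Inv :: 'm
  One :: 'm

text \<open>Product \<open>x y\<close> of two generalised elements \<open>x, y : T \<rightarrow> K\<close>, and the unit element \<open>T \<rightarrow> * \<rightarrow> K\<close>.\<close>

definition gmul :: "('o, 'm) cat \<Rightarrow> ('o, 'm) grp \<Rightarrow> 'o \<Rightarrow> 'm \<Rightarrow> 'm \<Rightarrow> 'm" where
  "gmul C K T x y = Mul K \<cdot>\<^bsub>C\<^esub> tuple C T (Carr K) (Carr K) x y"

definition gone :: "('o, 'm) cat \<Rightarrow> ('o, 'm) grp \<Rightarrow> 'o \<Rightarrow> 'm" where
  "gone C K T = One K \<cdot>\<^bsub>C\<^esub> bang C T"

definition group_object :: "('o, 'm) cat \<Rightarrow> ('o, 'm) grp \<Rightarrow> bool" where
  "group_object C K \<longleftrightarrow>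
     (let G = Carr K; GG = Prod C G G; GGG = Prod C GG G;
          x = pr1 C G G \<cdot>\<^bsub>C\<^esub> pr1 C GG G; y = pr2 C G G \<cdot>\<^bsub>C\<^esub> pr1 C GG G; z = pr2 C GG G
      in G \<in> Obj C \<and> Mul K \<in> Hom C GG G \<and> Inv K \<in> Hom C G G \<and> One K \<in> Hom C (Term C) G \<and>
         gmul C K GGG (gmul C K GGG x y) z = gmul C K GGG x (gmul C K GGG y z) \<and>
         gmul C K G (gone C K G) (Ident C G) = Ident C G \<and>
         gmul C K G (Ident C G) (gone C K G) = Ident C G \<and>
         gmul C K G (Inv K) (Ident C G) = gone C K G \<and>
         gmul C K G (Ident C G) (Inv K) = gone C K G)"

definition Grp :: "('o, 'm) cat \<Rightarrow> (('o, 'm) grp, 'm) cat" where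
  "Grp C = \<lparr>
     Obj = {K. group_object C K},
     Hom = (\<lambda>K L. {f \<in> Hom C (Carr K) (Carr L).
        f \<cdot>\<^bsub>C\<^esub> Mul K = Mul L \<cdot>\<^bsub>C\<^esub> prod_map C (Carr K) (Carr L) (Carr K) (Carr L) f f}),
     Ident = (\<lambda>K. Ident C (Carr K)),
     Comp = Comp C \<rparr>"

definition gact ::
  "('o, 'm) cat \<Rightarrow> ('o, 'm) grp \<Rightarrow> 'o \<Rightarrow> 'm \<Rightarrow> 'o \<Rightarrow> 'm \<Rightarrow> 'm \<Rightarrow> 'm" where
  "gact C K Y a T x y = a \<cdot>\<^bsub>C\<^esub> tuple C T (Carr K) Y x y"

definition is_action :: "('o, 'm) cat \<Rightarrow> ('o, 'm) grp \<Rightarrow> 'o \<Rightarrow> 'm \<Rightarrow> bool" where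
  "is_action C K Y a \<longleftrightarrow>
     (let G = Carr K; GG = Prod C G G; GGY = Prod C GG Y;
          x = pr1 C G G \<cdot>\<^bsub>C\<^esub> pr1 C GG Y; y = pr2 C G G \<cdot>\<^bsub>C\<^esub> pr1 C GG Y; z = pr2 C GG Y
      in Y \<in> Obj C \<and> a \<in> Hom C (Prod C G Y) Y \<and>
         gact C K Y a GGY (gmul C K GGY x y) z = gact C K Y a GGY x (gact C K Y a GGY y z) \<and>
         gact C K Y a Y (gone C K Y) (Ident C Y) = Ident C Y)"

text \<open>The functor \<open>K \<mapsto> (K \<times> Y \<rightarrow> Y)\<close> from groups in \<open>C\<close> to groups in the slice over \<open>Y\<close>.\<close>

definition Delta :: "('o, 'm) cat \<Rightarrow> 'o \<Rightarrow> ('o, 'm) grp \<Rightarrow> ('o \<times> 'm, 'm) grp" where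
  "Delta C Y K =
     (let G = Carr K; GY = Prod C G Y; S = Slice C Y; A = (GY, pr2 C G Y);
          AA = Prod S A A; x = pr1 S A A; y = pr2 S A A
      in \<lparr> Carr = A,
           Mul = tuple C (fst AA) G Y
             (gmul C K (fst AA) (pr1 C G Y \<cdot>\<^bsub>C\<^esub> x) (pr1 C G Y \<cdot>\<^bsub>C\<^esub> y)) (snd AA),
           Inv = tuple C GY G Y (Inv K \<cdot>\<^bsub>C\<^esub> pr1 C G Y) (pr2 C G Y),
           One = tuple C (fst (Term S)) G Y (gone C K (fst (Term S))) (snd (Term S)) \<rparr>)"

definition Delta_map ::
  "('o, 'm) cat \<Rightarrow> 'o \<Rightarrow> ('o, 'm) grp \<Rightarrow> ('o, 'm) grp \<Rightarrow> 'm \<Rightarrow> 'm" where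
  "Delta_map C Y K L f = prod_map C (Carr K) (Carr L) Y Y f (Ident C Y)"

text \<open>The group structure on \<open>S\<close> induced by a monic \<open>i : S \<rightarrow> H\<close>, when there is one.\<close>

definition induced_group :: "('o, 'm) cat \<Rightarrow> ('o, 'm) grp \<Rightarrow> 'o \<Rightarrow> 'm \<Rightarrow> ('o, 'm) grp" where
  "induced_group C H S i = \<lparr> Carr = S,
     Mul = (THE k. k \<in> Hom C (Prod C S S) S \<and>
              i \<cdot>\<^bsub>C\<^esub> k = Mul H \<cdot>\<^bsub>C\<^esub> prod_map C S (Carr H) S (Carr H) i i),
     Inv = (THE k. k \<in> Hom C S S \<and> i \<cdot>\<^bsub>C\<^esub> k = Inv H \<cdot>\<^bsub>C\<^esub> i),
     One = (THE k. k \<in> Hom C (Term C) S \<and> i \<cdot>\<^bsub>C\<^esub> k = One H) \<rparr>"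

text \<open>The stabiliser of an action \<open>a\<close> of \<open>K\<close> on \<open>X\<close>, as a subgroup of \<open>K \<times> X\<close> in the slice over \<open>X\<close>.\<close>

definition stab_obj :: "('o, 'm) cat \<Rightarrow> ('o, 'm) grp \<Rightarrow> 'o \<Rightarrow> 'm \<Rightarrow> 'o" where
  "stab_obj C K X a = fst (equaliser C (Prod C (Carr K) X) X a (pr2 C (Carr K) X))"

definition stab_incl :: "('o, 'm) cat \<Rightarrow> ('o, 'm) grp \<Rightarrow> 'o \<Rightarrow> 'm \<Rightarrow> 'm" where
  "stab_incl C K X a = snd (equaliser C (Prod C (Carr K) X) X a (pr2 C (Carr K) X))"

definition stabiliser ::
  "('o, 'm) cat \<Rightarrow> ('o, 'm) grp \<Rightarrow> 'o \<Rightarrow> 'm \<Rightarrow> ('o \<times> 'm, 'm) grp" where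
  "stabiliser C K X a =
     induced_group (Slice C X) (Delta C X K)
       (stab_obj C K X a, pr2 C (Carr K) X \<cdot>\<^bsub>C\<^esub> stab_incl C K X a) (stab_incl C K X a)"

text \<open>
  Pullback along \<open>s : Q \<rightarrow> X\<close> of a group \<open>K\<close> in the slice over \<open>X\<close>: the structure maps are the ones
  lying over those of \<open>K\<close>.
\<close>

definition pb_obj :: "('o, 'm) cat \<Rightarrow> 'o \<Rightarrow> 'm \<Rightarrow> ('o \<times> 'm, 'm) grp \<Rightarrow> 'o" where
  "pb_obj C Q s K = fst (pullback C Q (fst (Carr K)) s (snd (Carr K)))"

definition pb_base :: "('o, 'm) cat \<Rightarrow> 'o \<Rightarrow> 'm \<Rightarrow> ('o \<times> 'm, 'm) grp \<Rightarrow> 'm" where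
  "pb_base C Q s K = fst (snd (pullback C Q (fst (Carr K)) s (snd (Carr K))))"

definition pb_top :: "('o, 'm) cat \<Rightarrow> 'o \<Rightarrow> 'm \<Rightarrow> ('o \<times> 'm, 'm) grp \<Rightarrow> 'm" where
  "pb_top C Q s K = snd (snd (pullback C Q (fst (Carr K)) s (snd (Carr K))))"

definition pb_group ::
  "('o, 'm) cat \<Rightarrow> 'o \<Rightarrow> 'o \<Rightarrow> 'm \<Rightarrow> ('o \<times> 'm, 'm) grp \<Rightarrow> ('o \<times> 'm, 'm) grp" where
  "pb_group C Q X s K =
     (let P = pb_obj C Q s K; p = pb_base C Q s K; r = pb_top C Q s K;
          S = Slice C Q; A = (P, p); W = Prod S A A; U = Term S
      in \<lparr> Carr = A,
           Mul = (THE k. k \<in> Hom C (fst W) P \<and> p \<cdot>\<^bsub>C\<^esub> k = snd W \<and>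
                    r \<cdot>\<^bsub>C\<^esub> k = gmul (Slice C X) K (fst W, s \<cdot>\<^bsub>C\<^esub> snd W)
                              (r \<cdot>\<^bsub>C\<^esub> pr1 S A A) (r \<cdot>\<^bsub>C\<^esub> pr2 S A A)),
           Inv = (THE k. k \<in> Hom C P P \<and> p \<cdot>\<^bsub>C\<^esub> k = p \<and> r \<cdot>\<^bsub>C\<^esub> k = Inv K \<cdot>\<^bsub>C\<^esub> r),
           One = (THE k. k \<in> Hom C (fst U) P \<and> p \<cdot>\<^bsub>C\<^esub> k = snd U \<and>
                    r \<cdot>\<^bsub>C\<^esub> k = gone (Slice C X) K (fst U, s \<cdot>\<^bsub>C\<^esub> snd U)) \<rparr>)"

section \<open>Action Barr-exactness and Bass--Serre categories\<close>

definition regular_epi :: "('o, 'm) cat \<Rightarrow> 'o \<Rightarrow> 'o \<Rightarrow> 'm \<Rightarrow> bool" where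
  "regular_epi C B Z q \<longleftrightarrow>
     (\<exists>A\<in>Obj C. \<exists>f\<in>Hom C A B. \<exists>g\<in>Hom C A B. is_coequaliser C A B f g Z q)"

definition regular_category :: "('o, 'm) cat \<Rightarrow> bool" where
  "regular_category C \<longleftrightarrow> category C \<and> has_finite_limits C \<and>
     (\<forall>A\<in>Obj C. \<forall>B\<in>Obj C. \<forall>f\<in>Hom C A B. \<forall>K k l. is_pullback C A A f f K k l \<longrightarrow>
        (\<exists>Z q. is_coequaliser C K A k l Z q)) \<and>
     (\<forall>A\<in>Obj C. \<forall>B\<in>Obj C. \<forall>B'\<in>Obj C. \<forall>e f P p q.
        regular_epi C A B e \<and> f \<in> Hom C B' B \<and> is_pullback C A B' e f P p q \<longrightarrow>
        regular_epi C P B' q)"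

text \<open>
  The congruence given by an action is the subobject \<open>j : R \<rightarrow> Y \<times> Y\<close> in a (regular epi)-mono
  factorisation \<open>j \<cdot> e\<close> of \<open>(a, pr)\<close>; its two legs are the components of \<open>j\<close>.
\<close>

definition action_Barr_exact :: "('o, 'm) cat \<Rightarrow> bool" where
  "action_Barr_exact C \<longleftrightarrow> regular_category C \<and>
     (\<forall>H Y a R e j. group_object C H \<and> is_action C H Y a \<and>
        R \<in> Obj C \<and> regular_epi C (Prod C (Carr H) Y) R e \<and> monic C R (Prod C Y Y) j \<and>
        j \<cdot>\<^bsub>C\<^esub> e = tuple C (Prod C (Carr H) Y) Y Y a (pr2 C (Carr H) Y) \<longrightarrow>
        (let r1 = pr1 C Y Y \<cdot>\<^bsub>C\<^esub> j; r2 = pr2 C Y Y \<cdot>\<^bsub>C\<^esub> j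
         in \<exists>Z q. is_coequaliser C R Y r1 r2 Z q \<and> is_pullback C Y Y q q R r1 r2))"

definition locally_action_Barr_exact :: "('o, 'm) cat \<Rightarrow> bool" where
  "locally_action_Barr_exact C \<longleftrightarrow> (\<forall>Y\<in>Obj C. action_Barr_exact (Slice C Y))"

definition product_preserves_coequalisers :: "('o, 'm) cat \<Rightarrow> bool" where
  "product_preserves_coequalisers C \<longleftrightarrow>
     (\<forall>D\<in>Obj C. \<forall>A\<in>Obj C. \<forall>B\<in>Obj C. \<forall>f\<in>Hom C A B. \<forall>g\<in>Hom C A B. \<forall>Z q.
        is_coequaliser C A B f g Z q \<longrightarrow>
        is_coequaliser C (Prod C D A) (Prod C D B)
          (prod_map C D D A B (Ident C D) f) (prod_map C D D A B (Ident C D) g)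
          (Prod C D Z) (prod_map C D D B Z (Ident C D) q))"

text \<open>
  For a group \<open>H\<close> in the slice over \<open>D\<close> and a map \<open>u : H \<rightarrow> L \<times> D\<close> of groups over \<open>D\<close>, with first
  component \<open>h : H \<rightarrow> L\<close>: the maps \<open>(l, x) \<mapsto> l\<close> and \<open>(l, x) \<mapsto> l h(x)\<close> have the terminal object as
  coequaliser.
\<close>

definition generates ::
  "('o, 'm) cat \<Rightarrow> 'o \<Rightarrow> ('o \<times> 'm, 'm) grp \<Rightarrow> ('o, 'm) grp \<Rightarrow> 'm \<Rightarrow> bool" where
  "generates C D H L u \<longleftrightarrow>
     (let G = Carr L; A = fst (Carr H); LA = Prod C G A
      in is_coequaliser C LA G (pr1 C G A)
           (gmul C L LA (pr1 C G A) (pr1 C G D \<cdot>\<^bsub>C\<^esub> u \<cdot>\<^bsub>C\<^esub> pr2 C G A))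
           (Term C) (bang C G))"

definition Bass_Serre :: "('o, 'm) cat \<Rightarrow> bool" where
  "Bass_Serre C \<longleftrightarrow> category C \<and>
     locally_action_Barr_exact C \<and> (\<exists>Z. is_terminal C Z) \<and>
     has_coequalisers C \<and> product_preserves_coequalisers C \<and>
     has_coequalisers (Grp C) \<and>
     (\<forall>D\<in>Obj C. \<exists>L L1 \<eta>.
        is_left_adjoint (Grp C) (Grp (Slice C D)) (Delta C D) (Delta_map C D) L L1 \<eta> \<and>
        (\<forall>H\<in>Obj (Grp (Slice C D)). generates C D H (L H) (\<eta> H)))"

section \<open>Graphs\<close>

record ('o, 'm) igraph =
  Edges :: 'o
  Verts :: 'o
  d0 :: 'm
  d1 :: 'm

definition Graph :: "('o, 'm) cat \<Rightarrow> (('o, 'm) igraph, 'm \<times> 'm) cat" where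
  "Graph C = \<lparr>
     Obj = {X. Edges X \<in> Obj C \<and> Verts X \<in> Obj C \<and>
               d0 X \<in> Hom C (Edges X) (Verts X) \<and> d1 X \<in> Hom C (Edges X) (Verts X)},
     Hom = (\<lambda>X Y. {(f, g). f \<in> Hom C (Edges X) (Edges Y) \<and> g \<in> Hom C (Verts X) (Verts Y) \<and>
                      d0 Y \<cdot>\<^bsub>C\<^esub> f = g \<cdot>\<^bsub>C\<^esub> d0 X \<and> d1 Y \<cdot>\<^bsub>C\<^esub> f = g \<cdot>\<^bsub>C\<^esub> d1 X}),
     Ident = (\<lambda>X. (Ident C (Edges X), Ident C (Verts X))),
     Comp = (\<lambda>(f', g') (f, g). (f' \<cdot>\<^bsub>C\<^esub> f, g' \<cdot>\<^bsub>C\<^esub> g)) \<rparr>"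

definition const_graph :: "('o, 'm) cat \<Rightarrow> 'o \<Rightarrow> ('o, 'm) igraph" where
  "const_graph C A = \<lparr> Edges = A, Verts = A, d0 = Ident C A, d1 = Ident C A \<rparr>"

text \<open>
  A group of \<open>C\<close> as a constant group in graphs. The chosen product and terminal object of graphs need
  not be componentwise the chosen ones of \<open>C\<close>, so the structure maps are written through the
  components of the projections.
\<close>

definition const_group :: "('o, 'm) cat \<Rightarrow> ('o, 'm) grp \<Rightarrow> (('o, 'm) igraph, 'm \<times> 'm) grp" where
  "const_group C K =
     (let A = const_graph C (Carr K); AA = Prod (Graph C) A A; U = Term (Graph C);
          x = pr1 (Graph C) A A; y = pr2 (Graph C) A A
      in \<lparr> Carr = A,
           Mul = (gmul C K (Edges AA) (fst x) (fst y), gmul C K (Verts AA) (snd x) (snd y)),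
           Inv = (Inv K, Inv K),
           One = (gone C K (Edges U), gone C K (Verts U)) \<rparr>)"

text \<open>\<open>a\<close> and \<open>b\<close> are the actions of \<open>G\<close> on the edges and on the vertices of \<open>X\<close>.\<close>

definition G_graph ::
  "('o, 'm) cat \<Rightarrow> ('o, 'm) grp \<Rightarrow> ('o, 'm) igraph \<Rightarrow> 'm \<Rightarrow> 'm \<Rightarrow> bool" where
  "G_graph C G X a b \<longleftrightarrow> X \<in> Obj (Graph C) \<and>
     is_action C G (Edges X) a \<and> is_action C G (Verts X) b \<and>
     (\<forall>d\<in>{d0 X, d1 X}. d \<cdot>\<^bsub>C\<^esub> a =
        b \<cdot>\<^bsub>C\<^esub> prod_map C (Carr G) (Carr G) (Edges X) (Verts X) (Ident C (Carr G)) d)"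

definition action_map ::
  "('o, 'm) cat \<Rightarrow> ('o, 'm) grp \<Rightarrow> ('o, 'm) igraph \<Rightarrow> 'm \<Rightarrow> 'm \<Rightarrow> 'm \<times> 'm" where
  "action_map C G X a b =
     (let A = const_graph C (Carr G); P = Prod (Graph C) A X;
          x = pr1 (Graph C) A X; y = pr2 (Graph C) A X
      in (gact C G (Edges X) a (Edges P) (fst x) (fst y),
          gact C G (Verts X) b (Verts P) (snd x) (snd y)))"

section \<open>Graphs of groups\<close>

text \<open>
  A graph of groups over \<open>Q\<close> is an object of \<open>GrGrp C Q\<close>. If \<open>\<G>\<close> is one, then \<open>fst (Carr \<G>)\<close> is
  its underlying graph and \<open>snd (Carr \<G>)\<close> the map to \<open>Q\<close>.
\<close>

type_synonym ('o, 'm) gog = "(('o, 'm) igraph \<times> ('m \<times> 'm), 'm \<times> 'm) grp"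

abbreviation GrGrp :: "('o, 'm) cat \<Rightarrow> ('o, 'm) igraph \<Rightarrow> (('o, 'm) gog, 'm \<times> 'm) cat" where
  "GrGrp C Q \<equiv> Grp (Slice (Graph C) Q)"

definition DeltaG :: "('o, 'm) cat \<Rightarrow> ('o, 'm) igraph \<Rightarrow> ('o, 'm) grp \<Rightarrow> ('o, 'm) gog" where
  "DeltaG C Q H = Delta (Graph C) Q (const_group C H)"

definition DeltaG_map ::
  "('o, 'm) cat \<Rightarrow> ('o, 'm) igraph \<Rightarrow> ('o, 'm) grp \<Rightarrow> ('o, 'm) grp \<Rightarrow> 'm \<Rightarrow> 'm \<times> 'm" where
  "DeltaG_map C Q H H' f = Delta_map (Graph C) Q (const_group C H) (const_group C H') (f, f)"

text \<open>The value at \<open>\<G>\<close> of the left adjoint of \<open>DeltaG C Q\<close>, together with the unit at \<open>\<G>\<close>.\<close>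

definition colim :: "('o, 'm) cat \<Rightarrow> ('o, 'm) igraph \<Rightarrow> ('o, 'm) gog \<Rightarrow> ('o, 'm) grp \<times> ('m \<times> 'm)"
where
  "colim C Q \<G> =
     (SOME (U, u). universal_arrow (Grp C) (GrGrp C Q) (DeltaG C Q) (DeltaG_map C Q) \<G> U u)"

definition pi1 :: "('o, 'm) cat \<Rightarrow> ('o, 'm) igraph \<Rightarrow> ('o, 'm) gog \<Rightarrow> ('o, 'm) grp" where
  "pi1 C Q \<G> = fst (colim C Q \<G>)"

definition pi1_unit :: "('o, 'm) cat \<Rightarrow> ('o, 'm) igraph \<Rightarrow> ('o, 'm) gog \<Rightarrow> 'm \<times> 'm" where
  "pi1_unit C Q \<G> = snd (colim C Q \<G>)"

definition pi1_const ::
  "('o, 'm) cat \<Rightarrow> ('o, 'm) igraph \<Rightarrow> ('o, 'm) gog \<Rightarrow> (('o, 'm) igraph, 'm \<times> 'm) grp" where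
  "pi1_const C Q \<G> = const_group C (pi1 C Q \<G>)"

definition pi1_times :: "('o, 'm) cat \<Rightarrow> ('o, 'm) igraph \<Rightarrow> ('o, 'm) gog \<Rightarrow> ('o, 'm) igraph" where
  "pi1_times C Q \<G> = Prod (Graph C) (Carr (pi1_const C Q \<G>)) Q"

text \<open>
  The standard graph is the coequaliser of \<open>(g, x) \<mapsto> (g, u(x))\<close> and \<open>(g, x) \<mapsto> (g \<eta>(x), u(x))\<close>, where
  \<open>u : \<G> \<rightarrow> Q\<close> is the structure map.
\<close>

definition standard_coeq ::
  "('o, 'm) cat \<Rightarrow> ('o, 'm) igraph \<Rightarrow> ('o, 'm) gog \<Rightarrow> ('o, 'm) igraph \<times> ('m \<times> 'm)" where
  "standard_coeq C Q \<G> =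
     (let D = Graph C; K = pi1_const C Q \<G>; P = Carr K; A = fst (Carr \<G>); u = snd (Carr \<G>);
          \<eta> = pi1_unit C Q \<G>; PA = Prod D P A; g = pr1 D P A; x = pr2 D P A
      in coequaliser D PA (Prod D P Q)
           (prod_map D P P A Q (Ident D P) u)
           (tuple D PA P Q (gmul D K PA g (pr1 D P Q \<cdot>\<^bsub>D\<^esub> \<eta> \<cdot>\<^bsub>D\<^esub> x)) (pr2 D P Q \<cdot>\<^bsub>D\<^esub> \<eta> \<cdot>\<^bsub>D\<^esub> x)))"

definition standard_graph ::
  "('o, 'm) cat \<Rightarrow> ('o, 'm) igraph \<Rightarrow> ('o, 'm) gog \<Rightarrow> ('o, 'm) igraph" where
  "standard_graph C Q \<G> = fst (standard_coeq C Q \<G>)"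

definition standard_proj ::
  "('o, 'm) cat \<Rightarrow> ('o, 'm) igraph \<Rightarrow> ('o, 'm) gog \<Rightarrow> 'm \<times> 'm" where
  "standard_proj C Q \<G> = snd (standard_coeq C Q \<G>)"

text \<open>The action \<open>pi1 \<times> T \<rightarrow> T\<close> induced by \<open>(g, (h, q)) \<mapsto> (g h, q)\<close>.\<close>

definition standard_action ::
  "('o, 'm) cat \<Rightarrow> ('o, 'm) igraph \<Rightarrow> ('o, 'm) gog \<Rightarrow> 'm \<times> 'm" where
  "standard_action C Q \<G> =
     (let D = Graph C; K = pi1_const C Q \<G>; P = Carr K; PQ = pi1_times C Q \<G>;
          T = standard_graph C Q \<G>; p = standard_proj C Q \<G>;
          PPQ = Prod D P PQ; g = pr1 D P PQ; x = pr2 D P PQ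
      in THE a. a \<in> Hom D (Prod D P T) T \<and>
           a \<cdot>\<^bsub>D\<^esub> prod_map D P P PQ T (Ident D P) p =
           p \<cdot>\<^bsub>D\<^esub> tuple D PPQ P Q (gmul D K PPQ g (pr1 D P Q \<cdot>\<^bsub>D\<^esub> x)) (pr2 D P Q \<cdot>\<^bsub>D\<^esub> x))"

definition standard_section ::
  "('o, 'm) cat \<Rightarrow> ('o, 'm) igraph \<Rightarrow> ('o, 'm) gog \<Rightarrow> 'm \<times> 'm" where
  "standard_section C Q \<G> =
     (let D = Graph C; K = pi1_const C Q \<G>
      in standard_proj C Q \<G> \<cdot>\<^bsub>D\<^esub> tuple D Q (Carr K) Q (gone D K Q) (Ident D Q))"

definition standard_stab ::
  "('o, 'm) cat \<Rightarrow> ('o, 'm) igraph \<Rightarrow> ('o, 'm) gog \<Rightarrow> ('o, 'm) gog" where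
  "standard_stab C Q \<G> =
     stabiliser (Graph C) (pi1_const C Q \<G>) (standard_graph C Q \<G>) (standard_action C Q \<G>)"

text \<open>The group \<open>t\<^sup>* pi1\<^sub>T\<close> over \<open>Q\<close> and its inclusion into \<open>pi1 \<times> Q\<close>.\<close>

definition section_stab ::
  "('o, 'm) cat \<Rightarrow> ('o, 'm) igraph \<Rightarrow> ('o, 'm) gog \<Rightarrow> ('o, 'm) gog" where
  "section_stab C Q \<G> =
     pb_group (Graph C) Q (standard_graph C Q \<G>) (standard_section C Q \<G>) (standard_stab C Q \<G>)"

definition section_stab_incl ::
  "('o, 'm) cat \<Rightarrow> ('o, 'm) igraph \<Rightarrow> ('o, 'm) gog \<Rightarrow> 'm \<times> 'm" where
  "section_stab_incl C Q \<G> =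
     (let D = Graph C; P = Carr (pi1_const C Q \<G>); T = standard_graph C Q \<G>;
          t = standard_section C Q \<G>; K = standard_stab C Q \<G>;
          i = stab_incl D (pi1_const C Q \<G>) T (standard_action C Q \<G>)
      in tuple D (pb_obj D Q t K) P Q (pr1 D P T \<cdot>\<^bsub>D\<^esub> i \<cdot>\<^bsub>D\<^esub> pb_top D Q t K) (pb_base D Q t K))"

definition unit_monic :: "('o, 'm) cat \<Rightarrow> ('o, 'm) igraph \<Rightarrow> ('o, 'm) gog \<Rightarrow> bool" where
  "unit_monic C Q \<G> \<longleftrightarrow>
     monic (Graph C) (fst (Carr \<G>)) (pi1_times C Q \<G>) (pi1_unit C Q \<G>)"

text \<open>
  \<open>\<phi>\<close> is an isomorphism of graphs of groups from \<open>\<G>\<close> to \<open>t\<^sup>* pi1\<^sub>T\<close> through which the unit factors;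
  as the inclusion into \<open>pi1 \<times> Q\<close> is monic, the factorisation determines \<open>\<phi>\<close>.
\<close>

definition canonical_iso ::
  "('o, 'm) cat \<Rightarrow> ('o, 'm) igraph \<Rightarrow> ('o, 'm) gog \<Rightarrow> 'm \<times> 'm \<Rightarrow> bool" where
  "canonical_iso C Q \<G> \<phi> \<longleftrightarrow> is_iso (GrGrp C Q) \<G> (section_stab C Q \<G>) \<phi> \<and>
     section_stab_incl C Q \<G> \<cdot>\<^bsub>Graph C\<^esub> \<phi> = pi1_unit C Q \<G>"

text \<open>The graph of groups \<open>s\<^sup>* G\<^sub>X\<close> of an action with edge and vertex parts \<open>a\<close>, \<open>b\<close>.\<close>

definition action_gog ::
  "('o, 'm) cat \<Rightarrow> ('o, 'm) grp \<Rightarrow> ('o, 'm) igraph \<Rightarrow> 'm \<Rightarrow> 'm \<Rightarrow>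
   ('o, 'm) igraph \<Rightarrow> 'm \<times> 'm \<Rightarrow> ('o, 'm) gog" where
  "action_gog C G X a b Q s =
     pb_group (Graph C) Q X s (stabiliser (Graph C) (const_group C G) X (action_map C G X a b))"

definition is_quotient ::
  "('o, 'm) cat \<Rightarrow> ('o, 'm) grp \<Rightarrow> ('o, 'm) igraph \<Rightarrow> 'm \<Rightarrow> 'm \<Rightarrow>
   ('o, 'm) igraph \<Rightarrow> 'm \<times> 'm \<Rightarrow> bool" where
  "is_quotient C G X a b Q q \<longleftrightarrow>
     (let D = Graph C; A = const_graph C (Carr G)
      in is_coequaliser D (Prod D A X) X (action_map C G X a b) (pr2 D A X) Q q)"

end

theory Submission
  imports Defs
begin

text \<open>
  Let \<open>\<pi>\<close> be the fundamental group of \<open>\<G>\<close>, with unit \<open>\<eta> : \<G> \<rightarrow> \<pi> \<times> Q\<close>, and write \<open>e\<close> for the first component of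
  \<open>\<eta>\<close> and \<open>u : \<G> \<rightarrow> Q\<close> for the structure map. The standard graph \<open>T\<close> is the quotient \<open>p : \<pi> \<times> Q \<rightarrow> T\<close> of
  \<open>\<pi> \<times> Q\<close> by right translation by \<open>\<G>\<close>, that is, by \<open>(h e(\<gamma>), u(\<gamma>)) ~ (h, u(\<gamma>))\<close>, and \<open>t(x) = p(1, x)\<close>. On
  generalised elements the argument is short. Since \<open>g t(x) = p(g, x)\<close>, a pair \<open>(g, x)\<close> lies in \<open>t\<^sup>* \<pi>\<^sub>T\<close> iff
  \<open>p(g, x) = p(1, x)\<close>. If two points of \<open>\<pi> \<times> Q\<close> with the same image under \<open>p\<close> always differ by an element
  of \<open>\<G>\<close>, then this means \<open>(g, x) = (e(\<gamma>), u(\<gamma>)) = \<eta>(\<gamma>)\<close> for some \<open>\<gamma>\<close>, which is unique as \<open>\<eta>\<close> is monic.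
  So \<open>\<G>\<close> and \<open>t\<^sup>* \<pi>\<^sub>T\<close> are the same subgroup of \<open>\<pi> \<times> Q\<close> (\<open>stabiliser_of_section\<close>).

  The condition on \<open>p\<close> is where the hypotheses on \<open>C\<close> enter. As \<open>\<eta>\<close> is monic, the translation action is free,
  and its congruence is the full action graph; action Barr-exactness of the slices over the vertices and over
  the edges of \<open>Q\<close> says that this congruence is effective in each of the two components
  (\<open>translation_effective\<close>). Pullbacks and coequalisers of graphs are componentwise, so the pair of arrows
  that defines \<open>T\<close> is the kernel pair of its coequaliser (\<open>graph_translation_effective\<close>). Preservation of
  coequalisers by products provides the action of \<open>\<pi>\<close> on \<open>T\<close>.

  The fundamental group itself has to be constructed. A homomorphism from \<open>\<G>\<close> to \<open>\<Delta>K\<close> is a homomorphism from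
  the vertex groups to \<open>K\<close> whose restrictions along \<open>d\<^sub>0\<close> and \<open>d\<^sub>1\<close> to the edge groups coincide, so \<open>\<pi>\<close> is the
  coequaliser of two homomorphisms from the internal coproduct of the edge groups to that of the vertex
  groups (\<open>colim_exists\<close>).

  If \<open>\<G> = s\<^sup>* G\<^sub>X\<close>, then the pairs \<open>(g, x)\<close> with \<open>g s(x) = s(x)\<close> form a subgroup of \<open>G \<times> Q\<close>; its inclusion is a
  monic homomorphism \<open>\<G> \<rightarrow> \<Delta>G\<close>. By the universal property it factors through the unit, which is
  therefore monic (\<open>action_gog_unit_monic\<close>).

  Limits in \<open>C\<close>, in slices and in graphs are fixed by independent choices. All computations are therefore made
  with generalised elements, and constructions are compared through their universal properties.
\<close>

section \<open>Arrows and universal properties\<close>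

text \<open>A hom-set does not record that its two ends are objects. In \<open>arr\<close> this is included, so that the type
  of an arrow is a single hypothesis.\<close>

definition arr :: "('o, 'm) cat \<Rightarrow> 'm \<Rightarrow> 'o \<Rightarrow> 'o \<Rightarrow> bool" ("\<guillemotleft>_ : _ \<rightarrow> _\<guillemotright>\<index>" [51, 51, 51]) where
  "arr C f A B \<longleftrightarrow> A \<in> Obj C \<and> B \<in> Obj C \<and> f \<in> Hom C A B"

lemma arr_dom: "arr C f A B \<Longrightarrow> A \<in> Obj C" and arr_cod: "arr C f A B \<Longrightarrow> B \<in> Obj C"
  and arr_hom: "arr C f A B \<Longrightarrow> f \<in> Hom C A B"
  by (auto simp: arr_def)

lemma monic_iff:
  assumes "A \<in> Obj C" "B \<in> Obj C"
  shows "monic C A B f \<longleftrightarrow> arr C f A B \<and>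
    (\<forall>T x y. arr C x T A \<longrightarrow> arr C y T A \<longrightarrow> f \<cdot>\<^bsub>C\<^esub> x = f \<cdot>\<^bsub>C\<^esub> y \<longrightarrow> x = y)"
  using assms unfolding monic_def arr_def by blast

lemma monicD: "\<lbrakk>monic C A B f; arr C x T A; arr C y T A; f \<cdot>\<^bsub>C\<^esub> x = f \<cdot>\<^bsub>C\<^esub> y\<rbrakk> \<Longrightarrow> x = y"
  unfolding monic_def arr_def by blast

lemma is_productI:
  assumes "arr C p P A" "arr C q P B"
    and "\<And>T f g. \<lbrakk>arr C f T A; arr C g T B\<rbrakk> \<Longrightarrow> \<exists>h. arr C h T P \<and> p \<cdot>\<^bsub>C\<^esub> h = f \<and> q \<cdot>\<^bsub>C\<^esub> h = g"
    and "\<And>T h k. \<lbrakk>arr C h T P; arr C k T P; p \<cdot>\<^bsub>C\<^esub> h = p \<cdot>\<^bsub>C\<^esub> k; q \<cdot>\<^bsub>C\<^esub> h = q \<cdot>\<^bsub>C\<^esub> k\<rbrakk> \<Longrightarrow> h = k"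
  shows "is_product C A B P p q"
  unfolding is_product_def
proof (intro conjI ballI)
  fix T f g assume *: "T \<in> Obj C" "f \<in> Hom C T A" "g \<in> Hom C T B"
  have "arr C f T A" "arr C g T B" using * assms(1,2) by (auto simp: arr_def)
  then obtain h where h: "arr C h T P \<and> p \<cdot>\<^bsub>C\<^esub> h = f \<and> q \<cdot>\<^bsub>C\<^esub> h = g" using assms(3) by blast
  show "\<exists>!h. h \<in> Hom C T P \<and> p \<cdot>\<^bsub>C\<^esub> h = f \<and> q \<cdot>\<^bsub>C\<^esub> h = g"
  proof (rule ex1I[of _ h])
    fix k assume "k \<in> Hom C T P \<and> p \<cdot>\<^bsub>C\<^esub> k = f \<and> q \<cdot>\<^bsub>C\<^esub> k = g"
    moreover from this have "arr C k T P" using h by (auto simp: arr_def)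
    ultimately show "k = h" using h assms(4)[of k T h] by auto
  qed (use h in \<open>auto simp: arr_def\<close>)
qed (use assms(1,2) in \<open>auto simp: arr_def\<close>)

lemma is_productD:
  assumes "is_product C A B P p q" "A \<in> Obj C" "B \<in> Obj C"
  shows "arr C p P A" "arr C q P B"
    and "\<lbrakk>arr C f T A; arr C g T B\<rbrakk> \<Longrightarrow> \<exists>h. arr C h T P \<and> p \<cdot>\<^bsub>C\<^esub> h = f \<and> q \<cdot>\<^bsub>C\<^esub> h = g"
  using assms unfolding is_product_def arr_def by blast+

lemma is_product_ext:
  assumes "is_product C A B P p q" "category C" "A \<in> Obj C" "B \<in> Obj C"
    "arr C h T P" "arr C k T P" "p \<cdot>\<^bsub>C\<^esub> h = p \<cdot>\<^bsub>C\<^esub> k" "q \<cdot>\<^bsub>C\<^esub> h = q \<cdot>\<^bsub>C\<^esub> k"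
  shows "h = k"
proof -
  have o: "T \<in> Obj C" "P \<in> Obj C" "p \<in> Hom C P A" "q \<in> Hom C P B" "h \<in> Hom C T P" "k \<in> Hom C T P"
    using assms unfolding is_product_def arr_def by auto
  then have "p \<cdot>\<^bsub>C\<^esub> h \<in> Hom C T A" "q \<cdot>\<^bsub>C\<^esub> h \<in> Hom C T B"
    using category.Comp_in[OF assms(2)] assms(3,4) by blast+
  then have "\<exists>!l. l \<in> Hom C T P \<and> p \<cdot>\<^bsub>C\<^esub> l = p \<cdot>\<^bsub>C\<^esub> h \<and> q \<cdot>\<^bsub>C\<^esub> l = q \<cdot>\<^bsub>C\<^esub> h"
    using assms(1) o unfolding is_product_def by blast
  then show ?thesis using assms o by metis
qed

lemma is_pullbackI:
  assumes "arr C p P A" "arr C q P A'" "f \<cdot>\<^bsub>C\<^esub> p = g \<cdot>\<^bsub>C\<^esub> q"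
    and "\<And>T x y. \<lbrakk>arr C x T A; arr C y T A'; f \<cdot>\<^bsub>C\<^esub> x = g \<cdot>\<^bsub>C\<^esub> y\<rbrakk>
      \<Longrightarrow> \<exists>h. arr C h T P \<and> p \<cdot>\<^bsub>C\<^esub> h = x \<and> q \<cdot>\<^bsub>C\<^esub> h = y"
    and "\<And>T h k. \<lbrakk>arr C h T P; arr C k T P; p \<cdot>\<^bsub>C\<^esub> h = p \<cdot>\<^bsub>C\<^esub> k; q \<cdot>\<^bsub>C\<^esub> h = q \<cdot>\<^bsub>C\<^esub> k\<rbrakk> \<Longrightarrow> h = k"
  shows "is_pullback C A A' f g P p q"
  unfolding is_pullback_def
proof (intro conjI ballI impI)
  fix T x y assume *: "T \<in> Obj C" "x \<in> Hom C T A" "y \<in> Hom C T A'" "f \<cdot>\<^bsub>C\<^esub> x = g \<cdot>\<^bsub>C\<^esub> y"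
  have "arr C x T A" "arr C y T A'" using * assms(1,2) by (auto simp: arr_def)
  then obtain h where h: "arr C h T P \<and> p \<cdot>\<^bsub>C\<^esub> h = x \<and> q \<cdot>\<^bsub>C\<^esub> h = y" using assms(4) * by blast
  show "\<exists>!h. h \<in> Hom C T P \<and> p \<cdot>\<^bsub>C\<^esub> h = x \<and> q \<cdot>\<^bsub>C\<^esub> h = y"
  proof (rule ex1I[of _ h])
    fix k assume "k \<in> Hom C T P \<and> p \<cdot>\<^bsub>C\<^esub> k = x \<and> q \<cdot>\<^bsub>C\<^esub> k = y"
    moreover from this have "arr C k T P" using h by (auto simp: arr_def)
    ultimately show "k = h" using h assms(5)[of k T h] by auto
  qed (use h in \<open>auto simp: arr_def\<close>)
qed (use assms(1-3) in \<open>auto simp: arr_def\<close>)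

lemma is_pullbackD:
  assumes "is_pullback C A A' f g P p q" "A \<in> Obj C" "A' \<in> Obj C"
  shows "arr C p P A" "arr C q P A'" "f \<cdot>\<^bsub>C\<^esub> p = g \<cdot>\<^bsub>C\<^esub> q"
    and "\<lbrakk>arr C x T A; arr C y T A'; f \<cdot>\<^bsub>C\<^esub> x = g \<cdot>\<^bsub>C\<^esub> y\<rbrakk>
      \<Longrightarrow> \<exists>h. arr C h T P \<and> p \<cdot>\<^bsub>C\<^esub> h = x \<and> q \<cdot>\<^bsub>C\<^esub> h = y"
  using assms unfolding is_pullback_def arr_def by blast+

lemma is_equaliserI:
  assumes "arr C i E A" "f \<cdot>\<^bsub>C\<^esub> i = g \<cdot>\<^bsub>C\<^esub> i"
    and "\<And>T h. \<lbrakk>arr C h T A; f \<cdot>\<^bsub>C\<^esub> h = g \<cdot>\<^bsub>C\<^esub> h\<rbrakk> \<Longrightarrow> \<exists>k. arr C k T E \<and> i \<cdot>\<^bsub>C\<^esub> k = h"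
    and "\<And>T h k. \<lbrakk>arr C h T E; arr C k T E; i \<cdot>\<^bsub>C\<^esub> h = i \<cdot>\<^bsub>C\<^esub> k\<rbrakk> \<Longrightarrow> h = k"
  shows "is_equaliser C A B f g E i"
  unfolding is_equaliser_def
proof (intro conjI ballI impI)
  fix T x assume *: "T \<in> Obj C" "x \<in> Hom C T A" "f \<cdot>\<^bsub>C\<^esub> x = g \<cdot>\<^bsub>C\<^esub> x"
  have "arr C x T A" using * assms(1) by (auto simp: arr_def)
  then obtain h where h: "arr C h T E \<and> i \<cdot>\<^bsub>C\<^esub> h = x" using assms(3) * by blast
  show "\<exists>!h. h \<in> Hom C T E \<and> i \<cdot>\<^bsub>C\<^esub> h = x"
  proof (rule ex1I[of _ h])
    fix k assume "k \<in> Hom C T E \<and> i \<cdot>\<^bsub>C\<^esub> k = x"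
    moreover from this have "arr C k T E" using h by (auto simp: arr_def)
    ultimately show "k = h" using h assms(4)[of k T h] by auto
  qed (use h in \<open>auto simp: arr_def\<close>)
qed (use assms(1-2) in \<open>auto simp: arr_def\<close>)

lemma is_equaliserD:
  assumes "is_equaliser C A B f g E i" "A \<in> Obj C"
  shows "arr C i E A" "f \<cdot>\<^bsub>C\<^esub> i = g \<cdot>\<^bsub>C\<^esub> i"
    and "\<lbrakk>arr C h T A; f \<cdot>\<^bsub>C\<^esub> h = g \<cdot>\<^bsub>C\<^esub> h\<rbrakk> \<Longrightarrow> \<exists>k. arr C k T E \<and> i \<cdot>\<^bsub>C\<^esub> k = h"
  using assms unfolding is_equaliser_def arr_def by blast+

lemma is_coequaliserI:
  assumes "arr C q B Z" "q \<cdot>\<^bsub>C\<^esub> f = q \<cdot>\<^bsub>C\<^esub> g"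
    and "\<And>T h. \<lbrakk>arr C h B T; h \<cdot>\<^bsub>C\<^esub> f = h \<cdot>\<^bsub>C\<^esub> g\<rbrakk> \<Longrightarrow> \<exists>k. arr C k Z T \<and> k \<cdot>\<^bsub>C\<^esub> q = h"
    and "\<And>T h k. \<lbrakk>arr C h Z T; arr C k Z T; h \<cdot>\<^bsub>C\<^esub> q = k \<cdot>\<^bsub>C\<^esub> q\<rbrakk> \<Longrightarrow> h = k"
  shows "is_coequaliser C A B f g Z q"
  unfolding is_coequaliser_def
proof (intro conjI ballI impI)
  fix T x assume *: "T \<in> Obj C" "x \<in> Hom C B T" "x \<cdot>\<^bsub>C\<^esub> f = x \<cdot>\<^bsub>C\<^esub> g"
  have "arr C x B T" using * assms(1) by (auto simp: arr_def)
  then obtain h where h: "arr C h Z T \<and> h \<cdot>\<^bsub>C\<^esub> q = x" using assms(3) * by blast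
  show "\<exists>!h. h \<in> Hom C Z T \<and> h \<cdot>\<^bsub>C\<^esub> q = x"
  proof (rule ex1I[of _ h])
    fix k assume "k \<in> Hom C Z T \<and> k \<cdot>\<^bsub>C\<^esub> q = x"
    moreover from this have "arr C k Z T" using h by (auto simp: arr_def)
    ultimately show "k = h" using h assms(4)[of k T h] by auto
  qed (use h in \<open>auto simp: arr_def\<close>)
qed (use assms(1-2) in \<open>auto simp: arr_def\<close>)

lemma is_coequaliserD:
  assumes "is_coequaliser C A B f g Z q" "B \<in> Obj C"
  shows "arr C q B Z" "q \<cdot>\<^bsub>C\<^esub> f = q \<cdot>\<^bsub>C\<^esub> g"
    and "\<lbrakk>arr C h B T; h \<cdot>\<^bsub>C\<^esub> f = h \<cdot>\<^bsub>C\<^esub> g\<rbrakk> \<Longrightarrow> \<exists>k. arr C k Z T \<and> k \<cdot>\<^bsub>C\<^esub> q = h"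
  using assms unfolding is_coequaliser_def arr_def by blast+

lemma is_terminalD:
  assumes "is_terminal C Z" "A \<in> Obj C"
  shows "\<exists>f. arr C f A Z" "\<lbrakk>arr C f A Z; arr C g A Z\<rbrakk> \<Longrightarrow> f = g"
  using assms unfolding is_terminal_def arr_def by blast+

lemma is_terminalI:
  assumes "Z \<in> Obj C" "\<And>A. A \<in> Obj C \<Longrightarrow> \<exists>f. arr C f A Z"
    "\<And>A f g. \<lbrakk>arr C f A Z; arr C g A Z\<rbrakk> \<Longrightarrow> f = g"
  shows "is_terminal C Z"
  using assms unfolding is_terminal_def arr_def by metis

context category
begin

lemma ident: "A \<in> Obj C \<Longrightarrow> \<guillemotleft>Ident C A : A \<rightarrow> A\<guillemotright>"
  by (simp add: arr_def Ident_in)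

lemma comp: "\<lbrakk>\<guillemotleft>f : A \<rightarrow> B\<guillemotright>; \<guillemotleft>g : B \<rightarrow> D\<guillemotright>\<rbrakk> \<Longrightarrow> \<guillemotleft>g \<cdot> f : A \<rightarrow> D\<guillemotright>"
  unfolding arr_def by (blast intro: Comp_in)

lemma idr: "\<guillemotleft>f : A \<rightarrow> B\<guillemotright> \<Longrightarrow> f \<cdot> Ident C A = f"
  and idl: "\<guillemotleft>f : A \<rightarrow> B\<guillemotright> \<Longrightarrow> Ident C B \<cdot> f = f"
  unfolding arr_def by (blast intro: Comp_Ident Ident_Comp)+

lemma assoc: "\<lbrakk>\<guillemotleft>f : A \<rightarrow> B\<guillemotright>; \<guillemotleft>g : B \<rightarrow> D\<guillemotright>; \<guillemotleft>h : D \<rightarrow> E\<guillemotright>\<rbrakk> \<Longrightarrow> (h \<cdot> g) \<cdot> f = h \<cdot> (g \<cdot> f)"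
  unfolding arr_def by (blast intro: Comp_assoc)

lemma product_ext:
  "\<lbrakk>is_product C A B P p q; A \<in> Obj C; B \<in> Obj C; \<guillemotleft>h : T \<rightarrow> P\<guillemotright>; \<guillemotleft>k : T \<rightarrow> P\<guillemotright>;
    p \<cdot> h = p \<cdot> k; q \<cdot> h = q \<cdot> k\<rbrakk> \<Longrightarrow> h = k"
  using is_product_ext[OF _ category_axioms] by metis

lemma pullback_ext:
  assumes "is_pullback C A A' f g P p q" "\<guillemotleft>f : A \<rightarrow> B\<guillemotright>" "\<guillemotleft>g : A' \<rightarrow> B\<guillemotright>" "\<guillemotleft>h : T \<rightarrow> P\<guillemotright>" "\<guillemotleft>k : T \<rightarrow> P\<guillemotright>"
    "p \<cdot> h = p \<cdot> k" "q \<cdot> h = q \<cdot> k"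
  shows "h = k"
proof -
  have p: "\<guillemotleft>p : P \<rightarrow> A\<guillemotright>" "\<guillemotleft>q : P \<rightarrow> A'\<guillemotright>" "f \<cdot> p = g \<cdot> q"
    using is_pullbackD[OF assms(1)] assms(2,3) by (auto simp: arr_def)
  have "\<guillemotleft>p \<cdot> h : T \<rightarrow> A\<guillemotright>" "\<guillemotleft>q \<cdot> h : T \<rightarrow> A'\<guillemotright>" using p assms by (blast intro: comp)+
  moreover have "f \<cdot> (p \<cdot> h) = g \<cdot> (q \<cdot> h)" using p assms assoc by metis
  ultimately have "\<exists>!l. l \<in> Hom C T P \<and> p \<cdot> l = p \<cdot> h \<and> q \<cdot> l = q \<cdot> h"
    using assms(1) unfolding is_pullback_def arr_def by blast
  then show ?thesis using assms by (metis arr_hom)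
qed

lemma equaliser_ext:
  assumes "is_equaliser C A B f g E i" "\<guillemotleft>f : A \<rightarrow> B\<guillemotright>" "\<guillemotleft>g : A \<rightarrow> B\<guillemotright>" "\<guillemotleft>h : T \<rightarrow> E\<guillemotright>" "\<guillemotleft>k : T \<rightarrow> E\<guillemotright>"
    "i \<cdot> h = i \<cdot> k"
  shows "h = k"
proof -
  have p: "\<guillemotleft>i : E \<rightarrow> A\<guillemotright>" "f \<cdot> i = g \<cdot> i"
    using is_equaliserD[OF assms(1)] assms(2) by (auto simp: arr_def)
  have "\<guillemotleft>i \<cdot> h : T \<rightarrow> A\<guillemotright>" using p assms by (blast intro: comp)
  moreover have "f \<cdot> (i \<cdot> h) = g \<cdot> (i \<cdot> h)" using p assms assoc by metis
  ultimately have "\<exists>!l. l \<in> Hom C T E \<and> i \<cdot> l = i \<cdot> h"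
    using assms(1) unfolding is_equaliser_def arr_def by blast
  then show ?thesis using assms by (metis arr_hom)
qed

lemma coequaliser_ext:
  assumes "is_coequaliser C A B f g Z q" "\<guillemotleft>f : A \<rightarrow> B\<guillemotright>" "\<guillemotleft>g : A \<rightarrow> B\<guillemotright>" "\<guillemotleft>h : Z \<rightarrow> T\<guillemotright>" "\<guillemotleft>k : Z \<rightarrow> T\<guillemotright>"
    "h \<cdot> q = k \<cdot> q"
  shows "h = k"
proof -
  have p: "\<guillemotleft>q : B \<rightarrow> Z\<guillemotright>" "q \<cdot> f = q \<cdot> g"
    using is_coequaliserD[OF assms(1)] assms(2) by (auto simp: arr_def)
  have "\<guillemotleft>h \<cdot> q : B \<rightarrow> T\<guillemotright>" using p assms by (blast intro: comp)
  moreover have "(h \<cdot> q) \<cdot> f = (h \<cdot> q) \<cdot> g" using p assms assoc by metis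
  ultimately have "\<exists>!l. l \<in> Hom C Z T \<and> l \<cdot> q = h \<cdot> q"
    using assms(1) unfolding is_coequaliser_def arr_def by blast
  then show ?thesis using assms by (metis arr_hom)
qed

lemma terminal_bang:
  assumes "is_terminal C Z" shows "is_terminal C (Term C)"
  using assms unfolding Term_def by (rule someI)

lemma bang_arr: "\<lbrakk>is_terminal C Z; A \<in> Obj C\<rbrakk> \<Longrightarrow> \<guillemotleft>bang C A : A \<rightarrow> Term C\<guillemotright>"
  using terminal_bang[of Z] unfolding bang_def is_terminal_def arr_def
  by (metis (mono_tags, lifting) theI')

text \<open>These four results mediate between limits and colimits that are fixed by choice and those that are
  built by hand: a universal cone is determined up to an isomorphism compatible with the legs, and
  universality is invariant under such isomorphisms.\<close>

lemma pullback_iso: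
  assumes "is_pullback C A A' f g P p q" "is_pullback C A A' f g P' p' q'"
    "\<guillemotleft>f : A \<rightarrow> B\<guillemotright>" "\<guillemotleft>g : A' \<rightarrow> B\<guillemotright>"
  shows "\<exists>\<phi> \<psi>. \<guillemotleft>\<phi> : P \<rightarrow> P'\<guillemotright> \<and> \<guillemotleft>\<psi> : P' \<rightarrow> P\<guillemotright> \<and> \<psi> \<cdot> \<phi> = Ident C P \<and> \<phi> \<cdot> \<psi> = Ident C P' \<and>
    p' \<cdot> \<phi> = p \<and> q' \<cdot> \<phi> = q \<and> p \<cdot> \<psi> = p' \<and> q \<cdot> \<psi> = q'"
proof -
  have o: "A \<in> Obj C" "A' \<in> Obj C" using assms by (auto simp: arr_def)
  note P = is_pullbackD[OF assms(1) o] and P' = is_pullbackD[OF assms(2) o]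
  obtain \<phi> where \<phi>: "\<guillemotleft>\<phi> : P \<rightarrow> P'\<guillemotright>" "p' \<cdot> \<phi> = p" "q' \<cdot> \<phi> = q" using P'(4)[OF P(1-3)] by blast
  obtain \<psi> where \<psi>: "\<guillemotleft>\<psi> : P' \<rightarrow> P\<guillemotright>" "p \<cdot> \<psi> = p'" "q \<cdot> \<psi> = q'" using P(4)[OF P'(1-3)] by blast
  have i: "\<guillemotleft>Ident C P : P \<rightarrow> P\<guillemotright>" "\<guillemotleft>Ident C P' : P' \<rightarrow> P'\<guillemotright>" using ident \<phi> \<psi> by (blast dest: arr_dom)+
  have c: "\<guillemotleft>\<psi> \<cdot> \<phi> : P \<rightarrow> P\<guillemotright>" "\<guillemotleft>\<phi> \<cdot> \<psi> : P' \<rightarrow> P'\<guillemotright>" using \<phi> \<psi> by (blast intro: comp)+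
  have "\<psi> \<cdot> \<phi> = Ident C P"
    by (rule pullback_ext[OF assms(1,3,4) c(1) i(1)])
      (use \<phi> \<psi> P in \<open>simp_all add: assoc[symmetric, OF \<phi>(1) \<psi>(1)] idr\<close>)
  moreover have "\<phi> \<cdot> \<psi> = Ident C P'"
    by (rule pullback_ext[OF assms(2,3,4) c(2) i(2)])
      (use \<phi> \<psi> P' in \<open>simp_all add: assoc[symmetric, OF \<psi>(1) \<phi>(1)] idr\<close>)
  ultimately show ?thesis using \<phi> \<psi> by blast
qed

lemma pullback_transfer:
  assumes "is_pullback C A A' f g P' p' q'" "\<guillemotleft>f : A \<rightarrow> B\<guillemotright>" "\<guillemotleft>g : A' \<rightarrow> B\<guillemotright>"
    "\<guillemotleft>\<phi> : P \<rightarrow> P'\<guillemotright>" "\<guillemotleft>\<psi> : P' \<rightarrow> P\<guillemotright>" "\<psi> \<cdot> \<phi> = Ident C P" "\<phi> \<cdot> \<psi> = Ident C P'"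
    "p = p' \<cdot> \<phi>" "q = q' \<cdot> \<phi>"
  shows "is_pullback C A A' f g P p q"
proof -
  have o: "A \<in> Obj C" "A' \<in> Obj C" using assms by (auto simp: arr_def)
  note P' = is_pullbackD[OF assms(1) o]
  note a = assoc[OF _ assms(4) P'(1)] assoc[OF _ assms(4) P'(2)]
  show ?thesis
  proof (rule is_pullbackI)
    show p: "\<guillemotleft>p : P \<rightarrow> A\<guillemotright>" "\<guillemotleft>q : P \<rightarrow> A'\<guillemotright>" using assms P' by (auto intro: comp)
    show "f \<cdot> p = g \<cdot> q" using assms P' by (metis assoc)
    fix T
    show "\<exists>h. \<guillemotleft>h : T \<rightarrow> P\<guillemotright> \<and> p \<cdot> h = x \<and> q \<cdot> h = y"
      if x: "\<guillemotleft>x : T \<rightarrow> A\<guillemotright>" "\<guillemotleft>y : T \<rightarrow> A'\<guillemotright>" "f \<cdot> x = g \<cdot> y" for x y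
    proof -
      obtain h where h: "\<guillemotleft>h : T \<rightarrow> P'\<guillemotright>" "p' \<cdot> h = x" "q' \<cdot> h = y" using P'(4)[OF x] by blast
      have s: "\<guillemotleft>\<psi> \<cdot> h : T \<rightarrow> P\<guillemotright>" using h assms by (blast intro: comp)
      have "\<phi> \<cdot> (\<psi> \<cdot> h) = h" using h assms assoc idl by metis
      then show ?thesis using s a[OF s] h assms by metis
    qed
    show "h = k" if h: "\<guillemotleft>h : T \<rightarrow> P\<guillemotright>" "\<guillemotleft>k : T \<rightarrow> P\<guillemotright>" "p \<cdot> h = p \<cdot> k" "q \<cdot> h = q \<cdot> k" for h k
    proof -
      have "\<phi> \<cdot> h = \<phi> \<cdot> k"
        by (rule pullback_ext[OF assms(1-3), of _ T])
          (use h assms a in \<open>auto intro: comp\<close>)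
      then show ?thesis
        using assoc[OF h(1) assms(4,5)] assoc[OF h(2) assms(4,5)] idl[OF h(1)] idl[OF h(2)] assms(6)
        by metis
    qed
  qed
qed

lemma coequaliser_iso:
  assumes "is_coequaliser C A B f g Z q" "is_coequaliser C A B f g Z' q'" "\<guillemotleft>f : A \<rightarrow> B\<guillemotright>" "\<guillemotleft>g : A \<rightarrow> B\<guillemotright>"
  shows "\<exists>\<phi> \<psi>. \<guillemotleft>\<phi> : Z \<rightarrow> Z'\<guillemotright> \<and> \<guillemotleft>\<psi> : Z' \<rightarrow> Z\<guillemotright> \<and> \<psi> \<cdot> \<phi> = Ident C Z \<and> \<phi> \<cdot> \<psi> = Ident C Z' \<and>
    \<phi> \<cdot> q = q' \<and> \<psi> \<cdot> q' = q"
proof -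
  have o: "B \<in> Obj C" using assms by (auto simp: arr_def)
  note Z = is_coequaliserD[OF assms(1) o] and Z' = is_coequaliserD[OF assms(2) o]
  obtain \<phi> where \<phi>: "\<guillemotleft>\<phi> : Z \<rightarrow> Z'\<guillemotright>" "\<phi> \<cdot> q = q'" using Z(3)[OF Z'(1,2)] by blast
  obtain \<psi> where \<psi>: "\<guillemotleft>\<psi> : Z' \<rightarrow> Z\<guillemotright>" "\<psi> \<cdot> q' = q" using Z'(3)[OF Z(1,2)] by blast
  have i: "\<guillemotleft>Ident C Z : Z \<rightarrow> Z\<guillemotright>" "\<guillemotleft>Ident C Z' : Z' \<rightarrow> Z'\<guillemotright>" using ident \<phi> \<psi> by (blast dest: arr_dom)+
  have c: "\<guillemotleft>\<psi> \<cdot> \<phi> : Z \<rightarrow> Z\<guillemotright>" "\<guillemotleft>\<phi> \<cdot> \<psi> : Z' \<rightarrow> Z'\<guillemotright>" using \<phi> \<psi> by (blast intro: comp)+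
  have "\<psi> \<cdot> \<phi> = Ident C Z"
    by (rule coequaliser_ext[OF assms(1,3,4) c(1) i(1)])
      (use \<phi> \<psi> Z in \<open>simp add: assoc[OF Z(1) \<phi>(1) \<psi>(1)] idl\<close>)
  moreover have "\<phi> \<cdot> \<psi> = Ident C Z'"
    by (rule coequaliser_ext[OF assms(2,3,4) c(2) i(2)])
      (use \<phi> \<psi> Z' in \<open>simp add: assoc[OF Z'(1) \<psi>(1) \<phi>(1)] idl\<close>)
  ultimately show ?thesis using \<phi> \<psi> by blast
qed

lemma coequaliser_transfer:
  assumes "is_coequaliser C A B f g Z' q'" "\<guillemotleft>f : A \<rightarrow> B\<guillemotright>" "\<guillemotleft>g : A \<rightarrow> B\<guillemotright>"
    "\<guillemotleft>\<phi> : Z \<rightarrow> Z'\<guillemotright>" "\<guillemotleft>\<psi> : Z' \<rightarrow> Z\<guillemotright>" "\<psi> \<cdot> \<phi> = Ident C Z" "\<phi> \<cdot> \<psi> = Ident C Z'" "q = \<psi> \<cdot> q'"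
  shows "is_coequaliser C A B f g Z q"
proof -
  have o: "B \<in> Obj C" using assms by (auto simp: arr_def)
  note Z' = is_coequaliserD[OF assms(1) o]
  show ?thesis
  proof (rule is_coequaliserI)
    show q: "\<guillemotleft>q : B \<rightarrow> Z\<guillemotright>" using assms Z' by (auto intro: comp)
    show "q \<cdot> f = q \<cdot> g" using assms Z' by (metis assoc)
    fix T
    show "\<exists>k. \<guillemotleft>k : Z \<rightarrow> T\<guillemotright> \<and> k \<cdot> q = h" if x: "\<guillemotleft>h : B \<rightarrow> T\<guillemotright>" "h \<cdot> f = h \<cdot> g" for h
    proof -
      obtain k where k: "\<guillemotleft>k : Z' \<rightarrow> T\<guillemotright>" "k \<cdot> q' = h" using Z'(3)[OF x] by blast
      have "\<guillemotleft>k \<cdot> \<phi> : Z \<rightarrow> T\<guillemotright>" using k assms by (blast intro: comp)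
      moreover have "(k \<cdot> \<phi>) \<cdot> q = k \<cdot> ((\<phi> \<cdot> \<psi>) \<cdot> q')"
        using assoc[OF q assms(4) k(1)] assoc[OF Z'(1) assms(5,4)] assms(8) by simp
      ultimately show ?thesis using k assms Z' idl by metis
    qed
    show "h = k" if h: "\<guillemotleft>h : Z \<rightarrow> T\<guillemotright>" "\<guillemotleft>k : Z \<rightarrow> T\<guillemotright>" "h \<cdot> q = k \<cdot> q" for h k
    proof -
      have "h \<cdot> \<psi> = k \<cdot> \<psi>"
        by (rule coequaliser_ext[OF assms(1-3), of _ T])
          (use h assms assoc[OF Z'(1) assms(5)] in \<open>auto intro: comp\<close>)
      then show ?thesis
        using assoc[OF assms(4,5) h(1)] assoc[OF assms(4,5) h(2)] idr[OF h(1)] idr[OF h(2)] assms(6)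
        by metis
    qed
  qed
qed

end

section \<open>Finite limits and generalised elements\<close>

text \<open>Finite limits in terms of a terminal object and pullbacks: this form passes directly to slices, where
  pullbacks are those of the base category, and to graphs, where they are componentwise.\<close>

locale lex = category +
  assumes terminal_ex: "\<exists>Z. is_terminal C Z"
    and pullback_ex: "\<lbrakk>\<guillemotleft>f : A \<rightarrow> B\<guillemotright>; \<guillemotleft>g : A' \<rightarrow> B\<guillemotright>\<rbrakk> \<Longrightarrow> \<exists>P p q. is_pullback C A A' f g P p q"
begin

lemma is_terminal_Term: "is_terminal C (Term C)"
  using terminal_ex terminal_bang by blast

lemma Term_obj: "Term C \<in> Obj C"
  using is_terminal_Term by (simp add: is_terminal_def)

lemma bang: "A \<in> Obj C \<Longrightarrow> \<guillemotleft>bang C A : A \<rightarrow> Term C\<guillemotright>"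
  using terminal_ex bang_arr by blast

lemma bang_eq: "\<lbrakk>\<guillemotleft>f : A \<rightarrow> Term C\<guillemotright>; \<guillemotleft>g : A \<rightarrow> Term C\<guillemotright>\<rbrakk> \<Longrightarrow> f = g"
  using is_terminalD(2)[OF is_terminal_Term] arr_dom by metis

lemma product_iff_pullback:
  assumes "A \<in> Obj C" "B \<in> Obj C" "is_terminal C Z" "\<guillemotleft>a : A \<rightarrow> Z\<guillemotright>" "\<guillemotleft>b : B \<rightarrow> Z\<guillemotright>"
  shows "is_product C A B P p q \<longleftrightarrow> is_pullback C A B a b P p q"
proof
  assume P: "is_product C A B P p q"
  note p = is_productD[OF P assms(1,2)]
  have c: "a \<cdot> x = b \<cdot> y" if "\<guillemotleft>x : T \<rightarrow> A\<guillemotright>" "\<guillemotleft>y : T \<rightarrow> B\<guillemotright>" for T x y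
    using is_terminalD(2)[OF assms(3) arr_dom[OF that(1)] comp[OF that(1) assms(4)] comp[OF that(2) assms(5)]] .
  show "is_pullback C A B a b P p q"
  proof (rule is_pullbackI)
    show "a \<cdot> p = b \<cdot> q" using c p by blast
  qed (use p in blast, use p in blast, use p in blast, rule product_ext[OF P assms(1,2)])
next
  assume P: "is_pullback C A B a b P p q"
  note p = is_pullbackD[OF P assms(1,2)]
  have c: "a \<cdot> x = b \<cdot> y" if "\<guillemotleft>x : T \<rightarrow> A\<guillemotright>" "\<guillemotleft>y : T \<rightarrow> B\<guillemotright>" for T x y
    using is_terminalD(2)[OF assms(3) arr_dom[OF that(1)] comp[OF that(1) assms(4)] comp[OF that(2) assms(5)]] .
  show "is_product C A B P p q"
    by (rule is_productI)
      (use p in blast, use p in blast, use p c in blast, rule pullback_ext[OF P assms(4,5)])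
qed

lemma is_product_Prod:
  assumes "A \<in> Obj C" "B \<in> Obj C"
  shows "is_product C A B (Prod C A B) (pr1 C A B) (pr2 C A B)"
proof -
  obtain P p q where "is_product C A B P p q"
    using pullback_ex[OF bang bang] assms product_iff_pullback[OF assms is_terminal_Term bang bang]
    by blast
  then have "\<exists>x. case x of (P, p, q) \<Rightarrow> is_product C A B P p q" by auto
  then have "case product_cone C A B of (P, p, q) \<Rightarrow> is_product C A B P p q"
    unfolding product_cone_def by (rule someI_ex)
  then show ?thesis by (simp add: Prod_def pr1_def pr2_def split_beta)
qed

lemma pr1: "\<lbrakk>A \<in> Obj C; B \<in> Obj C\<rbrakk> \<Longrightarrow> \<guillemotleft>pr1 C A B : Prod C A B \<rightarrow> A\<guillemotright>"
  and pr2: "\<lbrakk>A \<in> Obj C; B \<in> Obj C\<rbrakk> \<Longrightarrow> \<guillemotleft>pr2 C A B : Prod C A B \<rightarrow> B\<guillemotright>"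
  using is_productD(1,2)[OF is_product_Prod] by metis+

lemma Prod_obj: "\<lbrakk>A \<in> Obj C; B \<in> Obj C\<rbrakk> \<Longrightarrow> Prod C A B \<in> Obj C"
  using pr1 by (rule arr_dom)

lemma prod_ext:
  "\<lbrakk>A \<in> Obj C; B \<in> Obj C; \<guillemotleft>h : T \<rightarrow> Prod C A B\<guillemotright>; \<guillemotleft>k : T \<rightarrow> Prod C A B\<guillemotright>; pr1 C A B \<cdot> h = pr1 C A B \<cdot> k;
    pr2 C A B \<cdot> h = pr2 C A B \<cdot> k\<rbrakk> \<Longrightarrow> h = k"
  using product_ext[OF is_product_Prod] by metis

lemma tuple_props:
  assumes "\<guillemotleft>x : T \<rightarrow> A\<guillemotright>" "\<guillemotleft>y : T \<rightarrow> B\<guillemotright>"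
  shows "\<guillemotleft>tuple C T A B x y : T \<rightarrow> Prod C A B\<guillemotright> \<and>
    pr1 C A B \<cdot> tuple C T A B x y = x \<and> pr2 C A B \<cdot> tuple C T A B x y = y"
proof -
  have o: "A \<in> Obj C" "B \<in> Obj C" "T \<in> Obj C" using assms by (auto dest: arr_dom arr_cod)
  have "\<exists>!h. h \<in> Hom C T (Prod C A B) \<and> pr1 C A B \<cdot> h = x \<and> pr2 C A B \<cdot> h = y"
    using is_product_Prod[OF o(1,2)] assms unfolding is_product_def arr_def by blast
  from theI'[OF this] show ?thesis
    unfolding tuple_def using o Prod_obj by (simp add: arr_def)
qed

lemma tuple: "\<lbrakk>\<guillemotleft>x : T \<rightarrow> A\<guillemotright>; \<guillemotleft>y : T \<rightarrow> B\<guillemotright>\<rbrakk> \<Longrightarrow> \<guillemotleft>tuple C T A B x y : T \<rightarrow> Prod C A B\<guillemotright>"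
  and pr1_tuple: "\<lbrakk>\<guillemotleft>x : T \<rightarrow> A\<guillemotright>; \<guillemotleft>y : T \<rightarrow> B\<guillemotright>\<rbrakk> \<Longrightarrow> pr1 C A B \<cdot> tuple C T A B x y = x"
  and pr2_tuple: "\<lbrakk>\<guillemotleft>x : T \<rightarrow> A\<guillemotright>; \<guillemotleft>y : T \<rightarrow> B\<guillemotright>\<rbrakk> \<Longrightarrow> pr2 C A B \<cdot> tuple C T A B x y = y"
  using tuple_props by auto

lemma tuple_eqI:
  assumes "\<guillemotleft>h : T \<rightarrow> Prod C A B\<guillemotright>" "A \<in> Obj C" "B \<in> Obj C" "pr1 C A B \<cdot> h = x" "pr2 C A B \<cdot> h = y"
  shows "tuple C T A B x y = h"
proof -
  have "\<guillemotleft>x : T \<rightarrow> A\<guillemotright>" "\<guillemotleft>y : T \<rightarrow> B\<guillemotright>" using assms pr1 pr2 comp by blast+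
  then show ?thesis using prod_ext[OF assms(2,3) tuple assms(1)] pr1_tuple pr2_tuple assms by simp
qed

lemma tuple_comp:
  assumes "\<guillemotleft>k : S \<rightarrow> T\<guillemotright>" "\<guillemotleft>x : T \<rightarrow> A\<guillemotright>" "\<guillemotleft>y : T \<rightarrow> B\<guillemotright>"
  shows "tuple C T A B x y \<cdot> k = tuple C S A B (x \<cdot> k) (y \<cdot> k)"
proof -
  note t = tuple[OF assms(2,3)]
  have o: "A \<in> Obj C" "B \<in> Obj C" using assms by (auto dest: arr_dom arr_cod)
  show ?thesis
    by (rule sym, rule tuple_eqI[OF comp[OF assms(1) t] o])
      (simp_all add: assoc[symmetric, OF assms(1) t pr1[OF o]] assoc[symmetric, OF assms(1) t pr2[OF o]]
        pr1_tuple[OF assms(2,3)] pr2_tuple[OF assms(2,3)])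
qed

lemma prod_map_elem:
  assumes "\<guillemotleft>f : A \<rightarrow> A'\<guillemotright>" "\<guillemotleft>g : B \<rightarrow> B'\<guillemotright>" "\<guillemotleft>x : T \<rightarrow> A\<guillemotright>" "\<guillemotleft>y : T \<rightarrow> B\<guillemotright>"
  shows "prod_map C A A' B B' f g \<cdot> tuple C T A B x y = tuple C T A' B' (f \<cdot> x) (g \<cdot> y)"
proof -
  have o: "A \<in> Obj C" "B \<in> Obj C" using assms by (auto dest: arr_dom arr_cod)
  note t = tuple[OF assms(3,4)] pr1[OF o] pr2[OF o]
  show ?thesis
    unfolding prod_map_def tuple_comp[OF t(1) comp[OF t(2) assms(1)] comp[OF t(3) assms(2)]]
      assoc[OF t(1,2) assms(1)] assoc[OF t(1,3) assms(2)] pr1_tuple[OF assms(3,4)] pr2_tuple[OF assms(3,4)] ..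
qed

lemma prod_map:
  assumes "\<guillemotleft>f : A \<rightarrow> A'\<guillemotright>" "\<guillemotleft>g : B \<rightarrow> B'\<guillemotright>"
  shows "\<guillemotleft>prod_map C A A' B B' f g : Prod C A B \<rightarrow> Prod C A' B'\<guillemotright>"
  unfolding prod_map_def using assms by (auto intro!: tuple intro: comp pr1 pr2 dest: arr_dom)

lemma tuple_prs: "\<lbrakk>\<guillemotleft>h : T \<rightarrow> Prod C A B\<guillemotright>; A \<in> Obj C; B \<in> Obj C\<rbrakk>
  \<Longrightarrow> tuple C T A B (pr1 C A B \<cdot> h) (pr2 C A B \<cdot> h) = h"
  by (rule tuple_eqI) auto

text \<open>The equaliser of \<open>f\<close> and \<open>g\<close> is the pullback of the graphs \<open>(1, f)\<close> and \<open>(1, g)\<close>.\<close>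

lemma equaliser_ex:
  assumes "\<guillemotleft>f : A \<rightarrow> B\<guillemotright>" "\<guillemotleft>g : A \<rightarrow> B\<guillemotright>"
  shows "\<exists>E i. is_equaliser C A B f g E i"
proof -
  have o: "A \<in> Obj C" "B \<in> Obj C" using assms by (auto dest: arr_dom arr_cod)
  note i = ident[OF o(1)]
  define u where "u = tuple C A A B (Ident C A) f"
  define v where "v = tuple C A A B (Ident C A) g"
  have uv: "\<guillemotleft>u : A \<rightarrow> Prod C A B\<guillemotright>" "\<guillemotleft>v : A \<rightarrow> Prod C A B\<guillemotright>"
    unfolding u_def v_def using assms i tuple by blast+
  obtain E p q where E: "is_pullback C A A u v E p q" using pullback_ex[OF uv] by blast
  note e = is_pullbackD[OF E o(1,1)]
  have ux: "u \<cdot> x = tuple C T A B x (f \<cdot> x)" "v \<cdot> x = tuple C T A B x (g \<cdot> x)" if "\<guillemotleft>x : T \<rightarrow> A\<guillemotright>" for x T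
    using that assms i by (simp_all add: u_def v_def tuple_comp[OF that] idl)
  have uv_eq: "x = y \<and> f \<cdot> x = g \<cdot> y" if "u \<cdot> x = v \<cdot> y" "\<guillemotleft>x : T \<rightarrow> A\<guillemotright>" "\<guillemotleft>y : T \<rightarrow> A\<guillemotright>" for x y T
  proof -
    have "tuple C T A B x (f \<cdot> x) = tuple C T A B y (g \<cdot> y)" using that ux by simp
    then show ?thesis using pr1_tuple pr2_tuple that assms comp by metis
  qed
  have pq: "p = q" "f \<cdot> p = g \<cdot> p" using uv_eq[OF e(3,1,2)] by auto
  have "is_equaliser C A B f g E p"
  proof (rule is_equaliserI)
    fix T h assume h: "\<guillemotleft>h : T \<rightarrow> A\<guillemotright>" "f \<cdot> h = g \<cdot> h"
    then have "u \<cdot> h = v \<cdot> h" using ux by simp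
    then show "\<exists>k. \<guillemotleft>k : T \<rightarrow> E\<guillemotright> \<and> p \<cdot> k = h" using e(4)[OF h(1,1)] by blast
  next
    fix T h k assume "\<guillemotleft>h : T \<rightarrow> E\<guillemotright>" "\<guillemotleft>k : T \<rightarrow> E\<guillemotright>" "p \<cdot> h = p \<cdot> k"
    then show "h = k" using pullback_ext[OF E uv] pq by blast
  qed (use e pq in auto)
  then show ?thesis by blast
qed

lemma is_equaliser_equaliser:
  assumes "\<guillemotleft>f : A \<rightarrow> B\<guillemotright>" "\<guillemotleft>g : A \<rightarrow> B\<guillemotright>"
  shows "is_equaliser C A B f g (fst (equaliser C A B f g)) (snd (equaliser C A B f g))"
proof -
  have "\<exists>x. case x of (E, i) \<Rightarrow> is_equaliser C A B f g E i" using equaliser_ex[OF assms] by auto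
  then have "case equaliser C A B f g of (E, i) \<Rightarrow> is_equaliser C A B f g E i"
    unfolding equaliser_def by (rule someI_ex)
  then show ?thesis by (simp add: split_beta)
qed

lemma is_pullback_pullback:
  assumes "\<guillemotleft>f : A \<rightarrow> B\<guillemotright>" "\<guillemotleft>g : A' \<rightarrow> B\<guillemotright>"
  shows "is_pullback C A A' f g (fst (pullback C A A' f g)) (fst (snd (pullback C A A' f g)))
    (snd (snd (pullback C A A' f g)))"
proof -
  have "\<exists>x. case x of (P, p, q) \<Rightarrow> is_pullback C A A' f g P p q" using pullback_ex[OF assms] by auto
  then have "case pullback C A A' f g of (P, p, q) \<Rightarrow> is_pullback C A A' f g P p q"
    unfolding pullback_def by (rule someI_ex)
  then show ?thesis by (simp add: split_beta)
qed

section \<open>Groups and actions on generalised elements\<close>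

lemma group_carr: "group_object C K \<Longrightarrow> Carr K \<in> Obj C"
  and group_Mul: "group_object C K \<Longrightarrow> \<guillemotleft>Mul K : Prod C (Carr K) (Carr K) \<rightarrow> Carr K\<guillemotright>"
  and group_Inv: "group_object C K \<Longrightarrow> \<guillemotleft>Inv K : Carr K \<rightarrow> Carr K\<guillemotright>"
  and group_One: "group_object C K \<Longrightarrow> \<guillemotleft>One K : Term C \<rightarrow> Carr K\<guillemotright>"
  by (auto simp: group_object_def Let_def arr_def Prod_obj Term_obj)

lemma gmul_arr':
  "\<lbrakk>\<guillemotleft>Mul K : Prod C (Carr K) (Carr K) \<rightarrow> Carr K\<guillemotright>; \<guillemotleft>x : T \<rightarrow> Carr K\<guillemotright>; \<guillemotleft>y : T \<rightarrow> Carr K\<guillemotright>\<rbrakk>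
    \<Longrightarrow> \<guillemotleft>gmul C K T x y : T \<rightarrow> Carr K\<guillemotright>"
  unfolding gmul_def by (blast intro: comp tuple)

lemma gmul_comp':
  assumes "\<guillemotleft>Mul K : Prod C (Carr K) (Carr K) \<rightarrow> Carr K\<guillemotright>" "\<guillemotleft>x : T \<rightarrow> Carr K\<guillemotright>" "\<guillemotleft>y : T \<rightarrow> Carr K\<guillemotright>" "\<guillemotleft>k : S \<rightarrow> T\<guillemotright>"
  shows "gmul C K T x y \<cdot> k = gmul C K S (x \<cdot> k) (y \<cdot> k)"
  unfolding gmul_def assoc[OF assms(4) tuple[OF assms(2,3)] assms(1)] tuple_comp[OF assms(4,2,3)] ..

lemmas gmul = gmul_arr'[OF group_Mul]
lemmas gmul_comp = gmul_comp'[OF group_Mul]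

lemma gone: "\<lbrakk>group_object C K; T \<in> Obj C\<rbrakk> \<Longrightarrow> \<guillemotleft>gone C K T : T \<rightarrow> Carr K\<guillemotright>"
  unfolding gone_def by (blast intro: comp bang group_One)

lemma gone_comp':
  assumes "\<guillemotleft>One K : Term C \<rightarrow> Carr K\<guillemotright>" "\<guillemotleft>k : S \<rightarrow> T\<guillemotright>" shows "gone C K T \<cdot> k = gone C K S"
proof -
  have b: "\<guillemotleft>bang C T : T \<rightarrow> Term C\<guillemotright>" "\<guillemotleft>bang C S : S \<rightarrow> Term C\<guillemotright>" using assms bang by (auto dest: arr_dom arr_cod)
  show ?thesis unfolding gone_def assoc[OF assms(2) b(1) assms(1)]
    using bang_eq[OF comp[OF assms(2) b(1)] b(2)] by simp
qed

lemmas gone_comp = gone_comp'[OF group_One]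

text \<open>Groups are handled through the products \<open>gmul C K T x y\<close> of generalised elements. The axioms of
  \<open>group_object\<close> are the group laws for the universal elements, that is, for the projections of
  \<open>G \<times> G \<times> G\<close> and the identity of \<open>G\<close>; composition with an arrow into the parameter object gives the laws
  for all elements.\<close>

lemma group_objectI:
  assumes "\<guillemotleft>Mul K : Prod C (Carr K) (Carr K) \<rightarrow> Carr K\<guillemotright>" "\<guillemotleft>Inv K : Carr K \<rightarrow> Carr K\<guillemotright>"
    "\<guillemotleft>One K : Term C \<rightarrow> Carr K\<guillemotright>"
    and "\<And>T x y z. \<lbrakk>\<guillemotleft>x : T \<rightarrow> Carr K\<guillemotright>; \<guillemotleft>y : T \<rightarrow> Carr K\<guillemotright>; \<guillemotleft>z : T \<rightarrow> Carr K\<guillemotright>\<rbrakk>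
      \<Longrightarrow> gmul C K T (gmul C K T x y) z = gmul C K T x (gmul C K T y z)"
    and "\<And>T x. \<guillemotleft>x : T \<rightarrow> Carr K\<guillemotright> \<Longrightarrow> gmul C K T (gone C K T) x = x"
    and "\<And>T x. \<guillemotleft>x : T \<rightarrow> Carr K\<guillemotright> \<Longrightarrow> gmul C K T x (gone C K T) = x"
    and "\<And>T x. \<guillemotleft>x : T \<rightarrow> Carr K\<guillemotright> \<Longrightarrow> gmul C K T (Inv K \<cdot> x) x = gone C K T"
    and "\<And>T x. \<guillemotleft>x : T \<rightarrow> Carr K\<guillemotright> \<Longrightarrow> gmul C K T x (Inv K \<cdot> x) = gone C K T"
  shows "group_object C K"
proof -
  have o: "Carr K \<in> Obj C" using assms(2) by (rule arr_dom)
  note o2 = Prod_obj[OF o o] and p = pr1[OF o o] pr2[OF o o]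
  note p3 = pr1[OF o2 o] pr2[OF o2 o] and i = ident[OF o]
  show ?thesis
    unfolding group_object_def Let_def
    using assms(1-3) assms(4)[OF comp[OF p3(1) p(1)] comp[OF p3(1) p(2)] p3(2)]
      assms(5-8)[OF i] idr[OF assms(2)]
    by (simp add: arr_def)
qed

lemma gmul_assoc:
  assumes K: "group_object C K" and xyz: "\<guillemotleft>x : T \<rightarrow> Carr K\<guillemotright>" "\<guillemotleft>y : T \<rightarrow> Carr K\<guillemotright>" "\<guillemotleft>z : T \<rightarrow> Carr K\<guillemotright>"
  shows "gmul C K T (gmul C K T x y) z = gmul C K T x (gmul C K T y z)"
proof -
  let ?G = "Carr K" let ?GG = "Prod C ?G ?G"
  note o = group_carr[OF K]
  note o2 = Prod_obj[OF o o] and p = pr1[OF o o] pr2[OF o o]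
  note p3 = pr1[OF o2 o] pr2[OF o2 o]
  let ?x = "pr1 C ?G ?G \<cdot> pr1 C ?GG ?G" let ?y = "pr2 C ?G ?G \<cdot> pr1 C ?GG ?G" let ?z = "pr2 C ?GG ?G"
  let ?U = "Prod C ?GG ?G"
  have e: "gmul C K ?U (gmul C K ?U ?x ?y) ?z = gmul C K ?U ?x (gmul C K ?U ?y ?z)"
    using K by (simp add: group_object_def Let_def)
  let ?s = "tuple C T ?G ?G x y" let ?t = "tuple C T ?GG ?G ?s z"
  note s = tuple[OF xyz(1,2)] note t = tuple[OF s xyz(3)]
  note X = comp[OF p3(1) p(1)] and Y = comp[OF p3(1) p(2)]
  have c: "?x \<cdot> ?t = x" "?y \<cdot> ?t = y" "?z \<cdot> ?t = z"
    unfolding assoc[OF t p3(1) p(1)] assoc[OF t p3(1) p(2)] pr1_tuple[OF s xyz(3)] pr2_tuple[OF s xyz(3)]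
      pr1_tuple[OF xyz(1,2)] pr2_tuple[OF xyz(1,2)] by auto
  have "gmul C K ?U (gmul C K ?U ?x ?y) ?z \<cdot> ?t = gmul C K T (gmul C K T x y) z"
    unfolding gmul_comp[OF K gmul[OF K X Y] p3(2) t] gmul_comp[OF K X Y t] c ..
  moreover have "gmul C K ?U ?x (gmul C K ?U ?y ?z) \<cdot> ?t = gmul C K T x (gmul C K T y z)"
    unfolding gmul_comp[OF K X gmul[OF K Y p3(2)] t] gmul_comp[OF K Y p3(2) t] c ..
  ultimately show ?thesis using e by simp
qed

lemma group_unit_laws:
  assumes K: "group_object C K" and x: "\<guillemotleft>x : T \<rightarrow> Carr K\<guillemotright>"
  shows "gmul C K T (gone C K T) x = x" "gmul C K T x (gone C K T) = x"
    "gmul C K T (Inv K \<cdot> x) x = gone C K T" "gmul C K T x (Inv K \<cdot> x) = gone C K T"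
proof -
  let ?G = "Carr K" let ?i = "Ident C ?G"
  note o = group_carr[OF K] note i = ident[OF o] note u = gone[OF K o]
  have e: "gmul C K ?G (gone C K ?G) ?i = ?i" "gmul C K ?G ?i (gone C K ?G) = ?i"
    "gmul C K ?G (Inv K) ?i = gone C K ?G" "gmul C K ?G ?i (Inv K) = gone C K ?G"
    using K by (simp_all add: group_object_def Let_def)
  note r = gmul_comp[OF K u i x] gmul_comp[OF K i u x] gmul_comp[OF K group_Inv[OF K] i x]
    gmul_comp[OF K i group_Inv[OF K] x]
  show "gmul C K T (gone C K T) x = x" "gmul C K T x (gone C K T) = x"
    "gmul C K T (Inv K \<cdot> x) x = gone C K T" "gmul C K T x (Inv K \<cdot> x) = gone C K T"
    using r unfolding e gone_comp[OF K x] idl[OF x] by auto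
qed

lemma inv: "\<lbrakk>group_object C K; \<guillemotleft>x : T \<rightarrow> Carr K\<guillemotright>\<rbrakk> \<Longrightarrow> \<guillemotleft>Inv K \<cdot> x : T \<rightarrow> Carr K\<guillemotright>"
  by (blast intro: comp group_Inv)

lemma gmul_cancel:
  assumes K: "group_object C K" and xy: "\<guillemotleft>x : T \<rightarrow> Carr K\<guillemotright>" "\<guillemotleft>y : T \<rightarrow> Carr K\<guillemotright>"
  shows "gmul C K T (gmul C K T x y) (Inv K \<cdot> y) = x" "gmul C K T (gmul C K T x (Inv K \<cdot> y)) y = x"
    "gmul C K T (Inv K \<cdot> y) (gmul C K T y x) = x"
  using gmul_assoc[OF K xy(1,2) inv[OF K xy(2)]] gmul_assoc[OF K xy(1) inv[OF K xy(2)] xy(2)]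
    gmul_assoc[OF K inv[OF K xy(2)] xy(2,1)] group_unit_laws[OF K] xy by simp_all

lemma gmul_left_inject:
  assumes K: "group_object C K" and "\<guillemotleft>x : T \<rightarrow> Carr K\<guillemotright>" "\<guillemotleft>y : T \<rightarrow> Carr K\<guillemotright>" "\<guillemotleft>z : T \<rightarrow> Carr K\<guillemotright>"
    "gmul C K T x y = gmul C K T x z"
  shows "y = z"
  using assms gmul_cancel(3)[OF K] by metis

lemma inv_unique:
  assumes K: "group_object C K" and "\<guillemotleft>x : T \<rightarrow> Carr K\<guillemotright>" "\<guillemotleft>y : T \<rightarrow> Carr K\<guillemotright>" "gmul C K T x y = gone C K T"
  shows "y = Inv K \<cdot> x"
  using assms gmul_left_inject[OF K assms(2,3) inv[OF K assms(2)]] group_unit_laws(4)[OF K assms(2)] by simp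

lemma inv_inv:
  assumes K: "group_object C K" and x: "\<guillemotleft>x : T \<rightarrow> Carr K\<guillemotright>"
  shows "Inv K \<cdot> (Inv K \<cdot> x) = x"
  using inv_unique[OF K inv[OF K x] x] group_unit_laws(3)[OF K x] by simp

lemma inv_gmul:
  assumes K: "group_object C K" and x: "\<guillemotleft>x : T \<rightarrow> Carr K\<guillemotright>" and y: "\<guillemotleft>y : T \<rightarrow> Carr K\<guillemotright>"
  shows "Inv K \<cdot> gmul C K T x y = gmul C K T (Inv K \<cdot> y) (Inv K \<cdot> x)"
proof -
  note i = inv[OF K x] inv[OF K y]
  have "gmul C K T (gmul C K T x y) (gmul C K T (Inv K \<cdot> y) (Inv K \<cdot> x))
    = gmul C K T (gmul C K T (gmul C K T x y) (Inv K \<cdot> y)) (Inv K \<cdot> x)"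
    using gmul_assoc[OF K gmul[OF K x y] i(2,1)] by simp
  also have "\<dots> = gone C K T" using gmul_cancel(1)[OF K x y] group_unit_laws(4)[OF K x] by simp
  finally show ?thesis using inv_unique[OF K gmul[OF K x y] gmul[OF K i(2,1)]] by simp
qed

lemma idempotent_gone:
  assumes K: "group_object C K" and x: "\<guillemotleft>x : T \<rightarrow> Carr K\<guillemotright>" and "gmul C K T x x = x"
  shows "x = gone C K T"
proof -
  have "gmul C K T x x = gmul C K T x (gone C K T)" using group_unit_laws(2)[OF K x] assms by simp
  then show ?thesis using gmul_left_inject[OF K x x gone[OF K arr_dom[OF x]]] by blast
qed

text \<open>Homomorphisms are always checked in this form, in which no arrow between products occurs.\<close>

lemma Grp_hom_iff:
  assumes K: "group_object C K" and L: "group_object C L"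
  shows "f \<in> Hom (Grp C) K L \<longleftrightarrow> \<guillemotleft>f : Carr K \<rightarrow> Carr L\<guillemotright> \<and>
    (\<forall>T x y. \<guillemotleft>x : T \<rightarrow> Carr K\<guillemotright> \<longrightarrow> \<guillemotleft>y : T \<rightarrow> Carr K\<guillemotright> \<longrightarrow>
      f \<cdot> gmul C K T x y = gmul C L T (f \<cdot> x) (f \<cdot> y))"
proof
  assume "f \<in> Hom (Grp C) K L"
  then have f: "\<guillemotleft>f : Carr K \<rightarrow> Carr L\<guillemotright>"
    and e: "f \<cdot> Mul K = Mul L \<cdot> prod_map C (Carr K) (Carr L) (Carr K) (Carr L) f f"
    using group_carr K L by (auto simp: Grp_def arr_def)
  have "f \<cdot> gmul C K T x y = gmul C L T (f \<cdot> x) (f \<cdot> y)" if x: "\<guillemotleft>x : T \<rightarrow> Carr K\<guillemotright>" "\<guillemotleft>y : T \<rightarrow> Carr K\<guillemotright>" for T x y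
    using assoc[OF tuple[OF x] group_Mul[OF K] f] assoc[OF tuple[OF x] prod_map[OF f f] group_Mul[OF L]]
      prod_map_elem[OF f f x] e unfolding gmul_def by simp
  then show "\<guillemotleft>f : Carr K \<rightarrow> Carr L\<guillemotright> \<and>
    (\<forall>T x y. \<guillemotleft>x : T \<rightarrow> Carr K\<guillemotright> \<longrightarrow> \<guillemotleft>y : T \<rightarrow> Carr K\<guillemotright> \<longrightarrow>
      f \<cdot> gmul C K T x y = gmul C L T (f \<cdot> x) (f \<cdot> y))" using f by blast
next
  assume a: "\<guillemotleft>f : Carr K \<rightarrow> Carr L\<guillemotright> \<and>
    (\<forall>T x y. \<guillemotleft>x : T \<rightarrow> Carr K\<guillemotright> \<longrightarrow> \<guillemotleft>y : T \<rightarrow> Carr K\<guillemotright> \<longrightarrow>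
      f \<cdot> gmul C K T x y = gmul C L T (f \<cdot> x) (f \<cdot> y))"
  note o = group_carr[OF K]
  note p = pr1[OF o o] pr2[OF o o]
  have "f \<cdot> gmul C K (Prod C (Carr K) (Carr K)) (pr1 C (Carr K) (Carr K)) (pr2 C (Carr K) (Carr K)) =
    gmul C L (Prod C (Carr K) (Carr K)) (f \<cdot> pr1 C (Carr K) (Carr K)) (f \<cdot> pr2 C (Carr K) (Carr K))"
    using a p by blast
  moreover have "tuple C (Prod C (Carr K) (Carr K)) (Carr K) (Carr K) (pr1 C (Carr K) (Carr K)) (pr2 C (Carr K) (Carr K))
      = Ident C (Prod C (Carr K) (Carr K))"
    by (rule tuple_eqI) (use p o in \<open>auto intro: ident Prod_obj simp: idr\<close>)
  ultimately have "f \<cdot> Mul K = Mul L \<cdot> prod_map C (Carr K) (Carr L) (Carr K) (Carr L) f f"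
    unfolding gmul_def prod_map_def using idr[OF group_Mul[OF K]] by simp
  then show "f \<in> Hom (Grp C) K L" using a by (auto simp: Grp_def arr_def)
qed

lemma Grp_hom_arr: "\<lbrakk>group_object C K; group_object C L; f \<in> Hom (Grp C) K L\<rbrakk> \<Longrightarrow> \<guillemotleft>f : Carr K \<rightarrow> Carr L\<guillemotright>"
  and Grp_hom_gmul: "\<lbrakk>group_object C K; group_object C L; f \<in> Hom (Grp C) K L; \<guillemotleft>x : T \<rightarrow> Carr K\<guillemotright>; \<guillemotleft>y : T \<rightarrow> Carr K\<guillemotright>\<rbrakk>
    \<Longrightarrow> f \<cdot> gmul C K T x y = gmul C L T (f \<cdot> x) (f \<cdot> y)"
  using Grp_hom_iff by blast+

lemma Grp_category: "category (Grp C)"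
proof unfold_locales
  fix A assume "A \<in> Obj (Grp C)"
  then have A: "group_object C A" by (simp add: Grp_def)
  have "Ident C (Carr A) \<in> Hom (Grp C) A A"
    unfolding Grp_hom_iff[OF A A] using ident[OF group_carr[OF A]] gmul[OF A] idl by metis
  then show "Ident (Grp C) A \<in> Hom (Grp C) A A" by (simp add: Grp_def)
next
  fix A B D f g assume *: "A \<in> Obj (Grp C)" "B \<in> Obj (Grp C)" "D \<in> Obj (Grp C)"
    and f: "f \<in> Hom (Grp C) A B" and g: "g \<in> Hom (Grp C) B D"
  have o: "group_object C A" "group_object C B" "group_object C D" using * by (auto simp: Grp_def)
  note af = Grp_hom_arr[OF o(1,2) f] and ag = Grp_hom_arr[OF o(2,3) g]
  have "(g \<cdot> f) \<cdot> gmul C A T x y = gmul C D T ((g \<cdot> f) \<cdot> x) ((g \<cdot> f) \<cdot> y)"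
    if x: "\<guillemotleft>x : T \<rightarrow> Carr A\<guillemotright>" "\<guillemotleft>y : T \<rightarrow> Carr A\<guillemotright>" for T x y
    unfolding assoc[OF gmul[OF o(1) x] af ag] assoc[OF x(1) af ag] assoc[OF x(2) af ag]
      Grp_hom_gmul[OF o(1,2) f x] Grp_hom_gmul[OF o(2,3) g comp[OF x(1) af] comp[OF x(2) af]] ..
  then have "g \<cdot> f \<in> Hom (Grp C) A D" unfolding Grp_hom_iff[OF o(1,3)] using comp[OF af ag] by blast
  then show "g \<cdot>\<^bsub>Grp C\<^esub> f \<in> Hom (Grp C) A D" by (simp add: Grp_def)
next
  fix A B f assume "A \<in> Obj (Grp C)" "B \<in> Obj (Grp C)" "f \<in> Hom (Grp C) A B"
  then have f: "\<guillemotleft>f : Carr A \<rightarrow> Carr B\<guillemotright>" using Grp_hom_arr by (auto simp: Grp_def)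
  show "f \<cdot>\<^bsub>Grp C\<^esub> Ident (Grp C) A = f" "Ident (Grp C) B \<cdot>\<^bsub>Grp C\<^esub> f = f"
    using idr[OF f] idl[OF f] by (simp_all add: Grp_def)
next
  fix A B D E f g h
  assume o: "A \<in> Obj (Grp C)" "B \<in> Obj (Grp C)" "D \<in> Obj (Grp C)" "E \<in> Obj (Grp C)"
    and "f \<in> Hom (Grp C) A B" "g \<in> Hom (Grp C) B D" "h \<in> Hom (Grp C) D E"
  then have "\<guillemotleft>f : Carr A \<rightarrow> Carr B\<guillemotright>" "\<guillemotleft>g : Carr B \<rightarrow> Carr D\<guillemotright>" "\<guillemotleft>h : Carr D \<rightarrow> Carr E\<guillemotright>"
    using Grp_hom_arr unfolding Grp_def by simp_all
  then show "h \<cdot>\<^bsub>Grp C\<^esub> g \<cdot>\<^bsub>Grp C\<^esub> f = h \<cdot>\<^bsub>Grp C\<^esub> (g \<cdot>\<^bsub>Grp C\<^esub> f)"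
    using assoc by (simp add: Grp_def)
qed

text \<open>The inclusion \<open>i\<close> is multiplicative and monic, so every group law can be checked after \<open>i\<close>.\<close>

lemma subgroup_object:
  assumes H: "group_object C H" and i: "monic C (Carr S) (Carr H) i" and o: "Carr S \<in> Obj C"
    and S: "\<guillemotleft>Mul S : Prod C (Carr S) (Carr S) \<rightarrow> Carr S\<guillemotright>" "\<guillemotleft>Inv S : Carr S \<rightarrow> Carr S\<guillemotright>" "\<guillemotleft>One S : Term C \<rightarrow> Carr S\<guillemotright>"
    and m: "i \<cdot> Mul S = gmul C H (Prod C (Carr S) (Carr S)) (i \<cdot> pr1 C (Carr S) (Carr S)) (i \<cdot> pr2 C (Carr S) (Carr S))"
    and n: "i \<cdot> Inv S = Inv H \<cdot> i" and e: "i \<cdot> One S = One H"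
  shows "group_object C S"
    and "\<And>T x y. \<lbrakk>\<guillemotleft>x : T \<rightarrow> Carr S\<guillemotright>; \<guillemotleft>y : T \<rightarrow> Carr S\<guillemotright>\<rbrakk> \<Longrightarrow> i \<cdot> gmul C S T x y = gmul C H T (i \<cdot> x) (i \<cdot> y)"
proof -
  have I: "\<guillemotleft>i : Carr S \<rightarrow> Carr H\<guillemotright>" using i o group_carr[OF H] by (simp add: monic_def arr_def)
  note p = pr1[OF o o] pr2[OF o o]
  show mul: "i \<cdot> gmul C S T x y = gmul C H T (i \<cdot> x) (i \<cdot> y)" if x: "\<guillemotleft>x : T \<rightarrow> Carr S\<guillemotright>" "\<guillemotleft>y : T \<rightarrow> Carr S\<guillemotright>" for T x y
  proof -
    note t = tuple[OF x]
    have "i \<cdot> gmul C S T x y = (i \<cdot> Mul S) \<cdot> tuple C T (Carr S) (Carr S) x y"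
      unfolding gmul_def assoc[OF t S(1) I] ..
    then show ?thesis unfolding m gmul_comp[OF H comp[OF p(1) I] comp[OF p(2) I] t] assoc[OF t p(1) I]
      assoc[OF t p(2) I] pr1_tuple[OF x] pr2_tuple[OF x] .
  qed
  have one: "i \<cdot> gone C S T = gone C H T" if "T \<in> Obj C" for T
    unfolding gone_def assoc[symmetric, OF bang[OF that] S(3) I] e ..
  have inv': "i \<cdot> (Inv S \<cdot> x) = Inv H \<cdot> (i \<cdot> x)" if x: "\<guillemotleft>x : T \<rightarrow> Carr S\<guillemotright>" for x T
    using assoc[OF x S(2) I] assoc[OF x I group_Inv[OF H]] n by simp
  note gm = gmul_arr'[OF S(1)]
  have gn: "\<guillemotleft>gone C S T : T \<rightarrow> Carr S\<guillemotright>" if "T \<in> Obj C" for T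
    unfolding gone_def using bang[OF that] S(3) by (rule comp)
  show "group_object C S"
  proof (rule group_objectI[OF S])
    fix T x assume x: "\<guillemotleft>x : T \<rightarrow> Carr S\<guillemotright>"
    note ix = comp[OF x I] and T = arr_dom[OF x] and nx = comp[OF x S(2)]
    note u = group_unit_laws[OF H ix]
    show "gmul C S T (gone C S T) x = x"
      by (rule monicD[OF i gm[OF gn[OF T] x] x]) (simp add: mul[OF gn[OF T] x] one[OF T] u)
    show "gmul C S T x (gone C S T) = x"
      by (rule monicD[OF i gm[OF x gn[OF T]] x]) (simp add: mul[OF x gn[OF T]] one[OF T] u)
    show "gmul C S T (Inv S \<cdot> x) x = gone C S T"
      by (rule monicD[OF i gm[OF nx x] gn[OF T]]) (simp add: mul[OF nx x] inv'[OF x] one[OF T] u)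
    show "gmul C S T x (Inv S \<cdot> x) = gone C S T"
      by (rule monicD[OF i gm[OF x nx] gn[OF T]]) (simp add: mul[OF x nx] inv'[OF x] one[OF T] u)
    fix y z assume y: "\<guillemotleft>y : T \<rightarrow> Carr S\<guillemotright>" and z: "\<guillemotleft>z : T \<rightarrow> Carr S\<guillemotright>"
    show "gmul C S T (gmul C S T x y) z = gmul C S T x (gmul C S T y z)"
      by (rule monicD[OF i gm[OF gm[OF x y] z] gm[OF x gm[OF y z]]])
        (simp add: mul[OF gm[OF x y] z] mul[OF x y] mul[OF x gm[OF y z]] mul[OF y z]
          gmul_assoc[OF H ix comp[OF y I] comp[OF z I]])
  qed
qed

lemma gact: "\<lbrakk>\<guillemotleft>a : Prod C (Carr K) Y \<rightarrow> Y\<guillemotright>; \<guillemotleft>x : T \<rightarrow> Carr K\<guillemotright>; \<guillemotleft>y : T \<rightarrow> Y\<guillemotright>\<rbrakk>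
    \<Longrightarrow> \<guillemotleft>gact C K Y a T x y : T \<rightarrow> Y\<guillemotright>"
  unfolding gact_def by (blast intro: comp tuple)

lemma gact_comp:
  assumes "\<guillemotleft>a : Prod C (Carr K) Y \<rightarrow> Y\<guillemotright>" "\<guillemotleft>x : T \<rightarrow> Carr K\<guillemotright>" "\<guillemotleft>y : T \<rightarrow> Y\<guillemotright>" "\<guillemotleft>k : S \<rightarrow> T\<guillemotright>"
  shows "gact C K Y a T x y \<cdot> k = gact C K Y a S (x \<cdot> k) (y \<cdot> k)"
  unfolding gact_def assoc[OF assms(4) tuple[OF assms(2,3)] assms(1)] tuple_comp[OF assms(4,2,3)] ..

text \<open>As for groups, the axioms are the laws for the universal elements.\<close>

lemma is_action_iff:
  assumes K: "group_object C K"
  shows "is_action C K Y a \<longleftrightarrow> \<guillemotleft>a : Prod C (Carr K) Y \<rightarrow> Y\<guillemotright> \<and>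
    (\<forall>T x y z. \<guillemotleft>x : T \<rightarrow> Carr K\<guillemotright> \<longrightarrow> \<guillemotleft>y : T \<rightarrow> Carr K\<guillemotright> \<longrightarrow> \<guillemotleft>z : T \<rightarrow> Y\<guillemotright> \<longrightarrow>
      gact C K Y a T (gmul C K T x y) z = gact C K Y a T x (gact C K Y a T y z)) \<and>
    (\<forall>T z. \<guillemotleft>z : T \<rightarrow> Y\<guillemotright> \<longrightarrow> gact C K Y a T (gone C K T) z = z)" (is "_ \<longleftrightarrow> ?arr \<and> ?ass \<and> ?unit")
proof -
  let ?G = "Carr K" let ?GG = "Prod C ?G ?G"
  note o = group_carr[OF K]
  note o2 = Prod_obj[OF o o] and p = pr1[OF o o] pr2[OF o o]
  let ?x = "pr1 C ?G ?G \<cdot> pr1 C ?GG Y" let ?y = "pr2 C ?G ?G \<cdot> pr1 C ?GG Y" let ?z = "pr2 C ?GG Y"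
  let ?U = "Prod C ?GG Y"
  have u: "is_action C K Y a \<longleftrightarrow> \<guillemotleft>a : Prod C (Carr K) Y \<rightarrow> Y\<guillemotright> \<and>
      gact C K Y a ?U (gmul C K ?U ?x ?y) ?z = gact C K Y a ?U ?x (gact C K Y a ?U ?y ?z) \<and>
      gact C K Y a Y (gone C K Y) (Ident C Y) = Ident C Y"
    using o by (auto simp: is_action_def Let_def arr_def Prod_obj)
  show ?thesis
  proof
    assume A: "is_action C K Y a"
    then have a: "\<guillemotleft>a : Prod C (Carr K) Y \<rightarrow> Y\<guillemotright>" using u by blast
    note Y = arr_cod[OF a]
    note p3 = pr1[OF o2 Y] pr2[OF o2 Y]
    note X = comp[OF p3(1) p(1)] comp[OF p3(1) p(2)]
    have e: "gact C K Y a ?U (gmul C K ?U ?x ?y) ?z = gact C K Y a ?U ?x (gact C K Y a ?U ?y ?z)"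
      "gact C K Y a Y (gone C K Y) (Ident C Y) = Ident C Y" using A u by auto
    have "gact C K Y a T (gmul C K T x y) z = gact C K Y a T x (gact C K Y a T y z)"
      if xyz: "\<guillemotleft>x : T \<rightarrow> Carr K\<guillemotright>" "\<guillemotleft>y : T \<rightarrow> Carr K\<guillemotright>" "\<guillemotleft>z : T \<rightarrow> Y\<guillemotright>" for T x y z
    proof -
      let ?s = "tuple C T ?G ?G x y" let ?t = "tuple C T ?GG Y ?s z"
      note s = tuple[OF xyz(1,2)] note t = tuple[OF s xyz(3)]
      have c: "?x \<cdot> ?t = x" "?y \<cdot> ?t = y" "?z \<cdot> ?t = z"
        unfolding assoc[OF t p3(1) p(1)] assoc[OF t p3(1) p(2)] pr1_tuple[OF s xyz(3)] pr2_tuple[OF s xyz(3)]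
          pr1_tuple[OF xyz(1,2)] pr2_tuple[OF xyz(1,2)] by auto
      have "gact C K Y a ?U (gmul C K ?U ?x ?y) ?z \<cdot> ?t = gact C K Y a T (gmul C K T x y) z"
        unfolding gact_comp[OF a gmul[OF K X] p3(2) t] gmul_comp[OF K X t] c ..
      moreover have "gact C K Y a ?U ?x (gact C K Y a ?U ?y ?z) \<cdot> ?t = gact C K Y a T x (gact C K Y a T y z)"
        unfolding gact_comp[OF a X(1) gact[OF a X(2) p3(2)] t] gact_comp[OF a X(2) p3(2) t] c ..
      ultimately show ?thesis using e by simp
    qed
    moreover have "gact C K Y a T (gone C K T) z = z" if z: "\<guillemotleft>z : T \<rightarrow> Y\<guillemotright>" for T z
      using gact_comp[OF a gone[OF K Y] ident[OF Y] z] e(2) gone_comp[OF K z] idl[OF z] by simp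
    ultimately show "?arr \<and> ?ass \<and> ?unit" using a by blast
  next
    assume A: "?arr \<and> ?ass \<and> ?unit"
    then have Y: "Y \<in> Obj C" by (auto dest: arr_cod)
    note p3 = pr1[OF o2 Y] pr2[OF o2 Y]
    show "is_action C K Y a" unfolding u
      using A comp[OF p3(1) p(1)] comp[OF p3(1) p(2)] p3(2) ident[OF Y] by blast
  qed
qed

end

section \<open>Slices\<close>

lemma Slice_Comp [simp]: "Comp (Slice C Y) = Comp C"
  and Slice_Ident [simp]: "Ident (Slice C Y) A = Ident C (fst A)"
  by (auto simp: Slice_def split_beta)

lemma Grp_Comp [simp]: "Comp (Grp C) = Comp C"
  and Grp_obj [simp]: "K \<in> Obj (Grp C) \<longleftrightarrow> group_object C K"
  and Grp_Ident [simp]: "Ident (Grp C) K = Ident C (Carr K)"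
  by (auto simp: Grp_def)

context category
begin

lemma Slice_obj: "Y \<in> Obj C \<Longrightarrow> A \<in> Obj (Slice C Y) \<longleftrightarrow> \<guillemotleft>snd A : fst A \<rightarrow> Y\<guillemotright>"
  by (auto simp: Slice_def arr_def)

lemma Slice_arr:
  "Y \<in> Obj C \<Longrightarrow> arr (Slice C Y) h A B \<longleftrightarrow>
    \<guillemotleft>h : fst A \<rightarrow> fst B\<guillemotright> \<and> \<guillemotleft>snd A : fst A \<rightarrow> Y\<guillemotright> \<and> \<guillemotleft>snd B : fst B \<rightarrow> Y\<guillemotright> \<and> snd B \<cdot> h = snd A"
  by (auto simp: Slice_def arr_def split_beta)

lemma Slice_arrI:
  "\<lbrakk>\<guillemotleft>h : T \<rightarrow> fst B\<guillemotright>; \<guillemotleft>snd B : fst B \<rightarrow> Y\<guillemotright>; snd B \<cdot> h = t\<rbrakk> \<Longrightarrow> arr (Slice C Y) h (T, t) B"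
  using comp[of h T "fst B" "snd B" Y] by (auto simp: Slice_arr arr_cod)

lemma Slice_arrD:
  assumes "arr (Slice C Y) h A B" "Y \<in> Obj C"
  shows "\<guillemotleft>h : fst A \<rightarrow> fst B\<guillemotright>" "\<guillemotleft>snd A : fst A \<rightarrow> Y\<guillemotright>" "\<guillemotleft>snd B : fst B \<rightarrow> Y\<guillemotright>" "snd B \<cdot> h = snd A"
  using assms by (auto simp: Slice_arr)

lemma Slice_category: assumes Y: "Y \<in> Obj C" shows "category (Slice C Y)"
proof unfold_locales
  fix A assume "A \<in> Obj (Slice C Y)"
  then have A: "\<guillemotleft>snd A : fst A \<rightarrow> Y\<guillemotright>" by (simp add: Slice_obj[OF Y])
  have "arr (Slice C Y) (Ident (Slice C Y) A) A A"
    using A ident[OF arr_dom[OF A]] idr[OF A] by (simp add: Slice_arr[OF Y])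
  then show "Ident (Slice C Y) A \<in> Hom (Slice C Y) A A" by (rule arr_hom)
next
  fix A B D f g
  assume "A \<in> Obj (Slice C Y)" "B \<in> Obj (Slice C Y)" "D \<in> Obj (Slice C Y)"
    "f \<in> Hom (Slice C Y) A B" "g \<in> Hom (Slice C Y) B D"
  then have "arr (Slice C Y) f A B" "arr (Slice C Y) g B D" by (auto simp: arr_def)
  note f = Slice_arrD[OF this(1) Y] and g = Slice_arrD[OF this(2) Y]
  have "arr (Slice C Y) (g \<cdot> f) A D"
    using f g comp[OF f(1) g(1)] assoc[OF f(1) g(1,3)] by (simp add: Slice_arr[OF Y])
  then show "g \<cdot>\<^bsub>Slice C Y\<^esub> f \<in> Hom (Slice C Y) A D" by (simp add: arr_hom)
next
  fix A B f assume "A \<in> Obj (Slice C Y)" "B \<in> Obj (Slice C Y)" "f \<in> Hom (Slice C Y) A B"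
  then have "\<guillemotleft>f : fst A \<rightarrow> fst B\<guillemotright>" using Slice_arrD(1)[OF _ Y] by (auto simp: arr_def)
  then show "f \<cdot>\<^bsub>Slice C Y\<^esub> Ident (Slice C Y) A = f" "Ident (Slice C Y) B \<cdot>\<^bsub>Slice C Y\<^esub> f = f"
    using idr idl by simp_all
next
  fix A B D E f g h
  assume "A \<in> Obj (Slice C Y)" "B \<in> Obj (Slice C Y)" "D \<in> Obj (Slice C Y)" "E \<in> Obj (Slice C Y)"
    "f \<in> Hom (Slice C Y) A B" "g \<in> Hom (Slice C Y) B D" "h \<in> Hom (Slice C Y) D E"
  then have "\<guillemotleft>f : fst A \<rightarrow> fst B\<guillemotright>" "\<guillemotleft>g : fst B \<rightarrow> fst D\<guillemotright>" "\<guillemotleft>h : fst D \<rightarrow> fst E\<guillemotright>"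
    using Slice_arrD(1)[OF _ Y] by (auto simp: arr_def)
  then show "h \<cdot>\<^bsub>Slice C Y\<^esub> g \<cdot>\<^bsub>Slice C Y\<^esub> f = h \<cdot>\<^bsub>Slice C Y\<^esub> (g \<cdot>\<^bsub>Slice C Y\<^esub> f)"
    using assoc by simp
qed

text \<open>A cone in \<open>C\<close> over arrows of the slice acquires its structure map to \<open>Y\<close> from either leg, so the two
  universal properties quantify over the same cones.\<close>

lemma Slice_pullback_iff:
  assumes Y: "Y \<in> Obj C" and f: "arr (Slice C Y) f A B" and g: "arr (Slice C Y) g A' B"
  shows "is_pullback (Slice C Y) A A' f g P p q \<longleftrightarrow>
    is_pullback C (fst A) (fst A') f g (fst P) p q \<and> snd P = snd A \<cdot> p"
proof -
  interpret S: category "Slice C Y" by (rule Slice_category[OF Y])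
  note F = Slice_arrD[OF f Y] and G = Slice_arrD[OF g Y]
  note o = arr_dom[OF F(1)] arr_dom[OF G(1)] and oS = arr_dom[OF f] arr_dom[OF g]
  have over: "arr (Slice C Y) x (T, snd A \<cdot> x) A \<and> arr (Slice C Y) y (T, snd A \<cdot> x) A'"
    if x: "\<guillemotleft>x : T \<rightarrow> fst A\<guillemotright>" "\<guillemotleft>y : T \<rightarrow> fst A'\<guillemotright>" "f \<cdot> x = g \<cdot> y" for T x y
    using Slice_arrI[OF x(1) F(2)] Slice_arrI[OF x(2) G(2), of "snd A \<cdot> x"]
      assoc[OF x(1) F(1,3)] assoc[OF x(2) G(1,3)] F(4) G(4) x(3) by simp
  show ?thesis
  proof
    assume P: "is_pullback (Slice C Y) A A' f g P p q"
    note PD = is_pullbackD[OF P oS]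
    note p = Slice_arrD[OF PD(1) Y] and q = Slice_arrD[OF PD(2) Y]
    have "is_pullback C (fst A) (fst A') f g (fst P) p q"
    proof (rule is_pullbackI)
      fix T x y assume x: "\<guillemotleft>x : T \<rightarrow> fst A\<guillemotright>" "\<guillemotleft>y : T \<rightarrow> fst A'\<guillemotright>" "f \<cdot> x = g \<cdot> y"
      obtain h where "arr (Slice C Y) h (T, snd A \<cdot> x) P" "p \<cdot> h = x" "q \<cdot> h = y"
        using PD(4)[of x "(T, snd A \<cdot> x)" y] over[OF x] x(3) by auto
      then show "\<exists>h. \<guillemotleft>h : T \<rightarrow> fst P\<guillemotright> \<and> p \<cdot> h = x \<and> q \<cdot> h = y"
        using Slice_arrD(1)[OF _ Y] by (metis fst_conv)
    next
      fix T h k assume h: "\<guillemotleft>h : T \<rightarrow> fst P\<guillemotright>" and k: "\<guillemotleft>k : T \<rightarrow> fst P\<guillemotright>" and e: "p \<cdot> h = p \<cdot> k" "q \<cdot> h = q \<cdot> k"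
      have "arr (Slice C Y) h (T, snd P \<cdot> h) P" by (rule Slice_arrI[OF h p(2)]) simp
      moreover have "arr (Slice C Y) k (T, snd P \<cdot> h) P"
        by (rule Slice_arrI[OF k p(2)])
          (use assoc[OF h p(1,3)] assoc[OF k p(1,3)] p(4) e in simp)
      ultimately show "h = k" using S.pullback_ext[OF P f g] e by simp
    qed (use p q PD(3) in simp_all)
    then show "is_pullback C (fst A) (fst A') f g (fst P) p q \<and> snd P = snd A \<cdot> p" using p by simp
  next
    assume "is_pullback C (fst A) (fst A') f g (fst P) p q \<and> snd P = snd A \<cdot> p"
    then have P: "is_pullback C (fst A) (fst A') f g (fst P) p q" and w: "snd P = snd A \<cdot> p" by auto
    note p = is_pullbackD[OF P o]
    have pS: "arr (Slice C Y) p P A" "arr (Slice C Y) q P A'"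
      using over[OF p(1-3)] w by (metis prod.collapse)+
    show "is_pullback (Slice C Y) A A' f g P p q"
    proof (rule is_pullbackI[OF pS])
      fix T x y
      assume x: "arr (Slice C Y) x T A" "arr (Slice C Y) y T A'" "f \<cdot>\<^bsub>Slice C Y\<^esub> x = g \<cdot>\<^bsub>Slice C Y\<^esub> y"
      note X = Slice_arrD[OF x(1) Y] and Y' = Slice_arrD[OF x(2) Y]
      obtain h where h: "\<guillemotleft>h : fst T \<rightarrow> fst P\<guillemotright>" "p \<cdot> h = x" "q \<cdot> h = y"
        using p(4)[OF X(1) Y'(1)] x(3) by auto
      have "arr (Slice C Y) h T P"
        using Slice_arrI[OF h(1) Slice_arrD(2)[OF pS(1) Y], of "snd T"] w assoc[OF h(1) p(1) F(2)] h(2) X(4) by simp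
      then show "\<exists>h. arr (Slice C Y) h T P \<and> p \<cdot>\<^bsub>Slice C Y\<^esub> h = x \<and> q \<cdot>\<^bsub>Slice C Y\<^esub> h = y"
        using h by auto
    next
      fix T h k
      assume h: "arr (Slice C Y) h T P" "arr (Slice C Y) k T P" "p \<cdot>\<^bsub>Slice C Y\<^esub> h = p \<cdot>\<^bsub>Slice C Y\<^esub> k"
        "q \<cdot>\<^bsub>Slice C Y\<^esub> h = q \<cdot>\<^bsub>Slice C Y\<^esub> k"
      show "h = k"
        using pullback_ext[OF P F(1) G(1) Slice_arrD(1)[OF h(1) Y] Slice_arrD(1)[OF h(2) Y]] h(3,4) by simp
    qed (use p in simp)
  qed
qed

lemma Slice_terminal: assumes Y: "Y \<in> Obj C" shows "is_terminal (Slice C Y) (Y, Ident C Y)"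
proof (rule is_terminalI)
  note i = ident[OF Y]
  show "(Y, Ident C Y) \<in> Obj (Slice C Y)" using i by (simp add: Slice_obj[OF Y])
  show "\<exists>f. arr (Slice C Y) f A (Y, Ident C Y)" if "A \<in> Obj (Slice C Y)" for A
    using that i idl by (auto simp: Slice_obj[OF Y] Slice_arr[OF Y])
  show "f = g" if "arr (Slice C Y) f A (Y, Ident C Y)" "arr (Slice C Y) g A (Y, Ident C Y)" for A f g
    using that idl by (auto simp: Slice_arr[OF Y])
qed

lemma Slice_bang: assumes "A \<in> Obj (Slice C Y)" "Y \<in> Obj C"
  shows "arr (Slice C Y) (snd A) A (Y, Ident C Y)"
  using assms ident idl by (simp add: Slice_obj Slice_arr)

text \<open>This is how a category gets its pullbacks from the products of its slices.\<close>

lemma Slice_product_imp_pullback: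
  assumes Y: "Y \<in> Obj C" and A: "\<guillemotleft>u : A \<rightarrow> Y\<guillemotright>" and B: "\<guillemotleft>v : B \<rightarrow> Y\<guillemotright>"
    and P: "is_product (Slice C Y) (A, u) (B, v) P p q"
  shows "is_pullback C A B u v (fst P) p q"
proof -
  interpret S: category "Slice C Y" by (rule Slice_category[OF Y])
  have o: "(A, u) \<in> Obj (Slice C Y)" "(B, v) \<in> Obj (Slice C Y)" using A B by (simp_all add: Slice_obj[OF Y])
  note PD = is_productD[OF P o]
  have c: "Ident C Y \<cdot> u \<cdot> x = Ident C Y \<cdot> v \<cdot> y"
    if "arr (Slice C Y) x T (A, u)" "arr (Slice C Y) y T (B, v)" for T x y
    using that A B by (simp add: Slice_arr[OF Y] idl)
  have "is_pullback (Slice C Y) (A, u) (B, v) u v P p q"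
  proof (rule is_pullbackI[OF PD(1,2)])
    show "u \<cdot>\<^bsub>Slice C Y\<^esub> p = v \<cdot>\<^bsub>Slice C Y\<^esub> q" using PD(1,2) by (simp add: Slice_arr[OF Y])
  next
    fix T x y assume "arr (Slice C Y) x T (A, u)" "arr (Slice C Y) y T (B, v)"
    then show "\<exists>h. arr (Slice C Y) h T P \<and> p \<cdot>\<^bsub>Slice C Y\<^esub> h = x \<and> q \<cdot>\<^bsub>Slice C Y\<^esub> h = y" by (rule PD(3))
  qed (rule S.product_ext[OF P o])
  then show ?thesis
    using Slice_pullback_iff[OF Y Slice_bang[OF o(1) Y, simplified] Slice_bang[OF o(2) Y, simplified]] by simp
qed

end

context lex
begin

lemma Slice_lex: assumes Y: "Y \<in> Obj C" shows "lex (Slice C Y)"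
proof -
  interpret S: category "Slice C Y" by (rule Slice_category[OF Y])
  show ?thesis
  proof unfold_locales
    show "\<exists>Z. is_terminal (Slice C Y) Z" using Slice_terminal[OF Y] by blast
    fix f A B g A' assume f: "arr (Slice C Y) f A B" and g: "arr (Slice C Y) g A' B"
    obtain P p q where "is_pullback C (fst A) (fst A') f g P p q"
      using pullback_ex[OF Slice_arrD(1)[OF f Y] Slice_arrD(1)[OF g Y]] by blast
    then have "is_pullback (Slice C Y) A A' f g (P, snd A \<cdot> p) p q"
      unfolding Slice_pullback_iff[OF Y f g] by simp
    then show "\<exists>P p q. is_pullback (Slice C Y) A A' f g P p q" by blast
  qed
qed

lemma Slice_monic:
  assumes "monic C (fst A) (fst B) i" "arr (Slice C Y) i A B" and Y: "Y \<in> Obj C"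
  shows "monic (Slice C Y) A B i"
proof -
  have "A \<in> Obj (Slice C Y)" "B \<in> Obj (Slice C Y)" using assms(2) by (auto dest: arr_dom arr_cod)
  then show ?thesis
    using assms(2) monicD[OF assms(1)] by (auto simp: monic_iff Slice_arr[OF Y])
qed

section \<open>Homomorphisms from a group over a base to a group\<close>

lemma Delta_carr: "Carr (Delta C Y K) = (Prod C (Carr K) Y, pr2 C (Carr K) Y)"
  by (simp add: Delta_def Let_def)

context
  fixes K Y assumes K: "group_object C K" and Y: "Y \<in> Obj C"
begin

interpretation S: lex "Slice C Y" by (rule Slice_lex[OF Y])

lemma Delta_elem_iff:
  "arr (Slice C Y) x T (Carr (Delta C Y K)) \<longleftrightarrow>
    \<guillemotleft>x : fst T \<rightarrow> Prod C (Carr K) Y\<guillemotright> \<and> pr2 C (Carr K) Y \<cdot> x = snd T"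
  using pr2[OF group_carr[OF K] Y] by (auto simp: Delta_carr Slice_arr[OF Y] dest: comp)

text \<open>An element of \<open>Delta C Y K\<close> over \<open>t : T \<rightarrow> Y\<close> is a pair \<open>(g, t)\<close>, and the operations act on \<open>g\<close>. These
  formulas replace the structure arrows, which are written through the chosen products of the slice.\<close>

lemma Delta_ops:
  shows Delta_Mul: "arr (Slice C Y) (Mul (Delta C Y K))
      (Prod (Slice C Y) (Carr (Delta C Y K)) (Carr (Delta C Y K))) (Carr (Delta C Y K))"
    and Delta_Inv: "arr (Slice C Y) (Inv (Delta C Y K)) (Carr (Delta C Y K)) (Carr (Delta C Y K))"
    and Delta_One: "arr (Slice C Y) (One (Delta C Y K)) (Term (Slice C Y)) (Carr (Delta C Y K))"
    and Delta_gmul: "\<lbrakk>arr (Slice C Y) x T (Carr (Delta C Y K)); arr (Slice C Y) y T (Carr (Delta C Y K))\<rbrakk> \<Longrightarrow>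
      gmul (Slice C Y) (Delta C Y K) T x y =
      tuple C (fst T) (Carr K) Y (gmul C K (fst T) (pr1 C (Carr K) Y \<cdot> x) (pr1 C (Carr K) Y \<cdot> y)) (snd T)"
    and Delta_inv: "arr (Slice C Y) x T (Carr (Delta C Y K)) \<Longrightarrow>
      Inv (Delta C Y K) \<cdot> x = tuple C (fst T) (Carr K) Y (Inv K \<cdot> (pr1 C (Carr K) Y \<cdot> x)) (snd T)"
    and Delta_gone: "T \<in> Obj (Slice C Y) \<Longrightarrow>
      gone (Slice C Y) (Delta C Y K) T = tuple C (fst T) (Carr K) Y (gone C K (fst T)) (snd T)"
proof -
  let ?G = "Carr K" and ?S = "Slice C Y" let ?A = "Carr (Delta C Y K)"
  let ?AA = "Prod ?S ?A ?A"
  note G = group_carr[OF K] note p = pr1[OF G Y] pr2[OF G Y]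
  have A: "?A \<in> Obj ?S" using p by (simp add: Delta_carr Slice_obj[OF Y])
  note P = S.pr1[OF A A] S.pr2[OF A A]
  have P': "\<guillemotleft>pr1 ?S ?A ?A : fst ?AA \<rightarrow> Prod C ?G Y\<guillemotright>" "\<guillemotleft>pr2 ?S ?A ?A : fst ?AA \<rightarrow> Prod C ?G Y\<guillemotright>"
    "\<guillemotleft>snd ?AA : fst ?AA \<rightarrow> Y\<guillemotright>"
    using Slice_arrD[OF P(1) Y] Slice_arrD[OF P(2) Y] by (auto simp: Delta_carr)
  note c = comp[OF P'(1) p(1)] comp[OF P'(2) p(1)]
  note m = gmul[OF K c]
  have Mul: "Mul (Delta C Y K) = tuple C (fst ?AA) ?G Y
      (gmul C K (fst ?AA) (pr1 C ?G Y \<cdot> pr1 ?S ?A ?A) (pr1 C ?G Y \<cdot> pr2 ?S ?A ?A)) (snd ?AA)"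
    and Inv: "Inv (Delta C Y K) = tuple C (Prod C ?G Y) ?G Y (Inv K \<cdot> pr1 C ?G Y) (pr2 C ?G Y)"
    and One: "One (Delta C Y K) = tuple C (fst (Term ?S)) ?G Y (gone C K (fst (Term ?S))) (snd (Term ?S))"
    by (simp_all add: Delta_def Let_def)
  show MM: "arr ?S (Mul (Delta C Y K)) ?AA ?A"
    unfolding Delta_elem_iff Mul using tuple[OF m P'(3)] pr2_tuple[OF m P'(3)] by simp
  show "arr ?S (Inv (Delta C Y K)) ?A ?A"
    unfolding Delta_elem_iff Inv using tuple[OF inv[OF K p(1)] p(2)] pr2_tuple[OF inv[OF K p(1)] p(2)]
    by (simp add: Delta_carr)
  have T: "\<guillemotleft>snd (Term ?S) : fst (Term ?S) \<rightarrow> Y\<guillemotright>" using S.Term_obj by (simp add: Slice_obj[OF Y])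
  note e = gone[OF K arr_dom[OF T]]
  show O: "arr ?S (One (Delta C Y K)) (Term ?S) ?A"
    unfolding Delta_elem_iff One using tuple[OF e T] pr2_tuple[OF e T] by simp
  show "gmul ?S (Delta C Y K) T x y =
      tuple C (fst T) ?G Y (gmul C K (fst T) (pr1 C ?G Y \<cdot> x) (pr1 C ?G Y \<cdot> y)) (snd T)"
    if x: "arr ?S x T ?A" "arr ?S y T ?A"
  proof -
    note t = S.tuple[OF x] and t' = Slice_arrD[OF S.tuple[OF x] Y]
    show ?thesis
      unfolding gmul_def[of ?S] Slice_Comp unfolding Mul tuple_comp[OF t'(1) m P'(3)] gmul_comp[OF K c t'(1)]
        assoc[OF t'(1) P'(1) p(1)] assoc[OF t'(1) P'(2) p(1)] S.pr1_tuple[OF x, simplified]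
        S.pr2_tuple[OF x, simplified] t'(4) ..
  qed
  show "Inv (Delta C Y K) \<cdot> x = tuple C (fst T) ?G Y (Inv K \<cdot> (pr1 C ?G Y \<cdot> x)) (snd T)"
    if x: "arr ?S x T ?A"
  proof -
    have x': "\<guillemotleft>x : fst T \<rightarrow> Prod C ?G Y\<guillemotright>" "pr2 C ?G Y \<cdot> x = snd T" using x by (auto simp: Delta_elem_iff)
    show ?thesis unfolding Inv tuple_comp[OF x'(1) inv[OF K p(1)] p(2)] x'(2)
      assoc[OF x'(1) p(1) group_Inv[OF K]] ..
  qed
  show "gone ?S (Delta C Y K) T = tuple C (fst T) ?G Y (gone C K (fst T)) (snd T)"
    if "T \<in> Obj ?S"
  proof -
    note b = Slice_arrD[OF S.bang[OF that] Y]
    show ?thesis unfolding gone_def[of ?S] Slice_Comp One tuple_comp[OF b(1) e T] gone_comp[OF K b(1)] b(4) ..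
  qed
qed

lemma Delta_group: "group_object (Slice C Y) (Delta C Y K)"
proof (rule S.group_objectI[OF Delta_Mul Delta_Inv Delta_One])
  let ?G = "Carr K" and ?S = "Slice C Y" and ?D = "Delta C Y K" let ?A = "Carr ?D"
  note G = group_carr[OF K] note p = pr1[OF G Y] pr2[OF G Y]
  fix T x assume x: "arr ?S x T ?A"
  have mk: "arr ?S (tuple C (fst T) ?G Y g (snd T)) T ?A \<and>
      pr1 C ?G Y \<cdot> tuple C (fst T) ?G Y g (snd T) = g" if "\<guillemotleft>g : fst T \<rightarrow> ?G\<guillemotright>" for g
    using that tuple pr1_tuple pr2_tuple Slice_arrD(2)[OF x Y] by (simp add: Delta_elem_iff)
  have el: "\<guillemotleft>pr1 C ?G Y \<cdot> x : fst T \<rightarrow> ?G\<guillemotright> \<and> x = tuple C (fst T) ?G Y (pr1 C ?G Y \<cdot> x) (snd T)"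
    if "arr ?S x T ?A" for x
    using that comp[OF _ p(1)] tuple_prs[OF _ G Y] unfolding Delta_elem_iff by metis
  note ex = el[OF x, THEN conjunct1]
  have T: "T \<in> Obj ?S" using x by (rule arr_dom)
  have T': "fst T \<in> Obj C" using ex by (rule arr_dom)
  note u = group_unit_laws[OF K ex]
  note e = mk[OF gone[OF K T']]
  show "gmul ?S ?D T (gone ?S ?D T) x = x" "gmul ?S ?D T x (gone ?S ?D T) = x"
    using Delta_gmul[OF conjunct1[OF e] x] Delta_gmul[OF x conjunct1[OF e]] e el[OF x] u
    by (simp_all add: Delta_gone[OF T])
  note n = mk[OF inv[OF K ex]]
  show "gmul ?S ?D T (Inv ?D \<cdot>\<^bsub>?S\<^esub> x) x = gone ?S ?D T" "gmul ?S ?D T x (Inv ?D \<cdot>\<^bsub>?S\<^esub> x) = gone ?S ?D T"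
    using Delta_gmul[OF conjunct1[OF n] x] Delta_gmul[OF x conjunct1[OF n]] n el[OF x] u
    by (simp_all add: Delta_gone[OF T] Delta_inv[OF x])
  fix y z assume y: "arr ?S y T ?A" and z: "arr ?S z T ?A"
  note ey = el[OF y, THEN conjunct1] and ez = el[OF z, THEN conjunct1]
  note xy = mk[OF gmul[OF K ex ey]] and yz = mk[OF gmul[OF K ey ez]]
  show "gmul ?S ?D T (gmul ?S ?D T x y) z = gmul ?S ?D T x (gmul ?S ?D T y z)"
    using Delta_gmul[OF conjunct1[OF xy] z] Delta_gmul[OF x conjunct1[OF yz]] xy yz
    by (simp add: Delta_gmul[OF x y] Delta_gmul[OF y z] gmul_assoc[OF K ex ey ez])
qed

end

end

text \<open>A homomorphism from \<open>\<G>\<close> to \<open>Delta C Q K\<close> over \<open>Q\<close> is determined by its first component, an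
  arrow \<open>e\<close> into \<open>K\<close> that is multiplicative on each fibre. Working with \<open>e\<close> avoids the pairing.\<close>

definition fibre_hom :: "('o, 'm) cat \<Rightarrow> 'o \<Rightarrow> ('o \<times> 'm, 'm) grp \<Rightarrow> ('o, 'm) grp \<Rightarrow> 'm \<Rightarrow> bool" where
  "fibre_hom C Q \<G> K e \<longleftrightarrow> arr C e (fst (Carr \<G>)) (Carr K) \<and>
    (\<forall>T x y. arr (Slice C Q) x T (Carr \<G>) \<longrightarrow> arr (Slice C Q) y T (Carr \<G>) \<longrightarrow>
      e \<cdot>\<^bsub>C\<^esub> gmul (Slice C Q) \<G> T x y = gmul C K (fst T) (e \<cdot>\<^bsub>C\<^esub> x) (e \<cdot>\<^bsub>C\<^esub> y))"

lemma fibre_homD: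
  assumes "fibre_hom C Q \<G> K e"
  shows "arr C e (fst (Carr \<G>)) (Carr K)"
    and "\<lbrakk>arr (Slice C Q) x T (Carr \<G>); arr (Slice C Q) y T (Carr \<G>)\<rbrakk> \<Longrightarrow>
      e \<cdot>\<^bsub>C\<^esub> gmul (Slice C Q) \<G> T x y = gmul C K (fst T) (e \<cdot>\<^bsub>C\<^esub> x) (e \<cdot>\<^bsub>C\<^esub> y)"
  using assms unfolding fibre_hom_def by blast+

context lex
begin

lemma group_over_arr:
  assumes Q: "Q \<in> Obj C" and \<G>: "group_object (Slice C Q) \<G>"
  shows "\<guillemotleft>snd (Carr \<G>) : fst (Carr \<G>) \<rightarrow> Q\<guillemotright>"
  using lex.group_carr[OF Slice_lex[OF Q] \<G>] by (simp add: Slice_obj[OF Q])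

context
  fixes Q \<G> K assumes Q: "Q \<in> Obj C" and \<G>: "group_object (Slice C Q) \<G>" and K: "group_object C K"
begin

interpretation S: lex "Slice C Q" by (rule Slice_lex[OF Q])

lemma Delta_hom_iff:
  "\<eta> \<in> Hom (Grp (Slice C Q)) \<G> (Delta C Q K) \<longleftrightarrow>
    fibre_hom C Q \<G> K (pr1 C (Carr K) Q \<cdot> \<eta>) \<and>
    \<guillemotleft>\<eta> : fst (Carr \<G>) \<rightarrow> Prod C (Carr K) Q\<guillemotright> \<and> pr2 C (Carr K) Q \<cdot> \<eta> = snd (Carr \<G>)"
proof -
  let ?S = "Slice C Q" and ?G = "Carr K" let ?A = "Carr (Delta C Q K)"
  note G = group_carr[OF K] and u = group_over_arr[OF Q \<G>] note p = pr1[OF G Q] pr2[OF G Q]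
  have "\<eta> \<cdot> gmul ?S \<G> T x y = gmul ?S (Delta C Q K) T (\<eta> \<cdot> x) (\<eta> \<cdot> y) \<longleftrightarrow>
      (pr1 C ?G Q \<cdot> \<eta>) \<cdot> gmul ?S \<G> T x y = gmul C K (fst T) ((pr1 C ?G Q \<cdot> \<eta>) \<cdot> x) ((pr1 C ?G Q \<cdot> \<eta>) \<cdot> y)"
    if h: "arr ?S \<eta> (Carr \<G>) ?A" and x: "arr ?S x T (Carr \<G>)" "arr ?S y T (Carr \<G>)" for T x y
  proof -
    have h': "\<guillemotleft>\<eta> : fst (Carr \<G>) \<rightarrow> Prod C ?G Q\<guillemotright>" using h by (simp add: Delta_elem_iff[OF K Q])
    have xS: "arr ?S (\<eta> \<cdot> x) T ?A" "arr ?S (\<eta> \<cdot> y) T ?A"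
      using S.comp[OF x(1) h] S.comp[OF x(2) h] by simp_all
    have gS: "arr ?S (gmul ?S \<G> T x y) T (Carr \<G>)" by (rule S.gmul[OF \<G> x])
    note x' = Slice_arrD[OF x(1) Q] Slice_arrD[OF x(2) Q] Slice_arrD[OF gS Q]
    have c: "\<guillemotleft>pr1 C ?G Q \<cdot> (\<eta> \<cdot> x) : fst T \<rightarrow> ?G\<guillemotright>" "\<guillemotleft>pr1 C ?G Q \<cdot> (\<eta> \<cdot> y) : fst T \<rightarrow> ?G\<guillemotright>"
      using comp[OF comp[OF x'(1) h'] p(1)] comp[OF comp[OF x'(5) h'] p(1)] .
    note m = gmul[OF K c]
    have hg: "\<guillemotleft>\<eta> \<cdot> gmul ?S \<G> T x y : fst T \<rightarrow> Prod C ?G Q\<guillemotright>" "pr2 C ?G Q \<cdot> (\<eta> \<cdot> gmul ?S \<G> T x y) = snd T"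
      using S.comp[OF gS h] by (simp_all add: Delta_elem_iff[OF K Q])
    have "\<eta> \<cdot> gmul ?S \<G> T x y = tuple C (fst T) ?G Q (gmul C K (fst T) (pr1 C ?G Q \<cdot> (\<eta> \<cdot> x)) (pr1 C ?G Q \<cdot> (\<eta> \<cdot> y))) (snd T)
      \<longleftrightarrow> pr1 C ?G Q \<cdot> (\<eta> \<cdot> gmul ?S \<G> T x y) = gmul C K (fst T) (pr1 C ?G Q \<cdot> (\<eta> \<cdot> x)) (pr1 C ?G Q \<cdot> (\<eta> \<cdot> y))"
      using pr1_tuple[OF m x'(2)] tuple_eqI[OF hg(1) G Q _ hg(2)] by metis
    then show ?thesis
      unfolding Delta_gmul[OF K Q xS] assoc[OF x'(1) h' p(1)] assoc[OF x'(5) h' p(1)] assoc[OF x'(9) h' p(1)] .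
  qed
  moreover have "\<guillemotleft>pr1 C ?G Q \<cdot> \<eta> : fst (Carr \<G>) \<rightarrow> ?G\<guillemotright>" if "arr ?S \<eta> (Carr \<G>) ?A"
    using that comp[OF _ p(1)] by (simp add: Delta_elem_iff[OF K Q])
  ultimately show ?thesis
    unfolding S.Grp_hom_iff[OF \<G> Delta_group[OF K Q]] Slice_Comp fibre_hom_def
    unfolding Delta_elem_iff[OF K Q] by blast
qed

lemma fibre_hom_tuple:
  assumes e: "fibre_hom C Q \<G> K e"
  shows "tuple C (fst (Carr \<G>)) (Carr K) Q e (snd (Carr \<G>)) \<in> Hom (Grp (Slice C Q)) \<G> (Delta C Q K)"
  unfolding Delta_hom_iff
  using e fibre_homD(1)[OF e] group_over_arr[OF Q \<G>] by (simp add: tuple pr1_tuple pr2_tuple)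

lemma fibre_hom_comp:
  assumes L: "group_object C L" and f: "f \<in> Hom (Grp C) K L" and e: "fibre_hom C Q \<G> K e"
  shows "fibre_hom C Q \<G> L (f \<cdot> e)"
proof -
  note f' = Grp_hom_arr[OF K L f] and e' = fibre_homD[OF e]
  have "(f \<cdot> e) \<cdot> gmul (Slice C Q) \<G> T x y = gmul C L (fst T) ((f \<cdot> e) \<cdot> x) ((f \<cdot> e) \<cdot> y)"
    if x: "arr (Slice C Q) x T (Carr \<G>)" "arr (Slice C Q) y T (Carr \<G>)" for T x y
  proof -
    note x' = Slice_arrD(1)[OF x(1) Q] Slice_arrD(1)[OF x(2) Q] Slice_arrD(1)[OF S.gmul[OF \<G> x] Q]
    show ?thesis
      unfolding assoc[OF x'(1) e'(1) f'] assoc[OF x'(2) e'(1) f'] assoc[OF x'(3) e'(1) f'] e'(2)[OF x]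
        Grp_hom_gmul[OF K L f comp[OF x'(1) e'(1)] comp[OF x'(2) e'(1)]] ..
  qed
  then show ?thesis unfolding fibre_hom_def using comp[OF e'(1) f'] by blast
qed

text \<open>The image of the unit is idempotent, and the unit is the only idempotent of a group.\<close>

lemma fibre_hom_one:
  assumes e: "fibre_hom C Q \<G> K e" and t: "T \<in> Obj (Slice C Q)"
  shows "e \<cdot> gone (Slice C Q) \<G> T = gone C K (fst T)"
proof -
  note e' = fibre_homD[OF e] and g = S.gone[OF \<G> t]
  show ?thesis
    using idempotent_gone[OF K comp[OF Slice_arrD(1)[OF g Q] e'(1)]] e'(2)[OF g g]
      S.group_unit_laws(1)[OF \<G> g] by simp
qed

end

lemma Delta_map_tuple:
  assumes Q: "Q \<in> Obj C" and K: "group_object C K" and L: "group_object C L" and f: "f \<in> Hom (Grp C) K L"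
    and e: "\<guillemotleft>e : A \<rightarrow> Carr K\<guillemotright>" and u: "\<guillemotleft>u : A \<rightarrow> Q\<guillemotright>"
  shows "Delta_map C Q K L f \<cdot> tuple C A (Carr K) Q e u = tuple C A (Carr L) Q (f \<cdot> e) u"
  unfolding Delta_map_def prod_map_elem[OF Grp_hom_arr[OF K L f] ident[OF Q] e u] idl[OF u] ..

text \<open>In this form the universal properties of the edge groups, of the vertex groups and of the whole graph of
  groups can be compared directly.\<close>

lemma universal_arrow_fibre_hom:
  assumes Q: "Q \<in> Obj C" and \<G>: "group_object (Slice C Q) \<G>"
    and u: "universal_arrow (Grp C) (Grp (Slice C Q)) (Delta C Q) (Delta_map C Q) \<G> U \<eta>"
  shows "group_object C U" and "fibre_hom C Q \<G> U (pr1 C (Carr U) Q \<cdot> \<eta>)"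
    and "\<lbrakk>group_object C K; fibre_hom C Q \<G> K e\<rbrakk> \<Longrightarrow>
      \<exists>!g. g \<in> Hom (Grp C) U K \<and> g \<cdot> (pr1 C (Carr U) Q \<cdot> \<eta>) = e"
proof -
  let ?S = "Slice C Q"
  show U: "group_object C U" using u by (simp add: universal_arrow_def Grp_def)
  have "\<eta> \<in> Hom (Grp ?S) \<G> (Delta C Q U)" using u by (simp add: universal_arrow_def)
  then have h: "fibre_hom C Q \<G> U (pr1 C (Carr U) Q \<cdot> \<eta>)"
    and eta: "\<guillemotleft>\<eta> : fst (Carr \<G>) \<rightarrow> Prod C (Carr U) Q\<guillemotright>" "pr2 C (Carr U) Q \<cdot> \<eta> = snd (Carr \<G>)"
    unfolding Delta_hom_iff[OF Q \<G> U] by auto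
  show "fibre_hom C Q \<G> U (pr1 C (Carr U) Q \<cdot> \<eta>)" by (rule h)
  note h' = fibre_homD(1)[OF h] and v = group_over_arr[OF Q \<G>]
  have et: "\<eta> = tuple C (fst (Carr \<G>)) (Carr U) Q (pr1 C (Carr U) Q \<cdot> \<eta>) (snd (Carr \<G>))"
    using tuple_eqI[OF eta(1) group_carr[OF U] Q refl eta(2)] by simp
  assume K: "group_object C K" and e: "fibre_hom C Q \<G> K e"
  let ?t = "tuple C (fst (Carr \<G>)) (Carr K) Q e (snd (Carr \<G>))"
  have "?t \<in> Hom (Grp ?S) \<G> (Delta C Q K)" by (rule fibre_hom_tuple[OF Q \<G> K e])
  then have "\<exists>!g. g \<in> Hom (Grp C) U K \<and> Delta_map C Q U K g \<cdot>\<^bsub>Grp ?S\<^esub> \<eta> = ?t"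
    using u K unfolding universal_arrow_def by (simp add: Grp_def)
  moreover have "Delta_map C Q U K g \<cdot>\<^bsub>Grp ?S\<^esub> \<eta> = ?t \<longleftrightarrow> g \<cdot> (pr1 C (Carr U) Q \<cdot> \<eta>) = e"
    if g: "g \<in> Hom (Grp C) U K" for g
  proof -
    have "Delta_map C Q U K g \<cdot> \<eta> = tuple C (fst (Carr \<G>)) (Carr K) Q (g \<cdot> (pr1 C (Carr U) Q \<cdot> \<eta>)) (snd (Carr \<G>))"
      using Delta_map_tuple[OF Q U K g h' v] unfolding et[symmetric] .
    then show ?thesis
      unfolding Grp_Comp Slice_Comp
      using pr1_tuple[OF comp[OF h' Grp_hom_arr[OF U K g]] v] pr1_tuple[OF fibre_homD(1)[OF e] v] by metis
  qed
  ultimately show "\<exists>!g. g \<in> Hom (Grp C) U K \<and> g \<cdot> (pr1 C (Carr U) Q \<cdot> \<eta>) = e" by metis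
qed

end

section \<open>Stabilisers and their pullbacks\<close>

context lex
begin

text \<open>The structure arrows of induced groups are given by description; this makes the description usable.\<close>

lemma monic_factor_THE:
  assumes "monic C S B i" "\<guillemotleft>k : T \<rightarrow> S\<guillemotright>" "i \<cdot> k = m"
  shows "\<guillemotleft>(THE k. k \<in> Hom C T S \<and> i \<cdot> k = m) : T \<rightarrow> S\<guillemotright>" "i \<cdot> (THE k. k \<in> Hom C T S \<and> i \<cdot> k = m) = m"
proof -
  have o: "T \<in> Obj C" "S \<in> Obj C" using assms(2) by (auto dest: arr_dom arr_cod)
  have "\<exists>!k. k \<in> Hom C T S \<and> i \<cdot> k = m"
    using assms monicD[OF assms(1)] o unfolding arr_def by metis
  from theI'[OF this] o show "\<guillemotleft>(THE k. k \<in> Hom C T S \<and> i \<cdot> k = m) : T \<rightarrow> S\<guillemotright>"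
    "i \<cdot> (THE k. k \<in> Hom C T S \<and> i \<cdot> k = m) = m" by (auto simp: arr_def)
qed

lemma induced_group_carr [simp]: "Carr (induced_group C H S i) = S"
  by (simp add: induced_group_def)

lemma induced_group:
  assumes H: "group_object C H" and i: "monic C S (Carr H) i" and S: "S \<in> Obj C"
    and m: "\<And>T x y. \<lbrakk>\<guillemotleft>x : T \<rightarrow> S\<guillemotright>; \<guillemotleft>y : T \<rightarrow> S\<guillemotright>\<rbrakk> \<Longrightarrow> \<exists>k. \<guillemotleft>k : T \<rightarrow> S\<guillemotright> \<and> i \<cdot> k = gmul C H T (i \<cdot> x) (i \<cdot> y)"
    and n: "\<And>T x. \<guillemotleft>x : T \<rightarrow> S\<guillemotright> \<Longrightarrow> \<exists>k. \<guillemotleft>k : T \<rightarrow> S\<guillemotright> \<and> i \<cdot> k = Inv H \<cdot> (i \<cdot> x)"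
    and e: "\<And>T. T \<in> Obj C \<Longrightarrow> \<exists>k. \<guillemotleft>k : T \<rightarrow> S\<guillemotright> \<and> i \<cdot> k = gone C H T"
  shows "group_object C (induced_group C H S i)"
    and "\<And>T x y. \<lbrakk>\<guillemotleft>x : T \<rightarrow> S\<guillemotright>; \<guillemotleft>y : T \<rightarrow> S\<guillemotright>\<rbrakk> \<Longrightarrow>
      i \<cdot> gmul C (induced_group C H S i) T x y = gmul C H T (i \<cdot> x) (i \<cdot> y)"
proof -
  let ?I = "induced_group C H S i"
  have I: "\<guillemotleft>i : S \<rightarrow> Carr H\<guillemotright>" using i S group_carr[OF H] by (simp add: monic_def arr_def)
  obtain k1 where k1: "\<guillemotleft>k1 : Prod C S S \<rightarrow> S\<guillemotright>"
    "i \<cdot> k1 = Mul H \<cdot> prod_map C S (Carr H) S (Carr H) i i"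
    using m[OF pr1[OF S S] pr2[OF S S]] unfolding gmul_def prod_map_def by blast
  obtain k2 where k2: "\<guillemotleft>k2 : S \<rightarrow> S\<guillemotright>" "i \<cdot> k2 = Inv H \<cdot> i" using n[OF ident[OF S]] idr[OF I] by auto
  have "gone C H (Term C) = One H"
    unfolding gone_def bang_eq[OF bang[OF Term_obj] ident[OF Term_obj]] by (rule idr[OF group_One[OF H]])
  then obtain k3 where k3: "\<guillemotleft>k3 : Term C \<rightarrow> S\<guillemotright>" "i \<cdot> k3 = One H" using e[OF Term_obj] by auto
  note t = monic_factor_THE[OF i k1] monic_factor_THE[OF i k2] monic_factor_THE[OF i k3]
  have M: "\<guillemotleft>Mul ?I : Prod C (Carr ?I) (Carr ?I) \<rightarrow> Carr ?I\<guillemotright>" "\<guillemotleft>Inv ?I : Carr ?I \<rightarrow> Carr ?I\<guillemotright>" "\<guillemotleft>One ?I : Term C \<rightarrow> Carr ?I\<guillemotright>"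
    and E: "i \<cdot> Mul ?I = gmul C H (Prod C (Carr ?I) (Carr ?I)) (i \<cdot> pr1 C (Carr ?I) (Carr ?I)) (i \<cdot> pr2 C (Carr ?I) (Carr ?I))"
    "i \<cdot> Inv ?I = Inv H \<cdot> i" "i \<cdot> One ?I = One H"
    using t by (simp_all add: induced_group_def gmul_def prod_map_def)
  note r = subgroup_object[OF H _ _ M E, unfolded induced_group_carr, OF i S]
  show "group_object C ?I" by (rule r(1))
  show "\<And>T x y. \<lbrakk>\<guillemotleft>x : T \<rightarrow> S\<guillemotright>; \<guillemotleft>y : T \<rightarrow> S\<guillemotright>\<rbrakk> \<Longrightarrow> i \<cdot> gmul C ?I T x y = gmul C H T (i \<cdot> x) (i \<cdot> y)" by (rule r(2))
qed

context
  fixes K X a assumes K: "group_object C K" and act: "is_action C K X a"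
begin

lemma action_arr: "\<guillemotleft>a : Prod C (Carr K) X \<rightarrow> X\<guillemotright>"
  and action_mul: "\<lbrakk>\<guillemotleft>g : T \<rightarrow> Carr K\<guillemotright>; \<guillemotleft>h : T \<rightarrow> Carr K\<guillemotright>; \<guillemotleft>x : T \<rightarrow> X\<guillemotright>\<rbrakk> \<Longrightarrow>
    gact C K X a T (gmul C K T g h) x = gact C K X a T g (gact C K X a T h x)"
  and action_one: "\<guillemotleft>x : T \<rightarrow> X\<guillemotright> \<Longrightarrow> gact C K X a T (gone C K T) x = x"
  using act unfolding is_action_iff[OF K] by blast+

lemma stab_incl: "\<guillemotleft>stab_incl C K X a : stab_obj C K X a \<rightarrow> Prod C (Carr K) X\<guillemotright>"
  "a \<cdot> stab_incl C K X a = pr2 C (Carr K) X \<cdot> stab_incl C K X a"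
  "monic C (stab_obj C K X a) (Prod C (Carr K) X) (stab_incl C K X a)"
  "\<lbrakk>\<guillemotleft>g : T \<rightarrow> Carr K\<guillemotright>; \<guillemotleft>x : T \<rightarrow> X\<guillemotright>; gact C K X a T g x = x\<rbrakk> \<Longrightarrow>
    \<exists>k. \<guillemotleft>k : T \<rightarrow> stab_obj C K X a\<guillemotright> \<and> stab_incl C K X a \<cdot> k = tuple C T (Carr K) X g x"
proof -
  let ?i = "stab_incl C K X a" and ?E = "stab_obj C K X a" and ?p = "pr2 C (Carr K) X"
  note a = action_arr
  note X = arr_cod[OF a] and G = group_carr[OF K] note p = pr1[OF G X] pr2[OF G X]
  have eq: "is_equaliser C (Prod C (Carr K) X) X a ?p ?E ?i"
    unfolding stab_incl_def stab_obj_def by (rule is_equaliser_equaliser[OF a p(2)])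
  note e = is_equaliserD[OF eq arr_dom[OF a]]
  show i: "\<guillemotleft>?i : ?E \<rightarrow> Prod C (Carr K) X\<guillemotright>" "a \<cdot> ?i = ?p \<cdot> ?i" by (rule e(1), rule e(2))
  show "monic C ?E (Prod C (Carr K) X) ?i"
    unfolding monic_iff[OF arr_dom[OF i(1)] arr_dom[OF a]] using i(1) equaliser_ext[OF eq a p(2)] by blast
  show "\<exists>k. \<guillemotleft>k : T \<rightarrow> ?E\<guillemotright> \<and> ?i \<cdot> k = tuple C T (Carr K) X g x"
    if g: "\<guillemotleft>g : T \<rightarrow> Carr K\<guillemotright>" "\<guillemotleft>x : T \<rightarrow> X\<guillemotright>" "gact C K X a T g x = x"
    using e(3)[OF tuple[OF g(1,2)]] pr2_tuple[OF g(1,2)] g(3) by (simp add: gact_def)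
qed

lemma stab_elem:
  assumes k: "\<guillemotleft>k : T \<rightarrow> stab_obj C K X a\<guillemotright>"
  shows "\<guillemotleft>pr1 C (Carr K) X \<cdot> (stab_incl C K X a \<cdot> k) : T \<rightarrow> Carr K\<guillemotright>"
    "\<guillemotleft>pr2 C (Carr K) X \<cdot> (stab_incl C K X a \<cdot> k) : T \<rightarrow> X\<guillemotright>"
    "gact C K X a T (pr1 C (Carr K) X \<cdot> (stab_incl C K X a \<cdot> k)) (pr2 C (Carr K) X \<cdot> (stab_incl C K X a \<cdot> k)) =
     pr2 C (Carr K) X \<cdot> (stab_incl C K X a \<cdot> k)"
proof -
  note a = action_arr
  note X = arr_cod[OF a] and G = group_carr[OF K] note p = pr1[OF G X] pr2[OF G X]
  note i = stab_incl(1,2) note ik = comp[OF k i(1)]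
  show "\<guillemotleft>pr1 C (Carr K) X \<cdot> (stab_incl C K X a \<cdot> k) : T \<rightarrow> Carr K\<guillemotright>"
    "\<guillemotleft>pr2 C (Carr K) X \<cdot> (stab_incl C K X a \<cdot> k) : T \<rightarrow> X\<guillemotright>" using comp[OF ik p(1)] comp[OF ik p(2)] .
  show "gact C K X a T (pr1 C (Carr K) X \<cdot> (stab_incl C K X a \<cdot> k)) (pr2 C (Carr K) X \<cdot> (stab_incl C K X a \<cdot> k)) =
     pr2 C (Carr K) X \<cdot> (stab_incl C K X a \<cdot> k)"
    unfolding gact_def tuple_prs[OF ik G X] using assoc[OF k i(1) a] assoc[OF k i(1) p(2)] i(2) by simp
qed

lemma stabiliser_carr: "Carr (stabiliser C K X a) =
    (stab_obj C K X a, pr2 C (Carr K) X \<cdot> stab_incl C K X a)"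
  by (simp add: stabiliser_def induced_group_def)

text \<open>The elements \<open>g\<close> with \<open>g x = x\<close> are closed under products and inverses by the axioms of an action.\<close>

lemma stabiliser:
  shows "group_object (Slice C X) (stabiliser C K X a)"
    and "\<lbrakk>arr (Slice C X) x T (Carr (stabiliser C K X a)); arr (Slice C X) y T (Carr (stabiliser C K X a))\<rbrakk> \<Longrightarrow>
      stab_incl C K X a \<cdot> gmul (Slice C X) (stabiliser C K X a) T x y =
      tuple C (fst T) (Carr K) X
        (gmul C K (fst T) (pr1 C (Carr K) X \<cdot> (stab_incl C K X a \<cdot> x)) (pr1 C (Carr K) X \<cdot> (stab_incl C K X a \<cdot> y)))
        (snd T)"
proof -
  let ?i = "stab_incl C K X a" and ?E = "stab_obj C K X a" and ?G = "Carr K" and ?S = "Slice C X"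
  let ?p = "pr1 C ?G X" and ?q = "pr2 C ?G X" let ?s = "(?E, ?q \<cdot> ?i)" let ?D = "Delta C X K"
  note a = action_arr
  note X = arr_cod[OF a] and G = group_carr[OF K] note p = pr1[OF G X] pr2[OF G X]
  interpret S: lex ?S by (rule Slice_lex[OF X])
  note i = stab_incl
  have iS: "arr ?S ?i ?s (Carr ?D)" unfolding Delta_elem_iff[OF K X] using i(1) by simp
  have mS: "monic ?S ?s (Carr ?D) ?i"
    by (rule Slice_monic[OF _ iS X]) (use i(3) in \<open>simp add: Delta_carr\<close>)
  have el: "\<guillemotleft>?p \<cdot> (?i \<cdot> x) : fst T \<rightarrow> ?G\<guillemotright> \<and> \<guillemotleft>snd T : fst T \<rightarrow> X\<guillemotright> \<and> arr ?S (?i \<cdot> x) T (Carr ?D) \<and>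
      gact C K X a (fst T) (?p \<cdot> (?i \<cdot> x)) (snd T) = snd T"
    if x: "arr ?S x T ?s" for x T
  proof -
    note x' = Slice_arrD[OF x X, unfolded fst_conv snd_conv assoc[OF Slice_arrD(1)[OF x X, unfolded fst_conv] i(1) p(2)]]
    show ?thesis using stab_elem[OF x'(1)] x'(2,4) S.comp[OF x iS] by simp
  qed
  have mk: "\<exists>k. arr ?S k T ?s \<and> ?i \<cdot> k = tuple C (fst T) ?G X g (snd T)"
    if g: "\<guillemotleft>g : fst T \<rightarrow> ?G\<guillemotright>" "\<guillemotleft>snd T : fst T \<rightarrow> X\<guillemotright>" "gact C K X a (fst T) g (snd T) = snd T" for g T
  proof -
    obtain k where k: "\<guillemotleft>k : fst T \<rightarrow> ?E\<guillemotright>" "?i \<cdot> k = tuple C (fst T) ?G X g (snd T)" using i(4)[OF g] by blast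
    have "arr ?S k (fst T, snd T) ?s"
      by (rule Slice_arrI) (use k assoc[OF k(1) i(1) p(2)] pr2_tuple[OF g(1,2)] comp[OF i(1) p(2)] in simp_all)
    then show ?thesis using k by auto
  qed
  have m: "\<exists>k. arr ?S k T ?s \<and> ?i \<cdot>\<^bsub>?S\<^esub> k = gmul ?S ?D T (?i \<cdot>\<^bsub>?S\<^esub> x) (?i \<cdot>\<^bsub>?S\<^esub> y)"
    if x: "arr ?S x T ?s" and y: "arr ?S y T ?s" for T x y
  proof -
    note ex = el[OF x] and ey = el[OF y]
    have "gact C K X a (fst T) (gmul C K (fst T) (?p \<cdot> (?i \<cdot> x)) (?p \<cdot> (?i \<cdot> y))) (snd T) = snd T"
      using action_mul[of "?p \<cdot> (?i \<cdot> x)" "fst T" "?p \<cdot> (?i \<cdot> y)" "snd T"] ex ey by simp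
    then show ?thesis using mk[OF gmul[OF K]] ex ey Delta_gmul[OF K X] by simp
  qed
  have n: "\<exists>k. arr ?S k T ?s \<and> ?i \<cdot>\<^bsub>?S\<^esub> k = Inv ?D \<cdot>\<^bsub>?S\<^esub> (?i \<cdot>\<^bsub>?S\<^esub> x)" if x: "arr ?S x T ?s" for T x
  proof -
    note ex = el[OF x]
    have g: "\<guillemotleft>?p \<cdot> (?i \<cdot> x) : fst T \<rightarrow> ?G\<guillemotright>" using ex by blast
    \<comment> \<open>The inverse fixes \<open>snd T\<close> because the element itself does.\<close>
    have "gact C K X a (fst T) (Inv K \<cdot> (?p \<cdot> (?i \<cdot> x))) (snd T) =
      gact C K X a (fst T) (Inv K \<cdot> (?p \<cdot> (?i \<cdot> x))) (gact C K X a (fst T) (?p \<cdot> (?i \<cdot> x)) (snd T))"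
      using ex by simp
    also have "\<dots> = snd T"
      using action_mul[of "Inv K \<cdot> (?p \<cdot> (?i \<cdot> x))" "fst T" "?p \<cdot> (?i \<cdot> x)" "snd T"] ex inv[OF K g]
        group_unit_laws(3)[OF K g] action_one[of "snd T" "fst T"] by simp
    finally show ?thesis using mk[OF inv[OF K g]] ex Delta_inv[OF K X conjunct1[OF conjunct2[OF conjunct2[OF ex]]]] by simp
  qed
  have e: "\<exists>k. arr ?S k T ?s \<and> ?i \<cdot>\<^bsub>?S\<^esub> k = gone ?S ?D T" if T: "T \<in> Obj ?S" for T
  proof -
    have t: "\<guillemotleft>snd T : fst T \<rightarrow> X\<guillemotright>" using T by (simp add: Slice_obj[OF X])
    show ?thesis using mk[OF gone[OF K arr_dom[OF t]] t action_one[OF t]] Delta_gone[OF K X T] by simp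
  qed
  note I = S.induced_group[OF Delta_group[OF K X] mS arr_dom[OF iS] m n e]
  show "group_object ?S (stabiliser C K X a)" unfolding stabiliser_def by (rule I(1))
  show "?i \<cdot> gmul ?S (stabiliser C K X a) T x y =
      tuple C (fst T) ?G X (gmul C K (fst T) (?p \<cdot> (?i \<cdot> x)) (?p \<cdot> (?i \<cdot> y))) (snd T)"
    if "arr ?S x T (Carr (stabiliser C K X a))" "arr ?S y T (Carr (stabiliser C K X a))"
    using I(2)[of x T y] that el[of x T] el[of y T] Delta_gmul[OF K X]
    unfolding stabiliser_carr by (simp add: stabiliser_def)
qed

end

text \<open>An element of the pullback over \<open>t : T \<rightarrow> Q\<close> is the same as an element of \<open>K\<close> over \<open>s \<cdot> t\<close>. The
  operations correspond under this bijection, hence so do the group laws.\<close>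

lemma pb_group:
  assumes K: "group_object (Slice C X) K" and s: "\<guillemotleft>s : Q \<rightarrow> X\<guillemotright>"
  shows "is_pullback C Q (fst (Carr K)) s (snd (Carr K)) (pb_obj C Q s K) (pb_base C Q s K) (pb_top C Q s K)"
    and "Carr (pb_group C Q X s K) = (pb_obj C Q s K, pb_base C Q s K)"
    and "group_object (Slice C Q) (pb_group C Q X s K)"
    and "\<lbrakk>arr (Slice C Q) x T (Carr (pb_group C Q X s K)); arr (Slice C Q) y T (Carr (pb_group C Q X s K))\<rbrakk> \<Longrightarrow>
      pb_top C Q s K \<cdot> gmul (Slice C Q) (pb_group C Q X s K) T x y =
      gmul (Slice C X) K (fst T, s \<cdot> snd T) (pb_top C Q s K \<cdot> x) (pb_top C Q s K \<cdot> y)"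
    and "arr (Slice C Q) x T (Carr (pb_group C Q X s K)) \<Longrightarrow>
      arr (Slice C X) (pb_top C Q s K \<cdot> x) (fst T, s \<cdot> snd T) (Carr K)"
proof -
  let ?B = "pb_group C Q X s K" and ?S = "Slice C Q" and ?SX = "Slice C X"
  let ?P = "pb_obj C Q s K" and ?p = "pb_base C Q s K" and ?r = "pb_top C Q s K"
  let ?A = "(?P, ?p)" let ?W = "Prod ?S ?A ?A" and ?U = "Term ?S"
  note Q = arr_dom[OF s] and X = arr_cod[OF s]
  interpret S: lex ?S by (rule Slice_lex[OF Q])
  interpret SX: lex ?SX by (rule Slice_lex[OF X])
  note v = group_over_arr[OF X K]
  show pb: "is_pullback C Q (fst (Carr K)) s (snd (Carr K)) ?P ?p ?r"
    unfolding pb_obj_def pb_base_def pb_top_def by (rule is_pullback_pullback[OF s v])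
  note pD = is_pullbackD[OF pb Q arr_dom[OF v]]
  have ext: "x = y" if "arr ?S x T ?A" "arr ?S y T ?A" "?r \<cdot> x = ?r \<cdot> y" for x y T
    using pullback_ext[OF pb s v Slice_arrD(1)[OF that(1) Q, unfolded fst_conv] Slice_arrD(1)[OF that(2) Q, unfolded fst_conv]]
      Slice_arrD(4)[OF that(1) Q] Slice_arrD(4)[OF that(2) Q] that(3) by simp
  have top: "arr ?SX (?r \<cdot> x) (fst T, s \<cdot> snd T) (Carr K)" if x: "arr ?S x T ?A" for x T
  proof -
    note x' = Slice_arrD[OF x Q, simplified]
    have "snd (Carr K) \<cdot> (?r \<cdot> x) = s \<cdot> snd T"
      using assoc[OF x'(1) pD(2) v] assoc[OF x'(1) pD(1) s] pD(3) x'(4) by simp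
    then show ?thesis by (rule Slice_arrI[OF comp[OF x'(1) pD(2)] v])
  qed
  have mk: "\<exists>!k. k \<in> Hom C T ?P \<and> ?p \<cdot> k = t \<and> ?r \<cdot> k = y"
    if t: "\<guillemotleft>t : T \<rightarrow> Q\<guillemotright>" and y: "arr ?SX y (T, s \<cdot> t) (Carr K)" for t T y
  proof -
    note y' = Slice_arrD[OF y X, simplified]
    obtain k where k: "\<guillemotleft>k : T \<rightarrow> ?P\<guillemotright>" "?p \<cdot> k = t" "?r \<cdot> k = y" using pD(4)[OF t y'(1)] y'(4) by auto
    have "h = k" if "h \<in> Hom C T ?P" "?p \<cdot> h = t" "?r \<cdot> h = y" for h
      by (rule pullback_ext[OF pb s v, of _ T]) (use that k in \<open>auto simp: arr_def\<close>)
    then show ?thesis using k arr_hom[OF k(1)] by blast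
  qed
  have mkS: "arr ?S k (T, t) ?A" if "\<guillemotleft>t : T \<rightarrow> Q\<guillemotright>" "k \<in> Hom C T ?P" "?p \<cdot> k = t" for k T t
  proof (rule Slice_arrI)
    show "\<guillemotleft>k : T \<rightarrow> fst ?A\<guillemotright>" using that arr_dom[OF that(1)] arr_dom[OF pD(1)] by (simp add: arr_def)
  qed (use that pD(1) in simp_all)
  have base: "arr ?SX k (fst T', s \<cdot> snd T') (fst T, s \<cdot> snd T)" if k: "arr ?S k T' T" for k T' T
  proof -
    note k' = Slice_arrD[OF k Q]
    show ?thesis
      by (rule Slice_arrI) (use k' comp[OF k'(3) s] assoc[OF k'(1,3) s] in simp_all)
  qed
  have A: "?A \<in> Obj ?S" using pD(1) by (simp add: Slice_obj[OF Q])
  note P = S.pr1[OF A A] S.pr2[OF A A]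
  note m = SX.gmul[OF K top[OF P(1)] top[OF P(2)]]
  note W = Slice_arrD(2)[OF P(1) Q]
  have U: "\<guillemotleft>snd ?U : fst ?U \<rightarrow> Q\<guillemotright>" using S.Term_obj by (simp add: Slice_obj[OF Q])
  have U': "(fst ?U, s \<cdot> snd ?U) \<in> Obj ?SX" using comp[OF U s] by (simp add: Slice_obj[OF X])
  have i: "arr ?S (Ident C ?P) ?A ?A" using S.ident[OF A] by simp
  have r: "arr ?SX ?r (?P, s \<cdot> ?p) (Carr K)" using top[OF i] idr[OF pD(2)] by simp
  show carr: "Carr ?B = ?A" by (simp add: pb_group_def Let_def)
  have Mul: "Mul ?B = (THE k. k \<in> Hom C (fst ?W) ?P \<and> ?p \<cdot> k = snd ?W \<and>
      ?r \<cdot> k = gmul ?SX K (fst ?W, s \<cdot> snd ?W) (?r \<cdot> pr1 ?S ?A ?A) (?r \<cdot> pr2 ?S ?A ?A))"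
    and Inv: "Inv ?B = (THE k. k \<in> Hom C ?P ?P \<and> ?p \<cdot> k = ?p \<and> ?r \<cdot> k = Inv K \<cdot> ?r)"
    and One: "One ?B = (THE k. k \<in> Hom C (fst ?U) ?P \<and> ?p \<cdot> k = snd ?U \<and>
      ?r \<cdot> k = gone ?SX K (fst ?U, s \<cdot> snd ?U))"
    by (simp_all add: pb_group_def Let_def)
  have M: "arr ?S (Mul ?B) ?W ?A"
    and rM: "?r \<cdot> Mul ?B = gmul ?SX K (fst ?W, s \<cdot> snd ?W) (?r \<cdot> pr1 ?S ?A ?A) (?r \<cdot> pr2 ?S ?A ?A)"
    using theI'[OF mk[OF W m], folded Mul] mkS[OF W] by simp_all
  have N: "arr ?S (Inv ?B) ?A ?A" and rN: "?r \<cdot> Inv ?B = Inv K \<cdot> ?r"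
    using theI'[OF mk[OF pD(1) SX.inv[OF K r, simplified]], folded Inv] mkS[OF pD(1)] by simp_all
  have E: "arr ?S (One ?B) ?U ?A" and rE: "?r \<cdot> One ?B = gone ?SX K (fst ?U, s \<cdot> snd ?U)"
    using theI'[OF mk[OF U SX.gone[OF K U']], folded One] mkS[OF U] by simp_all
  have mul: "?r \<cdot> gmul ?S ?B T x y = gmul ?SX K (fst T, s \<cdot> snd T) (?r \<cdot> x) (?r \<cdot> y)"
    if x: "arr ?S x T ?A" "arr ?S y T ?A" for T x y
  proof -
    note t = S.tuple[OF x] note t' = Slice_arrD(1)[OF t Q]
    have g: "gmul ?S ?B T x y = Mul ?B \<cdot> tuple ?S T ?A ?A x y" by (simp add: gmul_def carr)
    have "?r \<cdot> gmul ?S ?B T x y = (?r \<cdot> Mul ?B) \<cdot> tuple ?S T ?A ?A x y"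
      unfolding g using assoc[OF t' Slice_arrD(1)[OF M Q, simplified] pD(2)] by simp
    also have "\<dots> = gmul ?SX K (fst T, s \<cdot> snd T) ((?r \<cdot> pr1 ?S ?A ?A) \<cdot> tuple ?S T ?A ?A x y)
        ((?r \<cdot> pr2 ?S ?A ?A) \<cdot> tuple ?S T ?A ?A x y)"
      unfolding rM using SX.gmul_comp[OF K top[OF P(1)] top[OF P(2)] base[OF t]] by simp
    also have "\<dots> = gmul ?SX K (fst T, s \<cdot> snd T) (?r \<cdot> x) (?r \<cdot> y)"
      using assoc[OF t' Slice_arrD(1)[OF P(1) Q, simplified] pD(2)] assoc[OF t' Slice_arrD(1)[OF P(2) Q, simplified] pD(2)]
        S.pr1_tuple[OF x] S.pr2_tuple[OF x] by simp
    finally show ?thesis .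
  qed
  have mul_arr: "arr ?S (gmul ?S ?B T x y) T ?A" if "arr ?S x T ?A" "arr ?S y T ?A" for T x y
    using S.gmul_arr'[of ?B x T y] M that by (simp add: carr)
  have inv_r: "?r \<cdot> (Inv ?B \<cdot> x) = Inv K \<cdot> (?r \<cdot> x)" if x: "arr ?S x T ?A" for T x
    using assoc[OF Slice_arrD(1)[OF x Q, simplified] Slice_arrD(1)[OF N Q, simplified] pD(2)] rN
      assoc[OF Slice_arrD(1)[OF x Q, simplified] pD(2) Slice_arrD(1)[OF SX.group_Inv[OF K] X]] by simp
  have inv_arr: "arr ?S (Inv ?B \<cdot> x) T ?A" if "arr ?S x T ?A" for T x using S.comp[OF that N] by simp
  have one_arr: "arr ?S (gone ?S ?B T) T ?A" if "T \<in> Obj ?S" for T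
    using S.comp[OF S.bang[OF that] E] by (simp add: gone_def)
  have one_r: "?r \<cdot> gone ?S ?B T = gone ?SX K (fst T, s \<cdot> snd T)" if T: "T \<in> Obj ?S" for T
  proof -
    note b = S.bang[OF T]
    have "?r \<cdot> gone ?S ?B T = (?r \<cdot> One ?B) \<cdot> bang ?S T"
      unfolding gone_def using assoc[OF Slice_arrD(1)[OF b Q] Slice_arrD(1)[OF E Q, simplified] pD(2)] by simp
    then show ?thesis unfolding rE using SX.gone_comp[OF K base[OF b]] by simp
  qed
  show "group_object ?S ?B"
  proof (rule S.group_objectI; unfold carr)
    fix T x assume x: "arr ?S x T ?A"
    note T = arr_dom[OF x] and u = SX.group_unit_laws[OF K top[OF x], simplified]
    note e = one_arr[OF T] and n = inv_arr[OF x]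
    show "gmul ?S ?B T (gone ?S ?B T) x = x"
      by (rule ext[OF mul_arr[OF e x] x]) (simp add: mul[OF e x] one_r[OF T] u)
    show "gmul ?S ?B T x (gone ?S ?B T) = x"
      by (rule ext[OF mul_arr[OF x e] x]) (simp add: mul[OF x e] one_r[OF T] u)
    show "gmul ?S ?B T (Inv ?B \<cdot>\<^bsub>?S\<^esub> x) x = gone ?S ?B T"
      by (rule ext[of _ T]) (simp_all add: mul_arr[OF n x] e mul[OF n x] one_r[OF T] inv_r[OF x] u)
    show "gmul ?S ?B T x (Inv ?B \<cdot>\<^bsub>?S\<^esub> x) = gone ?S ?B T"
      by (rule ext[of _ T]) (simp_all add: mul_arr[OF x n] e mul[OF x n] one_r[OF T] inv_r[OF x] u)
    fix y z assume y: "arr ?S y T ?A" and z: "arr ?S z T ?A"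
    note xy = mul_arr[OF x y] and yz = mul_arr[OF y z]
    show "gmul ?S ?B T (gmul ?S ?B T x y) z = gmul ?S ?B T x (gmul ?S ?B T y z)"
      by (rule ext[OF mul_arr[OF xy z] mul_arr[OF x yz]])
        (simp add: mul[OF xy z] mul[OF x yz] mul[OF x y] mul[OF y z]
          SX.gmul_assoc[OF K top[OF x] top[OF y] top[OF z]])
  qed (use M N E in simp_all)
  show "arr ?S x T (Carr ?B) \<Longrightarrow> arr ?S y T (Carr ?B) \<Longrightarrow>
      ?r \<cdot> gmul ?S ?B T x y = gmul ?SX K (fst T, s \<cdot> snd T) (?r \<cdot> x) (?r \<cdot> y)"
    unfolding carr by (rule mul)
  show "arr ?S x T (Carr ?B) \<Longrightarrow> arr ?SX (?r \<cdot> x) (fst T, s \<cdot> snd T) (Carr K)"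
    unfolding carr by (rule top)
qed

text \<open>A pullback of an equaliser: an element of \<open>s\<^sup>* K\<^sub>X\<close> is a pair \<open>(g, x)\<close> with \<open>g s(x) = s(x)\<close>. All that
  is used about pulled back stabilisers is contained in this description.\<close>

lemma pulled_back_stabiliser:
  fixes K X a s Q
  defines "\<G> \<equiv> pb_group C Q X s (stabiliser C K X a)"
    and "e \<equiv> pr1 C (Carr K) X \<cdot> stab_incl C K X a \<cdot> pb_top C Q s (stabiliser C K X a)"
    and "p \<equiv> pb_base C Q s (stabiliser C K X a)" and "P \<equiv> pb_obj C Q s (stabiliser C K X a)"
  assumes K: "group_object C K" and act: "is_action C K X a" and s: "\<guillemotleft>s : Q \<rightarrow> X\<guillemotright>"
  shows "group_object (Slice C Q) \<G>" and "Carr \<G> = (P, p)" and "fibre_hom C Q \<G> K e"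
    and "monic C P (Prod C (Carr K) Q) (tuple C P (Carr K) Q e p)"
    and "\<guillemotleft>p : P \<rightarrow> Q\<guillemotright>"
    and "\<lbrakk>\<guillemotleft>g : T \<rightarrow> Carr K\<guillemotright>; \<guillemotleft>x : T \<rightarrow> Q\<guillemotright>; gact C K X a T g (s \<cdot> x) = s \<cdot> x\<rbrakk> \<Longrightarrow>
      \<exists>k. \<guillemotleft>k : T \<rightarrow> P\<guillemotright> \<and> e \<cdot> k = g \<and> p \<cdot> k = x"
    and "\<guillemotleft>k : T \<rightarrow> P\<guillemotright> \<Longrightarrow> gact C K X a T (e \<cdot> k) (s \<cdot> (p \<cdot> k)) = s \<cdot> (p \<cdot> k)"
proof -
  let ?St = "stabiliser C K X a" and ?G = "Carr K" let ?r = "pb_top C Q s ?St"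
  let ?i = "stab_incl C K X a" and ?E = "stab_obj C K X a"
  note Q = arr_dom[OF s] and X = arr_cod[OF s] and G = group_carr[OF K]
  note pX = pr1[OF G X] pr2[OF G X]
  note St = stabiliser[OF K act] and i = stab_incl[OF K act]
  note B = pb_group[OF St(1) s, folded \<G>_def p_def P_def]
  show "group_object (Slice C Q) \<G>" "Carr \<G> = (P, p)" by (rule B(3), rule B(2))
  have pb: "is_pullback C Q ?E s (pr2 C ?G X \<cdot> ?i) P p ?r"
    using B(1) unfolding stabiliser_carr[OF K act] by simp
  note v = comp[OF i(1) pX(2)]
  note pD = is_pullbackD[OF pb Q arr_dom[OF v]]
  show p: "\<guillemotleft>p : P \<rightarrow> Q\<guillemotright>" by (rule pD(1))
  note ir = comp[OF pD(2) i(1)]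
  have e: "e = pr1 C ?G X \<cdot> (?i \<cdot> ?r)" unfolding e_def by (rule assoc[OF pD(2) i(1) pX(1)])
  then have ea: "\<guillemotleft>e : P \<rightarrow> ?G\<guillemotright>" using comp[OF ir pX(1)] by simp
  have ek: "e \<cdot> k = pr1 C ?G X \<cdot> (?i \<cdot> (?r \<cdot> k))" "s \<cdot> (p \<cdot> k) = pr2 C ?G X \<cdot> (?i \<cdot> (?r \<cdot> k))"
    if k: "\<guillemotleft>k : T \<rightarrow> P\<guillemotright>" for k T
  proof -
    show "e \<cdot> k = pr1 C ?G X \<cdot> (?i \<cdot> (?r \<cdot> k))"
      unfolding e assoc[OF k ir pX(1)] assoc[OF k pD(2) i(1)] ..
    show "s \<cdot> (p \<cdot> k) = pr2 C ?G X \<cdot> (?i \<cdot> (?r \<cdot> k))"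
      using assoc[OF k p s] assoc[OF k pD(2) v] pD(3) assoc[OF comp[OF k pD(2)] i(1) pX(2)] by simp
  qed
  show "fibre_hom C Q \<G> K e"
    unfolding fibre_hom_def
  proof (intro conjI allI impI)
    show "\<guillemotleft>e : fst (Carr \<G>) \<rightarrow> Carr K\<guillemotright>" using ea B(2) by simp
    interpret S: lex "Slice C Q" by (rule Slice_lex[OF Q])
    fix T x y assume x: "arr (Slice C Q) x T (Carr \<G>)" and y: "arr (Slice C Q) y T (Carr \<G>)"
    note x' = Slice_arrD[OF x Q, unfolded B(2) fst_conv] and y' = Slice_arrD[OF y Q, unfolded B(2) fst_conv]
      and g' = Slice_arrD[OF S.gmul[OF B(3) x y] Q, unfolded B(2) fst_conv]
    have c: "\<guillemotleft>pr1 C ?G X \<cdot> (?i \<cdot> (?r \<cdot> x)) : fst T \<rightarrow> ?G\<guillemotright>" "\<guillemotleft>pr1 C ?G X \<cdot> (?i \<cdot> (?r \<cdot> y)) : fst T \<rightarrow> ?G\<guillemotright>"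
      using comp[OF x'(1) ea] comp[OF y'(1) ea] ek(1)[OF x'(1)] ek(1)[OF y'(1)] by simp_all
    have "pr1 C ?G X \<cdot> (?i \<cdot> (?r \<cdot> gmul (Slice C Q) \<G> T x y)) =
        gmul C K (fst T) (pr1 C ?G X \<cdot> (?i \<cdot> (?r \<cdot> x))) (pr1 C ?G X \<cdot> (?i \<cdot> (?r \<cdot> y)))"
      using B(4)[OF x y] St(2)[OF B(5)[OF x] B(5)[OF y]] pr1_tuple[OF gmul[OF K c] comp[OF x'(2) s]] by simp
    then show "e \<cdot> gmul (Slice C Q) \<G> T x y = gmul C K (fst T) (e \<cdot> x) (e \<cdot> y)"
      unfolding ek(1)[OF x'(1)] ek(1)[OF y'(1)] ek(1)[OF g'(1)] .
  qed
  show "monic C P (Prod C ?G Q) (tuple C P ?G Q e p)"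
    unfolding monic_iff[OF arr_dom[OF p] Prod_obj[OF G Q]]
  proof (intro conjI allI impI)
    show t: "\<guillemotleft>tuple C P ?G Q e p : P \<rightarrow> Prod C ?G Q\<guillemotright>" by (rule tuple[OF ea p])
    fix T x y assume x: "\<guillemotleft>x : T \<rightarrow> P\<guillemotright>" and y: "\<guillemotleft>y : T \<rightarrow> P\<guillemotright>"
      and xy: "tuple C P ?G Q e p \<cdot> x = tuple C P ?G Q e p \<cdot> y"
    have "tuple C T ?G Q (e \<cdot> x) (p \<cdot> x) = tuple C T ?G Q (e \<cdot> y) (p \<cdot> y)"
      using xy tuple_comp[OF x ea p] tuple_comp[OF y ea p] by simp
    then have q: "e \<cdot> x = e \<cdot> y" "p \<cdot> x = p \<cdot> y"
      using pr1_tuple[OF comp[OF x ea] comp[OF x p]] pr1_tuple[OF comp[OF y ea] comp[OF y p]]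
        pr2_tuple[OF comp[OF x ea] comp[OF x p]] pr2_tuple[OF comp[OF y ea] comp[OF y p]] by metis+
    note rx = comp[OF x pD(2)] and ry = comp[OF y pD(2)]
    have "?i \<cdot> (?r \<cdot> x) = ?i \<cdot> (?r \<cdot> y)"
      by (rule prod_ext[OF G X comp[OF rx i(1)] comp[OF ry i(1)]])
        (use q ek[OF x] ek[OF y] in simp_all)
    then have "?r \<cdot> x = ?r \<cdot> y" by (rule monicD[OF i(3) rx ry])
    then show "x = y" using pullback_ext[OF pb s v x y] q by blast
  qed
  show "\<exists>k. \<guillemotleft>k : T \<rightarrow> P\<guillemotright> \<and> e \<cdot> k = g \<and> p \<cdot> k = x"
    if g: "\<guillemotleft>g : T \<rightarrow> ?G\<guillemotright>" and x: "\<guillemotleft>x : T \<rightarrow> Q\<guillemotright>" and fx: "gact C K X a T g (s \<cdot> x) = s \<cdot> x"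
  proof -
    note sx = comp[OF x s]
    obtain k where k: "\<guillemotleft>k : T \<rightarrow> ?E\<guillemotright>" "?i \<cdot> k = tuple C T ?G X g (s \<cdot> x)" using i(4)[OF g sx fx] by blast
    have "(pr2 C ?G X \<cdot> ?i) \<cdot> k = s \<cdot> x" unfolding assoc[OF k(1) i(1) pX(2)] k(2) pr2_tuple[OF g sx] ..
    then obtain h where h: "\<guillemotleft>h : T \<rightarrow> P\<guillemotright>" "p \<cdot> h = x" "?r \<cdot> h = k" using pD(4)[OF x k(1)] by auto
    have "e \<cdot> h = g" unfolding ek(1)[OF h(1)] h(3) k(2) pr1_tuple[OF g sx] ..
    then show ?thesis using h by blast
  qed
  show "gact C K X a T (e \<cdot> k) (s \<cdot> (p \<cdot> k)) = s \<cdot> (p \<cdot> k)" if k: "\<guillemotleft>k : T \<rightarrow> P\<guillemotright>"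
    unfolding ek[OF k] using stab_elem(3)[OF K act comp[OF k pD(2)]] .
qed

end

section \<open>The stabiliser of the standard section\<close>

context lex
begin

lemma Grp_hom_cancel_monic:
  assumes A: "group_object C A" and B: "group_object C B" and D: "group_object C D"
    and j: "j \<in> Hom (Grp C) B D" "monic C (Carr B) (Carr D) j"
    and \<phi>: "\<guillemotleft>\<phi> : Carr A \<rightarrow> Carr B\<guillemotright>" and j\<phi>: "j \<cdot> \<phi> \<in> Hom (Grp C) A D"
  shows "\<phi> \<in> Hom (Grp C) A B"
  unfolding Grp_hom_iff[OF A B]
proof (intro conjI allI impI)
  note j' = Grp_hom_arr[OF B D j(1)]
  fix T x y assume x: "\<guillemotleft>x : T \<rightarrow> Carr A\<guillemotright>" and y: "\<guillemotleft>y : T \<rightarrow> Carr A\<guillemotright>"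
  note g = gmul[OF A x y] and px = comp[OF x \<phi>] and py = comp[OF y \<phi>]
  show "\<phi> \<cdot> gmul C A T x y = gmul C B T (\<phi> \<cdot> x) (\<phi> \<cdot> y)"
  proof (rule monicD[OF j(2) comp[OF g \<phi>] gmul[OF B px py]])
    show "j \<cdot> (\<phi> \<cdot> gmul C A T x y) = j \<cdot> gmul C B T (\<phi> \<cdot> x) (\<phi> \<cdot> y)"
      unfolding assoc[OF g \<phi> j', symmetric] Grp_hom_gmul[OF A D j\<phi> x y] Grp_hom_gmul[OF B D j(1) px py]
        assoc[OF x \<phi> j'] assoc[OF y \<phi> j'] ..
  qed
qed (rule \<phi>)

end

text \<open>The situation of the standard graph: \<open>B = K \<times> Q\<close>, the arrows \<open>f\<close> and \<open>g\<close> from \<open>K \<times> \<G>\<close> to \<open>B\<close> are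
  \<open>(h, \<gamma>) \<mapsto> (h, u \<gamma>)\<close> and \<open>(h, \<gamma>) \<mapsto> (h \<eta>(\<gamma>), u \<gamma>)\<close>, and \<open>p\<close> is their coequaliser. Left translation
  \<open>\<mu>\<close> on \<open>B\<close> induces the action \<open>a\<close> on \<open>T\<close>, and \<open>t\<close> is the section \<open>x \<mapsto> p(1, x)\<close>.\<close>

locale standard_quotient = lex +
  fixes K Q \<G> \<eta> T p G A u B e PA f g \<mu> a t
  assumes ppc: "product_preserves_coequalisers C"
    and K: "group_object C K" and Q: "Q \<in> Obj C" and \<G>: "group_object (Slice C Q) \<G>"
    and \<eta>: "\<eta> \<in> Hom (Grp (Slice C Q)) \<G> (Delta C Q K)"
    and G_def: "G = Carr K" and A_def: "A = fst (Carr \<G>)" and u_def: "u = snd (Carr \<G>)"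
    and B_def: "B = Prod C G Q" and e_def: "e = pr1 C G Q \<cdot> \<eta>" and PA_def: "PA = Prod C G A"
    and f_def: "f = prod_map C G G A Q (Ident C G) u"
    and g_def: "g = tuple C PA G Q (gmul C K PA (pr1 C G A) (pr1 C G Q \<cdot> \<eta> \<cdot> pr2 C G A)) (pr2 C G Q \<cdot> \<eta> \<cdot> pr2 C G A)"
    and \<mu>_def: "\<mu> = tuple C (Prod C G B) G Q (gmul C K (Prod C G B) (pr1 C G B) (pr1 C G Q \<cdot> pr2 C G B)) (pr2 C G Q \<cdot> pr2 C G B)"
    and t_def: "t = p \<cdot> tuple C Q G Q (gone C K Q) (Ident C Q)"
    and a_def: "a = (THE a. a \<in> Hom C (Prod C G T) T \<and> a \<cdot> prod_map C G G B T (Ident C G) p = p \<cdot> \<mu>)"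
    and coeq: "is_coequaliser C PA B f g T p"
begin

lemma G: "G \<in> Obj C" and u: "\<guillemotleft>u : A \<rightarrow> Q\<guillemotright>" and e: "fibre_hom C Q \<G> K e" and e_arr: "\<guillemotleft>e : A \<rightarrow> G\<guillemotright>"
  and eta: "\<guillemotleft>\<eta> : A \<rightarrow> B\<guillemotright>" "pr2 C G Q \<cdot> \<eta> = u" and eta_tuple: "\<eta> = tuple C A G Q e u"
proof -
  show G: "G \<in> Obj C" unfolding G_def by (rule group_carr[OF K])
  show "\<guillemotleft>u : A \<rightarrow> Q\<guillemotright>" unfolding u_def A_def by (rule group_over_arr[OF Q \<G>])
  have h: "fibre_hom C Q \<G> K e \<and> \<guillemotleft>\<eta> : A \<rightarrow> B\<guillemotright> \<and> pr2 C G Q \<cdot> \<eta> = u"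
    using \<eta> unfolding Delta_hom_iff[OF Q \<G> K] e_def A_def u_def B_def G_def .
  then show "fibre_hom C Q \<G> K e" "\<guillemotleft>\<eta> : A \<rightarrow> B\<guillemotright>" "pr2 C G Q \<cdot> \<eta> = u" by auto
  then show "\<guillemotleft>e : A \<rightarrow> G\<guillemotright>" using h fibre_homD(1)[of C Q \<G> K e] by (simp add: A_def G_def)
  show "\<eta> = tuple C A G Q e u"
    using tuple_eqI[OF _ G Q e_def[symmetric]] h unfolding B_def by metis
qed

lemma AO: "A \<in> Obj C" and BO: "B \<in> Obj C" and PA: "PA \<in> Obj C"
  using arr_dom[OF u] Prod_obj[OF G Q] Prod_obj[OF G arr_dom[OF u]] unfolding B_def PA_def .

lemma f: "\<guillemotleft>f : PA \<rightarrow> B\<guillemotright>" unfolding f_def PA_def B_def by (rule prod_map[OF ident[OF G] u])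

lemma pA: "\<guillemotleft>pr1 C G A : PA \<rightarrow> G\<guillemotright>" "\<guillemotleft>pr2 C G A : PA \<rightarrow> A\<guillemotright>"
  unfolding PA_def by (rule pr1[OF G AO], rule pr2[OF G AO])

lemma pB: "\<guillemotleft>pr1 C G Q : B \<rightarrow> G\<guillemotright>" "\<guillemotleft>pr2 C G Q : B \<rightarrow> Q\<guillemotright>"
  unfolding B_def by (rule pr1[OF G Q], rule pr2[OF G Q])

lemma g_alt: "g = tuple C PA G Q (gmul C K PA (pr1 C G A) (e \<cdot> pr2 C G A)) (u \<cdot> pr2 C G A)"
  unfolding g_def e_def eta(2) ..

lemma mG: "\<lbrakk>\<guillemotleft>x : T' \<rightarrow> G\<guillemotright>; \<guillemotleft>y : T' \<rightarrow> G\<guillemotright>\<rbrakk> \<Longrightarrow> \<guillemotleft>gmul C K T' x y : T' \<rightarrow> G\<guillemotright>"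
  using gmul[OF K] unfolding G_def .

lemma oneG: "T' \<in> Obj C \<Longrightarrow> \<guillemotleft>gone C K T' : T' \<rightarrow> G\<guillemotright>" using gone[OF K] unfolding G_def .

lemma tB: "\<lbrakk>\<guillemotleft>h : T' \<rightarrow> G\<guillemotright>; \<guillemotleft>x : T' \<rightarrow> Q\<guillemotright>\<rbrakk> \<Longrightarrow> \<guillemotleft>tuple C T' G Q h x : T' \<rightarrow> B\<guillemotright>"
  using tuple unfolding B_def .

lemma g: "\<guillemotleft>g : PA \<rightarrow> B\<guillemotright>"
  unfolding g_alt by (rule tB[OF mG[OF pA(1) comp[OF pA(2) e_arr]] comp[OF pA(2) u]])

lemma f_elem: "f \<cdot> k = tuple C T' G Q (pr1 C G A \<cdot> k) (u \<cdot> (pr2 C G A \<cdot> k))"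
  and g_elem: "g \<cdot> k = tuple C T' G Q (gmul C K T' (pr1 C G A \<cdot> k) (e \<cdot> (pr2 C G A \<cdot> k))) (u \<cdot> (pr2 C G A \<cdot> k))"
  if k: "\<guillemotleft>k : T' \<rightarrow> PA\<guillemotright>"
proof -
  note k1 = comp[OF k pA(1)] and k2 = comp[OF k pA(2)]
  have kt: "k = tuple C T' G A (pr1 C G A \<cdot> k) (pr2 C G A \<cdot> k)"
    using tuple_prs[OF _ G AO] k unfolding PA_def by metis
  show "f \<cdot> k = tuple C T' G Q (pr1 C G A \<cdot> k) (u \<cdot> (pr2 C G A \<cdot> k))"
    unfolding f_def using prod_map_elem[OF ident[OF G] u k1 k2] kt idl[OF k1] by simp
  show "g \<cdot> k = tuple C T' G Q (gmul C K T' (pr1 C G A \<cdot> k) (e \<cdot> (pr2 C G A \<cdot> k))) (u \<cdot> (pr2 C G A \<cdot> k))"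
    unfolding g_alt tuple_comp[OF k mG[OF pA(1) comp[OF pA(2) e_arr]] comp[OF pA(2) u]]
      gmul_comp[OF K pA(1)[unfolded G_def] comp[OF pA(2) e_arr, unfolded G_def] k, folded G_def]
      assoc[OF k pA(2) e_arr] assoc[OF k pA(2) u] ..
qed

lemma p: "\<guillemotleft>p : B \<rightarrow> T\<guillemotright>" "p \<cdot> f = p \<cdot> g"
  by (rule is_coequaliserD[OF coeq BO])+

text \<open>This is \<open>p \<cdot> f = p \<cdot> g\<close>, evaluated at the element \<open>(h, \<gamma>)\<close>.\<close>

lemma p_orbit:
  assumes h: "\<guillemotleft>h : T' \<rightarrow> G\<guillemotright>" and \<gamma>: "\<guillemotleft>\<gamma> : T' \<rightarrow> A\<guillemotright>"
  shows "p \<cdot> tuple C T' G Q (gmul C K T' h (e \<cdot> \<gamma>)) (u \<cdot> \<gamma>) = p \<cdot> tuple C T' G Q h (u \<cdot> \<gamma>)"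
proof -
  have k: "\<guillemotleft>tuple C T' G A h \<gamma> : T' \<rightarrow> PA\<guillemotright>" unfolding PA_def by (rule tuple[OF h \<gamma>])
  have "p \<cdot> (f \<cdot> tuple C T' G A h \<gamma>) = p \<cdot> (g \<cdot> tuple C T' G A h \<gamma>)"
    using assoc[OF k f p(1)] assoc[OF k g p(1)] p(2) by simp
  then show ?thesis unfolding f_elem[OF k] g_elem[OF k] pr1_tuple[OF h \<gamma>] pr2_tuple[OF h \<gamma>] by simp
qed

lemma mu: "\<guillemotleft>\<mu> : Prod C G B \<rightarrow> B\<guillemotright>"
  and mu_elem: "\<lbrakk>\<guillemotleft>a' : T' \<rightarrow> G\<guillemotright>; \<guillemotleft>h : T' \<rightarrow> G\<guillemotright>; \<guillemotleft>x : T' \<rightarrow> Q\<guillemotright>\<rbrakk> \<Longrightarrow>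
    \<mu> \<cdot> tuple C T' G B a' (tuple C T' G Q h x) = tuple C T' G Q (gmul C K T' a' h) x"
proof -
  note q = pr1[OF G BO] pr2[OF G BO] note q1 = comp[OF q(2) pB(1)] and q2 = comp[OF q(2) pB(2)]
  show "\<guillemotleft>\<mu> : Prod C G B \<rightarrow> B\<guillemotright>" unfolding \<mu>_def by (rule tB[OF mG[OF q(1) q1] q2])
  show "\<mu> \<cdot> tuple C T' G B a' (tuple C T' G Q h x) = tuple C T' G Q (gmul C K T' a' h) x"
    if a': "\<guillemotleft>a' : T' \<rightarrow> G\<guillemotright>" and h: "\<guillemotleft>h : T' \<rightarrow> G\<guillemotright>" and x: "\<guillemotleft>x : T' \<rightarrow> Q\<guillemotright>"
  proof -
    note hx = tB[OF h x] note k = tuple[OF a' hx]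
    show ?thesis
      unfolding \<mu>_def tuple_comp[OF k mG[OF q(1) q1] q2]
        gmul_comp[OF K q(1)[unfolded G_def] q1[unfolded G_def] k[unfolded G_def], folded G_def]
        assoc[OF k q(2) pB(1)] assoc[OF k q(2) pB(2)] pr1_tuple[OF a' hx] pr2_tuple[OF a' hx]
        pr1_tuple[OF h x] pr2_tuple[OF h x] ..
  qed
qed

lemma product_coequaliser:
  assumes D: "D \<in> Obj C"
  shows "is_coequaliser C (Prod C D PA) (Prod C D B) (prod_map C D D PA B (Ident C D) f)
    (prod_map C D D PA B (Ident C D) g) (Prod C D T) (prod_map C D D B T (Ident C D) p)"
  using ppc D PA BO f g coeq unfolding product_preserves_coequalisers_def arr_def by blast

text \<open>Left and right translations commute, so \<open>p \<cdot> \<mu>\<close> is compatible with \<open>K \<times> f\<close> and \<open>K \<times> g\<close>; as \<open>K \<times> p\<close> is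
  again a coequaliser, \<open>p \<cdot> \<mu>\<close> factors through it.\<close>

lemma action: "\<guillemotleft>a : Prod C G T \<rightarrow> T\<guillemotright>"
  and action_elem: "\<lbrakk>\<guillemotleft>a' : T' \<rightarrow> G\<guillemotright>; \<guillemotleft>h : T' \<rightarrow> G\<guillemotright>; \<guillemotleft>x : T' \<rightarrow> Q\<guillemotright>\<rbrakk> \<Longrightarrow>
    gact C K T a T' a' (p \<cdot> tuple C T' G Q h x) = p \<cdot> tuple C T' G Q (gmul C K T' a' h) x"
proof -
  let ?V = "Prod C G PA" note v = pr1[OF G PA] pr2[OF G PA]
  note w1 = comp[OF v(2) pA(1)] and w2 = comp[OF v(2) pA(2)]
  let ?a = "pr1 C G PA" and ?h = "pr1 C G A \<cdot> pr2 C G PA" and ?\<gamma> = "pr2 C G A \<cdot> pr2 C G PA"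
  let ?F = "prod_map C G G PA B (Ident C G) f" and ?H = "prod_map C G G PA B (Ident C G) g"
  let ?P = "prod_map C G G B T (Ident C G) p"
  note F = prod_map[OF ident[OF G] f] and H = prod_map[OF ident[OF G] g] and P = prod_map[OF ident[OF G] p(1)]
  have "p \<cdot> (\<mu> \<cdot> ?F) = p \<cdot> tuple C ?V G Q (gmul C K ?V ?a ?h) (u \<cdot> ?\<gamma>)"
    unfolding prod_map_def idl[OF v(1)] f_elem[OF v(2)] mu_elem[OF v(1) w1 comp[OF w2 u]] ..
  also have "\<dots> = p \<cdot> tuple C ?V G Q (gmul C K ?V (gmul C K ?V ?a ?h) (e \<cdot> ?\<gamma>)) (u \<cdot> ?\<gamma>)"
    using p_orbit[OF mG[OF v(1) w1] w2] by simp
  also have "\<dots> = p \<cdot> (\<mu> \<cdot> ?H)"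
    unfolding prod_map_def idl[OF v(1)] g_elem[OF v(2)] mu_elem[OF v(1) mG[OF w1 comp[OF w2 e_arr]] comp[OF w2 u]]
      gmul_assoc[OF K v(1)[unfolded G_def] w1[unfolded G_def] comp[OF w2 e_arr, unfolded G_def], folded G_def] ..
  finally have FH: "(p \<cdot> \<mu>) \<cdot> ?F = (p \<cdot> \<mu>) \<cdot> ?H" using assoc[OF F mu p(1)] assoc[OF H mu p(1)] by simp
  note pc = product_coequaliser[OF G] note pm = comp[OF mu p(1)]
  obtain b where b: "\<guillemotleft>b : Prod C G T \<rightarrow> T\<guillemotright>" "b \<cdot> ?P = p \<cdot> \<mu>"
    using is_coequaliserD(3)[OF pc Prod_obj[OF G BO] pm FH] by blast
  have "\<exists>!a. a \<in> Hom C (Prod C G T) T \<and> a \<cdot> ?P = p \<cdot> \<mu>"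
  proof (rule ex1I[of _ b])
    fix c assume "c \<in> Hom C (Prod C G T) T \<and> c \<cdot> ?P = p \<cdot> \<mu>"
    then show "c = b" using coequaliser_ext[OF pc F H _ b(1)] b by (auto simp: arr_def)
  qed (use b arr_hom[OF b(1)] in simp)
  from theI'[OF this] have a: "\<guillemotleft>a : Prod C G T \<rightarrow> T\<guillemotright>" "a \<cdot> ?P = p \<cdot> \<mu>"
    unfolding a_def using b(1) by (auto simp: arr_def)
  show "\<guillemotleft>a : Prod C G T \<rightarrow> T\<guillemotright>" by (rule a(1))
  show "gact C K T a T' a' (p \<cdot> tuple C T' G Q h x) = p \<cdot> tuple C T' G Q (gmul C K T' a' h) x"
    if a': "\<guillemotleft>a' : T' \<rightarrow> G\<guillemotright>" and h: "\<guillemotleft>h : T' \<rightarrow> G\<guillemotright>" and x: "\<guillemotleft>x : T' \<rightarrow> Q\<guillemotright>"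
  proof -
    note hx = tB[OF h x] note k = tuple[OF a' hx]
    have "tuple C T' G T a' (p \<cdot> tuple C T' G Q h x) = ?P \<cdot> tuple C T' G B a' (tuple C T' G Q h x)"
      unfolding prod_map_elem[OF ident[OF G] p(1) a' hx] idl[OF a'] ..
    then show ?thesis
      unfolding gact_def G_def[symmetric]
      using assoc[OF k P a(1)] a(2) assoc[OF k mu p(1)] mu_elem[OF a' h x] by simp
  qed
qed

lemma action_on_B:
  assumes a': "\<guillemotleft>a' : T' \<rightarrow> G\<guillemotright>" and z: "\<guillemotleft>z : T' \<rightarrow> B\<guillemotright>"
  shows "gact C K T a T' a' (p \<cdot> z) = p \<cdot> tuple C T' G Q (gmul C K T' a' (pr1 C G Q \<cdot> z)) (pr2 C G Q \<cdot> z)"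
  using action_elem[OF a' comp[OF z pB(1)] comp[OF z pB(2)]] tuple_prs[OF z[unfolded B_def] G Q] by simp

text \<open>The axioms of an action hold for left translation on \<open>B\<close>. They descend to \<open>T\<close> because \<open>p\<close> and
  \<open>(G \<times> G) \<times> p\<close> are coequalisers, hence epic.\<close>

lemma is_action_standard: "is_action C K T a"
proof -
  let ?GG = "Prod C G G" note GG = Prod_obj[OF G G] note T = arr_cod[OF p(1)]
  let ?U = "Prod C ?GG T" and ?UB = "Prod C ?GG B"
  note q = pr1[OF G G] pr2[OF G G] and qT = pr1[OF GG T] pr2[OF GG T] and qB = pr1[OF GG BO] pr2[OF GG BO]
  note P = prod_map[OF ident[OF GG] p(1)]
  let ?P = "prod_map C ?GG ?GG B T (Ident C ?GG) p"
  let ?x = "pr1 C G G \<cdot> pr1 C ?GG T" and ?y = "pr2 C G G \<cdot> pr1 C ?GG T" and ?z = "pr2 C ?GG T"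
  let ?x' = "pr1 C G G \<cdot> pr1 C ?GG B" and ?y' = "pr2 C G G \<cdot> pr1 C ?GG B" and ?z' = "pr2 C ?GG B"
  note x = comp[OF qT(1) q(1)] and y = comp[OF qT(1) q(2)] and x' = comp[OF qB(1) q(1)] and y' = comp[OF qB(1) q(2)]
  note pz = comp[OF qB(2) p(1)] note z1 = comp[OF qB(2) pB(1)] and z2 = comp[OF qB(2) pB(2)]
  have P_eq: "?P = tuple C ?UB ?GG T (pr1 C ?GG B) (p \<cdot> pr2 C ?GG B)" unfolding prod_map_def idl[OF qB(1)] ..
  have c: "?x \<cdot> ?P = ?x'" "?y \<cdot> ?P = ?y'" "?z \<cdot> ?P = p \<cdot> ?z'"
    unfolding assoc[OF P qT(1) q(1)] assoc[OF P qT(1) q(2)] unfolding P_eq pr1_tuple[OF qB(1) pz] pr2_tuple[OF qB(1) pz] by auto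
  note act = action[unfolded G_def]
  note K' = x[unfolded G_def] y[unfolded G_def] x'[unfolded G_def] y'[unfolded G_def] P[unfolded G_def] qT(2)[unfolded G_def]
  have xy: "\<guillemotleft>gmul C K ?U ?x ?y : ?U \<rightarrow> G\<guillemotright>" by (rule mG[OF x y])
  have ga: "\<guillemotleft>gact C K T a W b c : W \<rightarrow> T\<guillemotright>" if "\<guillemotleft>b : W \<rightarrow> G\<guillemotright>" "\<guillemotleft>c : W \<rightarrow> T\<guillemotright>" for W b c
    using gact[OF act] that unfolding G_def by blast
  have gc: "gact C K T a W b c \<cdot> k = gact C K T a W' (b \<cdot> k) (c \<cdot> k)" if "\<guillemotleft>b : W \<rightarrow> G\<guillemotright>" "\<guillemotleft>c : W \<rightarrow> T\<guillemotright>" "\<guillemotleft>k : W' \<rightarrow> W\<guillemotright>" for W W' b c k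
    using gact_comp[OF act] that unfolding G_def by blast
  have gmc: "gmul C K ?U ?x ?y \<cdot> ?P = gmul C K ?UB ?x' ?y'"
    using gmul_comp[OF K K'(1,2,5), folded G_def] c by simp
  have "gact C K T a ?U (gmul C K ?U ?x ?y) ?z = gact C K T a ?U ?x (gact C K T a ?U ?y ?z)"
  proof (rule coequaliser_ext[OF product_coequaliser[OF GG] prod_map[OF ident[OF GG] f] prod_map[OF ident[OF GG] g]
        ga[OF xy qT(2)] ga[OF x ga[OF y qT(2)]]])
    have "gact C K T a ?U (gmul C K ?U ?x ?y) ?z \<cdot> ?P = gact C K T a ?UB (gmul C K ?UB ?x' ?y') (p \<cdot> ?z')"
      unfolding gc[OF xy qT(2) P] gmc c ..
    also have "\<dots> = p \<cdot> tuple C ?UB G Q (gmul C K ?UB ?x' (gmul C K ?UB ?y' (pr1 C G Q \<cdot> ?z'))) (pr2 C G Q \<cdot> ?z')"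
      unfolding action_on_B[OF mG[OF x' y'] qB(2)]
        gmul_assoc[OF K x'[unfolded G_def] y'[unfolded G_def] z1[unfolded G_def], folded G_def] ..
    also have "\<dots> = gact C K T a ?UB ?x' (gact C K T a ?UB ?y' (p \<cdot> ?z'))"
      unfolding action_on_B[OF y' qB(2)] action_elem[OF x' mG[OF y' z1] z2] ..
    also have "\<dots> = gact C K T a ?U ?x (gact C K T a ?U ?y ?z) \<cdot> ?P"
      unfolding gc[OF x ga[OF y qT(2)] P] gc[OF y qT(2) P] c ..
    finally show "gact C K T a ?U (gmul C K ?U ?x ?y) ?z \<cdot> ?P = gact C K T a ?U ?x (gact C K T a ?U ?y ?z) \<cdot> ?P" .
  qed
  moreover have "gact C K T a T (gone C K T) (Ident C T) = Ident C T"
  proof (rule coequaliser_ext[OF coeq f g ga[OF oneG[OF T] ident[OF T]] ident[OF T]])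
    have "gact C K T a T (gone C K T) (Ident C T) \<cdot> p = gact C K T a B (gone C K B) (p \<cdot> Ident C B)"
      unfolding gc[OF oneG[OF T] ident[OF T] p(1)] gone_comp[OF K p(1)] idl[OF p(1)] idr[OF p(1)] ..
    also have "\<dots> = p \<cdot> tuple C B G Q (pr1 C G Q) (pr2 C G Q)"
      unfolding action_on_B[OF oneG[OF BO] ident[OF BO]] idr[OF pB(1)] idr[OF pB(2)]
        group_unit_laws(1)[OF K pB(1)[unfolded G_def], folded G_def] ..
    also have "\<dots> = Ident C T \<cdot> p"
      using tuple_prs[OF ident[OF BO, folded B_def, unfolded B_def] G Q] idr[OF pB(1)] idr[OF pB(2)] idr[OF p(1)] idl[OF p(1)]
      unfolding B_def by simp
    finally show "gact C K T a T (gone C K T) (Ident C T) \<cdot> p = Ident C T \<cdot> p" .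
  qed
  ultimately show ?thesis
    unfolding is_action_def Let_def G_def[symmetric] using T action by (simp add: arr_def)
qed

lemma section_arr: "\<guillemotleft>t : Q \<rightarrow> T\<guillemotright>"
  unfolding t_def by (rule comp[OF tB[OF oneG[OF Q] ident[OF Q]] p(1)])

lemma section_elem: "\<guillemotleft>x : T' \<rightarrow> Q\<guillemotright> \<Longrightarrow> t \<cdot> x = p \<cdot> tuple C T' G Q (gone C K T') x"
  unfolding t_def using assoc[OF _ tB[OF oneG[OF Q] ident[OF Q]] p(1)] tuple_comp[OF _ oneG[OF Q] ident[OF Q]]
    gone_comp[OF K] idl by simp

text \<open>An element \<open>(g, x)\<close> of \<open>K \<times> Q\<close> satisfies \<open>g t(x) = t(x)\<close> iff \<open>p\<close> identifies it with \<open>(1, x)\<close>. As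
  \<open>f\<close>, \<open>g\<close> is the kernel pair of \<open>p\<close>, this happens iff \<open>(g, x)\<close> comes from \<open>\<G>\<close>.\<close>

lemma stabiliser_of_section:
  fixes \<S> j
  defines "\<S> \<equiv> pb_group C Q T t (stabiliser C K T a)"
    and "j \<equiv> tuple C (pb_obj C Q t (stabiliser C K T a)) G Q
      (pr1 C G T \<cdot> stab_incl C K T a \<cdot> pb_top C Q t (stabiliser C K T a)) (pb_base C Q t (stabiliser C K T a))"
  assumes mono: "monic C A B \<eta>" and ker: "is_pullback C B B p p PA f g"
  shows "\<exists>!\<phi>. is_iso (Grp (Slice C Q)) \<G> \<S> \<phi> \<and> j \<cdot> \<phi> = \<eta>"
proof -
  let ?S = "Slice C Q" and ?D = "Delta C Q K"
  interpret S: lex ?S by (rule Slice_lex[OF Q])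
  let ?St = "stabiliser C K T a"
  define P where "P = pb_obj C Q t ?St" define v where "v = pb_base C Q t ?St"
  define d where "d = pr1 C G T \<cdot> stab_incl C K T a \<cdot> pb_top C Q t ?St"
  note ps = pulled_back_stabiliser[OF K is_action_standard section_arr, folded G_def \<S>_def, folded P_def v_def d_def]
  have j: "j = tuple C P G Q d v" unfolding j_def P_def v_def d_def ..
  have d: "\<guillemotleft>d : P \<rightarrow> G\<guillemotright>" using fibre_homD(1)[OF ps(3)] ps(2) by (simp add: G_def)
  have jB: "\<guillemotleft>j : P \<rightarrow> B\<guillemotright>" unfolding j by (rule tB[OF d ps(5)])
  have jm: "monic C P B j" using ps(4) unfolding j B_def .
  have carr: "fst (Carr \<S>) = P" "snd (Carr \<S>) = v" using ps(2) by auto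
  have jH: "j \<in> Hom (Grp ?S) \<S> ?D"
    using fibre_hom_tuple[OF Q ps(1) K ps(3)] unfolding carr j G_def .
  note DG = Delta_group[OF K Q] and \<eta>S = S.Grp_hom_arr[OF \<G> Delta_group[OF K Q] \<eta>]
  note jS = S.Grp_hom_arr[OF ps(1) Delta_group[OF K Q] jH]
  have \<eta>m: "monic ?S (Carr \<G>) (Carr ?D) \<eta>"
    by (rule Slice_monic[OF _ \<eta>S Q]) (use mono in \<open>simp add: Delta_carr A_def B_def G_def\<close>)
  have jmS: "monic ?S (Carr \<S>) (Carr ?D) j"
    by (rule Slice_monic[OF _ jS Q]) (use jm in \<open>simp add: Delta_carr carr B_def G_def\<close>)
  have over: "arr ?S k (Carr X) (Carr Y)"
    if "arr ?S i (Carr X) (Carr ?D)" "arr ?S i' (Carr Y) (Carr ?D)" "\<guillemotleft>k : fst (Carr X) \<rightarrow> fst (Carr Y)\<guillemotright>" "i' \<cdot> k = i"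
    for i i' k and X Y :: "('a \<times> 'b, 'b) grp"
  proof -
    note i = Slice_arrD[OF that(1) Q] and i' = Slice_arrD[OF that(2) Q]
    have "snd (Carr Y) \<cdot> k = snd (Carr X)"
      using assoc[OF that(3) i'(1,3)] i(4) i'(4) that(4) by simp
    then show ?thesis using that(3) i i' by (simp add: Slice_arr[OF Q])
  qed
  \<comment> \<open>The unit factors through the stabiliser.\<close>
  note oA = oneG[OF AO]
  have "gact C K T a A e (t \<cdot> u) = p \<cdot> tuple C A G Q (gmul C K A (gone C K A) (e \<cdot> Ident C A)) (u \<cdot> Ident C A)"
    unfolding section_elem[OF u] action_elem[OF e_arr oA u] idr[OF e_arr] idr[OF u]
    using group_unit_laws[OF K e_arr[unfolded G_def]] by simp
  also have "\<dots> = t \<cdot> u" using p_orbit[OF oA ident[OF AO]] section_elem[OF u] idr[OF u] by simp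
  finally obtain \<phi> where \<phi>: "\<guillemotleft>\<phi> : A \<rightarrow> P\<guillemotright>" "d \<cdot> \<phi> = e" "v \<cdot> \<phi> = u" using ps(6)[OF e_arr u] by blast
  have j\<phi>: "j \<cdot> \<phi> = \<eta>" unfolding j tuple_comp[OF \<phi>(1) d ps(5)] \<phi>(2,3) eta_tuple ..
  \<comment> \<open>The inclusion of the stabiliser factors through the unit.\<close>
  note oP = oneG[OF arr_dom[OF d]]
  have "gact C K T a P d (t \<cdot> v) = t \<cdot> v"
    using ps(7)[OF ident[OF arr_dom[OF d]]] idr[OF d] idr[OF ps(5)] by simp
  then have "p \<cdot> tuple C P G Q (gone C K P) v = p \<cdot> tuple C P G Q d v"
    unfolding section_elem[OF ps(5)] action_elem[OF d oP ps(5)] group_unit_laws(2)[OF K d[unfolded G_def], folded G_def] by simp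
  then obtain k where k: "\<guillemotleft>k : P \<rightarrow> PA\<guillemotright>" "f \<cdot> k = tuple C P G Q (gone C K P) v" "g \<cdot> k = tuple C P G Q d v"
    using is_pullbackD(4)[OF ker BO BO tB[OF oP ps(5)] tB[OF d ps(5)]] by auto
  define \<psi> where "\<psi> = pr2 C G A \<cdot> k"
  have \<psi>: "\<guillemotleft>\<psi> : P \<rightarrow> A\<guillemotright>" unfolding \<psi>_def by (rule comp[OF k(1) pA(2)])
  note k1 = comp[OF k(1) pA(1)] note e\<psi> = comp[OF \<psi> e_arr] and u\<psi> = comp[OF \<psi> u]
  have "pr1 C G A \<cdot> k = gone C K P" "u \<cdot> \<psi> = v"
    using k(2) unfolding f_elem[OF k(1)] \<psi>_def[symmetric]
    using pr1_tuple[OF k1 u\<psi>] pr2_tuple[OF k1 u\<psi>] pr1_tuple[OF oP ps(5)] pr2_tuple[OF oP ps(5)] by metis+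
  moreover have "gmul C K P (pr1 C G A \<cdot> k) (e \<cdot> \<psi>) = d"
    using k(3) unfolding g_elem[OF k(1)] \<psi>_def[symmetric]
    using pr1_tuple[OF mG[OF k1 e\<psi>] u\<psi>] pr1_tuple[OF d ps(5)] by metis
  ultimately have "e \<cdot> \<psi> = d" "u \<cdot> \<psi> = v"
    using group_unit_laws(1)[OF K e\<psi>[unfolded G_def]] by simp_all
  then have \<eta>\<psi>: "\<eta> \<cdot> \<psi> = j" unfolding j eta_tuple tuple_comp[OF \<psi> e_arr u] by simp
  have \<phi>\<psi>: "\<phi> \<cdot> \<psi> = Ident C P"
    by (rule monicD[OF jm comp[OF \<psi> \<phi>(1)] ident[OF arr_dom[OF d]]])
      (use assoc[OF \<psi> \<phi>(1) jB] j\<phi> \<eta>\<psi> idr[OF jB] in simp)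
  have \<psi>\<phi>: "\<psi> \<cdot> \<phi> = Ident C A"
    by (rule monicD[OF mono comp[OF \<phi>(1) \<psi>] ident[OF AO]])
      (use assoc[OF \<phi>(1) \<psi> eta(1)] j\<phi> \<eta>\<psi> idr[OF eta(1)] in simp)
  have \<phi>S: "arr ?S \<phi> (Carr \<G>) (Carr \<S>)" by (rule over[OF \<eta>S jS _ j\<phi>]) (use \<phi>(1) carr A_def in simp)
  have \<psi>S: "arr ?S \<psi> (Carr \<S>) (Carr \<G>)" by (rule over[OF jS \<eta>S _ \<eta>\<psi>]) (use \<psi> carr A_def in simp)
  have "\<phi> \<in> Hom (Grp ?S) \<G> \<S>"
    by (rule S.Grp_hom_cancel_monic[OF \<G> ps(1) DG jH jmS \<phi>S]) (use j\<phi> \<eta> in simp)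
  moreover have "\<psi> \<in> Hom (Grp ?S) \<S> \<G>"
    by (rule S.Grp_hom_cancel_monic[OF ps(1) \<G> DG \<eta> \<eta>m \<psi>S]) (use \<eta>\<psi> jH in simp)
  ultimately have iso: "is_iso (Grp ?S) \<G> \<S> \<phi>"
    unfolding is_iso_def using \<G> ps(1) \<phi>\<psi> \<psi>\<phi> carr A_def by (auto intro!: bexI[of _ \<psi>])
  show ?thesis
  proof (rule ex1I[of _ \<phi>])
    fix \<phi>' assume a: "is_iso (Grp ?S) \<G> \<S> \<phi>' \<and> j \<cdot> \<phi>' = \<eta>"
    then have "\<phi>' \<in> Hom (Grp ?S) \<G> \<S>" by (simp add: is_iso_def)
    from Slice_arrD(1)[OF S.Grp_hom_arr[OF \<G> ps(1) this] Q]
    have "\<guillemotleft>\<phi>' : A \<rightarrow> P\<guillemotright>" unfolding carr A_def .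
    then show "\<phi>' = \<phi>" using monicD[OF jm _ \<phi>(1)] a j\<phi> by simp
  qed (use iso j\<phi> in blast)
qed

end

section \<open>Translation by a subgroup is effective\<close>

context lex
begin

lemma Slice_coequaliser:
  assumes Y: "Y \<in> Obj C" and f: "arr (Slice C Y) f A B" and g: "arr (Slice C Y) g A B"
    and q: "is_coequaliser (Slice C Y) A B f g Z q"
  shows "is_coequaliser C (fst A) (fst B) f g (fst Z) q"
proof -
  interpret S: lex "Slice C Y" by (rule Slice_lex[OF Y])
  note F = Slice_arrD[OF f Y] and Gg = Slice_arrD[OF g Y]
  note qD = is_coequaliserD[OF q arr_cod[OF f]]
  note q' = Slice_arrD[OF qD(1) Y]
  \<comment> \<open>An arrow into \<open>T\<close> is the same as an arrow over \<open>Y\<close> into \<open>T \<times> Y\<close>.\<close>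
  have over: "arr (Slice C Y) (tuple C (fst D) T Y m (snd D)) D (Prod C T Y, pr2 C T Y)"
    if m: "\<guillemotleft>m : fst D \<rightarrow> T\<guillemotright>" "\<guillemotleft>snd D : fst D \<rightarrow> Y\<guillemotright>" for D T m
    using tuple[OF m] pr2_tuple[OF m] pr2[OF arr_cod[OF m(1)] Y] m(2) by (simp add: Slice_arr[OF Y])
  show ?thesis
  proof (rule is_coequaliserI[OF q'(1)])
    show "q \<cdot> f = q \<cdot> g" using qD(2) by simp
    fix T
    show "\<exists>k. \<guillemotleft>k : fst Z \<rightarrow> T\<guillemotright> \<and> k \<cdot> q = m" if m: "\<guillemotleft>m : fst B \<rightarrow> T\<guillemotright>" and e: "m \<cdot> f = m \<cdot> g" for m
    proof -
      note T = arr_cod[OF m] note o = over[OF m F(3)]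
      have "tuple C (fst B) T Y m (snd B) \<cdot> f = tuple C (fst B) T Y m (snd B) \<cdot> g"
        unfolding tuple_comp[OF F(1) m F(3)] tuple_comp[OF Gg(1) m F(3)] e F(4) Gg(4) ..
      then obtain k where k: "arr (Slice C Y) k Z (Prod C T Y, pr2 C T Y)" "k \<cdot> q = tuple C (fst B) T Y m (snd B)"
        using qD(3)[OF o] by auto
      note k' = Slice_arrD(1)[OF k(1) Y, unfolded fst_conv]
      have "(pr1 C T Y \<cdot> k) \<cdot> q = m" unfolding assoc[OF q'(1) k' pr1[OF T Y]] k(2) by (rule pr1_tuple[OF m F(3)])
      then show ?thesis using comp[OF k' pr1[OF T Y]] by blast
    qed
    show "h = k" if h: "\<guillemotleft>h : fst Z \<rightarrow> T\<guillemotright>" and k: "\<guillemotleft>k : fst Z \<rightarrow> T\<guillemotright>" and e: "h \<cdot> q = k \<cdot> q" for h k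
    proof -
      have "tuple C (fst Z) T Y h (snd Z) = tuple C (fst Z) T Y k (snd Z)"
        by (rule S.coequaliser_ext[OF q f g over[OF h q'(3)] over[OF k q'(3)]])
          (use tuple_comp[OF q'(1) h q'(3)] tuple_comp[OF q'(1) k q'(3)] e in simp)
      then show ?thesis using pr1_tuple[OF h q'(3)] pr1_tuple[OF k q'(3)] by metis
    qed
  qed
qed

lemma regular_epi_Ident: assumes A: "A \<in> Obj C" shows "regular_epi C A A (Ident C A)"
proof -
  note i = ident[OF A]
  have "is_coequaliser C A A (Ident C A) (Ident C A) A (Ident C A)"
    by (rule is_coequaliserI[OF i]) (use idr in auto)
  then show ?thesis unfolding regular_epi_def using A arr_hom[OF i] by blast
qed

text \<open>If \<open>(e, u)\<close> embeds \<open>\<G>\<close> into \<open>K \<times> Q\<close>, then \<open>\<G>\<close> acts freely on \<open>B = K \<times> Q\<close> over \<open>Q\<close> by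
  \<open>\<gamma> (h, x) = (h e(\<gamma>)\<^sup>-\<^sup>1, x)\<close>. As the action is free, \<open>(a, pr)\<close> is already monic, so the congruence of
  action Barr-exactness is the whole action graph; and that is the pair \<open>f, g\<close> below up to the
  reparametrisation \<open>(h, \<gamma>) \<mapsto> (\<gamma>, (h e(\<gamma>), u \<gamma>))\<close>. Arbitrary products \<open>R\<close> and \<open>B\<close> are allowed, since
  the lemma will be applied to the components of products of graphs.\<close>

lemma translation_effective:
  assumes Q: "Q \<in> Obj C" and exact: "action_Barr_exact (Slice C Q)"
    and K: "group_object C K" and \<G>: "group_object (Slice C Q) \<G>" and e: "fibre_hom C Q \<G> K e"
    and inj: "\<And>T x y. \<lbrakk>\<guillemotleft>x : T \<rightarrow> fst (Carr \<G>)\<guillemotright>; \<guillemotleft>y : T \<rightarrow> fst (Carr \<G>)\<guillemotright>; e \<cdot> x = e \<cdot> y;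
      snd (Carr \<G>) \<cdot> x = snd (Carr \<G>) \<cdot> y\<rbrakk> \<Longrightarrow> x = y"
    and R: "is_product C (Carr K) (fst (Carr \<G>)) R r1 r2" and B: "is_product C (Carr K) Q B b1 b2"
    and f: "\<guillemotleft>f : R \<rightarrow> B\<guillemotright>" "b1 \<cdot> f = r1" "b2 \<cdot> f = snd (Carr \<G>) \<cdot> r2"
    and g: "\<guillemotleft>g : R \<rightarrow> B\<guillemotright>" "b1 \<cdot> g = gmul C K R r1 (e \<cdot> r2)" "b2 \<cdot> g = snd (Carr \<G>) \<cdot> r2"
  shows "\<exists>Z q. is_coequaliser C R B f g Z q \<and> is_pullback C B B q q R f g"
proof -
  let ?S = "Slice C Q" and ?G = "Carr K" and ?c = "Carr \<G>" and ?Y = "(B, b2)" let ?A = "fst ?c" and ?u = "snd ?c"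
  let ?W = "Prod ?S ?c ?Y" let ?p1 = "pr1 ?S ?c ?Y" and ?p2 = "pr2 ?S ?c ?Y" let ?V = "fst ?W"
  interpret S: lex ?S by (rule Slice_lex[OF Q])
  note G = group_carr[OF K] and u = group_over_arr[OF Q \<G>] and A = arr_dom[OF group_over_arr[OF Q \<G>]]
  note e' = fibre_homD(1)[OF e] and eh = fibre_homD(2)[OF e]
  note r = is_productD[OF R G A] and b = is_productD[OF B G Q]
  note BO = arr_dom[OF b(1)]
  have cS: "?c \<in> Obj ?S" using S.group_carr[OF \<G>] .
  have YS: "?Y \<in> Obj ?S" using b(2) by (simp add: Slice_obj[OF Q])
  note P = S.pr1[OF cS YS] S.pr2[OF cS YS]
  note p1 = Slice_arrD[OF P(1) Q] and p2 = Slice_arrD[OF P(2) Q, unfolded fst_conv snd_conv]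
  note ep = comp[OF p1(1) e'] and bp = comp[OF p2(1) b(1)]
  note m = gmul[OF K bp inv[OF K ep]]
  obtain a where a: "\<guillemotleft>a : ?V \<rightarrow> B\<guillemotright>" "b1 \<cdot> a = gmul C K ?V (b1 \<cdot> ?p2) (Inv K \<cdot> (e \<cdot> ?p1))" "b2 \<cdot> a = snd ?W"
    using b(3)[OF m p1(2)] by blast
  have aS: "arr ?S a ?W ?Y" using a p1(2) b(2) by (simp add: Slice_arr[OF Q])
  have extB: "x = y" if "\<guillemotleft>x : T \<rightarrow> B\<guillemotright>" "\<guillemotleft>y : T \<rightarrow> B\<guillemotright>" "b1 \<cdot> x = b1 \<cdot> y" "b2 \<cdot> x = b2 \<cdot> y" for x y T
    by (rule product_ext[OF B G Q that])
  have act1: "b1 \<cdot> (a \<cdot> k) = gmul C K T (b1 \<cdot> (?p2 \<cdot> k)) (Inv K \<cdot> (e \<cdot> (?p1 \<cdot> k)))" if k: "\<guillemotleft>k : T \<rightarrow> ?V\<guillemotright>" for T k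
    using assoc[OF k a(1) b(1)] a(2) gmul_comp[OF K bp inv[OF K ep] k] assoc[OF k p2(1) b(1)]
      assoc[OF k ep group_Inv[OF K]] assoc[OF k p1(1) e'] by simp
  have act: "b1 \<cdot> gact ?S \<G> ?Y a T \<gamma> y = gmul C K (fst T) (b1 \<cdot> y) (Inv K \<cdot> (e \<cdot> \<gamma>))"
    "arr ?S (gact ?S \<G> ?Y a T \<gamma> y) T ?Y"
    if \<gamma>: "arr ?S \<gamma> T ?c" and y: "arr ?S y T ?Y" for T \<gamma> y
  proof -
    note t = S.tuple[OF \<gamma> y]
    show "b1 \<cdot> gact ?S \<G> ?Y a T \<gamma> y = gmul C K (fst T) (b1 \<cdot> y) (Inv K \<cdot> (e \<cdot> \<gamma>))"
      using act1[OF Slice_arrD(1)[OF t Q]] S.pr1_tuple[OF \<gamma> y] S.pr2_tuple[OF \<gamma> y] by (simp add: gact_def)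
    show "arr ?S (gact ?S \<G> ?Y a T \<gamma> y) T ?Y" by (rule S.gact[OF aS \<gamma> y])
  qed
  have Yel: "\<guillemotleft>y : fst T \<rightarrow> B\<guillemotright> \<and> b2 \<cdot> y = snd T \<and> \<guillemotleft>b1 \<cdot> y : fst T \<rightarrow> ?G\<guillemotright>" if y: "arr ?S y T ?Y" for y T
    using Slice_arrD[OF y Q, unfolded fst_conv snd_conv] comp[OF _ b(1)] by blast
  have extY: "x = y" if x: "arr ?S x T ?Y" and y: "arr ?S y T ?Y" and "b1 \<cdot> x = b1 \<cdot> y" for x y T
    using extB[of x "fst T" y] Yel[OF x] Yel[OF y] that(3) by simp
  have "is_action ?S \<G> ?Y a"
    unfolding S.is_action_iff[OF \<G>]
  proof (intro conjI allI impI)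
    fix T x y z assume x: "arr ?S x T ?c" and y: "arr ?S y T ?c" and z: "arr ?S z T ?Y"
    note xy = S.gmul[OF \<G> x y] and yz = act[OF y z]
    note ex = comp[OF Slice_arrD(1)[OF x Q] e'] and ey = comp[OF Slice_arrD(1)[OF y Q] e']
    note ix = inv[OF K ex] and iy = inv[OF K ey]
    have bz: "\<guillemotleft>b1 \<cdot> z : fst T \<rightarrow> ?G\<guillemotright>" using Yel[OF z] by blast
    show "gact ?S \<G> ?Y a T (gmul ?S \<G> T x y) z = gact ?S \<G> ?Y a T x (gact ?S \<G> ?Y a T y z)"
      by (rule extY[OF act(2)[OF xy z] act(2)[OF x yz(2)]])
        (simp add: act(1)[OF xy z] act(1)[OF x yz(2)] yz(1) eh[OF x y] inv_gmul[OF K ex ey] gmul_assoc[OF K bz iy ix])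
  next
    fix T z assume z: "arr ?S z T ?Y"
    note T = arr_dom[OF z] note o = S.gone[OF \<G> T]
    have bz: "\<guillemotleft>b1 \<cdot> z : fst T \<rightarrow> ?G\<guillemotright>" and T': "fst T \<in> Obj C" using Yel[OF z] by (auto dest: arr_dom)
    note one = gone[OF K T']
    have "Inv K \<cdot> gone C K (fst T) = gone C K (fst T)"
      using inv_unique[OF K one one] group_unit_laws(1)[OF K one] by simp
    then show "gact ?S \<G> ?Y a T (gone ?S \<G> T) z = z"
      by (intro extY[OF act(2)[OF o z] z])
        (simp add: act(1)[OF o z] fibre_hom_one[OF Q \<G> K e T] group_unit_laws(2)[OF K bz])
  qed (rule aS)
  moreover
  let ?j = "tuple ?S ?W ?Y ?Y a ?p2"
  note jS = S.tuple[OF aS P(2)]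
  note YY = S.pr1[OF YS YS] S.pr2[OF YS YS]
  have "monic ?S ?W (Prod ?S ?Y ?Y) ?j"
    unfolding monic_iff[OF arr_dom[OF jS] arr_cod[OF jS]]
  proof (intro conjI allI impI)
    fix T x y assume x: "arr ?S x T ?W" and y: "arr ?S y T ?W" and j: "?j \<cdot>\<^bsub>?S\<^esub> x = ?j \<cdot>\<^bsub>?S\<^esub> y"
    have j': "tuple ?S T ?Y ?Y (a \<cdot> x) (?p2 \<cdot> x) = tuple ?S T ?Y ?Y (a \<cdot> y) (?p2 \<cdot> y)"
      using j S.tuple_comp[OF x aS P(2)] S.tuple_comp[OF y aS P(2)] by simp
    note ax = S.comp[OF x aS, simplified] and ay = S.comp[OF y aS, simplified]
    note qx = S.comp[OF x P(2), simplified] and qy = S.comp[OF y P(2), simplified]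
    have ap: "a \<cdot> x = a \<cdot> y" "?p2 \<cdot> x = ?p2 \<cdot> y"
      using j' S.pr1_tuple[OF ax qx] S.pr1_tuple[OF ay qy] S.pr2_tuple[OF ax qx] S.pr2_tuple[OF ay qy] by metis+
    note x' = Slice_arrD(1)[OF x Q] and y' = Slice_arrD(1)[OF y Q]
    note ex = comp[OF comp[OF x' p1(1)] e'] and ey = comp[OF comp[OF y' p1(1)] e']
    note bz = comp[OF comp[OF y' p2(1)] b(1)]
    have "gmul C K (fst T) (b1 \<cdot> (?p2 \<cdot> y)) (Inv K \<cdot> (e \<cdot> (?p1 \<cdot> x))) = gmul C K (fst T) (b1 \<cdot> (?p2 \<cdot> y)) (Inv K \<cdot> (e \<cdot> (?p1 \<cdot> y)))"
      using act1[OF x'] act1[OF y'] ap by simp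
    then have "Inv K \<cdot> (e \<cdot> (?p1 \<cdot> x)) = Inv K \<cdot> (e \<cdot> (?p1 \<cdot> y))"
      by (rule gmul_left_inject[OF K bz inv[OF K ex] inv[OF K ey]])
    then have "e \<cdot> (?p1 \<cdot> x) = e \<cdot> (?p1 \<cdot> y)" using inv_inv[OF K ex] inv_inv[OF K ey] by metis
    moreover have "?u \<cdot> (?p1 \<cdot> x) = ?u \<cdot> (?p1 \<cdot> y)"
      using assoc[OF x' p1(1,3)] assoc[OF y' p1(1,3)] p1(4) Slice_arrD(4)[OF x Q] Slice_arrD(4)[OF y Q] by simp
    ultimately have "?p1 \<cdot> x = ?p1 \<cdot> y" by (rule inj[OF comp[OF x' p1(1)] comp[OF y' p1(1)]])
    then show "x = y" using S.prod_ext[OF cS YS x y] ap by simp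
  qed (rule jS)
  ultimately have "let r1 = pr1 ?S ?Y ?Y \<cdot>\<^bsub>?S\<^esub> ?j; r2 = pr2 ?S ?Y ?Y \<cdot>\<^bsub>?S\<^esub> ?j
         in \<exists>Z q. is_coequaliser ?S ?W ?Y r1 r2 Z q \<and> is_pullback ?S ?Y ?Y q q ?W r1 r2"
    using exact \<G> S.regular_epi_Ident[OF arr_dom[OF jS]] arr_dom[OF jS] idr[OF Slice_arrD(1)[OF jS Q]]
    unfolding action_Barr_exact_def Slice_Comp Slice_Ident by blast
  then obtain Z q where Z: "is_coequaliser ?S ?W ?Y a ?p2 Z q" "is_pullback ?S ?Y ?Y q q ?W a ?p2"
    using S.pr1_tuple[OF aS P(2)] S.pr2_tuple[OF aS P(2)] by (auto simp: Let_def)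
  have co: "is_coequaliser C ?V B a ?p2 (fst Z) q" using Slice_coequaliser[OF Q aS P(2) Z(1)] by simp
  note coD = is_coequaliserD[OF co BO] note q = coD(1)
  note qS = is_coequaliserD(1)[OF Z(1) YS]
  have pb: "is_pullback C B B q q ?V a ?p2" using Z(2) unfolding Slice_pullback_iff[OF Q qS qS] by simp
  \<comment> \<open>The two parametrisations \<open>(h, \<gamma>)\<close> and \<open>(\<gamma>, (h, x))\<close> of the congruence.\<close>
  note ur = comp[OF r(2) u] and er = comp[OF r(2) e']
  have r2S: "arr ?S r2 (R, ?u \<cdot> r2) ?c" by (rule Slice_arrI[OF r(2) u refl])
  have gS: "arr ?S g (R, ?u \<cdot> r2) ?Y" by (rule Slice_arrI) (use g b(2) in simp_all)
  define \<theta> where "\<theta> = tuple ?S (R, ?u \<cdot> r2) ?c ?Y r2 g"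
  have \<theta>: "\<guillemotleft>\<theta> : R \<rightarrow> ?V\<guillemotright>" "?p1 \<cdot> \<theta> = r2" "?p2 \<cdot> \<theta> = g"
    unfolding \<theta>_def using Slice_arrD(1)[OF S.tuple[OF r2S gS] Q] S.pr1_tuple[OF r2S gS] S.pr2_tuple[OF r2S gS] by simp_all
  have a\<theta>: "a \<cdot> \<theta> = f"
  proof (rule extB[OF comp[OF \<theta>(1) a(1)] f(1)])
    show "b1 \<cdot> (a \<cdot> \<theta>) = b1 \<cdot> f" unfolding act1[OF \<theta>(1)] \<theta>(2,3) g(2) f(2) by (rule gmul_cancel(1)[OF K r(1) er])
    show "b2 \<cdot> (a \<cdot> \<theta>) = b2 \<cdot> f"
      using assoc[OF \<theta>(1) a(1) b(2)] a(3) f(3) assoc[OF \<theta>(1) p1(1,3)] p1(4) \<theta>(2) by simp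
  qed
  obtain \<theta>' where \<theta>': "\<guillemotleft>\<theta>' : ?V \<rightarrow> R\<guillemotright>" "r1 \<cdot> \<theta>' = b1 \<cdot> a" "r2 \<cdot> \<theta>' = ?p1"
    using r(3)[OF comp[OF a(1) b(1)] p1(1)] by blast
  have f\<theta>': "f \<cdot> \<theta>' = a"
    by (rule extB[OF comp[OF \<theta>'(1) f(1)] a(1)])
      (use assoc[OF \<theta>'(1) f(1) b(1)] assoc[OF \<theta>'(1) f(1) b(2)] f(2,3) \<theta>'(2,3) assoc[OF \<theta>'(1) r(2) u] p1(4) a(3) in simp_all)
  have g\<theta>': "g \<cdot> \<theta>' = ?p2"
  proof (rule extB[OF comp[OF \<theta>'(1) g(1)] p2(1)])
    have "b1 \<cdot> (g \<cdot> \<theta>') = gmul C K ?V (b1 \<cdot> a) (e \<cdot> ?p1)"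
      using assoc[OF \<theta>'(1) g(1) b(1)] g(2) gmul_comp[OF K r(1) er \<theta>'(1)] \<theta>'(2,3) assoc[OF \<theta>'(1) r(2) e'] by simp
    then show "b1 \<cdot> (g \<cdot> \<theta>') = b1 \<cdot> ?p2" unfolding a(2) using gmul_cancel(2)[OF K bp ep] by simp
    show "b2 \<cdot> (g \<cdot> \<theta>') = b2 \<cdot> ?p2"
      using assoc[OF \<theta>'(1) g(1) b(2)] g(3) assoc[OF \<theta>'(1) r(2) u] \<theta>'(3) p1(4) p2(4) by simp
  qed
  have "is_coequaliser C R B f g (fst Z) q"
  proof (rule is_coequaliserI[OF q])
    show "q \<cdot> f = q \<cdot> g"
      using assoc[OF \<theta>(1) a(1) q] assoc[OF \<theta>(1) p2(1) q] coD(2) a\<theta> \<theta>(3) by simp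
    fix T
    show "\<exists>k. \<guillemotleft>k : fst Z \<rightarrow> T\<guillemotright> \<and> k \<cdot> q = h" if h: "\<guillemotleft>h : B \<rightarrow> T\<guillemotright>" "h \<cdot> f = h \<cdot> g" for h
    proof (rule coD(3)[OF h(1)])
      show "h \<cdot> a = h \<cdot> ?p2" using assoc[OF \<theta>'(1) f(1) h(1)] assoc[OF \<theta>'(1) g(1) h(1)] f\<theta>' g\<theta>' h(2) by simp
    qed
    show "h = k" if "\<guillemotleft>h : fst Z \<rightarrow> T\<guillemotright>" "\<guillemotleft>k : fst Z \<rightarrow> T\<guillemotright>" "h \<cdot> q = k \<cdot> q" for h k
      by (rule coequaliser_ext[OF co a(1) p2(1) that])
  qed
  moreover have "is_pullback C B B q q R f g"
  proof (rule is_pullbackI[OF f(1) g(1)])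
    show "q \<cdot> f = q \<cdot> g"
      using assoc[OF \<theta>(1) a(1) q] assoc[OF \<theta>(1) p2(1) q] coD(2) a\<theta> \<theta>(3) by simp
    fix T
    show "\<exists>h. \<guillemotleft>h : T \<rightarrow> R\<guillemotright> \<and> f \<cdot> h = x \<and> g \<cdot> h = y" if x: "\<guillemotleft>x : T \<rightarrow> B\<guillemotright>" "\<guillemotleft>y : T \<rightarrow> B\<guillemotright>" "q \<cdot> x = q \<cdot> y" for x y
    proof -
      obtain k where k: "\<guillemotleft>k : T \<rightarrow> ?V\<guillemotright>" "a \<cdot> k = x" "?p2 \<cdot> k = y" using is_pullbackD(4)[OF pb BO BO x] by blast
      show ?thesis
        using comp[OF k(1) \<theta>'(1)] assoc[OF k(1) \<theta>'(1) f(1)] assoc[OF k(1) \<theta>'(1) g(1)] f\<theta>' g\<theta>' k(2,3) by auto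
    qed
    show "h = k" if h: "\<guillemotleft>h : T \<rightarrow> R\<guillemotright>" and k: "\<guillemotleft>k : T \<rightarrow> R\<guillemotright>" and fg: "f \<cdot> h = f \<cdot> k" "g \<cdot> h = g \<cdot> k" for h k
    proof -
      note h' = comp[OF h r(2)] comp[OF h r(1)] and k' = comp[OF k r(2)] comp[OF k r(1)]
      have r1: "r1 \<cdot> h = r1 \<cdot> k" using assoc[OF h f(1) b(1)] assoc[OF k f(1) b(1)] f(2) fg by simp
      have "gmul C K T (r1 \<cdot> h) (e \<cdot> (r2 \<cdot> h)) = gmul C K T (r1 \<cdot> k) (e \<cdot> (r2 \<cdot> k))"
        using assoc[OF h g(1) b(1)] assoc[OF k g(1) b(1)] g(2) fg gmul_comp[OF K r(1) er h] gmul_comp[OF K r(1) er k]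
          assoc[OF h r(2) e'] assoc[OF k r(2) e'] by simp
      then have "e \<cdot> (r2 \<cdot> h) = e \<cdot> (r2 \<cdot> k)"
        using gmul_left_inject[OF K k'(2) comp[OF h'(1) e'] comp[OF k'(1) e']] r1 by simp
      moreover have "?u \<cdot> (r2 \<cdot> h) = ?u \<cdot> (r2 \<cdot> k)"
        using assoc[OF h f(1) b(2)] assoc[OF k f(1) b(2)] f(3) fg assoc[OF h r(2) u] assoc[OF k r(2) u] by simp
      ultimately have "r2 \<cdot> h = r2 \<cdot> k" by (rule inj[OF h'(1) k'(1)])
      then show ?thesis by (rule product_ext[OF R G A h k r1])
    qed
  qed
  ultimately show ?thesis by blast
qed

end

section \<open>Functors that preserve finite limits\<close>

text \<open>The examples are the functors of edges and of vertices and the functors that they induce on slices.\<close>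

locale lex_functor = D: lex D + C: lex C
  for D :: "('p, 'n) cat" and C :: "('o, 'm) cat" +
  fixes F :: "'p \<Rightarrow> 'o" and F1 :: "'n \<Rightarrow> 'm"
  assumes F_arr: "arr D f A B \<Longrightarrow> arr C (F1 f) (F A) (F B)"
    and F_comp: "\<lbrakk>arr D f A B; arr D g B E\<rbrakk> \<Longrightarrow> F1 (g \<cdot>\<^bsub>D\<^esub> f) = F1 g \<cdot>\<^bsub>C\<^esub> F1 f"
    and F_ident: "A \<in> Obj D \<Longrightarrow> F1 (Ident D A) = Ident C (F A)"
    and F_pullback: "\<lbrakk>arr D f A B; arr D g A' B; is_pullback D A A' f g P p q\<rbrakk> \<Longrightarrow>
      is_pullback C (F A) (F A') (F1 f) (F1 g) (F P) (F1 p) (F1 q)"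
    and F_terminal: "is_terminal D Z \<Longrightarrow> is_terminal C (F Z)"
begin

lemma F_obj: "A \<in> Obj D \<Longrightarrow> F A \<in> Obj C"
  using F_arr[OF D.ident] by (rule arr_dom)

lemma F_product:
  assumes "A \<in> Obj D" "B \<in> Obj D" "is_product D A B P p q"
  shows "is_product C (F A) (F B) (F P) (F1 p) (F1 q)"
proof -
  note b = D.bang[OF assms(1)] D.bang[OF assms(2)]
  have "is_pullback D A B (bang D A) (bang D B) P p q"
    using assms(3) unfolding D.product_iff_pullback[OF assms(1,2) D.is_terminal_Term b] .
  from F_pullback[OF b this] show ?thesis
    unfolding C.product_iff_pullback[OF F_obj[OF assms(1)] F_obj[OF assms(2)] F_terminal[OF D.is_terminal_Term]
      F_arr[OF b(1)] F_arr[OF b(2)]] .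
qed

lemma F_monic:
  assumes m: "monic D A B f" and o: "A \<in> Obj D" "B \<in> Obj D"
  shows "monic C (F A) (F B) (F1 f)"
proof -
  have f: "arr D f A B" using m o by (simp add: monic_iff)
  \<comment> \<open>An arrow is monic iff it has the identities as a kernel pair.\<close>
  have "is_pullback D A A f f A (Ident D A) (Ident D A)"
  proof (rule is_pullbackI[OF D.ident[OF o(1)] D.ident[OF o(1)] refl])
    fix T x y assume x: "arr D x T A" "arr D y T A" "f \<cdot>\<^bsub>D\<^esub> x = f \<cdot>\<^bsub>D\<^esub> y"
    then have "x = y" by (rule monicD[OF m])
    then show "\<exists>h. arr D h T A \<and> Ident D A \<cdot>\<^bsub>D\<^esub> h = x \<and> Ident D A \<cdot>\<^bsub>D\<^esub> h = y" using x D.idl by metis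
  next
    fix T h k assume "arr D h T A" "arr D k T A" "Ident D A \<cdot>\<^bsub>D\<^esub> h = Ident D A \<cdot>\<^bsub>D\<^esub> k"
    then show "h = k" using D.idl by metis
  qed
  from F_pullback[OF f f this] have pb: "is_pullback C (F A) (F A) (F1 f) (F1 f) (F A) (Ident C (F A)) (Ident C (F A))"
    by (simp add: F_ident[OF o(1)])
  have "x = y" if "arr C x T (F A)" "arr C y T (F A)" "F1 f \<cdot>\<^bsub>C\<^esub> x = F1 f \<cdot>\<^bsub>C\<^esub> y" for T x y
    using is_pullbackD(4)[OF pb F_obj[OF o(1)] F_obj[OF o(1)] that] C.idl by metis
  then show ?thesis unfolding monic_iff[OF F_obj[OF o(1)] F_obj[OF o(2)]] using F_arr[OF f] by blast
qed

end

text \<open>The image of a group object. The chosen product \<open>F G \<times> F G\<close> need not be the image of the chosen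
  product \<open>G \<times> G\<close>, so a comparison arrow intervenes; likewise for the terminal object.\<close>

definition image_group ::
  "('p, 'n) cat \<Rightarrow> ('o, 'm) cat \<Rightarrow> ('p \<Rightarrow> 'o) \<Rightarrow> ('n \<Rightarrow> 'm) \<Rightarrow> ('p, 'n) grp \<Rightarrow> ('o, 'm) grp" where
  "image_group D C F F1 K =
     (let G = Carr K; FG = F G
      in \<lparr> Carr = FG,
           Mul = F1 (Mul K) \<cdot>\<^bsub>C\<^esub> (THE k. k \<in> Hom C (Prod C FG FG) (F (Prod D G G)) \<and>
             F1 (pr1 D G G) \<cdot>\<^bsub>C\<^esub> k = pr1 C FG FG \<and> F1 (pr2 D G G) \<cdot>\<^bsub>C\<^esub> k = pr2 C FG FG),
           Inv = F1 (Inv K),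
           One = F1 (One K) \<cdot>\<^bsub>C\<^esub> (THE k. k \<in> Hom C (Term C) (F (Term D))) \<rparr>)"

lemma image_group_carr [simp]: "Carr (image_group D C F F1 K) = F (Carr K)"
  by (simp add: image_group_def Let_def)

context lex_functor
begin

context
  fixes K assumes K: "group_object D K"
begin

lemma image_ops:
  shows "arr C (Mul (image_group D C F F1 K)) (Prod C (F (Carr K)) (F (Carr K))) (F (Carr K))"
    and "arr C (One (image_group D C F F1 K)) (Term C) (F (Carr K))"
    and image_gmul_factor: "arr C k T (F (Prod D (Carr K) (Carr K))) \<Longrightarrow>
      gmul C (image_group D C F F1 K) T (F1 (pr1 D (Carr K) (Carr K)) \<cdot>\<^bsub>C\<^esub> k) (F1 (pr2 D (Carr K) (Carr K)) \<cdot>\<^bsub>C\<^esub> k) =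
      F1 (Mul K) \<cdot>\<^bsub>C\<^esub> k"
    and image_gone: "\<lbrakk>T' \<in> Obj D; arr C k T (F T')\<rbrakk> \<Longrightarrow> F1 (gone D K T') \<cdot>\<^bsub>C\<^esub> k = gone C (image_group D C F F1 K) T"
proof -
  let ?I = "image_group D C F F1 K" and ?G = "Carr K" let ?FG = "F ?G" let ?P = "F (Prod D ?G ?G)"
  let ?p = "F1 (pr1 D ?G ?G)" and ?q = "F1 (pr2 D ?G ?G)"
  note G = D.group_carr[OF K] note FG = F_obj[OF G]
  note p = F_arr[OF D.pr1[OF G G]] F_arr[OF D.pr2[OF G G]]
  note P = F_product[OF G G D.is_product_Prod[OF G G]]
  note pC = C.pr1[OF FG FG] C.pr2[OF FG FG]
  define k0 where "k0 = (THE k. k \<in> Hom C (Prod C ?FG ?FG) ?P \<and> ?p \<cdot>\<^bsub>C\<^esub> k = pr1 C ?FG ?FG \<and> ?q \<cdot>\<^bsub>C\<^esub> k = pr2 C ?FG ?FG)"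
  have "\<exists>!k. k \<in> Hom C (Prod C ?FG ?FG) ?P \<and> ?p \<cdot>\<^bsub>C\<^esub> k = pr1 C ?FG ?FG \<and> ?q \<cdot>\<^bsub>C\<^esub> k = pr2 C ?FG ?FG"
    using P C.Prod_obj[OF FG FG] pC unfolding is_product_def arr_def by blast
  from theI'[OF this, folded k0_def] have k0: "arr C k0 (Prod C ?FG ?FG) ?P"
    "?p \<cdot>\<^bsub>C\<^esub> k0 = pr1 C ?FG ?FG" "?q \<cdot>\<^bsub>C\<^esub> k0 = pr2 C ?FG ?FG"
    using arr_dom[OF pC(1)] arr_dom[OF p(1)] by (auto simp: arr_def)
  define z where "z = (THE k. k \<in> Hom C (Term C) (F (Term D)))"
  note FT = F_terminal[OF D.is_terminal_Term]
  have "\<exists>!k. k \<in> Hom C (Term C) (F (Term D))" using FT C.Term_obj by (simp add: is_terminal_def)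
  from theI'[OF this, folded z_def] have z: "arr C z (Term C) (F (Term D))"
    using C.Term_obj F_obj[OF D.Term_obj] by (simp add: arr_def)
  have Mul: "Mul ?I = F1 (Mul K) \<cdot>\<^bsub>C\<^esub> k0" and One: "One ?I = F1 (One K) \<cdot>\<^bsub>C\<^esub> z"
    by (simp_all add: image_group_def Let_def k0_def z_def)
  note FM = F_arr[OF D.group_Mul[OF K]] and FO = F_arr[OF D.group_One[OF K]]
  show M: "arr C (Mul ?I) (Prod C ?FG ?FG) ?FG" unfolding Mul by (rule C.comp[OF k0(1) FM])
  show "arr C (One ?I) (Term C) ?FG" unfolding One by (rule C.comp[OF z FO])
  show "gmul C ?I T (?p \<cdot>\<^bsub>C\<^esub> k) (?q \<cdot>\<^bsub>C\<^esub> k) = F1 (Mul K) \<cdot>\<^bsub>C\<^esub> k" if k: "arr C k T ?P"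
  proof -
    note pk = C.comp[OF k p(1)] C.comp[OF k p(2)] note t = C.tuple[OF pk]
    have "k0 \<cdot>\<^bsub>C\<^esub> tuple C T ?FG ?FG (?p \<cdot>\<^bsub>C\<^esub> k) (?q \<cdot>\<^bsub>C\<^esub> k) = k"
      by (rule C.product_ext[OF P FG FG C.comp[OF t k0(1)] k])
        (use C.assoc[OF t k0(1) p(1)] C.assoc[OF t k0(1) p(2)] k0(2,3) C.pr1_tuple[OF pk] C.pr2_tuple[OF pk] in simp_all)
    then show ?thesis unfolding gmul_def Mul using C.assoc[OF t k0(1) FM] by simp
  qed
  show "F1 (gone D K T') \<cdot>\<^bsub>C\<^esub> k = gone C ?I T" if k: "arr C k T (F T')" and T': "T' \<in> Obj D"
  proof -
    note b = D.bang[OF T'] note Fb = F_arr[OF b] and bC = C.bang[OF arr_dom[OF k]]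
    have "F1 (bang D T') \<cdot>\<^bsub>C\<^esub> k = z \<cdot>\<^bsub>C\<^esub> bang C T"
      by (rule is_terminalD(2)[OF FT arr_dom[OF k] C.comp[OF k Fb] C.comp[OF bC z]])
    then show ?thesis
      unfolding gone_def One F_comp[OF b D.group_One[OF K]] using C.assoc[OF k Fb FO] C.assoc[OF bC z FO] by simp
  qed
qed

lemma image_gmul:
  assumes "arr D x T' (Carr K)" "arr D y T' (Carr K)" "arr C k T (F T')"
  shows "F1 (gmul D K T' x y) \<cdot>\<^bsub>C\<^esub> k = gmul C (image_group D C F F1 K) T (F1 x \<cdot>\<^bsub>C\<^esub> k) (F1 y \<cdot>\<^bsub>C\<^esub> k)"
proof -
  note G = D.group_carr[OF K]
  note t = D.tuple[OF assms(1,2)] note Ft = F_arr[OF t] note kt = C.comp[OF assms(3) Ft]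
  note p = D.pr1[OF G G] D.pr2[OF G G]
  have "F1 (pr1 D (Carr K) (Carr K)) \<cdot>\<^bsub>C\<^esub> (F1 (tuple D T' (Carr K) (Carr K) x y) \<cdot>\<^bsub>C\<^esub> k) = F1 x \<cdot>\<^bsub>C\<^esub> k"
    "F1 (pr2 D (Carr K) (Carr K)) \<cdot>\<^bsub>C\<^esub> (F1 (tuple D T' (Carr K) (Carr K) x y) \<cdot>\<^bsub>C\<^esub> k) = F1 y \<cdot>\<^bsub>C\<^esub> k"
    using C.assoc[OF assms(3) Ft F_arr[OF p(1)]] C.assoc[OF assms(3) Ft F_arr[OF p(2)]]
      F_comp[OF t p(1)] F_comp[OF t p(2)] D.pr1_tuple[OF assms(1,2)] D.pr2_tuple[OF assms(1,2)] by simp_all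
  then show ?thesis
    using image_gmul_factor[OF kt] C.assoc[OF assms(3) Ft F_arr[OF D.group_Mul[OF K]]] F_comp[OF t D.group_Mul[OF K]]
    by (simp add: gmul_def)
qed

lemma image_gmul_ident:
  assumes "arr D x T (Carr K)" "arr D y T (Carr K)"
  shows "F1 (gmul D K T x y) = gmul C (image_group D C F F1 K) (F T) (F1 x) (F1 y)"
  using image_gmul[OF assms C.ident[OF F_obj[OF arr_dom[OF assms(1)]]]] C.idr[OF F_arr[OF D.gmul[OF K assms]]]
    C.idr[OF F_arr[OF assms(1)]] C.idr[OF F_arr[OF assms(2)]] by simp

text \<open>Every law of \<open>K\<close> is an equation between generalised elements with a product of copies of \<open>K\<close> as
  parameter object; \<open>F\<close> carries it to the image.\<close>

lemma image_group: "group_object C (image_group D C F F1 K)"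
proof -
  let ?I = "image_group D C F F1 K" and ?G = "Carr K"
  note G = D.group_carr[OF K] note FG = F_obj[OF G]
  let ?GG = "Prod D ?G ?G" note GG = D.Prod_obj[OF G G]
  note p = D.pr1[OF G G] D.pr2[OF G G] and q = D.pr1[OF GG G] D.pr2[OF GG G]
  note i = D.ident[OF G]
  show ?thesis
  proof (rule C.group_objectI; unfold image_group_carr)
    show "arr C (Inv ?I) (F ?G) (F ?G)"
      using F_arr[OF D.group_Inv[OF K]] by (simp add: image_group_def Let_def)
    have Inv: "Inv ?I = F1 (Inv K)" by (simp add: image_group_def Let_def)
    fix T x assume x: "arr C x T (F ?G)"
    have Ix: "F1 (Ident D ?G) \<cdot>\<^bsub>C\<^esub> x = x" unfolding F_ident[OF G] by (rule C.idl[OF x])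
    note o = D.gone[OF K G]
    note u = D.group_unit_laws[OF K i, unfolded D.idr[OF D.group_Inv[OF K]]]
    note r = image_gmul[OF o i x] image_gmul[OF i o x] image_gmul[OF D.group_Inv[OF K] i x]
      image_gmul[OF i D.group_Inv[OF K] x]
    note r' = r[unfolded u image_gone[OF G x] Ix]
    show "gmul C ?I T (gone C ?I T) x = x" "gmul C ?I T x (gone C ?I T) = x"
      "gmul C ?I T (Inv ?I \<cdot>\<^bsub>C\<^esub> x) x = gone C ?I T" "gmul C ?I T x (Inv ?I \<cdot>\<^bsub>C\<^esub> x) = gone C ?I T"
      unfolding Inv using r' by simp_all
    fix y z assume y: "arr C y T (F ?G)" and z: "arr C z T (F ?G)"
    obtain s where s: "arr C s T (F ?GG)" "F1 (pr1 D ?G ?G) \<cdot>\<^bsub>C\<^esub> s = x" "F1 (pr2 D ?G ?G) \<cdot>\<^bsub>C\<^esub> s = y"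
      using is_productD(3)[OF F_product[OF G G D.is_product_Prod[OF G G]] FG FG x y] by blast
    obtain t where t: "arr C t T (F (Prod D ?GG ?G))" "F1 (pr1 D ?GG ?G) \<cdot>\<^bsub>C\<^esub> t = s" "F1 (pr2 D ?GG ?G) \<cdot>\<^bsub>C\<^esub> t = z"
      using is_productD(3)[OF F_product[OF GG G D.is_product_Prod[OF GG G]] F_obj[OF GG] FG s(1) z] by blast
    let ?x = "pr1 D ?G ?G \<cdot>\<^bsub>D\<^esub> pr1 D ?GG ?G" and ?y = "pr2 D ?G ?G \<cdot>\<^bsub>D\<^esub> pr1 D ?GG ?G" and ?z = "pr2 D ?GG ?G"
    note X = D.comp[OF q(1) p(1)] and Y = D.comp[OF q(1) p(2)]
    have c: "F1 ?x \<cdot>\<^bsub>C\<^esub> t = x" "F1 ?y \<cdot>\<^bsub>C\<^esub> t = y"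
      unfolding F_comp[OF q(1) p(1)] F_comp[OF q(1) p(2)]
      using C.assoc[OF t(1) F_arr[OF q(1)] F_arr[OF p(1)]] C.assoc[OF t(1) F_arr[OF q(1)] F_arr[OF p(2)]] s t by simp_all
    have "F1 (gmul D K (Prod D ?GG ?G) (gmul D K (Prod D ?GG ?G) ?x ?y) ?z) \<cdot>\<^bsub>C\<^esub> t = gmul C ?I T (gmul C ?I T x y) z"
      unfolding image_gmul[OF D.gmul[OF K X Y] q(2) t(1)] image_gmul[OF X Y t(1)] c t(3) ..
    moreover have "F1 (gmul D K (Prod D ?GG ?G) ?x (gmul D K (Prod D ?GG ?G) ?y ?z)) \<cdot>\<^bsub>C\<^esub> t = gmul C ?I T x (gmul C ?I T y z)"
      unfolding image_gmul[OF X D.gmul[OF K Y q(2)] t(1)] image_gmul[OF Y q(2) t(1)] c t(3) ..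
    ultimately show "gmul C ?I T (gmul C ?I T x y) z = gmul C ?I T x (gmul C ?I T y z)"
      using D.gmul_assoc[OF K X Y q(2)] by simp
  qed (rule image_ops(1), rule image_ops(2))
qed

end

end

lemma (in category) terminal_transfer:
  assumes Z: "is_terminal C Z" and w: "\<guillemotleft>w : Z \<rightarrow> Z'\<guillemotright>" and z: "\<guillemotleft>z : Z' \<rightarrow> Z\<guillemotright>" and wz: "w \<cdot> z = Ident C Z'"
  shows "is_terminal C Z'"
proof (rule is_terminalI[OF arr_cod[OF w]])
  fix A assume "A \<in> Obj C"
  then show "\<exists>f. \<guillemotleft>f : A \<rightarrow> Z'\<guillemotright>" using is_terminalD(1)[OF Z] comp[OF _ w] by blast
next
  fix A f g assume f: "\<guillemotleft>f : A \<rightarrow> Z'\<guillemotright>" and g: "\<guillemotleft>g : A \<rightarrow> Z'\<guillemotright>"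
  have "z \<cdot> f = z \<cdot> g" by (rule is_terminalD(2)[OF Z arr_dom[OF f] comp[OF f z] comp[OF g z]])
  then show "f = g" using assoc[OF f z w] assoc[OF g z w] idl[OF f] idl[OF g] wz by simp
qed

text \<open>Pullbacks of a slice are those of the category. A terminal object over \<open>Q\<close> is an isomorphism onto \<open>Q\<close>,
  and this is preserved by every functor.\<close>

lemma (in lex_functor) slice_functor:
  assumes Q: "Q \<in> Obj D"
  shows "lex_functor (Slice D Q) (Slice C (F Q)) (\<lambda>A. (F (fst A), F1 (snd A))) F1"
proof -
  note FQ = F_obj[OF Q]
  interpret SD: lex "Slice D Q" by (rule D.Slice_lex[OF Q])
  interpret SC: lex "Slice C (F Q)" by (rule C.Slice_lex[OF FQ])
  have A: "arr (Slice C (F Q)) (F1 f) (F (fst A), F1 (snd A)) (F (fst B), F1 (snd B))"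
    if f: "arr (Slice D Q) f A B" for f A B
  proof -
    note f' = D.Slice_arrD[OF f Q]
    show ?thesis using F_arr[OF f'(1)] F_arr[OF f'(2)] F_arr[OF f'(3)] F_comp[OF f'(1,3)] f'(4)
      by (simp add: C.Slice_arr[OF FQ])
  qed
  show ?thesis
  proof unfold_locales
    show "arr (Slice D Q) f A B \<Longrightarrow> arr (Slice C (F Q)) (F1 f) (F (fst A), F1 (snd A)) (F (fst B), F1 (snd B))" for f A B
      by (rule A)
    show "F1 (g \<cdot>\<^bsub>Slice D Q\<^esub> f) = F1 g \<cdot>\<^bsub>Slice C (F Q)\<^esub> F1 f"
      if "arr (Slice D Q) f A B" "arr (Slice D Q) g B E" for f A B g E
      unfolding Slice_Comp by (rule F_comp[OF D.Slice_arrD(1)[OF that(1) Q] D.Slice_arrD(1)[OF that(2) Q]])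
    show "F1 (Ident (Slice D Q) A) = Ident (Slice C (F Q)) (F (fst A), F1 (snd A))" if "A \<in> Obj (Slice D Q)" for A
      using F_ident[OF arr_dom[OF that[unfolded D.Slice_obj[OF Q]]]] by simp
    show "is_pullback (Slice C (F Q)) (F (fst A), F1 (snd A)) (F (fst A'), F1 (snd A')) (F1 f) (F1 g) (F (fst P), F1 (snd P)) (F1 p) (F1 q)"
      if f: "arr (Slice D Q) f A B" and g: "arr (Slice D Q) g A' B" and P: "is_pullback (Slice D Q) A A' f g P p q" for f A B g A' P p q
    proof -
      note f' = D.Slice_arrD[OF f Q] and g' = D.Slice_arrD[OF g Q]
      have P': "is_pullback D (fst A) (fst A') f g (fst P) p q" "snd P = snd A \<cdot>\<^bsub>D\<^esub> p"
        using P unfolding D.Slice_pullback_iff[OF Q f g] by auto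
      note p = is_pullbackD(1)[OF P'(1) arr_dom[OF f'(1)] arr_dom[OF g'(1)]]
      show ?thesis
        unfolding C.Slice_pullback_iff[OF FQ A[OF f] A[OF g]]
        using F_pullback[OF f'(1) g'(1) P'(1)] P'(2) F_comp[OF p f'(2)] by simp
    qed
    show "is_terminal (Slice C (F Q)) (F (fst Z), F1 (snd Z))" if Z: "is_terminal (Slice D Q) Z" for Z
    proof -
      note i = D.Slice_terminal[OF Q]
      have o: "Z \<in> Obj (Slice D Q)" "(Q, Ident D Q) \<in> Obj (Slice D Q)" using Z i by (auto simp: is_terminal_def)
      note z = D.Slice_bang[OF o(1) Q]
      obtain w where w: "arr (Slice D Q) w (Q, Ident D Q) Z" using is_terminalD(1)[OF Z o(2)] by blast
      have "w \<cdot>\<^bsub>Slice D Q\<^esub> snd Z = Ident (Slice D Q) Z"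
        by (rule is_terminalD(2)[OF Z o(1) SD.comp[OF z w] SD.ident[OF o(1)]])
      then have "F1 w \<cdot>\<^bsub>C\<^esub> F1 (snd Z) = Ident C (F (fst Z))"
        using F_comp[OF D.Slice_arrD(1)[OF z Q] D.Slice_arrD(1)[OF w Q]] F_ident[OF arr_dom[OF D.Slice_arrD(1)[OF z Q]]] by simp
      then show ?thesis
        using SC.terminal_transfer[OF _ A[OF w] A[OF z]] C.Slice_terminal[OF FQ] F_ident[OF Q] by simp
    qed
  qed
qed

section \<open>Graphs\<close>

lemma Graph_Comp [simp]: "Comp (Graph C) x y = (fst x \<cdot>\<^bsub>C\<^esub> fst y, snd x \<cdot>\<^bsub>C\<^esub> snd y)"
  and Graph_Ident [simp]: "Ident (Graph C) X = (Ident C (Edges X), Ident C (Verts X))"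
  by (auto simp: Graph_def split_beta)

context category
begin

lemma Graph_obj: "X \<in> Obj (Graph C) \<longleftrightarrow> \<guillemotleft>d0 X : Edges X \<rightarrow> Verts X\<guillemotright> \<and> \<guillemotleft>d1 X : Edges X \<rightarrow> Verts X\<guillemotright>"
  by (auto simp: Graph_def arr_def)

lemma Graph_d: "\<lbrakk>X \<in> Obj (Graph C); d \<in> {d0, d1}\<rbrakk> \<Longrightarrow> \<guillemotleft>d X : Edges X \<rightarrow> Verts X\<guillemotright>"
  by (auto simp: Graph_obj)

lemma Graph_arr:
  "arr (Graph C) f X Y \<longleftrightarrow> X \<in> Obj (Graph C) \<and> Y \<in> Obj (Graph C) \<and>
    \<guillemotleft>fst f : Edges X \<rightarrow> Edges Y\<guillemotright> \<and> \<guillemotleft>snd f : Verts X \<rightarrow> Verts Y\<guillemotright> \<and>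
    (\<forall>d\<in>{d0, d1}. d Y \<cdot> fst f = snd f \<cdot> d X)"
  by (auto simp: Graph_def arr_def split_beta)

lemma Graph_arrD:
  assumes "arr (Graph C) f X Y"
  shows "\<guillemotleft>fst f : Edges X \<rightarrow> Edges Y\<guillemotright>" "\<guillemotleft>snd f : Verts X \<rightarrow> Verts Y\<guillemotright>"
    "d \<in> {d0, d1} \<Longrightarrow> \<guillemotleft>d X : Edges X \<rightarrow> Verts X\<guillemotright>" "d \<in> {d0, d1} \<Longrightarrow> \<guillemotleft>d Y : Edges Y \<rightarrow> Verts Y\<guillemotright>"
    "d \<in> {d0, d1} \<Longrightarrow> d Y \<cdot> fst f = snd f \<cdot> d X"
  using assms Graph_d by (auto simp: Graph_arr)

lemma Graph_category: "category (Graph C)"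
proof unfold_locales
  fix X assume X: "X \<in> Obj (Graph C)"
  have "arr (Graph C) (Ident (Graph C) X) X X"
    unfolding Graph_arr using X idl[OF Graph_d[OF X]] idr[OF Graph_d[OF X]]
      ident[OF arr_dom[OF Graph_d[OF X, of d0]]] ident[OF arr_cod[OF Graph_d[OF X, of d0]]] by simp
  then show "Ident (Graph C) X \<in> Hom (Graph C) X X" by (rule arr_hom)
next
  fix A B D f g
  assume "A \<in> Obj (Graph C)" "B \<in> Obj (Graph C)" "D \<in> Obj (Graph C)" "f \<in> Hom (Graph C) A B" "g \<in> Hom (Graph C) B D"
  then have F: "arr (Graph C) f A B" and G: "arr (Graph C) g B D" by (auto simp: arr_def)
  note f = Graph_arrD[OF F] and g = Graph_arrD[OF G]
  have "d D \<cdot> (fst g \<cdot> fst f) = (snd g \<cdot> snd f) \<cdot> d A" if d: "d \<in> {d0, d1}" for d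
    using assoc[OF f(1) g(1) g(4)[OF d]] assoc[OF f(1) g(3)[OF d] g(2)] assoc[OF f(3)[OF d] f(2) g(2)]
      f(5)[OF d] g(5)[OF d] by simp
  then have "arr (Graph C) (g \<cdot>\<^bsub>Graph C\<^esub> f) A D"
    using comp[OF f(1) g(1)] comp[OF f(2) g(2)] arr_dom[OF F] arr_cod[OF G] by (simp add: Graph_arr)
  then show "g \<cdot>\<^bsub>Graph C\<^esub> f \<in> Hom (Graph C) A D" by (rule arr_hom)
next
  fix A B f assume "A \<in> Obj (Graph C)" "B \<in> Obj (Graph C)" "f \<in> Hom (Graph C) A B"
  then have "arr (Graph C) f A B" by (simp add: arr_def)
  note f = Graph_arrD[OF this]
  show "f \<cdot>\<^bsub>Graph C\<^esub> Ident (Graph C) A = f" "Ident (Graph C) B \<cdot>\<^bsub>Graph C\<^esub> f = f"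
    using idr[OF f(1)] idr[OF f(2)] idl[OF f(1)] idl[OF f(2)] by simp_all
next
  fix A B D E f g h
  assume "A \<in> Obj (Graph C)" "B \<in> Obj (Graph C)" "D \<in> Obj (Graph C)" "E \<in> Obj (Graph C)"
    "f \<in> Hom (Graph C) A B" "g \<in> Hom (Graph C) B D" "h \<in> Hom (Graph C) D E"
  then have "arr (Graph C) f A B" "arr (Graph C) g B D" "arr (Graph C) h D E" by (auto simp: arr_def)
  note f = Graph_arrD[OF this(1)] and g = Graph_arrD[OF this(2)] and h = Graph_arrD[OF this(3)]
  show "h \<cdot>\<^bsub>Graph C\<^esub> g \<cdot>\<^bsub>Graph C\<^esub> f = h \<cdot>\<^bsub>Graph C\<^esub> (g \<cdot>\<^bsub>Graph C\<^esub> f)"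
    using assoc[OF f(1) g(1) h(1)] assoc[OF f(2) g(2) h(2)] by simp
qed

text \<open>The components of a mediating arrow commute with \<open>d\<^sub>0\<close> and \<open>d\<^sub>1\<close> because the legs on vertices are jointly
  monic.\<close>

lemma Graph_pullbackI:
  assumes f: "arr (Graph C) f X Z" and g: "arr (Graph C) g Y Z"
    and p: "arr (Graph C) p P X" and q: "arr (Graph C) q P Y"
    and PE: "is_pullback C (Edges X) (Edges Y) (fst f) (fst g) (Edges P) (fst p) (fst q)"
    and PV: "is_pullback C (Verts X) (Verts Y) (snd f) (snd g) (Verts P) (snd p) (snd q)"
  shows "is_pullback (Graph C) X Y f g P p q"
proof (rule is_pullbackI[OF p q])
  note f' = Graph_arrD[OF f] and g' = Graph_arrD[OF g] and p' = Graph_arrD[OF p] and q' = Graph_arrD[OF q]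
  note E = is_pullbackD[OF PE arr_dom[OF f'(1)] arr_dom[OF g'(1)]]
    and V = is_pullbackD[OF PV arr_dom[OF f'(2)] arr_dom[OF g'(2)]]
  show "f \<cdot>\<^bsub>Graph C\<^esub> p = g \<cdot>\<^bsub>Graph C\<^esub> q" using E(3) V(3) by simp
  fix T
  show "\<exists>h. arr (Graph C) h T P \<and> p \<cdot>\<^bsub>Graph C\<^esub> h = x \<and> q \<cdot>\<^bsub>Graph C\<^esub> h = y"
    if x: "arr (Graph C) x T X" and y: "arr (Graph C) y T Y" and e: "f \<cdot>\<^bsub>Graph C\<^esub> x = g \<cdot>\<^bsub>Graph C\<^esub> y" for x y
  proof -
    note x' = Graph_arrD[OF x] and y' = Graph_arrD[OF y]
    obtain hE where hE: "\<guillemotleft>hE : Edges T \<rightarrow> Edges P\<guillemotright>" "fst p \<cdot> hE = fst x" "fst q \<cdot> hE = fst y"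
      using E(4)[OF x'(1) y'(1)] e by auto
    obtain hV where hV: "\<guillemotleft>hV : Verts T \<rightarrow> Verts P\<guillemotright>" "snd p \<cdot> hV = snd x" "snd q \<cdot> hV = snd y"
      using V(4)[OF x'(2) y'(2)] e by auto
    have "d P \<cdot> hE = hV \<cdot> d T" if d: "d \<in> {d0, d1}" for d
      by (rule pullback_ext[OF PV f'(2) g'(2) comp[OF hE(1) p'(3)[OF d]] comp[OF x'(3)[OF d] hV(1)]])
        (use assoc[OF hE(1) p'(3)[OF d] p'(2)] assoc[OF hE(1) p'(3)[OF d] q'(2)] assoc[OF x'(3)[OF d] hV(1) p'(2)]
          assoc[OF x'(3)[OF d] hV(1) q'(2)] assoc[OF hE(1) p'(1) p'(4)[OF d]] assoc[OF hE(1) q'(1) q'(4)[OF d]]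
          p'(5)[OF d] q'(5)[OF d] x'(5)[OF d] y'(5)[OF d] hE hV in simp_all)
    then have "arr (Graph C) (hE, hV) T P" using hE hV arr_dom[OF x] arr_dom[OF p] by (simp add: Graph_arr)
    then show ?thesis using hE hV by (intro exI[of _ "(hE, hV)"]) simp
  qed
  show "h = k" if h: "arr (Graph C) h T P" and k: "arr (Graph C) k T P"
    and e: "p \<cdot>\<^bsub>Graph C\<^esub> h = p \<cdot>\<^bsub>Graph C\<^esub> k" "q \<cdot>\<^bsub>Graph C\<^esub> h = q \<cdot>\<^bsub>Graph C\<^esub> k" for h k
    using pullback_ext[OF PE f'(1) g'(1) Graph_arrD(1)[OF h] Graph_arrD(1)[OF k]]
      pullback_ext[OF PV f'(2) g'(2) Graph_arrD(2)[OF h] Graph_arrD(2)[OF k]] e by (simp add: prod_eq_iff)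
qed

end

context lex
begin

lemma Graph_pullback_ex:
  assumes f: "arr (Graph C) f X Z" and g: "arr (Graph C) g Y Z"
  shows "\<exists>P p q. is_pullback (Graph C) X Y f g P p q \<and> arr (Graph C) p P X \<and> arr (Graph C) q P Y \<and>
    is_pullback C (Edges X) (Edges Y) (fst f) (fst g) (Edges P) (fst p) (fst q) \<and>
    is_pullback C (Verts X) (Verts Y) (snd f) (snd g) (Verts P) (snd p) (snd q)"
proof -
  note f' = Graph_arrD[OF f] and g' = Graph_arrD[OF g]
  obtain PE pE qE where PE: "is_pullback C (Edges X) (Edges Y) (fst f) (fst g) PE pE qE"
    using pullback_ex[OF f'(1) g'(1)] by blast
  obtain PV pV qV where PV: "is_pullback C (Verts X) (Verts Y) (snd f) (snd g) PV pV qV"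
    using pullback_ex[OF f'(2) g'(2)] by blast
  note E = is_pullbackD[OF PE arr_dom[OF f'(1)] arr_dom[OF g'(1)]]
    and V = is_pullbackD[OF PV arr_dom[OF f'(2)] arr_dom[OF g'(2)]]
  have ex: "\<exists>e. \<guillemotleft>e : PE \<rightarrow> PV\<guillemotright> \<and> pV \<cdot> e = d X \<cdot> pE \<and> qV \<cdot> e = d Y \<cdot> qE" if d: "d \<in> {d0, d1}" for d
  proof (rule V(4)[OF comp[OF E(1) f'(3)[OF d]] comp[OF E(2) g'(3)[OF d]]])
    show "snd f \<cdot> (d X \<cdot> pE) = snd g \<cdot> (d Y \<cdot> qE)"
      using assoc[OF E(1) f'(3)[OF d] f'(2)] assoc[OF E(2) g'(3)[OF d] g'(2)] f'(5)[OF d] g'(5)[OF d]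
        assoc[OF E(1) f'(1) f'(4)[OF d]] assoc[OF E(2) g'(1) f'(4)[OF d]] E(3) by simp
  qed
  obtain e0 where e0: "\<guillemotleft>e0 : PE \<rightarrow> PV\<guillemotright>" "pV \<cdot> e0 = d0 X \<cdot> pE" "qV \<cdot> e0 = d0 Y \<cdot> qE" using ex[of d0] by blast
  obtain e1 where e1: "\<guillemotleft>e1 : PE \<rightarrow> PV\<guillemotright>" "pV \<cdot> e1 = d1 X \<cdot> pE" "qV \<cdot> e1 = d1 Y \<cdot> qE" using ex[of d1] by blast
  let ?P = "\<lparr>Edges = PE, Verts = PV, d0 = e0, d1 = e1\<rparr>"
  have p: "arr (Graph C) (pE, pV) ?P X" and q: "arr (Graph C) (qE, qV) ?P Y"
    using arr_dom[OF f] arr_dom[OF g] e0 e1 E V by (simp_all add: Graph_arr Graph_obj)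
  show ?thesis
    using Graph_pullbackI[OF f g p q] PE PV p q
    by (intro exI[of _ ?P] exI[of _ "(pE, pV)"] exI[of _ "(qE, qV)"]) simp
qed

lemma const_graph_arr:
  assumes X: "X \<in> Obj (Graph C)" and A: "A \<in> Obj C"
  shows "arr (Graph C) f X (const_graph C A) \<longleftrightarrow> \<guillemotleft>snd f : Verts X \<rightarrow> A\<guillemotright> \<and> fst f = snd f \<cdot> d0 X \<and> fst f = snd f \<cdot> d1 X"
  using X comp[of "d0 X" "Edges X" "Verts X" "snd f" A] ident[OF A] idl
  by (auto simp: Graph_arr Graph_obj const_graph_def)

lemma const_graph_obj: "A \<in> Obj C \<Longrightarrow> const_graph C A \<in> Obj (Graph C)"
  using ident by (simp add: Graph_obj const_graph_def)

lemma Graph_terminal: "is_terminal (Graph C) (const_graph C (Term C))"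
proof (rule is_terminalI[OF const_graph_obj[OF Term_obj]])
  fix X assume X: "X \<in> Obj (Graph C)"
  then have d: "\<guillemotleft>d0 X : Edges X \<rightarrow> Verts X\<guillemotright>" "\<guillemotleft>d1 X : Edges X \<rightarrow> Verts X\<guillemotright>" by (auto simp: Graph_obj)
  note b = bang[OF arr_cod[OF d(1)]]
  have "arr (Graph C) (bang C (Verts X) \<cdot> d0 X, bang C (Verts X)) X (const_graph C (Term C))"
    unfolding const_graph_arr[OF X Term_obj] using b bang_eq[OF comp[OF d(1) b] comp[OF d(2) b]] by simp
  then show "\<exists>f. arr (Graph C) f X (const_graph C (Term C))" by blast
next
  fix X f g assume f: "arr (Graph C) f X (const_graph C (Term C))" and g: "arr (Graph C) g X (const_graph C (Term C))"
  note X = arr_dom[OF f]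
  have "snd f = snd g" using f g bang_eq unfolding const_graph_arr[OF X Term_obj] by blast
  then show "f = g" using f g unfolding const_graph_arr[OF X Term_obj] by (simp add: prod_eq_iff)
qed

lemma Graph_lex: "lex (Graph C)"
proof -
  interpret G: category "Graph C" by (rule Graph_category)
  show ?thesis by unfold_locales (use Graph_terminal Graph_pullback_ex in blast)+
qed

text \<open>Every pullback of graphs is isomorphic to one that is built componentwise.\<close>

lemma Graph_pullbackD:
  assumes f: "arr (Graph C) f X Z" and g: "arr (Graph C) g Y Z" and P: "is_pullback (Graph C) X Y f g P p q"
  shows "is_pullback C (Edges X) (Edges Y) (fst f) (fst g) (Edges P) (fst p) (fst q)"
    and "is_pullback C (Verts X) (Verts Y) (snd f) (snd g) (Verts P) (snd p) (snd q)"
proof -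
  interpret G: category "Graph C" by (rule Graph_category)
  obtain P' p' q' where P': "is_pullback (Graph C) X Y f g P' p' q'"
    and E: "is_pullback C (Edges X) (Edges Y) (fst f) (fst g) (Edges P') (fst p') (fst q')"
    and V: "is_pullback C (Verts X) (Verts Y) (snd f) (snd g) (Verts P') (snd p') (snd q')"
    using Graph_pullback_ex[OF f g] by blast
  obtain \<phi> \<psi> where \<phi>: "arr (Graph C) \<phi> P P'" and \<psi>: "arr (Graph C) \<psi> P' P"
    and inv: "\<psi> \<cdot>\<^bsub>Graph C\<^esub> \<phi> = Ident (Graph C) P" "\<phi> \<cdot>\<^bsub>Graph C\<^esub> \<psi> = Ident (Graph C) P'"
    and leg: "p' \<cdot>\<^bsub>Graph C\<^esub> \<phi> = p" "q' \<cdot>\<^bsub>Graph C\<^esub> \<phi> = q"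
    using G.pullback_iso[OF P P' f g] by blast
  show "is_pullback C (Edges X) (Edges Y) (fst f) (fst g) (Edges P) (fst p) (fst q)"
    by (rule pullback_transfer[OF E Graph_arrD(1)[OF f] Graph_arrD(1)[OF g] Graph_arrD(1)[OF \<phi>] Graph_arrD(1)[OF \<psi>]])
      (use inv leg in auto)
  show "is_pullback C (Verts X) (Verts Y) (snd f) (snd g) (Verts P) (snd p) (snd q)"
    by (rule pullback_transfer[OF V Graph_arrD(2)[OF f] Graph_arrD(2)[OF g] Graph_arrD(2)[OF \<phi>] Graph_arrD(2)[OF \<psi>]])
      (use inv leg in auto)
qed

lemma edges_lex_functor: "lex_functor (Graph C) C Edges fst"
  and verts_lex_functor: "lex_functor (Graph C) C Verts snd"
proof -
  interpret G: lex "Graph C" by (rule Graph_lex)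
  have t: "is_terminal C (Edges Z) \<and> is_terminal C (Verts Z)" if Z: "is_terminal (Graph C) Z" for Z
  proof -
    have o: "Z \<in> Obj (Graph C)" using Z by (simp add: is_terminal_def)
    obtain w where w: "arr (Graph C) w (const_graph C (Term C)) Z"
      using is_terminalD(1)[OF Z const_graph_obj[OF Term_obj]] by blast
    obtain z where z: "arr (Graph C) z Z (const_graph C (Term C))" using is_terminalD(1)[OF Graph_terminal o] by blast
    have "w \<cdot>\<^bsub>Graph C\<^esub> z = Ident (Graph C) Z"
      by (rule is_terminalD(2)[OF Z o G.comp[OF z w] G.ident[OF o]])
    then show ?thesis
      using terminal_transfer[OF is_terminal_Term, of "fst w" "Edges Z" "fst z"]
        terminal_transfer[OF is_terminal_Term, of "snd w" "Verts Z" "snd z"] Graph_arrD(1,2)[OF w] Graph_arrD(1,2)[OF z]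
      by (simp add: const_graph_def)
  qed
  show "lex_functor (Graph C) C Edges fst"
    by unfold_locales (use Graph_arrD(1) Graph_pullbackD(1) t in auto)
  show "lex_functor (Graph C) C Verts snd"
    by unfold_locales (use Graph_arrD(2) Graph_pullbackD(2) t in auto)
qed

end

section \<open>Coequalisers of graphs\<close>

context lex
begin

lemma product_iso:
  assumes o: "A \<in> Obj C" "B \<in> Obj C" and P: "is_product C A B P p q" and P': "is_product C A B P' p' q'"
  shows "\<exists>\<phi> \<psi>. \<guillemotleft>\<phi> : P \<rightarrow> P'\<guillemotright> \<and> \<guillemotleft>\<psi> : P' \<rightarrow> P\<guillemotright> \<and> \<psi> \<cdot> \<phi> = Ident C P \<and> \<phi> \<cdot> \<psi> = Ident C P' \<and>
    p' \<cdot> \<phi> = p \<and> q' \<cdot> \<phi> = q \<and> p \<cdot> \<psi> = p' \<and> q \<cdot> \<psi> = q'"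
  using pullback_iso[OF _ _ bang[OF o(1)] bang[OF o(2)]] P P'
  unfolding product_iff_pullback[OF o is_terminal_Term bang[OF o(1)] bang[OF o(2)]] by blast

text \<open>The components of a chosen product of graphs are products in \<open>C\<close>, but not necessarily the chosen ones;
  hence this version for arbitrary product cones.\<close>

lemma product_preserves_coequaliser_cone:
  assumes ppc: "product_preserves_coequalisers C" and D: "D \<in> Obj C"
    and f: "\<guillemotleft>f : A \<rightarrow> B\<guillemotright>" and g: "\<guillemotleft>g : A \<rightarrow> B\<guillemotright>" and q: "is_coequaliser C A B f g Z q"
    and PA: "is_product C D A PA a1 a2" and PB: "is_product C D B PB b1 b2" and PZ: "is_product C D Z PZ z1 z2"
    and f': "\<guillemotleft>f' : PA \<rightarrow> PB\<guillemotright>" "b1 \<cdot> f' = a1" "b2 \<cdot> f' = f \<cdot> a2"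
    and g': "\<guillemotleft>g' : PA \<rightarrow> PB\<guillemotright>" "b1 \<cdot> g' = a1" "b2 \<cdot> g' = g \<cdot> a2"
    and q': "\<guillemotleft>q' : PB \<rightarrow> PZ\<guillemotright>" "z1 \<cdot> q' = b1" "z2 \<cdot> q' = q \<cdot> b2"
  shows "is_coequaliser C PA PB f' g' PZ q'"
proof -
  note A = arr_dom[OF f] and B = arr_cod[OF f] note qD = is_coequaliserD[OF q B] note Z = arr_cod[OF qD(1)]
  note a = is_productD[OF PA D A] and b = is_productD[OF PB D B] and z = is_productD[OF PZ D Z]
  obtain \<alpha>A \<beta>A where \<alpha>A: "\<guillemotleft>\<alpha>A : Prod C D A \<rightarrow> PA\<guillemotright>" "a1 \<cdot> \<alpha>A = pr1 C D A" "a2 \<cdot> \<alpha>A = pr2 C D A"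
    using product_iso[OF D A is_product_Prod[OF D A] PA] by blast
  obtain \<alpha>B \<beta>B where \<alpha>B: "\<guillemotleft>\<alpha>B : Prod C D B \<rightarrow> PB\<guillemotright>" "b1 \<cdot> \<alpha>B = pr1 C D B" "b2 \<cdot> \<alpha>B = pr2 C D B"
    and \<beta>B: "\<guillemotleft>\<beta>B : PB \<rightarrow> Prod C D B\<guillemotright>" "pr1 C D B \<cdot> \<beta>B = b1" "pr2 C D B \<cdot> \<beta>B = b2" and \<alpha>\<beta>B: "\<alpha>B \<cdot> \<beta>B = Ident C PB"
    using product_iso[OF D B is_product_Prod[OF D B] PB] by blast
  obtain \<alpha>Z \<beta>Z where \<alpha>Z: "\<guillemotleft>\<alpha>Z : Prod C D Z \<rightarrow> PZ\<guillemotright>" "z1 \<cdot> \<alpha>Z = pr1 C D Z" "z2 \<cdot> \<alpha>Z = pr2 C D Z"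
    and \<beta>Z: "\<guillemotleft>\<beta>Z : PZ \<rightarrow> Prod C D Z\<guillemotright>" "pr1 C D Z \<cdot> \<beta>Z = z1" "pr2 C D Z \<cdot> \<beta>Z = z2" and \<alpha>\<beta>Z: "\<alpha>Z \<cdot> \<beta>Z = Ident C PZ"
    using product_iso[OF D Z is_product_Prod[OF D Z] PZ] by blast
  note i = ident[OF D]
  note pA = pr1[OF D A] pr2[OF D A] and pB = pr1[OF D B] pr2[OF D B]
  have nat: "h' \<cdot> \<alpha>A = \<alpha>B \<cdot> prod_map C D D A B (Ident C D) h"
    if h: "\<guillemotleft>h : A \<rightarrow> B\<guillemotright>" and h': "\<guillemotleft>h' : PA \<rightarrow> PB\<guillemotright>" "b1 \<cdot> h' = a1" "b2 \<cdot> h' = h \<cdot> a2" for h h'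
  proof -
    note H = prod_map[OF i h]
    have H': "pr1 C D B \<cdot> prod_map C D D A B (Ident C D) h = pr1 C D A"
      "pr2 C D B \<cdot> prod_map C D D A B (Ident C D) h = h \<cdot> pr2 C D A"
      unfolding prod_map_def idl[OF pA(1)] pr1_tuple[OF pA(1) comp[OF pA(2) h]] pr2_tuple[OF pA(1) comp[OF pA(2) h]] by auto
    show ?thesis
      by (rule product_ext[OF PB D B comp[OF \<alpha>A(1) h'(1)] comp[OF H \<alpha>B(1)]])
        (use assoc[OF \<alpha>A(1) h'(1) b(1)] assoc[OF \<alpha>A(1) h'(1) b(2)] assoc[OF H \<alpha>B(1) b(1)] assoc[OF H \<alpha>B(1) b(2)]
          h'(2,3) \<alpha>A \<alpha>B(2,3) H' assoc[OF \<alpha>A(1) a(2) h] in simp_all)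
  qed
  note nf = nat[OF f f'] and ng = nat[OF g g']
  let ?F = "prod_map C D D A B (Ident C D) f" and ?G = "prod_map C D D A B (Ident C D) g"
  let ?Q = "prod_map C D D B Z (Ident C D) q"
  note F = prod_map[OF i f] and G = prod_map[OF i g] and Q = prod_map[OF i qD(1)]
  have Q': "pr1 C D Z \<cdot> ?Q = pr1 C D B" "pr2 C D Z \<cdot> ?Q = q \<cdot> pr2 C D B"
    unfolding prod_map_def idl[OF pB(1)] pr1_tuple[OF pB(1) comp[OF pB(2) qD(1)]] pr2_tuple[OF pB(1) comp[OF pB(2) qD(1)]] by auto
  have nq: "q' \<cdot> \<alpha>B = \<alpha>Z \<cdot> ?Q"
    by (rule product_ext[OF PZ D Z comp[OF \<alpha>B(1) q'(1)] comp[OF Q \<alpha>Z(1)]])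
      (use assoc[OF \<alpha>B(1) q'(1) z(1)] assoc[OF \<alpha>B(1) q'(1) z(2)] assoc[OF Q \<alpha>Z(1) z(1)] assoc[OF Q \<alpha>Z(1) z(2)]
        q'(2,3) \<alpha>Z \<alpha>B Q' assoc[OF \<alpha>B(1) b(2) qD(1)] in simp_all)
  note pZ = pr1[OF D Z] pr2[OF D Z]
  have nq': "\<beta>Z \<cdot> q' = ?Q \<cdot> \<beta>B"
    by (rule prod_ext[OF D Z comp[OF q'(1) \<beta>Z(1)] comp[OF \<beta>B(1) Q]])
      (use assoc[OF q'(1) \<beta>Z(1) pZ(1)] assoc[OF q'(1) \<beta>Z(1) pZ(2)] assoc[OF \<beta>B(1) Q pZ(1)] assoc[OF \<beta>B(1) Q pZ(2)]
        q'(2,3) \<beta>Z \<beta>B Q' assoc[OF \<beta>B(1) pB(2) qD(1)] in simp_all)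
  have co: "is_coequaliser C (Prod C D A) (Prod C D B) ?F ?G (Prod C D Z) ?Q"
    using ppc D A B f g q unfolding product_preserves_coequalisers_def arr_def by blast
  show ?thesis
  proof (rule is_coequaliserI[OF q'(1)])
    show "q' \<cdot> f' = q' \<cdot> g'"
      by (rule product_ext[OF PZ D Z comp[OF f'(1) q'(1)] comp[OF g'(1) q'(1)]])
        (use assoc[OF f'(1) q'(1) z(1)] assoc[OF f'(1) q'(1) z(2)] assoc[OF g'(1) q'(1) z(1)] assoc[OF g'(1) q'(1) z(2)]
          q' f' g' assoc[OF f'(1) b(2) qD(1)] assoc[OF g'(1) b(2) qD(1)]
          assoc[OF a(2) f qD(1)] assoc[OF a(2) g qD(1)] qD(2) in simp_all)
    fix T
    show "\<exists>k. \<guillemotleft>k : PZ \<rightarrow> T\<guillemotright> \<and> k \<cdot> q' = m" if m: "\<guillemotleft>m : PB \<rightarrow> T\<guillemotright>" and e: "m \<cdot> f' = m \<cdot> g'" for m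
    proof -
      have "(m \<cdot> \<alpha>B) \<cdot> ?F = (m \<cdot> \<alpha>B) \<cdot> ?G"
        using assoc[OF F \<alpha>B(1) m] assoc[OF G \<alpha>B(1) m] nf ng assoc[OF \<alpha>A(1) f'(1) m] assoc[OF \<alpha>A(1) g'(1) m] e by simp
      then obtain k where k: "\<guillemotleft>k : Prod C D Z \<rightarrow> T\<guillemotright>" "k \<cdot> ?Q = m \<cdot> \<alpha>B"
        using is_coequaliserD(3)[OF co arr_dom[OF \<alpha>B(1)] comp[OF \<alpha>B(1) m]] by blast
      have "(k \<cdot> \<beta>Z) \<cdot> q' = (k \<cdot> ?Q) \<cdot> \<beta>B" using assoc[OF q'(1) \<beta>Z(1) k(1)] nq' assoc[OF \<beta>B(1) Q k(1)] by simp
      also have "\<dots> = m" using k(2) assoc[OF \<beta>B(1) \<alpha>B(1) m] \<alpha>\<beta>B idr[OF m] by simp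
      finally show ?thesis using comp[OF \<beta>Z(1) k(1)] by blast
    qed
    show "h = k" if h: "\<guillemotleft>h : PZ \<rightarrow> T\<guillemotright>" and k: "\<guillemotleft>k : PZ \<rightarrow> T\<guillemotright>" and e: "h \<cdot> q' = k \<cdot> q'" for h k
    proof -
      have "h \<cdot> \<alpha>Z = k \<cdot> \<alpha>Z"
        by (rule coequaliser_ext[OF co F G comp[OF \<alpha>Z(1) h] comp[OF \<alpha>Z(1) k]])
          (use assoc[OF Q \<alpha>Z(1) h] assoc[OF Q \<alpha>Z(1) k] nq assoc[OF \<alpha>B(1) q'(1) h] assoc[OF \<alpha>B(1) q'(1) k] e in simp)
      then show ?thesis
        using assoc[OF \<beta>Z(1) \<alpha>Z(1) h] assoc[OF \<beta>Z(1) \<alpha>Z(1) k] \<alpha>\<beta>Z idr[OF h] idr[OF k] by metis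
    qed
  qed
qed

end

text \<open>Compatibility of the components of an induced arrow with \<open>d\<^sub>0\<close> and \<open>d\<^sub>1\<close> can be checked on edges of \<open>B\<close>,
  since \<open>fst q\<close> is epic.\<close>

lemma (in category) Graph_coequaliserI:
  assumes f: "arr (Graph C) f A B" and g: "arr (Graph C) g A B" and q: "arr (Graph C) q B Z"
    and E: "is_coequaliser C (Edges A) (Edges B) (fst f) (fst g) (Edges Z) (fst q)"
    and V: "is_coequaliser C (Verts A) (Verts B) (snd f) (snd g) (Verts Z) (snd q)"
  shows "is_coequaliser (Graph C) A B f g Z q"
proof (rule is_coequaliserI[OF q])
  note f' = Graph_arrD[OF f] and g' = Graph_arrD[OF g] and q' = Graph_arrD[OF q]
  note ED = is_coequaliserD[OF E arr_dom[OF q'(1)]] and VD = is_coequaliserD[OF V arr_dom[OF q'(2)]]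
  show "q \<cdot>\<^bsub>Graph C\<^esub> f = q \<cdot>\<^bsub>Graph C\<^esub> g" using ED(2) VD(2) by simp
  fix T
  show "\<exists>k. arr (Graph C) k Z T \<and> k \<cdot>\<^bsub>Graph C\<^esub> q = h"
    if h: "arr (Graph C) h B T" and e: "h \<cdot>\<^bsub>Graph C\<^esub> f = h \<cdot>\<^bsub>Graph C\<^esub> g" for h
  proof -
    note h' = Graph_arrD[OF h]
    obtain kE where kE: "\<guillemotleft>kE : Edges Z \<rightarrow> Edges T\<guillemotright>" "kE \<cdot> fst q = fst h" using ED(3)[OF h'(1)] e by auto
    obtain kV where kV: "\<guillemotleft>kV : Verts Z \<rightarrow> Verts T\<guillemotright>" "kV \<cdot> snd q = snd h" using VD(3)[OF h'(2)] e by auto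
    have "d T \<cdot> kE = kV \<cdot> d Z" if d: "d \<in> {d0, d1}" for d
      by (rule coequaliser_ext[OF E f'(1) g'(1) comp[OF kE(1) h'(4)[OF d]] comp[OF q'(4)[OF d] kV(1)]])
        (use assoc[OF q'(1) kE(1) h'(4)[OF d]] kE(2) assoc[OF q'(1) q'(4)[OF d] kV(1)] q'(5)[OF d]
          assoc[OF q'(3)[OF d] q'(2) kV(1)] kV(2) h'(5)[OF d] in simp)
    then have "arr (Graph C) (kE, kV) Z T" using kE kV arr_cod[OF q] arr_cod[OF h] by (simp add: Graph_arr)
    then show ?thesis using kE kV by (intro exI[of _ "(kE, kV)"]) simp
  qed
  show "h = k" if h: "arr (Graph C) h Z T" and k: "arr (Graph C) k Z T" and e: "h \<cdot>\<^bsub>Graph C\<^esub> q = k \<cdot>\<^bsub>Graph C\<^esub> q" for h k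
    using coequaliser_ext[OF E f'(1) g'(1) Graph_arrD(1)[OF h] Graph_arrD(1)[OF k]]
      coequaliser_ext[OF V f'(2) g'(2) Graph_arrD(2)[OF h] Graph_arrD(2)[OF k]] e by (simp add: prod_eq_iff)
qed

lemma (in category) Graph_coequaliser_ex:
  assumes f: "arr (Graph C) f A B" and g: "arr (Graph C) g A B"
    and E: "is_coequaliser C (Edges A) (Edges B) (fst f) (fst g) ZE qE"
    and V: "is_coequaliser C (Verts A) (Verts B) (snd f) (snd g) ZV qV"
  shows "\<exists>Z. Edges Z = ZE \<and> Verts Z = ZV \<and> arr (Graph C) (qE, qV) B Z \<and>
    is_coequaliser (Graph C) A B f g Z (qE, qV)"
proof -
  note f' = Graph_arrD[OF f] and g' = Graph_arrD[OF g]
  note ED = is_coequaliserD[OF E arr_cod[OF f'(1)]] and VD = is_coequaliserD[OF V arr_cod[OF f'(2)]]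
  have ex: "\<exists>e. \<guillemotleft>e : ZE \<rightarrow> ZV\<guillemotright> \<and> e \<cdot> qE = qV \<cdot> d B" if d: "d \<in> {d0, d1}" for d
  proof (rule ED(3)[OF comp[OF f'(4)[OF d] VD(1)]])
    show "(qV \<cdot> d B) \<cdot> fst f = (qV \<cdot> d B) \<cdot> fst g"
      using assoc[OF f'(1) f'(4)[OF d] VD(1)] assoc[OF g'(1) f'(4)[OF d] VD(1)] f'(5)[OF d] g'(5)[OF d]
        assoc[OF f'(3)[OF d] f'(2) VD(1)] assoc[OF f'(3)[OF d] g'(2) VD(1)] VD(2) by simp
  qed
  obtain e0 where e0: "\<guillemotleft>e0 : ZE \<rightarrow> ZV\<guillemotright>" "e0 \<cdot> qE = qV \<cdot> d0 B" using ex[of d0] by blast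
  obtain e1 where e1: "\<guillemotleft>e1 : ZE \<rightarrow> ZV\<guillemotright>" "e1 \<cdot> qE = qV \<cdot> d1 B" using ex[of d1] by blast
  let ?Z = "\<lparr>Edges = ZE, Verts = ZV, d0 = e0, d1 = e1\<rparr>"
  have q: "arr (Graph C) (qE, qV) B ?Z"
    using arr_cod[OF f] e0 e1 ED VD by (simp add: Graph_arr Graph_obj)
  show ?thesis using Graph_coequaliserI[OF f g q] q E V by (intro exI[of _ ?Z]) simp
qed

lemma (in category) has_coequalisersD:
  "\<lbrakk>has_coequalisers C; \<guillemotleft>f : A \<rightarrow> B\<guillemotright>; \<guillemotleft>g : A \<rightarrow> B\<guillemotright>\<rbrakk> \<Longrightarrow> \<exists>Z q. is_coequaliser C A B f g Z q"
  unfolding has_coequalisers_def arr_def by blast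

lemma (in category) Graph_coequaliserD:
  assumes co: "has_coequalisers C" and f: "arr (Graph C) f A B" and g: "arr (Graph C) g A B"
    and q: "is_coequaliser (Graph C) A B f g Z q"
  shows "is_coequaliser C (Edges A) (Edges B) (fst f) (fst g) (Edges Z) (fst q)"
    and "is_coequaliser C (Verts A) (Verts B) (snd f) (snd g) (Verts Z) (snd q)"
proof -
  interpret G: category "Graph C" by (rule Graph_category)
  note f' = Graph_arrD[OF f] and g' = Graph_arrD[OF g]
  obtain ZE qE where E: "is_coequaliser C (Edges A) (Edges B) (fst f) (fst g) ZE qE"
    using has_coequalisersD[OF co f'(1) g'(1)] by blast
  obtain ZV qV where V: "is_coequaliser C (Verts A) (Verts B) (snd f) (snd g) ZV qV"
    using has_coequalisersD[OF co f'(2) g'(2)] by blast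
  obtain Z' where Z': "Edges Z' = ZE" "Verts Z' = ZV" "is_coequaliser (Graph C) A B f g Z' (qE, qV)"
    using Graph_coequaliser_ex[OF f g E V] by blast
  obtain \<phi> \<psi> where \<phi>: "arr (Graph C) \<phi> Z Z'" and \<psi>: "arr (Graph C) \<psi> Z' Z"
    and inv: "\<psi> \<cdot>\<^bsub>Graph C\<^esub> \<phi> = Ident (Graph C) Z" "\<phi> \<cdot>\<^bsub>Graph C\<^esub> \<psi> = Ident (Graph C) Z'"
    and leg: "\<psi> \<cdot>\<^bsub>Graph C\<^esub> (qE, qV) = q"
    using G.coequaliser_iso[OF q Z'(3) f g] by blast
  show "is_coequaliser C (Edges A) (Edges B) (fst f) (fst g) (Edges Z) (fst q)"
    by (rule coequaliser_transfer[OF E f'(1) g'(1), of "fst \<phi>" _ "fst \<psi>"])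
      (use Graph_arrD(1)[OF \<phi>] Graph_arrD(1)[OF \<psi>] Z' inv leg in auto)
  show "is_coequaliser C (Verts A) (Verts B) (snd f) (snd g) (Verts Z) (snd q)"
    by (rule coequaliser_transfer[OF V f'(2) g'(2), of "snd \<phi>" _ "snd \<psi>"])
      (use Graph_arrD(2)[OF \<phi>] Graph_arrD(2)[OF \<psi>] Z' inv leg in auto)
qed

context lex
begin

lemma Graph_product_preserves_coequalisers:
  assumes co: "has_coequalisers C" and ppc: "product_preserves_coequalisers C"
  shows "product_preserves_coequalisers (Graph C)"
  unfolding product_preserves_coequalisers_def
proof (intro ballI allI impI)
  let ?G = "Graph C"
  interpret G: lex ?G by (rule Graph_lex)
  interpret E: lex_functor ?G C Edges fst by (rule edges_lex_functor)
  interpret V: lex_functor ?G C Verts snd by (rule verts_lex_functor)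
  fix D A B f g Z q
  assume D: "D \<in> Obj ?G" and "A \<in> Obj ?G" "B \<in> Obj ?G" "f \<in> Hom ?G A B" "g \<in> Hom ?G A B"
    and q: "is_coequaliser ?G A B f g Z q"
  then have f: "arr ?G f A B" and g: "arr ?G g A B" by (auto simp: arr_def)
  note A = arr_dom[OF f] and B = arr_cod[OF f]
  note qa = is_coequaliserD(1)[OF q B] note Z = arr_cod[OF qa]
  note i = G.ident[OF D]
  note F = G.prod_map[OF i f] and G' = G.prod_map[OF i g] and Q = G.prod_map[OF i qa]
  note PA = G.is_product_Prod[OF D A] and PB = G.is_product_Prod[OF D B] and PZ = G.is_product_Prod[OF D Z]
  have legs: "pr1 ?G D Y \<cdot>\<^bsub>?G\<^esub> prod_map ?G D D X Y (Ident ?G D) h = pr1 ?G D X"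
    "pr2 ?G D Y \<cdot>\<^bsub>?G\<^esub> prod_map ?G D D X Y (Ident ?G D) h = h \<cdot>\<^bsub>?G\<^esub> pr2 ?G D X" if h: "arr ?G h X Y" for h X Y
  proof -
    note p = G.pr1[OF D arr_dom[OF h]] G.pr2[OF D arr_dom[OF h]]
    show "pr1 ?G D Y \<cdot>\<^bsub>?G\<^esub> prod_map ?G D D X Y (Ident ?G D) h = pr1 ?G D X"
      "pr2 ?G D Y \<cdot>\<^bsub>?G\<^esub> prod_map ?G D D X Y (Ident ?G D) h = h \<cdot>\<^bsub>?G\<^esub> pr2 ?G D X"
      unfolding prod_map_def G.idl[OF p(1)] by (rule G.pr1_tuple[OF p(1) G.comp[OF p(2) h]], rule G.pr2_tuple[OF p(1) G.comp[OF p(2) h]])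
  qed
  show "is_coequaliser ?G (Prod ?G D A) (Prod ?G D B) (prod_map ?G D D A B (Ident ?G D) f)
      (prod_map ?G D D A B (Ident ?G D) g) (Prod ?G D Z) (prod_map ?G D D B Z (Ident ?G D) q)"
  proof (rule Graph_coequaliserI[OF F G' Q])
    show "is_coequaliser C (Edges (Prod ?G D A)) (Edges (Prod ?G D B)) (fst (prod_map ?G D D A B (Ident ?G D) f))
      (fst (prod_map ?G D D A B (Ident ?G D) g)) (Edges (Prod ?G D Z)) (fst (prod_map ?G D D B Z (Ident ?G D) q))"
      by (rule product_preserves_coequaliser_cone[OF ppc E.F_obj[OF D] Graph_arrD(1)[OF f] Graph_arrD(1)[OF g]
            Graph_coequaliserD(1)[OF co f g q] E.F_product[OF D A PA] E.F_product[OF D B PB] E.F_product[OF D Z PZ]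
            Graph_arrD(1)[OF F] _ _ Graph_arrD(1)[OF G'] _ _ Graph_arrD(1)[OF Q]])
        (use legs[OF f] legs[OF g] legs[OF qa] in \<open>simp_all add: prod_eq_iff\<close>)
    show "is_coequaliser C (Verts (Prod ?G D A)) (Verts (Prod ?G D B)) (snd (prod_map ?G D D A B (Ident ?G D) f))
      (snd (prod_map ?G D D A B (Ident ?G D) g)) (Verts (Prod ?G D Z)) (snd (prod_map ?G D D B Z (Ident ?G D) q))"
      by (rule product_preserves_coequaliser_cone[OF ppc V.F_obj[OF D] Graph_arrD(2)[OF f] Graph_arrD(2)[OF g]
            Graph_coequaliserD(2)[OF co f g q] V.F_product[OF D A PA] V.F_product[OF D B PB] V.F_product[OF D Z PZ]
            Graph_arrD(2)[OF F] _ _ Graph_arrD(2)[OF G'] _ _ Graph_arrD(2)[OF Q]])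
        (use legs[OF f] legs[OF g] legs[OF qa] in \<open>simp_all add: prod_eq_iff\<close>)
  qed
qed

section \<open>Graphs of groups and their components\<close>

lemma const_group_carr [simp]: "Carr (const_group C K) = const_graph C (Carr K)"
  by (simp add: const_group_def Let_def)

context
  fixes K assumes K: "group_object C K"
begin

interpretation G: lex "Graph C" by (rule Graph_lex)

lemma const_arrD:
  assumes x: "arr (Graph C) x T (const_graph C (Carr K))"
  shows "\<guillemotleft>fst x : Edges T \<rightarrow> Carr K\<guillemotright>" "\<guillemotleft>snd x : Verts T \<rightarrow> Carr K\<guillemotright>"
    "d \<in> {d0, d1} \<Longrightarrow> \<guillemotleft>d T : Edges T \<rightarrow> Verts T\<guillemotright>" "d \<in> {d0, d1} \<Longrightarrow> snd x \<cdot> d T = fst x"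
  using Graph_arrD(1-3)[OF x] x unfolding const_graph_arr[OF arr_dom[OF x] group_carr[OF K]]
  by (auto simp: const_graph_def)

lemma const_arrI:
  assumes "T \<in> Obj (Graph C)" "\<guillemotleft>y : Verts T \<rightarrow> Carr K\<guillemotright>" "\<And>d. d \<in> {d0, d1} \<Longrightarrow> y \<cdot> d T = x"
  shows "arr (Graph C) (x, y) T (const_graph C (Carr K))"
  unfolding const_graph_arr[OF assms(1) group_carr[OF K]] using assms(2) assms(3)[of d0] assms(3)[of d1] by simp

lemma const_gmul_arr:
  assumes x: "arr (Graph C) x T (const_graph C (Carr K))" and y: "arr (Graph C) y T (const_graph C (Carr K))"
  shows "arr (Graph C) (gmul C K (Edges T) (fst x) (fst y), gmul C K (Verts T) (snd x) (snd y)) T (const_graph C (Carr K))"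
proof (rule const_arrI[OF arr_dom[OF x] gmul[OF K const_arrD(2)[OF x] const_arrD(2)[OF y]]])
  fix d :: "('a, 'b) igraph \<Rightarrow> 'b" assume d: "d \<in> {d0, d1}"
  show "gmul C K (Verts T) (snd x) (snd y) \<cdot> d T = gmul C K (Edges T) (fst x) (fst y)"
    unfolding gmul_comp[OF K const_arrD(2)[OF x] const_arrD(2)[OF y] const_arrD(3)[OF x d]]
      const_arrD(4)[OF x d] const_arrD(4)[OF y d] ..
qed

lemma const_ops:
  shows const_Mul: "arr (Graph C) (Mul (const_group C K))
      (Prod (Graph C) (const_graph C (Carr K)) (const_graph C (Carr K))) (const_graph C (Carr K))"
    and const_Inv: "arr (Graph C) (Inv (const_group C K)) (const_graph C (Carr K)) (const_graph C (Carr K))"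
    and const_One: "arr (Graph C) (One (const_group C K)) (Term (Graph C)) (const_graph C (Carr K))"
    and const_gmul: "\<lbrakk>arr (Graph C) x T (const_graph C (Carr K)); arr (Graph C) y T (const_graph C (Carr K))\<rbrakk> \<Longrightarrow>
      gmul (Graph C) (const_group C K) T x y = (gmul C K (Edges T) (fst x) (fst y), gmul C K (Verts T) (snd x) (snd y))"
    and const_gone: "T \<in> Obj (Graph C) \<Longrightarrow> gone (Graph C) (const_group C K) T = (gone C K (Edges T), gone C K (Verts T))"
proof -
  let ?G = "Graph C" and ?A = "const_graph C (Carr K)" let ?P = "Prod ?G ?A ?A"
  note A = const_graph_obj[OF group_carr[OF K]]
  note p = G.pr1[OF A A] G.pr2[OF A A]
  let ?m = "(gmul C K (Edges ?P) (fst (pr1 ?G ?A ?A)) (fst (pr2 ?G ?A ?A)), gmul C K (Verts ?P) (snd (pr1 ?G ?A ?A)) (snd (pr2 ?G ?A ?A)))"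
  have Mul: "Mul (const_group C K) = ?m" and Inv: "Inv (const_group C K) = (Inv K, Inv K)"
    and One: "One (const_group C K) = (gone C K (Edges (Term ?G)), gone C K (Verts (Term ?G)))"
    by (simp_all add: const_group_def Let_def)
  show "arr ?G (Mul (const_group C K)) ?P ?A" unfolding Mul by (rule const_gmul_arr[OF p])
  show "arr ?G (Inv (const_group C K)) ?A ?A" unfolding Inv
    by (rule const_arrI[OF A]) (use group_Inv[OF K] idr[OF group_Inv[OF K]] in \<open>auto simp: const_graph_def\<close>)
  have U: "Term ?G \<in> Obj ?G" by (rule G.Term_obj)
  have oT: "Verts T \<in> Obj C" "Edges T \<in> Obj C" if "T \<in> Obj ?G" for T
    using that by (auto simp: Graph_obj dest: arr_dom arr_cod)
  show "arr ?G (One (const_group C K)) (Term ?G) ?A" unfolding One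
    by (rule const_arrI[OF U gone[OF K oT(1)[OF U]]]) (rule gone_comp[OF K Graph_d[OF U]])
  show "gmul ?G (const_group C K) T x y = (gmul C K (Edges T) (fst x) (fst y), gmul C K (Verts T) (snd x) (snd y))"
    if x: "arr ?G x T ?A" and y: "arr ?G y T ?A"
  proof -
    note t = G.tuple[OF x y] note t' = Graph_arrD[OF t]
    have e: "fst (pr1 ?G ?A ?A) \<cdot> fst (tuple ?G T ?A ?A x y) = fst x" "snd (pr1 ?G ?A ?A) \<cdot> snd (tuple ?G T ?A ?A x y) = snd x"
      "fst (pr2 ?G ?A ?A) \<cdot> fst (tuple ?G T ?A ?A x y) = fst y" "snd (pr2 ?G ?A ?A) \<cdot> snd (tuple ?G T ?A ?A x y) = snd y"
      using G.pr1_tuple[OF x y] G.pr2_tuple[OF x y] by (simp_all add: prod_eq_iff)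
    show ?thesis
      using gmul_comp[OF K const_arrD(1)[OF p(1)] const_arrD(1)[OF p(2)] t'(1)]
        gmul_comp[OF K const_arrD(2)[OF p(1)] const_arrD(2)[OF p(2)] t'(2)] e
      by (simp add: gmul_def[of ?G] Mul)
  qed
  show "gone ?G (const_group C K) T = (gone C K (Edges T), gone C K (Verts T))" if T: "T \<in> Obj ?G"
    using gone_comp[OF K Graph_arrD(1)[OF G.bang[OF T]]] gone_comp[OF K Graph_arrD(2)[OF G.bang[OF T]]]
    by (simp add: gone_def[of ?G] One)
qed

lemma const_group: "group_object (Graph C) (const_group C K)"
proof (rule G.group_objectI; unfold const_group_carr)
  let ?G = "Graph C" and ?A = "const_graph C (Carr K)" and ?K = "const_group C K"
  fix T x assume x: "arr ?G x T ?A"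
  note T = arr_dom[OF x] note x' = const_arrD[OF x]
  have o: "arr ?G (gone ?G ?K T) T ?A" using G.comp[OF G.bang[OF T] const_One] by (simp add: gone_def)
  note n = G.comp[OF x const_Inv]
  have Inv: "Inv ?K = (Inv K, Inv K)" by (simp add: const_group_def Let_def)
  show "gmul ?G ?K T (gone ?G ?K T) x = x" "gmul ?G ?K T x (gone ?G ?K T) = x"
    "gmul ?G ?K T (Inv ?K \<cdot>\<^bsub>?G\<^esub> x) x = gone ?G ?K T" "gmul ?G ?K T x (Inv ?K \<cdot>\<^bsub>?G\<^esub> x) = gone ?G ?K T"
    using const_gmul[OF o x] const_gmul[OF x o] const_gmul[OF n x] const_gmul[OF x n]
      group_unit_laws[OF K x'(1)] group_unit_laws[OF K x'(2)] by (simp_all add: const_gone[OF T] Inv)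
  fix y z assume y: "arr ?G y T ?A" and z: "arr ?G z T ?A"
  note y' = const_arrD[OF y] and z' = const_arrD[OF z]
  show "gmul ?G ?K T (gmul ?G ?K T x y) z = gmul ?G ?K T x (gmul ?G ?K T y z)"
    unfolding const_gmul[OF x y] const_gmul[OF y z] const_gmul[OF const_gmul_arr[OF x y] z] const_gmul[OF x const_gmul_arr[OF y z]]
    using gmul_assoc[OF K x'(1) y'(1) z'(1)] gmul_assoc[OF K x'(2) y'(2) z'(2)] by simp
qed (rule const_Mul const_Inv const_One)+

end

lemma const_group_hom:
  assumes K: "group_object C K" and L: "group_object C L" and f: "f \<in> Hom (Grp C) K L"
  shows "(f, f) \<in> Hom (Grp (Graph C)) (const_group C K) (const_group C L)"
proof -
  interpret G: lex "Graph C" by (rule Graph_lex)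
  note f' = Grp_hom_arr[OF K L f]
  have a: "arr (Graph C) (f, f) (const_graph C (Carr K)) (const_graph C (Carr L))"
    by (rule const_arrI[OF L const_graph_obj[OF group_carr[OF K]]]) (use f' idr[OF f'] in \<open>auto simp: const_graph_def\<close>)
  have "(f, f) \<cdot>\<^bsub>Graph C\<^esub> gmul (Graph C) (const_group C K) T x y =
      gmul (Graph C) (const_group C L) T ((f, f) \<cdot>\<^bsub>Graph C\<^esub> x) ((f, f) \<cdot>\<^bsub>Graph C\<^esub> y)"
    if x: "arr (Graph C) x T (const_graph C (Carr K))" and y: "arr (Graph C) y T (const_graph C (Carr K))" for T x y
    unfolding const_gmul[OF K x y] const_gmul[OF L G.comp[OF x a] G.comp[OF y a]]
    using Grp_hom_gmul[OF K L f const_arrD(1)[OF K x] const_arrD(1)[OF K y]]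
      Grp_hom_gmul[OF K L f const_arrD(2)[OF K x] const_arrD(2)[OF K y]] by simp
  then show ?thesis unfolding G.Grp_hom_iff[OF const_group[OF K] const_group[OF L]] const_group_carr using a by blast
qed

end

abbreviation edge_group :: "('o, 'm) cat \<Rightarrow> ('o, 'm) igraph \<Rightarrow> ('o, 'm) gog \<Rightarrow> ('o \<times> 'm, 'm) grp" where
  "edge_group C Q \<G> \<equiv> image_group (Slice (Graph C) Q) (Slice C (Edges Q)) (\<lambda>A. (Edges (fst A), fst (snd A))) fst \<G>"

abbreviation vertex_group :: "('o, 'm) cat \<Rightarrow> ('o, 'm) igraph \<Rightarrow> ('o, 'm) gog \<Rightarrow> ('o \<times> 'm, 'm) grp" where
  "vertex_group C Q \<G> \<equiv> image_group (Slice (Graph C) Q) (Slice C (Verts Q)) (\<lambda>A. (Verts (fst A), snd (snd A))) snd \<G>"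

context lex_functor
begin

lemma image_pair:
  assumes K: "group_object D K" and x: "arr C x T (F (Carr K))" and y: "arr C y T (F (Carr K))"
  shows "\<exists>k. arr C k T (F (Prod D (Carr K) (Carr K))) \<and> F1 (pr1 D (Carr K) (Carr K)) \<cdot>\<^bsub>C\<^esub> k = x \<and>
    F1 (pr2 D (Carr K) (Carr K)) \<cdot>\<^bsub>C\<^esub> k = y"
  using is_productD(3)[OF F_product[OF D.group_carr[OF K] D.group_carr[OF K] D.is_product_Prod] F_obj F_obj x y]
    D.group_carr[OF K] by blast

text \<open>Multiplicativity of \<open>e\<close> is an equation between arrows on \<open>\<G> \<times> \<G>\<close>, which \<open>F\<close> preserves. The condition on
  \<open>L\<close> and \<open>K\<close> says that \<open>K\<close> computes the image of the product in \<open>L\<close>; it is adapted to constant groups,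
  whose components are \<open>K\<close> itself.\<close>

lemma fibre_hom_image:
  assumes Q: "Q \<in> Obj D" and \<G>: "group_object (Slice D Q) \<G>" and L: "group_object D L" and K: "group_object C K"
    and mul: "\<And>T x y. \<lbrakk>arr D x T (Carr L); arr D y T (Carr L)\<rbrakk> \<Longrightarrow>
      arr C (F1 x) (F T) (Carr K) \<and> F1 (gmul D L T x y) = gmul C K (F T) (F1 x) (F1 y)"
    and e: "fibre_hom D Q \<G> L e"
  shows "fibre_hom C (F Q) (image_group (Slice D Q) (Slice C (F Q)) (\<lambda>A. (F (fst A), F1 (snd A))) F1 \<G>) K (F1 e)"
proof -
  let ?F = "\<lambda>A. (F (fst A), F1 (snd A))" let ?I = "image_group (Slice D Q) (Slice C (F Q)) ?F F1 \<G>"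
  interpret S: lex_functor "Slice D Q" "Slice C (F Q)" ?F F1 by (rule slice_functor[OF Q])
  let ?c = "Carr \<G>" let ?W = "Prod (Slice D Q) ?c ?c"
  note cS = S.D.group_carr[OF \<G>] note P = S.D.pr1[OF cS cS] S.D.pr2[OF cS cS]
  note p = D.Slice_arrD(1)[OF P(1) Q] D.Slice_arrD(1)[OF P(2) Q]
  note ea = fibre_homD(1)[OF e] note FQ = F_obj[OF Q]
  note M = S.D.gmul[OF \<G> P] note M' = D.Slice_arrD(1)[OF M Q]
  note ep = D.comp[OF p(1) ea] D.comp[OF p(2) ea]
  show ?thesis
    unfolding fibre_hom_def image_group_carr fst_conv
  proof (intro conjI allI impI)
    have "arr C (F1 e) (F (fst ?c)) (Carr K)" using mul[OF ea ea] by blast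
    then show "arr C (F1 e) (F (fst ?c)) (Carr K)" .
    fix T x y assume x: "arr (Slice C (F Q)) x T (?F ?c)" and y: "arr (Slice C (F Q)) y T (?F ?c)"
    obtain k where k: "arr (Slice C (F Q)) k T (?F ?W)" "F1 (pr1 (Slice D Q) ?c ?c) \<cdot>\<^bsub>C\<^esub> k = x" "F1 (pr2 (Slice D Q) ?c ?c) \<cdot>\<^bsub>C\<^esub> k = y"
      using S.image_pair[OF \<G> x y] by auto
    note k' = C.Slice_arrD(1)[OF k(1) FQ, unfolded fst_conv]
    have "gmul (Slice C (F Q)) ?I T x y = F1 (gmul (Slice D Q) \<G> ?W (pr1 (Slice D Q) ?c ?c) (pr2 (Slice D Q) ?c ?c)) \<cdot>\<^bsub>C\<^esub> k"
      using S.image_gmul[OF \<G> P k(1)] k(2,3) by simp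
    then have "F1 e \<cdot>\<^bsub>C\<^esub> gmul (Slice C (F Q)) ?I T x y =
        F1 (e \<cdot>\<^bsub>D\<^esub> gmul (Slice D Q) \<G> ?W (pr1 (Slice D Q) ?c ?c) (pr2 (Slice D Q) ?c ?c)) \<cdot>\<^bsub>C\<^esub> k"
      using C.assoc[OF k' F_arr[OF M'] F_arr[OF ea]] F_comp[OF M' ea] by simp
    also have "\<dots> = gmul C K (F (fst ?W)) (F1 (e \<cdot>\<^bsub>D\<^esub> pr1 (Slice D Q) ?c ?c)) (F1 (e \<cdot>\<^bsub>D\<^esub> pr2 (Slice D Q) ?c ?c)) \<cdot>\<^bsub>C\<^esub> k"
      using fibre_homD(2)[OF e P] mul[OF ep] by simp
    also have "\<dots> = gmul C K (fst T) (F1 e \<cdot>\<^bsub>C\<^esub> x) (F1 e \<cdot>\<^bsub>C\<^esub> y)"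
      using C.gmul_comp[OF K _ _ k'] mul[OF ep(1,1)] mul[OF ep(2,2)] F_comp[OF p(1) ea] F_comp[OF p(2) ea]
        C.assoc[OF k' F_arr[OF p(1)] F_arr[OF ea]] C.assoc[OF k' F_arr[OF p(2)] F_arr[OF ea]] k(2,3) by simp
    finally show "F1 e \<cdot>\<^bsub>C\<^esub> gmul (Slice C (F Q)) ?I T x y = gmul C K (fst T) (F1 e \<cdot>\<^bsub>C\<^esub> x) (F1 e \<cdot>\<^bsub>C\<^esub> y)" .
  qed
qed

end

context lex
begin

context
  fixes Q \<G> assumes Q: "Q \<in> Obj (Graph C)" and \<G>: "group_object (Slice (Graph C) Q) \<G>"
begin

interpretation G: lex "Graph C" by (rule Graph_lex)
interpretation E: lex_functor "Graph C" C Edges fst by (rule edges_lex_functor)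
interpretation V: lex_functor "Graph C" C Verts snd by (rule verts_lex_functor)
interpretation SE: lex_functor "Slice (Graph C) Q" "Slice C (Edges Q)" "\<lambda>A. (Edges (fst A), fst (snd A))" fst
  by (rule E.slice_functor[OF Q])
interpretation SV: lex_functor "Slice (Graph C) Q" "Slice C (Verts Q)" "\<lambda>A. (Verts (fst A), snd (snd A))" snd
  by (rule V.slice_functor[OF Q])

lemma edge_group: "group_object (Slice C (Edges Q)) (edge_group C Q \<G>)"
  and vertex_group: "group_object (Slice C (Verts Q)) (vertex_group C Q \<G>)"
  by (rule SE.image_group[OF \<G>], rule SV.image_group[OF \<G>])

text \<open>Arrows of graphs are equal when their components are, and the product of elements of \<open>\<G>\<close> is computed
  by the products in the edge group and in the vertex group.\<close>

lemma fibre_hom_const_iff: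
  assumes K: "group_object C K"
  shows "fibre_hom (Graph C) Q \<G> (const_group C K) e \<longleftrightarrow>
    arr (Graph C) e (fst (Carr \<G>)) (const_graph C (Carr K)) \<and>
    fibre_hom C (Edges Q) (edge_group C Q \<G>) K (fst e) \<and> fibre_hom C (Verts Q) (vertex_group C Q \<G>) K (snd e)"
proof (intro iffI conjI)
  let ?G = "Graph C" let ?S = "Slice ?G Q"
  assume e: "fibre_hom ?G Q \<G> (const_group C K) e"
  show "arr ?G e (fst (Carr \<G>)) (const_graph C (Carr K))" using fibre_homD(1)[OF e] by simp
  show "fibre_hom C (Edges Q) (edge_group C Q \<G>) K (fst e)"
    by (rule E.fibre_hom_image[OF Q \<G> const_group[OF K] K _ e])
      (use const_arrD(1)[OF K] const_gmul[OF K] in simp)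
  show "fibre_hom C (Verts Q) (vertex_group C Q \<G>) K (snd e)"
    by (rule V.fibre_hom_image[OF Q \<G> const_group[OF K] K _ e])
      (use const_arrD(2)[OF K] const_gmul[OF K] in simp)
next
  let ?G = "Graph C" let ?S = "Slice ?G Q"
  assume "arr ?G e (fst (Carr \<G>)) (const_graph C (Carr K)) \<and>
    fibre_hom C (Edges Q) (edge_group C Q \<G>) K (fst e) \<and> fibre_hom C (Verts Q) (vertex_group C Q \<G>) K (snd e)"
  then have e: "arr ?G e (fst (Carr \<G>)) (const_graph C (Carr K))"
    and eE: "fibre_hom C (Edges Q) (edge_group C Q \<G>) K (fst e)"
    and eV: "fibre_hom C (Verts Q) (vertex_group C Q \<G>) K (snd e)" by auto
  have "e \<cdot>\<^bsub>?G\<^esub> gmul ?S \<G> T x y = gmul ?G (const_group C K) (fst T) (e \<cdot>\<^bsub>?G\<^esub> x) (e \<cdot>\<^bsub>?G\<^esub> y)"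
    if x: "arr ?S x T (Carr \<G>)" and y: "arr ?S y T (Carr \<G>)" for T x y
  proof -
    note x' = G.Slice_arrD(1)[OF x Q] and y' = G.Slice_arrD(1)[OF y Q]
    have xE: "arr (Slice C (Edges Q)) (fst x) (Edges (fst T), fst (snd T)) (Carr (edge_group C Q \<G>))"
      and yE: "arr (Slice C (Edges Q)) (fst y) (Edges (fst T), fst (snd T)) (Carr (edge_group C Q \<G>))"
      and xV: "arr (Slice C (Verts Q)) (snd x) (Verts (fst T), snd (snd T)) (Carr (vertex_group C Q \<G>))"
      and yV: "arr (Slice C (Verts Q)) (snd y) (Verts (fst T), snd (snd T)) (Carr (vertex_group C Q \<G>))"
      using SE.F_arr[OF x] SE.F_arr[OF y] SV.F_arr[OF x] SV.F_arr[OF y] by simp_all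
    show ?thesis
      unfolding const_gmul[OF K G.comp[OF x' e] G.comp[OF y' e]]
      using SE.image_gmul_ident[OF \<G> x y] SV.image_gmul_ident[OF \<G> x y] fibre_homD(2)[OF eE xE yE] fibre_homD(2)[OF eV xV yV]
      by simp
  qed
  then show "fibre_hom ?G Q \<G> (const_group C K) e" unfolding fibre_hom_def using e by simp
qed

text \<open>The incidence maps of \<open>\<G>\<close> are homomorphisms on fibres, since the multiplication of \<open>\<G>\<close> is an
  arrow of graphs.\<close>

lemma fibre_hom_incidence:
  assumes d: "d \<in> {d0, d1}" and K: "group_object C K" and e: "fibre_hom C (Verts Q) (vertex_group C Q \<G>) K e"
  shows "fibre_hom C (Edges Q) (edge_group C Q \<G>) K (e \<cdot> d (fst (Carr \<G>)))"
proof -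
  let ?G = "Graph C" let ?S = "Slice ?G Q" let ?c = "Carr \<G>" let ?W = "Prod ?S ?c ?c" let ?A = "fst ?c"
  note cS = SE.D.group_carr[OF \<G>] note P = SE.D.pr1[OF cS cS] SE.D.pr2[OF cS cS]
  let ?p = "pr1 ?S ?c ?c" and ?q = "pr2 ?S ?c ?c"
  note W = G.Slice_arrD(2)[OF P(1) Q] note w = Graph_arrD[OF W]
  note p = Graph_arrD[OF G.Slice_arrD(1)[OF P(1) Q]] and q = Graph_arrD[OF G.Slice_arrD(1)[OF P(2) Q]]
  have ea: "\<guillemotleft>e : Verts ?A \<rightarrow> Carr K\<guillemotright>" using fibre_homD(1)[OF e] by simp
  note M = SE.D.gmul[OF \<G> P] note m = Graph_arrD[OF G.Slice_arrD(1)[OF M Q]]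
  let ?m = "gmul ?S \<G> ?W ?p ?q"
  note dA = m(4)[OF d] and dW = m(3)[OF d] and dQ = w(4)[OF d]
  show ?thesis
    unfolding fibre_hom_def image_group_carr fst_conv
  proof (intro conjI allI impI)
    show "\<guillemotleft>e \<cdot> d ?A : Edges ?A \<rightarrow> Carr K\<guillemotright>" by (rule comp[OF dA ea])
    fix T x y
    assume x: "arr (Slice C (Edges Q)) x T (Edges (fst (Carr \<G>)), fst (snd (Carr \<G>)))"
      and y: "arr (Slice C (Edges Q)) y T (Edges (fst (Carr \<G>)), fst (snd (Carr \<G>)))"
    obtain k where k: "arr (Slice C (Edges Q)) k T (Edges (fst ?W), fst (snd ?W))" "fst ?p \<cdot> k = x" "fst ?q \<cdot> k = y"
      using SE.image_pair[OF \<G> x y] by auto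
    note k' = Slice_arrD[OF k(1) arr_cod[OF w(1)], unfolded fst_conv snd_conv]
    define k1 where "k1 = d (fst ?W) \<cdot> k" define T1 where "T1 = (fst T, d Q \<cdot> snd T)"
    have k1: "arr (Slice C (Verts Q)) k1 T1 (Verts (fst ?W), snd (snd ?W))"
      unfolding T1_def k1_def
      by (rule Slice_arrI) (use comp[OF k'(1) dW] w(2) assoc[OF k'(1) dW w(2)] w(5)[OF d] assoc[OF k'(1) w(1) dQ] k'(4) in simp_all)
    have "snd ?p \<cdot> k1 = d ?A \<cdot> x" "snd ?q \<cdot> k1 = d ?A \<cdot> y"
      unfolding k1_def using assoc[OF k'(1) dW p(2)] assoc[OF k'(1) dW q(2)] p(5)[OF d] q(5)[OF d]
        assoc[OF k'(1) p(1) dA] assoc[OF k'(1) q(1) dA] k(2,3) by simp_all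
    note pq = this
    have gV: "gmul (Slice C (Verts Q)) (vertex_group C Q \<G>) T1 (d ?A \<cdot> x) (d ?A \<cdot> y) = snd ?m \<cdot> k1"
      using SV.image_gmul[OF \<G> P k1] pq by simp
    have dx: "arr (Slice C (Verts Q)) (d ?A \<cdot> x) T1 (Carr (vertex_group C Q \<G>))"
      "arr (Slice C (Verts Q)) (d ?A \<cdot> y) T1 (Carr (vertex_group C Q \<G>))"
      using SV.C.comp[OF k1 SV.F_arr[OF P(1)]] SV.C.comp[OF k1 SV.F_arr[OF P(2)]] pq by simp_all
    have gE: "gmul (Slice C (Edges Q)) (edge_group C Q \<G>) T x y = fst ?m \<cdot> k"
      using SE.image_gmul[OF \<G> P k(1)] k(2,3) by simp
    have "d ?A \<cdot> (fst ?m \<cdot> k) = snd ?m \<cdot> k1"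
      unfolding k1_def using assoc[OF k'(1) m(1) dA] assoc[OF k'(1) dW m(2)] m(5)[OF d] by simp
    then have "e \<cdot> (d ?A \<cdot> (fst ?m \<cdot> k)) = gmul C K (fst T) (e \<cdot> (d ?A \<cdot> x)) (e \<cdot> (d ?A \<cdot> y))"
      using fibre_homD(2)[OF e dx] gV by (simp add: T1_def)
    then show "(e \<cdot> d ?A) \<cdot> gmul (Slice C (Edges Q)) (edge_group C Q \<G>) T x y =
        gmul C K (fst T) ((e \<cdot> d ?A) \<cdot> x) ((e \<cdot> d ?A) \<cdot> y)"
      unfolding gE using assoc[OF comp[OF k'(1) m(1)] dA ea] assoc[OF comp[OF k'(1) p(1)] dA ea]
        assoc[OF comp[OF k'(1) q(1)] dA ea] k(2,3) by simp
  qed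
qed

end

end

section \<open>The fundamental group and the standard graph\<close>

lemma Bass_Serre_lex:
  assumes "Bass_Serre C" shows "lex C"
proof -
  interpret category C using assms by (simp add: Bass_Serre_def)
  show ?thesis
  proof unfold_locales
    show "\<exists>Z. is_terminal C Z" using assms by (simp add: Bass_Serre_def)
    fix f A B g A' assume f: "arr C f A B" and g: "arr C g A' B"
    note B = arr_cod[OF f]
    have "has_finite_limits (Slice C B)"
      using assms B unfolding Bass_Serre_def locally_action_Barr_exact_def action_Barr_exact_def regular_category_def by blast
    moreover have "(A, f) \<in> Obj (Slice C B)" "(A', g) \<in> Obj (Slice C B)" using f g by (simp_all add: Slice_obj[OF B])
    ultimately obtain P p q where "is_product (Slice C B) (A, f) (A', g) P p q"
      unfolding has_finite_limits_def by blast
    then show "\<exists>P p q. is_pullback C A A' f g P p q" using Slice_product_imp_pullback[OF B f g] by blast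
  qed
qed

context lex
begin

text \<open>The fundamental group: a homomorphism from \<open>\<G>\<close> to \<open>\<Delta>K\<close> is a homomorphism from the vertex groups
  to \<open>K\<close> whose two restrictions to the edge groups agree. So, with \<open>L\<^sub>V\<close> and \<open>L\<^sub>E\<close> the colimits of the
  vertex and edge groups over \<open>VQ\<close> and \<open>EQ\<close>, the coequaliser of the two homomorphisms \<open>L\<^sub>E \<rightarrow> L\<^sub>V\<close> given by
  \<open>d\<^sub>0\<close> and \<open>d\<^sub>1\<close> is universal.\<close>

lemma colim_exists:
  assumes adj: "\<And>D H. \<lbrakk>D \<in> Obj C; group_object (Slice C D) H\<rbrakk> \<Longrightarrow>
      \<exists>U \<eta>. universal_arrow (Grp C) (Grp (Slice C D)) (Delta C D) (Delta_map C D) H U \<eta>"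
    and co: "has_coequalisers (Grp C)"
    and Q: "Q \<in> Obj (Graph C)" and \<G>: "group_object (Slice (Graph C) Q) \<G>"
  shows "\<exists>U u. universal_arrow (Grp C) (GrGrp C Q) (DeltaG C Q) (DeltaG_map C Q) \<G> U u"
proof -
  let ?G = "Graph C" let ?A = "fst (Carr \<G>)" and ?v = "snd (Carr \<G>)"
  interpret G: lex ?G by (rule Graph_lex)
  have QE: "Edges Q \<in> Obj C" and QV: "Verts Q \<in> Obj C" using Q by (auto simp: Graph_obj dest: arr_dom arr_cod)
  note gE = edge_group[OF Q \<G>] and gV = vertex_group[OF Q \<G>]
  note v = G.group_over_arr[OF Q \<G>] note A = arr_dom[OF v]
  have dA: "\<guillemotleft>d ?A : Edges ?A \<rightarrow> Verts ?A\<guillemotright>" if "d \<in> {d0, d1}" for d using Graph_d[OF A that] .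
  obtain LE \<eta>E where E: "universal_arrow (Grp C) (Grp (Slice C (Edges Q))) (Delta C (Edges Q)) (Delta_map C (Edges Q)) (edge_group C Q \<G>) LE \<eta>E"
    using adj[OF QE gE] by blast
  obtain LV \<eta>V where V: "universal_arrow (Grp C) (Grp (Slice C (Verts Q))) (Delta C (Verts Q)) (Delta_map C (Verts Q)) (vertex_group C Q \<G>) LV \<eta>V"
    using adj[OF QV gV] by blast
  define b where "b = pr1 C (Carr LE) (Edges Q) \<cdot> \<eta>E" define a where "a = pr1 C (Carr LV) (Verts Q) \<cdot> \<eta>V"
  note uE = universal_arrow_fibre_hom[OF QE gE E, folded b_def] and uV = universal_arrow_fibre_hom[OF QV gV V, folded a_def]
  have aa: "\<guillemotleft>a : Verts ?A \<rightarrow> Carr LV\<guillemotright>" and bb: "\<guillemotleft>b : Edges ?A \<rightarrow> Carr LE\<guillemotright>"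
    using fibre_homD(1)[OF uV(2)] fibre_homD(1)[OF uE(2)] by simp_all
  have ex: "\<exists>\<delta>. \<delta> \<in> Hom (Grp C) LE LV \<and> \<delta> \<cdot> b = a \<cdot> d ?A" if d: "d \<in> {d0, d1}" for d
    using uE(3)[OF uV(1) fibre_hom_incidence[OF Q \<G> d uV(1,2)]] by blast
  obtain \<delta>0 where \<delta>0: "\<delta>0 \<in> Hom (Grp C) LE LV" "\<delta>0 \<cdot> b = a \<cdot> d0 ?A" using ex[of d0] by blast
  obtain \<delta>1 where \<delta>1: "\<delta>1 \<in> Hom (Grp C) LE LV" "\<delta>1 \<cdot> b = a \<cdot> d1 ?A" using ex[of d1] by blast
  note \<delta>0a = Grp_hom_arr[OF uE(1) uV(1) \<delta>0(1)] and \<delta>1a = Grp_hom_arr[OF uE(1) uV(1) \<delta>1(1)]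
  obtain U c where U: "is_coequaliser (Grp C) LE LV \<delta>0 \<delta>1 U c"
    using category.has_coequalisersD[OF Grp_category co] uE(1) uV(1) \<delta>0(1) \<delta>1(1) by (metis arr_def Grp_obj)
  then have Ug: "group_object C U" and c: "c \<in> Hom (Grp C) LV U" and c\<delta>: "c \<cdot> \<delta>0 = c \<cdot> \<delta>1"
    by (simp_all add: is_coequaliser_def)
  note ca = Grp_hom_arr[OF uV(1) Ug c] note cc = comp[OF aa ca]
  define e where "e = ((c \<cdot> a) \<cdot> d0 ?A, c \<cdot> a)"
  note ca_hom = fibre_hom_comp[OF QV gV uV(1) Ug c uV(2)]
  have c01: "(c \<cdot> a) \<cdot> d1 ?A = (c \<cdot> a) \<cdot> d0 ?A"
    using assoc[OF dA aa ca, of d0] assoc[OF dA aa ca, of d1] \<delta>0(2) \<delta>1(2)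
      assoc[OF bb \<delta>0a ca] assoc[OF bb \<delta>1a ca] c\<delta> by simp
  have e_arr: "arr ?G e ?A (const_graph C (Carr U))"
    unfolding e_def by (rule const_arrI[OF Ug A cc]) (use c01 in auto)
  have e_hom: "fibre_hom ?G Q \<G> (const_group C U) e"
    unfolding fibre_hom_const_iff[OF Q \<G> Ug] using e_arr ca_hom fibre_hom_incidence[OF Q \<G> _ Ug ca_hom, of d0]
    by (simp add: e_def)
  let ?u = "tuple ?G ?A (Carr (const_group C U)) Q e ?v"
  have "universal_arrow (Grp C) (GrGrp C Q) (DeltaG C Q) (DeltaG_map C Q) \<G> U ?u"
    unfolding universal_arrow_def
  proof (intro conjI ballI)
    show "U \<in> Obj (Grp C)" using Ug by simp
    show "?u \<in> Hom (GrGrp C Q) \<G> (DeltaG C Q U)"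
      unfolding DeltaG_def by (rule G.fibre_hom_tuple[OF Q \<G> const_group[OF Ug] e_hom])
    fix Y h assume "Y \<in> Obj (Grp C)" and h: "h \<in> Hom (GrGrp C Q) \<G> (DeltaG C Q Y)"
    then have Y: "group_object C Y" by simp
    let ?Y = "const_graph C (Carr Y)"
    define e' where "e' = pr1 ?G ?Y Q \<cdot>\<^bsub>?G\<^esub> h"
    have h': "fibre_hom ?G Q \<G> (const_group C Y) e'" "arr ?G h ?A (Prod ?G ?Y Q)" "pr2 ?G ?Y Q \<cdot>\<^bsub>?G\<^esub> h = ?v"
      using h unfolding DeltaG_def G.Delta_hom_iff[OF Q \<G> const_group[OF Y]] const_group_carr e'_def by blast+
    note YO = const_graph_obj[OF group_carr[OF Y]]
    have h_eq: "h = tuple ?G ?A ?Y Q e' ?v"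
      using G.tuple_eqI[OF h'(2) YO Q refl h'(3)] unfolding e'_def by simp
    have e'_arr: "arr ?G e' ?A ?Y" using fibre_homD(1)[OF h'(1)] by simp
    note e'' = h'(1)[unfolded fibre_hom_const_iff[OF Q \<G> Y]]
    note e'd = const_arrD(4)[OF Y e'_arr]
    have iff: "DeltaG_map C Q U Y g \<cdot>\<^bsub>GrGrp C Q\<^esub> ?u = h \<longleftrightarrow> g \<cdot> (c \<cdot> a) = snd e'"
      if g: "g \<in> Hom (Grp C) U Y" for g
    proof -
      note ga = Grp_hom_arr[OF Ug Y g] note gh = const_group_hom[OF Ug Y g]
      have gg: "arr ?G ((g, g) \<cdot>\<^bsub>?G\<^esub> e) ?A ?Y"
        by (rule G.comp[OF e_arr G.Grp_hom_arr[OF const_group[OF Ug] const_group[OF Y] gh, unfolded const_group_carr]])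
      have "DeltaG_map C Q U Y g \<cdot>\<^bsub>?G\<^esub> ?u = tuple ?G ?A ?Y Q ((g, g) \<cdot>\<^bsub>?G\<^esub> e) ?v"
        using G.Delta_map_tuple[OF Q const_group[OF Ug] const_group[OF Y] gh _ v, of e] e_arr
        unfolding DeltaG_map_def const_group_carr by blast
      then have "DeltaG_map C Q U Y g \<cdot>\<^bsub>GrGrp C Q\<^esub> ?u = h \<longleftrightarrow> (g, g) \<cdot>\<^bsub>?G\<^esub> e = e'"
        unfolding Grp_Comp Slice_Comp h_eq using G.pr1_tuple[OF gg v] G.pr1_tuple[OF e'_arr v] by metis
      also have "\<dots> \<longleftrightarrow> snd ((g, g) \<cdot>\<^bsub>?G\<^esub> e) = snd e'"
        using const_arrD(4)[OF Y gg, of d0] e'd[of d0] by (metis insertI1 prod.collapse)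
      finally show ?thesis by (simp add: e_def)
    qed
    obtain k where k: "k \<in> Hom (Grp C) LV Y" "k \<cdot> a = snd e'"
      and k_unique: "\<And>k'. k' \<in> Hom (Grp C) LV Y \<Longrightarrow> k' \<cdot> a = snd e' \<Longrightarrow> k' = k"
      using uV(3)[OF Y] e'' by blast
    note ka = Grp_hom_arr[OF uV(1) Y k(1)]
    interpret Gr: category "Grp C" by (rule Grp_category)
    have Gc: "g \<cdot> f \<in> Hom (Grp C) X Z" if "f \<in> Hom (Grp C) X W" "g \<in> Hom (Grp C) W Z"
      "group_object C X" "group_object C W" "group_object C Z" for f g X W Z
      using Gr.Comp_in[of X W Z f g] that by simp
    have "(k \<cdot> \<delta>0) \<cdot> b = fst e'" "(k \<cdot> \<delta>1) \<cdot> b = fst e'"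
      using assoc[OF bb \<delta>0a ka] assoc[OF bb \<delta>1a ka] \<delta>0(2) \<delta>1(2) assoc[OF dA aa ka, of d0] assoc[OF dA aa ka, of d1] k(2)
        e'd[of d0] e'd[of d1] by simp_all
    then have k\<delta>: "k \<cdot> \<delta>0 = k \<cdot> \<delta>1"
      using uE(3)[OF Y] e'' Gc[OF \<delta>0(1) k(1) uE(1) uV(1) Y] Gc[OF \<delta>1(1) k(1) uE(1) uV(1) Y] by blast
    have "\<exists>!g. g \<in> Hom (Grp C) U Y \<and> g \<cdot> c = k"
      using U Y k(1) k\<delta> unfolding is_coequaliser_def by simp
    moreover have "g \<cdot> c = k \<longleftrightarrow> g \<cdot> (c \<cdot> a) = snd e'" if g: "g \<in> Hom (Grp C) U Y" for g
      using k_unique[OF Gc[OF c g uV(1) Ug Y]] assoc[OF aa ca Grp_hom_arr[OF Ug Y g]] k(2) by metis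
    ultimately show "\<exists>!g. g \<in> Hom (Grp C) U Y \<and> DeltaG_map C Q U Y g \<cdot>\<^bsub>GrGrp C Q\<^esub> ?u = h"
      using iff by metis
  qed
  then show ?thesis by blast
qed

text \<open>Effectivity of the two arrows that define the standard graph holds componentwise by
  action Barr-exactness of the slices over \<open>EQ\<close> and \<open>VQ\<close>, and coequalisers and pullbacks of graphs are
  componentwise.\<close>

lemma graph_translation_effective:
  fixes Q \<G> K \<eta>
  defines "D \<equiv> Graph C" and "P \<equiv> Carr (const_group C K)" and "A \<equiv> fst (Carr \<G>)"
  assumes exact: "locally_action_Barr_exact C"
    and K: "group_object C K" and Q: "Q \<in> Obj D" and \<G>: "group_object (Slice D Q) \<G>"
    and \<eta>: "\<eta> \<in> Hom (Grp (Slice D Q)) \<G> (Delta D Q (const_group C K))"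
    and mono: "monic D A (Prod D P Q) \<eta>"
  shows "\<exists>Z q. is_coequaliser D (Prod D P A) (Prod D P Q) (prod_map D P P A Q (Ident D P) (snd (Carr \<G>)))
      (tuple D (Prod D P A) P Q (gmul D (const_group C K) (Prod D P A) (pr1 D P A) (pr1 D P Q \<cdot>\<^bsub>D\<^esub> \<eta> \<cdot>\<^bsub>D\<^esub> pr2 D P A))
        (pr2 D P Q \<cdot>\<^bsub>D\<^esub> \<eta> \<cdot>\<^bsub>D\<^esub> pr2 D P A)) Z q \<and>
    is_pullback D (Prod D P Q) (Prod D P Q) q q (Prod D P A) (prod_map D P P A Q (Ident D P) (snd (Carr \<G>)))
      (tuple D (Prod D P A) P Q (gmul D (const_group C K) (Prod D P A) (pr1 D P A) (pr1 D P Q \<cdot>\<^bsub>D\<^esub> \<eta> \<cdot>\<^bsub>D\<^esub> pr2 D P A))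
        (pr2 D P Q \<cdot>\<^bsub>D\<^esub> \<eta> \<cdot>\<^bsub>D\<^esub> pr2 D P A))"
    (is "\<exists>Z q. is_coequaliser D ?R ?B ?f ?g Z q \<and> is_pullback D ?B ?B q q ?R ?f ?g")
proof -
  interpret D: lex D unfolding D_def by (rule Graph_lex)
  interpret E: lex_functor D C Edges fst unfolding D_def by (rule edges_lex_functor)
  interpret V: lex_functor D C Verts snd unfolding D_def by (rule verts_lex_functor)
  have cD: "x \<cdot>\<^bsub>D\<^esub> y = (fst x \<cdot> fst y, snd x \<cdot> snd y)" for x y by (simp add: D_def)
  note KD = const_group[OF K, folded D_def]
  have PO: "P \<in> Obj D" using D.group_carr[OF KD] by (simp add: P_def)
  let ?u = "snd (Carr \<G>)" define e where "e = pr1 D P Q \<cdot>\<^bsub>D\<^esub> \<eta>"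
  have u: "arr D ?u A Q" unfolding A_def by (rule D.group_over_arr[OF Q \<G>])
  note AO = arr_dom[OF u]
  have e: "fibre_hom D Q \<G> (const_group C K) e" and eta: "arr D \<eta> A ?B" "pr2 D P Q \<cdot>\<^bsub>D\<^esub> \<eta> = ?u"
    using \<eta> unfolding D.Delta_hom_iff[OF Q \<G> KD] e_def P_def A_def by blast+
  have eC: "arr D e A (const_graph C (Carr K))" "fibre_hom C (Edges Q) (edge_group C Q \<G>) K (fst e)"
    "fibre_hom C (Verts Q) (vertex_group C Q \<G>) K (snd e)"
    using e unfolding D_def fibre_hom_const_iff[OF Q[unfolded D_def] \<G>[unfolded D_def] K] A_def by blast+
  have P': "P = const_graph C (Carr K)" by (simp add: P_def)
  note rp = D.pr1[OF PO AO] D.pr2[OF PO AO] and bp = D.pr1[OF PO Q] D.pr2[OF PO Q]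
  note er = D.comp[OF rp(2) eC(1), folded P'] and ur = D.comp[OF rp(2) u]
  note m = D.gmul[OF KD rp(1)[unfolded P_def] er[unfolded P_def], folded P_def]
  have g_eq: "?g = tuple D ?R P Q (gmul D (const_group C K) ?R (pr1 D P A) (e \<cdot>\<^bsub>D\<^esub> pr2 D P A)) (?u \<cdot>\<^bsub>D\<^esub> pr2 D P A)"
    unfolding e_def eta(2) ..
  have f: "arr D ?f ?R ?B" by (rule D.prod_map[OF D.ident[OF PO] u])
  have f': "pr1 D P Q \<cdot>\<^bsub>D\<^esub> ?f = pr1 D P A" "pr2 D P Q \<cdot>\<^bsub>D\<^esub> ?f = ?u \<cdot>\<^bsub>D\<^esub> pr2 D P A"
    unfolding prod_map_def D.idl[OF rp(1)] by (rule D.pr1_tuple[OF rp(1) ur], rule D.pr2_tuple[OF rp(1) ur])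
  have g: "arr D ?g ?R ?B" unfolding g_eq by (rule D.tuple[OF m ur])
  have g': "pr1 D P Q \<cdot>\<^bsub>D\<^esub> ?g = (gmul C K (Edges ?R) (fst (pr1 D P A)) (fst (e \<cdot>\<^bsub>D\<^esub> pr2 D P A)),
      gmul C K (Verts ?R) (snd (pr1 D P A)) (snd (e \<cdot>\<^bsub>D\<^esub> pr2 D P A)))" "pr2 D P Q \<cdot>\<^bsub>D\<^esub> ?g = ?u \<cdot>\<^bsub>D\<^esub> pr2 D P A"
    unfolding g_eq D.pr1_tuple[OF m ur] D.pr2_tuple[OF m ur]
    using const_gmul[OF K rp(1)[unfolded P' D_def] er[unfolded P' D_def]] by (simp_all add: D_def P')
  have cmp: "fst x \<cdot> fst y = fst z \<and> snd x \<cdot> snd y = snd z" if "x \<cdot>\<^bsub>D\<^esub> y = z" for x y z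
    using that[symmetric] by (simp add: cD)
  have fs: "fst (x \<cdot>\<^bsub>D\<^esub> y) = fst x \<cdot> fst y" "snd (x \<cdot>\<^bsub>D\<^esub> y) = snd x \<cdot> snd y" for x y by (simp_all add: cD)
  have comp_E: "fst (pr1 D P Q) \<cdot> fst ?f = fst (pr1 D P A)" "fst (pr2 D P Q) \<cdot> fst ?f = fst ?u \<cdot> fst (pr2 D P A)"
    "fst (pr1 D P Q) \<cdot> fst ?g = gmul C K (Edges ?R) (fst (pr1 D P A)) (fst e \<cdot> fst (pr2 D P A))"
    "fst (pr2 D P Q) \<cdot> fst ?g = fst ?u \<cdot> fst (pr2 D P A)"
    and comp_V: "snd (pr1 D P Q) \<cdot> snd ?f = snd (pr1 D P A)" "snd (pr2 D P Q) \<cdot> snd ?f = snd ?u \<cdot> snd (pr2 D P A)"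
    "snd (pr1 D P Q) \<cdot> snd ?g = gmul C K (Verts ?R) (snd (pr1 D P A)) (snd e \<cdot> snd (pr2 D P A))"
    "snd (pr2 D P Q) \<cdot> snd ?g = snd ?u \<cdot> snd (pr2 D P A)"
    using cmp[OF f'(1)] cmp[OF f'(2)] cmp[OF g'(1)] cmp[OF g'(2)]
    unfolding fs[of ?u] fs[of e "pr2 D P A"] fst_conv snd_conv by blast+
  note R = D.is_product_Prod[OF PO AO] and B = D.is_product_Prod[OF PO Q]
  have PE: "Edges P = Carr K" and PV: "Verts P = Carr K" by (simp_all add: P' const_graph_def)
  have QO: "Edges Q \<in> Obj C" "Verts Q \<in> Obj C" using E.F_obj[OF Q] V.F_obj[OF Q] .
  have exact': "action_Barr_exact (Slice C (Edges Q))" "action_Barr_exact (Slice C (Verts Q))"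
    using exact QO unfolding locally_action_Barr_exact_def by blast+
  have injE: "x = y" if x: "\<guillemotleft>x : T \<rightarrow> Edges A\<guillemotright>" and y: "\<guillemotleft>y : T \<rightarrow> Edges A\<guillemotright>"
    and "fst e \<cdot> x = fst e \<cdot> y" "fst ?u \<cdot> x = fst ?u \<cdot> y" for T x y
  proof (rule monicD[OF E.F_monic[OF mono AO arr_cod[OF eta(1)]] x y])
    note p = E.F_arr[OF bp(1)] E.F_arr[OF bp(2)] and t = E.F_arr[OF eta(1)]
    show "fst \<eta> \<cdot> x = fst \<eta> \<cdot> y"
      by (rule product_ext[OF E.F_product[OF PO Q B] E.F_obj[OF PO] QO(1) comp[OF x t] comp[OF y t]])
        (use assoc[OF x t p(1)] assoc[OF x t p(2)] assoc[OF y t p(1)] assoc[OF y t p(2)] that(3,4) e_def eta(2)[symmetric] cD in simp_all)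
  qed
  have injV: "x = y" if x: "\<guillemotleft>x : T \<rightarrow> Verts A\<guillemotright>" and y: "\<guillemotleft>y : T \<rightarrow> Verts A\<guillemotright>"
    and "snd e \<cdot> x = snd e \<cdot> y" "snd ?u \<cdot> x = snd ?u \<cdot> y" for T x y
  proof (rule monicD[OF V.F_monic[OF mono AO arr_cod[OF eta(1)]] x y])
    note p = V.F_arr[OF bp(1)] V.F_arr[OF bp(2)] and t = V.F_arr[OF eta(1)]
    show "snd \<eta> \<cdot> x = snd \<eta> \<cdot> y"
      by (rule product_ext[OF V.F_product[OF PO Q B] V.F_obj[OF PO] QO(2) comp[OF x t] comp[OF y t]])
        (use assoc[OF x t p(1)] assoc[OF x t p(2)] assoc[OF y t p(1)] assoc[OF y t p(2)] that(3,4) e_def eta(2)[symmetric] cD in simp_all)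
  qed
  have "\<exists>Z q. is_coequaliser C (Edges ?R) (Edges ?B) (fst ?f) (fst ?g) Z q \<and>
      is_pullback C (Edges ?B) (Edges ?B) q q (Edges ?R) (fst ?f) (fst ?g)"
    by (rule translation_effective[OF QO(1) exact'(1) K edge_group[OF Q[unfolded D_def] \<G>[unfolded D_def]] eC(2),
        where R = "Edges ?R" and B = "Edges ?B" and f = "fst ?f" and g = "fst ?g" and ?r1.0 = "fst (pr1 D P A)"
          and ?r2.0 = "fst (pr2 D P A)" and ?b1.0 = "fst (pr1 D P Q)" and ?b2.0 = "fst (pr2 D P Q)",
        unfolded image_group_carr fst_conv snd_conv, folded A_def,
        OF _ E.F_product[OF PO AO R, unfolded PE] E.F_product[OF PO Q B, unfolded PE] E.F_arr[OF f] comp_E(1,2) E.F_arr[OF g] comp_E(3,4)]) (rule injE)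
  then obtain ZE qE where ZE: "is_coequaliser C (Edges ?R) (Edges ?B) (fst ?f) (fst ?g) ZE qE"
    "is_pullback C (Edges ?B) (Edges ?B) qE qE (Edges ?R) (fst ?f) (fst ?g)"
    by blast
  have "\<exists>Z q. is_coequaliser C (Verts ?R) (Verts ?B) (snd ?f) (snd ?g) Z q \<and>
      is_pullback C (Verts ?B) (Verts ?B) q q (Verts ?R) (snd ?f) (snd ?g)"
    by (rule translation_effective[OF QO(2) exact'(2) K vertex_group[OF Q[unfolded D_def] \<G>[unfolded D_def]] eC(3),
        where R = "Verts ?R" and B = "Verts ?B" and f = "snd ?f" and g = "snd ?g" and ?r1.0 = "snd (pr1 D P A)"
          and ?r2.0 = "snd (pr2 D P A)" and ?b1.0 = "snd (pr1 D P Q)" and ?b2.0 = "snd (pr2 D P Q)",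
        unfolded image_group_carr fst_conv snd_conv, folded A_def,
        OF _ V.F_product[OF PO AO R, unfolded PV] V.F_product[OF PO Q B, unfolded PV] V.F_arr[OF f] comp_V(1,2) V.F_arr[OF g] comp_V(3,4)]) (rule injV)
  then obtain ZV qV where ZV: "is_coequaliser C (Verts ?R) (Verts ?B) (snd ?f) (snd ?g) ZV qV"
    "is_pullback C (Verts ?B) (Verts ?B) qV qV (Verts ?R) (snd ?f) (snd ?g)"
    by blast
  obtain Z where Z: "arr D (qE, qV) ?B Z" "is_coequaliser D ?R ?B ?f ?g Z (qE, qV)"
    using Graph_coequaliser_ex[OF f[unfolded D_def] g[unfolded D_def]] ZE(1) ZV(1) unfolding D_def by blast
  have "is_pullback D ?B ?B (qE, qV) (qE, qV) ?R ?f ?g"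
    using Graph_pullbackI[of "(qE, qV)" ?B Z "(qE, qV)" ?B ?f ?R ?g] Z(1) f g ZE(2) ZV(2) unfolding D_def by simp
  then show ?thesis using Z(2) by blast
qed

text \<open>The action map is an arrow of graphs because \<open>d\<^sub>0\<close> and \<open>d\<^sub>1\<close> are equivariant; the laws hold on edges and
  on vertices.\<close>

lemma action_map_is_action:
  assumes G: "group_object C G" and X: "G_graph C G X a b"
  shows "is_action (Graph C) (const_group C G) X (action_map C G X a b)"
proof -
  let ?D = "Graph C" and ?A = "const_graph C (Carr G)" and ?m = "action_map C G X a b" let ?P = "Prod ?D ?A X"
  interpret D: lex ?D by (rule Graph_lex)
  have XO: "X \<in> Obj ?D" and a: "is_action C G (Edges X) a" and b: "is_action C G (Verts X) b"
    and eqv: "\<And>d. d \<in> {d0, d1} \<Longrightarrow> d X \<cdot> a = b \<cdot> prod_map C (Carr G) (Carr G) (Edges X) (Verts X) (Ident C (Carr G)) (d X)"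
    using X by (auto simp: G_graph_def)
  note A = const_graph_obj[OF group_carr[OF G]]
  note p = D.pr1[OF A XO] D.pr2[OF A XO]
  note aa = action_arr[OF G a] and bb = action_arr[OF G b]
  have equivariant: "d X \<cdot> gact C G (Edges X) a T g x = gact C G (Verts X) b T g (d X \<cdot> x)"
    if d: "d \<in> {d0, d1}" and g: "\<guillemotleft>g : T \<rightarrow> Carr G\<guillemotright>" and x: "\<guillemotleft>x : T \<rightarrow> Edges X\<guillemotright>" for d T g x
  proof -
    note dX = Graph_d[OF XO d] note t = tuple[OF g x] note i = ident[OF group_carr[OF G]]
    show ?thesis
      unfolding gact_def
      using assoc[OF t aa dX] eqv[OF d] assoc[OF t prod_map[OF i dX] bb] prod_map_elem[OF i dX g x] idl[OF g] by simp
  qed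
  have pair_arr: "arr ?D (gact C G (Edges X) a (Edges T) (fst g) (fst x), gact C G (Verts X) b (Verts T) (snd g) (snd x)) T X"
    if g: "arr ?D g T ?A" and x: "arr ?D x T X" for T g x
  proof -
    note g' = const_arrD[OF G g] and x' = Graph_arrD[OF x]
    note e = gact[OF aa g'(1) x'(1)] gact[OF bb g'(2) x'(2)]
    have "d X \<cdot> gact C G (Edges X) a (Edges T) (fst g) (fst x) = gact C G (Verts X) b (Verts T) (snd g) (snd x) \<cdot> d T"
      if d: "d \<in> {d0, d1}" for d
      unfolding gact_comp[OF bb g'(2) x'(2) x'(3)[OF d]] equivariant[OF d g'(1) x'(1)] g'(4)[OF d] x'(5)[OF d] ..
    then show ?thesis using e arr_dom[OF x] XO by (simp add: Graph_arr)
  qed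
  have m_eq: "?m = (gact C G (Edges X) a (Edges ?P) (fst (pr1 ?D ?A X)) (fst (pr2 ?D ?A X)),
      gact C G (Verts X) b (Verts ?P) (snd (pr1 ?D ?A X)) (snd (pr2 ?D ?A X)))"
    by (simp add: action_map_def Let_def)
  have m: "arr ?D ?m ?P X" unfolding m_eq by (rule pair_arr[OF p])
  have elem: "gact ?D (const_group C G) X ?m T g x =
      (gact C G (Edges X) a (Edges T) (fst g) (fst x), gact C G (Verts X) b (Verts T) (snd g) (snd x))"
    if g: "arr ?D g T ?A" and x: "arr ?D x T X" for T g x
  proof -
    note t = D.tuple[OF g x] note t' = Graph_arrD[OF t]
    have e: "fst (pr1 ?D ?A X) \<cdot> fst (tuple ?D T ?A X g x) = fst g" "snd (pr1 ?D ?A X) \<cdot> snd (tuple ?D T ?A X g x) = snd g"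
      "fst (pr2 ?D ?A X) \<cdot> fst (tuple ?D T ?A X g x) = fst x" "snd (pr2 ?D ?A X) \<cdot> snd (tuple ?D T ?A X g x) = snd x"
      using D.pr1_tuple[OF g x] D.pr2_tuple[OF g x] by (simp_all add: prod_eq_iff)
    show ?thesis
      using gact_comp[OF aa const_arrD(1)[OF G p(1)] Graph_arrD(1)[OF p(2)] t'(1)]
        gact_comp[OF bb const_arrD(2)[OF G p(1)] Graph_arrD(2)[OF p(2)] t'(2)] e
      by (simp add: gact_def[of ?D] m_eq)
  qed
  show ?thesis
    unfolding D.is_action_iff[OF const_group[OF G]] const_group_carr
  proof (intro conjI allI impI)
    fix T g h x assume g: "arr ?D g T ?A" and h: "arr ?D h T ?A" and x: "arr ?D x T X"
    note g' = const_arrD[OF G g] and h' = const_arrD[OF G h] and x' = Graph_arrD[OF x]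
    show "gact ?D (const_group C G) X ?m T (gmul ?D (const_group C G) T g h) x =
        gact ?D (const_group C G) X ?m T g (gact ?D (const_group C G) X ?m T h x)"
      unfolding const_gmul[OF G g h] elem[OF h x] elem[OF g pair_arr[OF h x]] elem[OF const_gmul_arr[OF G g h] x]
      using action_mul[OF G a g'(1) h'(1) x'(1)] action_mul[OF G b g'(2) h'(2) x'(2)] by simp
  next
    fix T x assume x: "arr ?D x T X"
    note T = arr_dom[OF x] and x' = Graph_arrD[OF x]
    have "arr ?D (gone ?D (const_group C G) T) T ?A" using D.gone[OF const_group[OF G] T] by simp
    from elem[OF this x] show "gact ?D (const_group C G) X ?m T (gone ?D (const_group C G) T) x = x"
      using action_one[OF G a x'(1)] action_one[OF G b x'(2)] by (simp add: const_gone[OF G T])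
  qed (rule m)
qed

end

lemma Bass_Serre_pi1:
  assumes BS: "Bass_Serre C" and Q: "Q \<in> Obj (Graph C)" and \<G>: "\<G> \<in> Obj (GrGrp C Q)"
  shows "universal_arrow (Grp C) (GrGrp C Q) (DeltaG C Q) (DeltaG_map C Q) \<G> (pi1 C Q \<G>) (pi1_unit C Q \<G>)"
proof -
  interpret lex C by (rule Bass_Serre_lex[OF BS])
  have adj: "\<exists>U \<eta>. universal_arrow (Grp C) (Grp (Slice C D)) (Delta C D) (Delta_map C D) H U \<eta>"
    if D: "D \<in> Obj C" and H: "group_object (Slice C D) H" for D H
  proof -
    obtain L L1 \<eta> where "is_left_adjoint (Grp C) (Grp (Slice C D)) (Delta C D) (Delta_map C D) L L1 \<eta>"
      using BS D unfolding Bass_Serre_def by blast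
    moreover have "H \<in> Obj (Grp (Slice C D))" using H by simp
    ultimately show ?thesis unfolding is_left_adjoint_def by blast
  qed
  have co: "has_coequalisers (Grp C)" using BS by (simp add: Bass_Serre_def)
  have "\<exists>x. case x of (U, u) \<Rightarrow> universal_arrow (Grp C) (GrGrp C Q) (DeltaG C Q) (DeltaG_map C Q) \<G> U u"
    using colim_exists[OF adj co Q] \<G> by simp
  then have "case colim C Q \<G> of (U, u) \<Rightarrow> universal_arrow (Grp C) (GrGrp C Q) (DeltaG C Q) (DeltaG_map C Q) \<G> U u"
    unfolding colim_def by (rule someI_ex)
  then show ?thesis by (simp add: pi1_def pi1_unit_def split_beta)
qed

text \<open>The standard graph is the coequaliser of an effective pair, so the description of the stabiliser of
  the section applies to it.\<close>

lemma canonical_iso_of_unit_monic: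
  assumes BS: "Bass_Serre C" and Q: "Q \<in> Obj (Graph C)" and \<G>: "\<G> \<in> Obj (GrGrp C Q)"
    and mono: "unit_monic C Q \<G>"
  shows "\<exists>!\<phi>. canonical_iso C Q \<G> \<phi>"
proof -
  let ?D = "Graph C" and ?K = "pi1_const C Q \<G>" and ?\<eta> = "pi1_unit C Q \<G>"
  let ?T = "standard_graph C Q \<G>" and ?p = "standard_proj C Q \<G>"
  let ?P = "Carr ?K" and ?A = "fst (Carr \<G>)"
  let ?f = "prod_map ?D ?P ?P ?A Q (Ident ?D ?P) (snd (Carr \<G>))"
  let ?g = "tuple ?D (Prod ?D ?P ?A) ?P Q (gmul ?D ?K (Prod ?D ?P ?A) (pr1 ?D ?P ?A) (pr1 ?D ?P Q \<cdot>\<^bsub>?D\<^esub> ?\<eta> \<cdot>\<^bsub>?D\<^esub> pr2 ?D ?P ?A))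
        (pr2 ?D ?P Q \<cdot>\<^bsub>?D\<^esub> ?\<eta> \<cdot>\<^bsub>?D\<^esub> pr2 ?D ?P ?A)"
  let ?R = "Prod ?D ?P ?A" and ?B = "Prod ?D ?P Q"
  interpret lex C by (rule Bass_Serre_lex[OF BS])
  interpret D: lex ?D by (rule Graph_lex)
  have \<G>': "group_object (Slice ?D Q) \<G>" using \<G> by simp
  note u = Bass_Serre_pi1[OF BS Q \<G>]
  have pi: "group_object C (pi1 C Q \<G>)" using u by (simp add: universal_arrow_def)
  have eta: "?\<eta> \<in> Hom (Grp (Slice ?D Q)) \<G> (Delta ?D Q ?K)"
    using u unfolding universal_arrow_def DeltaG_def pi1_const_def by blast
  have mono': "monic ?D ?A ?B ?\<eta>" using mono unfolding unit_monic_def pi1_times_def .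
  have exact: "locally_action_Barr_exact C" and co: "has_coequalisers C" and ppc: "product_preserves_coequalisers C"
    using BS by (simp_all add: Bass_Serre_def)
  note K = const_group[OF pi, folded pi1_const_def]
  obtain Z q where Z: "is_coequaliser ?D ?R ?B ?f ?g Z q" "is_pullback ?D ?B ?B q q ?R ?f ?g"
    using graph_translation_effective[OF exact pi Q \<G>', folded pi1_const_def, OF eta mono'] by blast
  have "\<exists>x. case x of (T, p) \<Rightarrow> is_coequaliser ?D ?R ?B ?f ?g T p"
    by (intro exI[of _ "(Z, q)"]) (simp only: prod.case Z(1))
  then have "case coequaliser ?D ?R ?B ?f ?g of (T, p) \<Rightarrow> is_coequaliser ?D ?R ?B ?f ?g T p"
    unfolding coequaliser_def by (rule someI_ex)
  then have T: "is_coequaliser ?D ?R ?B ?f ?g ?T ?p"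
    unfolding standard_graph_def standard_proj_def standard_coeq_def Let_def by (simp only: split_beta)
  have BO: "?B \<in> Obj ?D" using D.Prod_obj[OF D.group_carr[OF K] Q] .
  note pb = is_pullbackD[OF Z(2) BO BO]
  note q = is_coequaliserD[OF Z(1) BO] and p = is_coequaliserD[OF T BO]
  \<comment> \<open>Having \<open>f, g\<close> as kernel pair does not depend on the choice of the coequaliser.\<close>
  obtain k where k: "arr ?D k ?T Z" "k \<cdot>\<^bsub>?D\<^esub> ?p = q" using p(3)[OF q(1,2)] by blast
  have ker: "is_pullback ?D ?B ?B ?p ?p ?R ?f ?g"
  proof (rule is_pullbackI[OF pb(1,2) p(2)])
    fix W x y assume x: "arr ?D x W ?B" and y: "arr ?D y W ?B" and "?p \<cdot>\<^bsub>?D\<^esub> x = ?p \<cdot>\<^bsub>?D\<^esub> y"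
    then have "q \<cdot>\<^bsub>?D\<^esub> x = q \<cdot>\<^bsub>?D\<^esub> y"
      using D.assoc[OF x p(1) k(1)] D.assoc[OF y p(1) k(1)] k(2) by metis
    then show "\<exists>h. arr ?D h W ?R \<and> ?f \<cdot>\<^bsub>?D\<^esub> h = x \<and> ?g \<cdot>\<^bsub>?D\<^esub> h = y" by (rule pb(4)[OF x y])
  qed (rule D.pullback_ext[OF Z(2) q(1) q(1)])
  note std = standard_quotient.intro[OF Graph_lex standard_quotient_axioms.intro[OF
    Graph_product_preserves_coequalisers[OF co ppc] K Q \<G>' eta refl refl refl refl refl refl refl refl refl refl refl T]]
  show ?thesis
    using standard_quotient.stabiliser_of_section[OF std mono' ker]
    unfolding canonical_iso_def section_stab_def standard_stab_def standard_section_def standard_action_def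
      section_stab_incl_def Let_def pi1_times_def .
qed

text \<open>For a group coming from an action of \<open>G\<close>, the inclusion of \<open>s\<^sup>* G\<^sub>X\<close> into \<open>G \<times> Q\<close> is a monic
  homomorphism, and it factors through the unit.\<close>

lemma action_gog_unit_monic:
  assumes BS: "Bass_Serre C" and G: "group_object C G" and X: "G_graph C G X a b" and s: "arr (Graph C) s Q X"
  shows "action_gog C G X a b Q s \<in> Obj (GrGrp C Q)" and "unit_monic C Q (action_gog C G X a b Q s)"
proof -
  let ?D = "Graph C" and ?K = "const_group C G" and ?H = "action_gog C G X a b Q s"
  interpret lex C by (rule Bass_Serre_lex[OF BS])
  interpret D: lex ?D by (rule Graph_lex)
  note Q = arr_dom[OF s]
  interpret S: lex "Slice ?D Q" by (rule D.Slice_lex[OF Q])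
  note K = const_group[OF G]
  let ?St = "stabiliser ?D ?K X (action_map C G X a b)"
  define P where "P = pb_obj ?D Q s ?St" define v where "v = pb_base ?D Q s ?St"
  define e where "e = pr1 ?D (Carr ?K) X \<cdot>\<^bsub>?D\<^esub> stab_incl ?D ?K X (action_map C G X a b) \<cdot>\<^bsub>?D\<^esub> pb_top ?D Q s ?St"
  note ps = D.pulled_back_stabiliser[OF K action_map_is_action[OF G X] s, folded action_gog_def P_def v_def, folded e_def]
  show H: "?H \<in> Obj (GrGrp C Q)" using ps(1) by simp
  let ?j = "tuple ?D P (Carr ?K) Q e v"
  have carr: "fst (Carr ?H) = P" "snd (Carr ?H) = v" using ps(2) by simp_all
  have j: "?j \<in> Hom (GrGrp C Q) ?H (DeltaG C Q G)"
    using D.fibre_hom_tuple[OF Q ps(1) K ps(3)] unfolding carr DeltaG_def .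
  note u = Bass_Serre_pi1[OF BS Q H]
  let ?\<eta> = "pi1_unit C Q ?H" let ?pi = "pi1 C Q ?H"
  have pi: "group_object C ?pi" and eta: "?\<eta> \<in> Hom (GrGrp C Q) ?H (DeltaG C Q ?pi)"
    using u by (simp_all add: universal_arrow_def)
  obtain g where g: "g \<in> Hom (Grp C) ?pi G" "DeltaG_map C Q ?pi G g \<cdot>\<^bsub>GrGrp C Q\<^esub> ?\<eta> = ?j"
    using u j G unfolding universal_arrow_def by (metis Grp_obj)
  have eta_arr: "arr ?D ?\<eta> P (pi1_times C Q ?H)"
    using eta unfolding DeltaG_def D.Delta_hom_iff[OF Q ps(1) const_group[OF pi]] carr pi1_times_def pi1_const_def by blast
  have ga: "arr ?D (g, g) (Carr (const_group C ?pi)) (Carr ?K)"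
    by (rule D.Grp_hom_arr[OF const_group[OF pi] K const_group_hom[OF pi G g(1)]])
  note da = D.prod_map[OF ga D.ident[OF Q], folded Delta_map_def, folded DeltaG_map_def]
  show "unit_monic C Q ?H"
    unfolding unit_monic_def carr monic_iff[OF arr_dom[OF eta_arr] arr_cod[OF eta_arr]]
  proof (intro conjI allI impI)
    fix T x y assume x: "arr ?D x T P" and y: "arr ?D y T P" and xy: "?\<eta> \<cdot>\<^bsub>?D\<^esub> x = ?\<eta> \<cdot>\<^bsub>?D\<^esub> y"
    note A = D.assoc[OF _ eta_arr[unfolded pi1_times_def pi1_const_def] da]
    have "?j \<cdot>\<^bsub>?D\<^esub> x = ?j \<cdot>\<^bsub>?D\<^esub> y"
      using A[OF x] A[OF y] xy g(2) unfolding Grp_Comp Slice_Comp DeltaG_map_def Delta_map_def by metis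
    then show "x = y" by (rule monicD[OF ps(4) x y])
  qed (rule eta_arr)
qed

theorem theorem5p3:
  fixes C :: "('o, 'm) cat"
  assumes "Bass_Serre C"
  shows "(\<forall>Q \<G>. Q \<in> Obj (Graph C) \<and> \<G> \<in> Obj (GrGrp C Q) \<and> unit_monic C Q \<G> \<longrightarrow>
            (\<exists>!\<phi>. canonical_iso C Q \<G> \<phi>)) \<and>
         (\<forall>G X a b Q q s. G \<in> Obj (Grp C) \<and> G_graph C G X a b \<and> is_quotient C G X a b Q q \<and>
            s \<in> Hom (Graph C) Q X \<and> q \<cdot>\<^bsub>Graph C\<^esub> s = Ident (Graph C) Q \<longrightarrow>
            unit_monic C Q (action_gog C G X a b Q s) \<and>
            (\<exists>!\<phi>. canonical_iso C Q (action_gog C G X a b Q s) \<phi>))"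
proof (intro conjI allI impI)
  fix Q \<G> assume "Q \<in> Obj (Graph C) \<and> \<G> \<in> Obj (GrGrp C Q) \<and> unit_monic C Q \<G>"
  then show "\<exists>!\<phi>. canonical_iso C Q \<G> \<phi>" using canonical_iso_of_unit_monic[OF assms] by blast
next
  fix G X a b Q q s
  assume a: "G \<in> Obj (Grp C) \<and> G_graph C G X a b \<and> is_quotient C G X a b Q q \<and>
            s \<in> Hom (Graph C) Q X \<and> q \<cdot>\<^bsub>Graph C\<^esub> s = Ident (Graph C) Q"
  then have "Q \<in> Obj (Graph C)" "X \<in> Obj (Graph C)"
    by (auto simp: is_quotient_def is_coequaliser_def G_graph_def Let_def)
  then have Q: "Q \<in> Obj (Graph C)" and s: "arr (Graph C) s Q X" using a by (auto simp: arr_def)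
  have G: "group_object C G" and X: "G_graph C G X a b" using a by auto
  note m = action_gog_unit_monic[OF assms G X s]
  show "unit_monic C Q (action_gog C G X a b Q s)" by (rule m(2))
  show "\<exists>!\<phi>. canonical_iso C Q (action_gog C G X a b Q s) \<phi>"
    by (rule canonical_iso_of_unit_monic[OF assms Q m])
qed

end
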